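(* Let $m,n,\nu\in\mathbb{N}$ with $m\ge 1$, let $0<s<1$ and $1\le p<+\infty$, and let $N^n\subset\mathbb{R}^\nu$ be a compact smooth $n$-dimensional manifold without boundary embedded in $\mathbb{R}^\nu$. Denote by $\lfloor sp\rfloor$ the integral part of $sp$. If $sp<m$ and if for every $\ell\in\{0,\dots,\lfloor sp\rfloor\}$ the homotopy group $\pi_\ell(N^n)$ is trivial, $\pi_\ell(N^n)\simeq\{0\}$, then $C^\infty(\overline{Q}^m;N^n)$ is strongly dense in $W^{s,p}(Q^m;N^n)$; that is, for every $u\in W^{s,p}(Q^m;N^n)$ there exists a sequence $(u_k)_{k\in\mathbb{N}}$ in $C^\infty(\overline{Q}^m;N^n)$ such that $d_{s,p}(u_k,u)\to 0$ as $k\to\infty$.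
   Context: $Q^m=(-1,1)^m$ is the unit cube of $\mathbb{R}^m$ and $\overline{Q}^m$ its closure. $W^{s,p}(Q^m;N^n)$ is the set of measurable maps $u:Q^m\to\mathbb{R}^\nu$ with $u(x)\in N^n$ for a.e. $x\in Q^m$ and finite Gagliardo seminorm $$[u]_{W^{s,p}(Q^m)}=\Big(\int_{Q^m}\int_{Q^m}\frac{|u(x)-u(y)|^p}{|x-y|^{m+sp}}\,dx\,dy\Big)^{1/p}.$$ The distance is $d_{s,p}(u,v)=\|u-v\|_{L^p(Q^m)}+[u-v]_{W^{s,p}(Q^m)}$. $C^\infty(\overline{Q}^m;N^n)$ is the set of maps smooth up to the boundary on $\overline{Q}^m$ with values in $N^n$. The condition $\pi_\ell(N^n)\simeq\{0\}$ means that every continuous map $f:\mathbb{S}^\ell\to N^n$ is homotopic in $N^n$ to a constant map; for $\ell=0$ this means that $N^n$ is (path-)connected. *)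

theory Defs
  imports "HOL-Analysis.Analysis"
begin

text \<open>
  \<open>Ck_on k S f\<close> is meant for open \<open>S\<close>: then the full derivative at each point is
  well defined, and continuity of all iterated directional derivatives of order at most
  \<open>k\<close> is the usual notion of \<open>k\<close> times continuous differentiability on finite-dimensional
  spaces.
\<close>

fun Ck_on :: "nat \<Rightarrow> 'a::euclidean_space set \<Rightarrow> ('a \<Rightarrow> 'b::euclidean_space) \<Rightarrow> bool" where
  "Ck_on 0 S f \<longleftrightarrow> continuous_on S f"
| "Ck_on (Suc k) S f \<longleftrightarrow>
     (\<forall>x\<in>S. f differentiable (at x)) \<and>
     (\<forall>v. Ck_on k S (\<lambda>x. frechet_derivative f (at x) v))"

definition smooth_on_open ::
    "'a::euclidean_space set \<Rightarrow> ('a \<Rightarrow> 'b::euclidean_space) \<Rightarrow> bool" where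
  "smooth_on_open S f \<longleftrightarrow> open S \<and> (\<forall>k. Ck_on k S f)"

text \<open>
  Embedded submanifolds without boundary: near each of its points, \<open>M\<close> is straightened
  onto an open piece of an \<open>n\<close>-dimensional linear subspace by a smooth diffeomorphism
  between open subsets of the ambient space.
\<close>

definition embedded_submanifold :: "nat \<Rightarrow> 'a::euclidean_space set \<Rightarrow> bool" where
  "embedded_submanifold n M \<longleftrightarrow>
     (\<forall>y\<in>M. \<exists>U V \<Phi> \<Psi> E.
        y \<in> U \<and> homeomorphism U V \<Phi> \<Psi> \<and>
        smooth_on_open U \<Phi> \<and> smooth_on_open V \<Psi> \<and>
        subspace (E :: 'a set) \<and> dim E = n \<and> \<Phi> ` (U \<inter> M) = V \<inter> E)"

text \<open>
  No base points are involved, so \<open>l = 0\<close> makes sense as well: maps from the two-point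
  space \<open>nsphere 0\<close> are homotopic to constants exactly when \<open>M\<close> is path-connected.
\<close>

definition trivial_homotopy_group :: "nat \<Rightarrow> 'a::euclidean_space set \<Rightarrow> bool" where
  "trivial_homotopy_group l M \<longleftrightarrow>
     (\<forall>f. continuous_map (nsphere l) (top_of_set M) f \<longrightarrow>
        (\<exists>c\<in>M. homotopic_with (\<lambda>h. True) (nsphere l) (top_of_set M) f (\<lambda>x. c)))"

definition open_cube :: "(real^'m) set" where
  "open_cube = {x. \<forall>i. -1 < x $ i \<and> x $ i < 1}"

text \<open>
  The real power on \<open>[0,\<infinity>]\<close> with value \<open>\<infinity>\<close> at \<open>\<infinity>\<close>; only used for positive exponents.
  Keeping the seminorm, the norm and the distance in \<^typ>\<open>ennreal\<close> avoids giving the value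
  \<open>0\<close> to a divergent integral.
\<close>

definition ennreal_pow :: "ennreal \<Rightarrow> real \<Rightarrow> ennreal" where
  "ennreal_pow a r = (if a = \<infinity> then \<infinity> else ennreal (enn2real a powr r))"

text \<open>On the diagonal the integrand is \<open>0 / 0 = 0\<close>; the diagonal is a null set.\<close>

definition gagliardo_seminorm :: "real \<Rightarrow> real \<Rightarrow> (real^'m \<Rightarrow> real^'v) \<Rightarrow> ennreal" where
  "gagliardo_seminorm s p u =
     ennreal_pow
       (\<integral>\<^sup>+x. (\<integral>\<^sup>+y. ennreal (norm (u x - u y) powr p / norm (x - y) powr (real CARD('m) + s * p))
          \<partial>lebesgue_on open_cube) \<partial>lebesgue_on open_cube)
       (1 / p)"

definition cube_Lp_norm :: "real \<Rightarrow> (real^'m \<Rightarrow> real^'v) \<Rightarrow> ennreal" where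
  "cube_Lp_norm p u =
     ennreal_pow (\<integral>\<^sup>+x. ennreal (norm (u x) powr p) \<partial>lebesgue_on open_cube) (1 / p)"

definition sobolev_dist ::
    "real \<Rightarrow> real \<Rightarrow> (real^'m \<Rightarrow> real^'v) \<Rightarrow> (real^'m \<Rightarrow> real^'v) \<Rightarrow> ennreal" where
  "sobolev_dist s p u v =
     cube_Lp_norm p (\<lambda>x. u x - v x) + gagliardo_seminorm s p (\<lambda>x. u x - v x)"

text \<open>
  Maps on the cube or on its closure are represented by total functions whose values
  elsewhere are irrelevant.
\<close>

definition sobolev_maps :: "real \<Rightarrow> real \<Rightarrow> (real^'v) set \<Rightarrow> (real^'m \<Rightarrow> real^'v) set" where
  "sobolev_maps s p M =
     {u. u \<in> borel_measurable (lebesgue_on open_cube) \<and>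
         (AE x in lebesgue_on open_cube. u x \<in> M) \<and>
         gagliardo_seminorm s p u < \<infinity>}"

text \<open>
  Smoothness up to the boundary: the map is the restriction to the closed cube of a smooth
  map, with values in the ambient space, on an open neighbourhood of the closed cube.
\<close>

definition smooth_maps :: "(real^'v) set \<Rightarrow> (real^'m \<Rightarrow> real^'v) set" where
  "smooth_maps M =
     {u. (\<forall>x\<in>closure open_cube. u x \<in> M) \<and>
         (\<exists>W g. closure open_cube \<subseteq> W \<and> smooth_on_open W g \<and>
                (\<forall>x\<in>closure open_cube. g x = u x))}"

end

theory Submission
  imports Defs "HOL-Analysis.Analysis"
begin

text \<open>
  Write \<open>\<sigma> = s p\<close> and \<open>k = \<lfloor>\<sigma>\<rfloor>\<close>, and fix \<open>q\<close> with \<open>\<sigma> < q < min p (k + 1)\<close>. Cut the target space into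
  small cubes. Since \<open>\<pi>\<^sub>0, \<dots>, \<pi>\<^sub>k\<close> of \<open>N\<close> vanish, the inclusion of the part of the \<open>k\<close>-skeleton near
  \<open>N\<close>, retracted to \<open>N\<close>, is homotopic to a constant. Pulling this homotopy back along the radial
  retraction onto the \<open>k\<close>-skeleton and cutting it off away from \<open>N\<close> yields maps \<open>\<kappa>\<^sub>\<delta>\<close> of the whole
  space into \<open>N\<close> that agree with a Lipschitz retraction \<open>P\<close> near \<open>N\<close>, except within \<open>2 \<delta>\<close> of the dual
  skeleton of codimension \<open>k + 1\<close>, and whose Lipschitz constant is at most the inverse of the
  distance \<open>d\<close> to the dual skeleton, up to a constant independent of \<open>\<delta>\<close>. The function \<open>d\<close> to the
  power \<open>- q\<close> is locally integrable.

  The averages \<open>u\<^sub>\<epsilon>\<close> of \<open>u\<close> satisfy \<open>\<parallel>u\<^sub>\<epsilon> - u\<parallel>\<^sub>p = o(\<epsilon>\<^sup>s)\<close> and have Lipschitz constant \<open>O(1/\<epsilon>)\<close>, so the energy of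
  \<open>\<kappa>\<^sub>\<delta>(u\<^sub>\<epsilon> - \<xi>) - P(u\<^sub>\<epsilon> - \<xi>)\<close> is at most a constant times \<open>\<epsilon>\<close> to the power \<open>- \<sigma>\<close> times the integral of
  the above weight over the set where \<open>u\<^sub>\<epsilon> - \<xi>\<close> is far from \<open>N\<close> or near the dual skeleton. Averaging over
  small translations \<open>\<xi>\<close> shows that for suitable \<open>\<epsilon>\<close>, then \<open>\<delta>\<close>, then \<open>\<xi>\<close> this is as small as desired,
  while \<open>P(u\<^sub>\<epsilon> - \<xi>)\<close> is close to \<open>P(u) = u\<close>. The resulting map is Lipschitz with values in \<open>N\<close>, and
  convolution followed by a smooth retraction makes it smooth.
\<close>

section \<open>Calculus of smooth functions\<close>

text \<open>For \<sigma> < m, the dimension of the cube, the averages of u need not be close to N,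
  so they cannot simply be projected onto N; the singular maps absorb the points where this fails.
  Only the difference from P is estimated. It vanishes off the bad set, so its energy is charged to
  bad points alone, and the gap of whichever point of a pair is bad controls the increment. The
  exponent q reconciles three demands: \<sigma> < q makes the truncated kernel integrable at the
  diagonal, q < k + 1 makes the weight integrable across the dual skeleton, and q \<le> p lets the
  surplus power p - q be absorbed by the sup bound of the error. Rescaling the kernel to size
  \<epsilon> costs \<epsilon>^(-\<sigma>). Against this factor, points where the average is far from
  N are paid for by the rate of convergence of the averages, and points near the dual skeleton by
  taking \<delta> after \<epsilon>, which is not circular because the constants do not depend on
  \<delta>. Translations turn an integral over the cube, where nothing is known about the law of the
  averages, into one over the target, where the weight is integrable.\<close>

lemma Ck_on_SucI:
  fixes f :: "'a::euclidean_space \<Rightarrow> 'b::euclidean_space"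
  assumes "open S" and der: "\<And>x. x \<in> S \<Longrightarrow> (f has_derivative D x) (at x)"
    and "\<And>v. Ck_on k S (\<lambda>x. D x v)"
    and cong: "\<And>g h :: 'a \<Rightarrow> 'b. (\<And>x. x \<in> S \<Longrightarrow> g x = h x) \<Longrightarrow> Ck_on k S g \<Longrightarrow> Ck_on k S h"
  shows "Ck_on (Suc k) S f"
proof -
  have "frechet_derivative f (at x) = D x" if "x \<in> S" for x
    using frechet_derivative_at[OF der[OF that]] by simp
  then have "Ck_on k S (\<lambda>x. frechet_derivative f (at x) v)" for v
    by (intro cong[OF _ assms(3)[of v]]) auto
  then show ?thesis
    using der by (auto simp: differentiable_def)
qed

lemma Ck_on_cong:
  assumes "open S" "\<And>x. x \<in> S \<Longrightarrow> f x = g x" "Ck_on k S f"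
  shows "Ck_on k S g"
  using assms(2,3)
proof (induction k arbitrary: f g)
  case 0
  then show ?case by (simp cong: continuous_on_cong)
next
  case (Suc k)
  have der: "(g has_derivative frechet_derivative f (at x)) (at x)" if x: "x \<in> S" for x
  proof -
    have "(f has_derivative frechet_derivative f (at x)) (at x)"
      using Suc.prems(2) x by (simp add: frechet_derivative_works[symmetric])
    then show ?thesis
      using has_derivative_transform_within_open[OF _ assms(1) x] Suc.prems(1) by blast
  qed
  show ?case
    using Suc by (intro Ck_on_SucI[OF assms(1) der]) auto
qed

text \<open>Discharges the congruence premise of \<open>Ck_on_SucI\<close>, which had to be a
  premise there because \<open>Ck_on_cong\<close> is itself proved from that lemma.\<close>

lemma Ck_on_SucI':
  fixes f :: "'a::euclidean_space \<Rightarrow> 'b::euclidean_space"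
  assumes "open S" "\<And>x. x \<in> S \<Longrightarrow> (f has_derivative D x) (at x)"
    and "\<And>v. Ck_on k S (\<lambda>x. D x v)"
  shows "Ck_on (Suc k) S f"
proof (rule Ck_on_SucI[OF assms])
  show "Ck_on k S h" if "\<And>x. x \<in> S \<Longrightarrow> g x = h x" "Ck_on k S g" for g h :: "'a \<Rightarrow> 'b"
    using Ck_on_cong[OF assms(1) that] .
qed

lemma Ck_on_Suc_has_derivative:
  "Ck_on (Suc k) S f \<Longrightarrow> x \<in> S \<Longrightarrow> (f has_derivative frechet_derivative f (at x)) (at x)"
  by (simp add: frechet_derivative_works[symmetric])

lemma Ck_on_SucD: "Ck_on (Suc k) S f \<Longrightarrow> Ck_on k S f"
proof (induction k arbitrary: f)
  case 0
  then show ?case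
    by (auto intro!: continuous_at_imp_continuous_on differentiable_imp_continuous_within)
next
  case (Suc k)
  have "Ck_on k S (\<lambda>x. frechet_derivative f (at x) v)" for v
    using Suc.prems by (intro Suc.IH) (metis Ck_on.simps(2))
  then show ?case
    using Suc.prems by auto
qed

lemma Ck_on_subset: "Ck_on k S f \<Longrightarrow> T \<subseteq> S \<Longrightarrow> Ck_on k T f"
  by (induction k arbitrary: f) (auto intro: continuous_on_subset)

lemma Ck_on_continuous: "Ck_on k S f \<Longrightarrow> continuous_on S f"
  by (induction k) (auto dest: Ck_on_SucD simp del: Ck_on.simps(2))

lemma Ck_on_local:
  "(\<And>x. x \<in> S \<Longrightarrow> \<exists>T. open T \<and> x \<in> T \<and> Ck_on k T f) \<Longrightarrow> Ck_on k S f"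
proof (induction k arbitrary: f)
  case 0
  then show ?case
    by (metis Ck_on.simps(1) continuous_at_imp_continuous_on continuous_on_eq_continuous_at)
next
  case (Suc k)
  have "f differentiable at x" if "x \<in> S" for x
    using Suc.prems[OF that] by auto
  moreover have "Ck_on k S (\<lambda>x. frechet_derivative f (at x) v)" for v
    using Suc.prems by (intro Suc.IH) (metis Ck_on.simps(2))
  ultimately show ?case by simp
qed

lemma Ck_on_const: "Ck_on k S (\<lambda>x. c)"
  by (induction k arbitrary: c) (auto simp: frechet_derivative_const)

lemma Ck_on_linear:
  assumes "bounded_linear L"
  shows "Ck_on k S L"
proof (cases k)
  case 0
  then show ?thesis using assms by (simp add: linear_continuous_on)
next
  case (Suc j)
  have "(L has_derivative L) (at x)" for x
    using assms by (rule bounded_linear_imp_has_derivative)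
  \<comment> \<open>\<open>Ck_on_SucI'\<close> wants an open set while S is arbitrary, hence the
    detour through \<open>UNIV\<close>.\<close>
  then have "Ck_on (Suc j) UNIV L"
    by (intro Ck_on_SucI'[where D="\<lambda>x. L"]) (auto simp: Ck_on_const)
  then show ?thesis using Suc by (auto intro: Ck_on_subset[of _ UNIV])
qed

lemma Ck_on_add:
  assumes "open S"
  shows "Ck_on k S f \<Longrightarrow> Ck_on k S g \<Longrightarrow> Ck_on k S (\<lambda>x. f x + g x)"
proof (induction k arbitrary: f g)
  case 0
  then show ?case by (simp add: continuous_on_add)
next
  case (Suc k)
  show ?case
    apply (rule Ck_on_SucI'[OF assms has_derivative_add[OF Ck_on_Suc_has_derivative[OF Suc.prems(1)] Ck_on_Suc_has_derivative[OF Suc.prems(2)]]])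
    using Suc by auto
qed

lemma Ck_on_bilinear:
  assumes "open S" "bounded_bilinear h"
  shows "Ck_on k S f \<Longrightarrow> Ck_on k S g \<Longrightarrow> Ck_on k S (\<lambda>x. h (f x) (g x))"
proof (induction k arbitrary: f g)
  case 0
  then show ?case by (simp add: bounded_bilinear.continuous_on[OF assms(2)])
next
  case (Suc k)
  show ?case
    apply (rule Ck_on_SucI'[OF assms(1) bounded_bilinear.FDERIV[OF assms(2) Ck_on_Suc_has_derivative[OF Suc.prems(1)] Ck_on_Suc_has_derivative[OF Suc.prems(2)]]])
      apply assumption+
    using Suc Ck_on_SucD[OF Suc.prems(1)] Ck_on_SucD[OF Suc.prems(2)]
    by (intro Ck_on_add[OF assms(1)] Suc.IH) auto
qed

lemma Ck_on_sum:
  assumes "open S" "\<And>i. i \<in> I \<Longrightarrow> Ck_on k S (f i)"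
  shows "Ck_on k S (\<lambda>x. \<Sum>i\<in>I. f i x)"
  using assms(2)
  by (induction I rule: infinite_finite_induct) (auto simp: Ck_on_const intro!: Ck_on_add[OF assms(1)])

lemma Ck_on_compose:
  assumes "open S" "open T" "f ` S \<subseteq> T"
  shows "Ck_on k S f \<Longrightarrow> Ck_on k T g \<Longrightarrow> Ck_on k S (\<lambda>x. g (f x))"
  using assms(3)
proof (induction k arbitrary: f g)
  case 0
  then show ?case by (auto intro: continuous_on_compose2)
next
  case (Suc k)
  let ?f' = "\<lambda>x. frechet_derivative f (at x)" and ?g' = "\<lambda>y. frechet_derivative g (at y)"
  have g': "(g has_derivative ?g' (f x)) (at (f x))" if "x \<in> S" for x
    using Ck_on_Suc_has_derivative[OF Suc.prems(2)] Suc.prems(3) that by blast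
  have der: "((\<lambda>x. g (f x)) has_derivative (\<lambda>v. ?g' (f x) (?f' x v))) (at x)" if "x \<in> S" for x
    using has_derivative_compose[OF Ck_on_Suc_has_derivative[OF Suc.prems(1) that] g'[OF that]] .
  \<comment> \<open>The induction hypothesis controls derivatives of g only in fixed directions,
    whereas the direction \<open>?f' x v\<close> moves with x; expanding it in the basis separates
    the two dependences on x.\<close>
  have eq: "(\<Sum>b\<in>Basis. (?f' x v \<bullet> b) *\<^sub>R ?g' (f x) b) = ?g' (f x) (?f' x v)" if "x \<in> S" for x v
  proof -
    have lin: "linear (?g' (f x))" using g'[OF that] by (rule has_derivative_linear)
    have "?g' (f x) (?f' x v) = ?g' (f x) (\<Sum>b\<in>Basis. (?f' x v \<bullet> b) *\<^sub>R b)"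
      by (simp add: euclidean_representation)
    also have "\<dots> = (\<Sum>b\<in>Basis. (?f' x v \<bullet> b) *\<^sub>R ?g' (f x) b)"
      by (simp add: linear_sum[OF lin] linear_cmul[OF lin])
    finally show ?thesis by simp
  qed
  have sm: "Ck_on k S (\<lambda>x. \<Sum>b\<in>Basis. (?f' x v \<bullet> b) *\<^sub>R ?g' (f x) b)" for v
  proof (intro Ck_on_sum[OF assms(1)] Ck_on_bilinear[OF assms(1) bounded_bilinear_scaleR] 
      Ck_on_bilinear[OF assms(1) bounded_bilinear_inner] Ck_on_const)
    show "Ck_on k S (\<lambda>x. ?f' x v)" using Suc.prems(1) by simp
    show "Ck_on k S (\<lambda>x. ?g' (f x) b)" for b
      using Suc.prems Ck_on_SucD[OF Suc.prems(1)] by (intro Suc.IH[where g="\<lambda>y. ?g' y b"]) auto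
  qed
  have sm': "Ck_on k S (\<lambda>x. ?g' (f x) (?f' x v))" for v
    by (rule Ck_on_cong[OF assms(1) _ sm[of v]]) (rule eq)
  show ?case
    by (rule Ck_on_SucI'[OF assms(1) _ sm']) (rule der)
qed

lemma smooth_on_open_compose:
  assumes "smooth_on_open S f" "smooth_on_open T g" "f ` S \<subseteq> T"
  shows "smooth_on_open S (\<lambda>x. g (f x))"
  using assms Ck_on_compose[of S T f _ g] unfolding smooth_on_open_def by auto

lemma smooth_on_open_bilinear:
  "bounded_bilinear h \<Longrightarrow> smooth_on_open S f \<Longrightarrow> smooth_on_open S g \<Longrightarrow> smooth_on_open S (\<lambda>x. h (f x) (g x))"
  unfolding smooth_on_open_def using Ck_on_bilinear[of S h _ f g] by auto

lemma smooth_on_open_add: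
  "smooth_on_open S f \<Longrightarrow> smooth_on_open S g \<Longrightarrow> smooth_on_open S (\<lambda>x. f x + g x)"
  unfolding smooth_on_open_def using Ck_on_add[of S _ f g] by auto

lemma smooth_on_open_const: "open S \<Longrightarrow> smooth_on_open S (\<lambda>x. c)"
  unfolding smooth_on_open_def by (auto intro: Ck_on_const)

lemma smooth_on_open_linear: "open S \<Longrightarrow> bounded_linear L \<Longrightarrow> smooth_on_open S L"
  unfolding smooth_on_open_def by (auto intro: Ck_on_linear)

lemma smooth_on_open_subset:
  "smooth_on_open S f \<Longrightarrow> open T \<Longrightarrow> T \<subseteq> S \<Longrightarrow> smooth_on_open T f"
  unfolding smooth_on_open_def by (auto intro: Ck_on_subset[of _ S])

lemma smooth_on_open_cong:
  "smooth_on_open S f \<Longrightarrow> (\<And>x. x \<in> S \<Longrightarrow> f x = g x) \<Longrightarrow> smooth_on_open S g"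
  unfolding smooth_on_open_def using Ck_on_cong[of S f g] by auto

lemma smooth_on_open_Union:
  assumes "\<And>T. T \<in> \<T> \<Longrightarrow> smooth_on_open T f"
  shows "smooth_on_open (\<Union>\<T>) f"
proof -
  have "Ck_on k (\<Union>\<T>) f" for k
    using assms unfolding smooth_on_open_def by (intro Ck_on_local) blast
  then show ?thesis
    using assms unfolding smooth_on_open_def by auto
qed

lemma smooth_on_open_continuous: "smooth_on_open S f \<Longrightarrow> continuous_on S f"
  unfolding smooth_on_open_def by (auto intro: Ck_on_continuous)

section \<open>Flat functions, smooth steps and bumps\<close>

definition flat :: "nat \<Rightarrow> real \<Rightarrow> real" where
  "flat n t = (if t > 0 then (1/t) ^ n * exp (- (1/t)) else 0)"

lemma flat_tendsto_0: "(flat n \<longlongrightarrow> 0) (at_right 0)"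
proof -
  have "((\<lambda>x::real. x ^ n / exp x) \<longlongrightarrow> 0) at_top"
    by (rule tendsto_power_div_exp_0)
  then have "((\<lambda>t::real. (inverse t) ^ n / exp (inverse t)) \<longlongrightarrow> 0) (at_right 0)"
    by (rule filterlim_compose) (rule filterlim_inverse_at_top_right)
  moreover have "\<forall>\<^sub>F t in at_right (0::real). (inverse t) ^ n / exp (inverse t) = flat n t"
    by (simp add: eventually_at_filter flat_def exp_minus divide_inverse)
  ultimately show ?thesis by (rule Lim_transform_eventually)
qed

text \<open>The family is closed under differentiation, which is why the power n is carried along: a
  claim about \<open>flat 0\<close> alone would not be inductive. At 0 the right difference quotient
  of \<open>flat n\<close> is \<open>flat (Suc n)\<close>, which tends to 0.\<close>

lemma flat_has_derivative:
  "(flat n has_real_derivative (flat (n + 2) t - n * flat (n + 1) t)) (at t)"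
proof -
  consider "t > 0" | "t < 0" | "t = 0" by linarith
  then show ?thesis
  proof cases
    case 1
    have "((\<lambda>t. (1/t) ^ n * exp (- (1/t))) has_real_derivative (flat (n + 2) t - n * flat (n + 1) t)) (at t)"
      using 1
      apply (auto intro!: derivative_eq_intros simp: flat_def)
      apply (cases n)
       apply (auto simp: field_simps power2_eq_square)
      done
    then show ?thesis
      by (rule has_field_derivative_transform_within[where d=t]) (use 1 in \<open>auto simp: dist_real_def flat_def\<close>)
  next
    case 2
    have "((\<lambda>t. 0) has_real_derivative 0) (at t)" by simp
    then have "(flat n has_real_derivative 0) (at t)"
      by (rule has_field_derivative_transform_within[where d="-t"]) (use 2 in \<open>auto simp: dist_real_def flat_def\<close>)
    then show ?thesis using 2 by (simp add: flat_def)
  next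
    case 3
    have "((\<lambda>t. (flat n t - flat n 0) / (t - 0)) \<longlongrightarrow> 0) (at 0)"
      unfolding filterlim_at_split
    proof
      show "((\<lambda>t. (flat n t - flat n 0) / (t - 0)) \<longlongrightarrow> 0) (at_left 0)"
        by (rule tendsto_eventually) (auto simp: eventually_at_filter flat_def)
      have "\<forall>\<^sub>F t in at_right (0::real). flat (Suc n) t = (flat n t - flat n 0) / (t - 0)"
        by (auto simp: eventually_at_filter flat_def)
      then show "((\<lambda>t. (flat n t - flat n 0) / (t - 0)) \<longlongrightarrow> 0) (at_right 0)"
        by (rule Lim_transform_eventually[OF flat_tendsto_0])
    qed
    then have "(flat n has_real_derivative 0) (at 0)"
      by (simp add: has_field_derivative_iff)
    then show ?thesis using 3 by (simp add: flat_def)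
  qed
qed

lemma Ck_on_real_SucI:
  fixes f :: "real \<Rightarrow> real"
  assumes "open S" "\<And>x. x \<in> S \<Longrightarrow> (f has_real_derivative f' x) (at x)" "Ck_on k S f'"
  shows "Ck_on (Suc k) S f"
proof (rule Ck_on_SucI'[OF assms(1)])
  show "(f has_derivative (*) (f' x)) (at x)" if "x \<in> S" for x
    using assms(2)[OF that] by (simp add: has_field_derivative_def)
  show "Ck_on k S (\<lambda>x. f' x * v)" for v
    by (intro Ck_on_bilinear[OF assms(1) bounded_bilinear_mult assms(3)] Ck_on_const)
qed

lemma Ck_on_flat: "Ck_on k UNIV (flat n)"
proof (induction k arbitrary: n)
  case 0
  show ?case
    using DERIV_continuous[OF flat_has_derivative] by (simp add: continuous_at_imp_continuous_on)
next
  case (Suc k)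
  have "Ck_on k UNIV (\<lambda>t. (- real n) * flat (n + 1) t)"
    by (rule Ck_on_bilinear[OF open_UNIV bounded_bilinear_mult Ck_on_const Suc])
  from Ck_on_add[OF open_UNIV Suc this]
  have "Ck_on k UNIV (\<lambda>t. flat (n + 2) t - real n * flat (n + 1) t)"
    by simp
  then show ?case
    by (rule Ck_on_real_SucI[OF open_UNIV flat_has_derivative])
qed

lemma Ck_on_inverse: "Ck_on k {0<..} (inverse :: real \<Rightarrow> real)"
proof (induction k)
  case 0
  show ?case by (auto intro!: continuous_intros)
next
  case (Suc k)
  have "Ck_on k {0<..} (\<lambda>x::real. inverse x * inverse x)"
    by (rule Ck_on_bilinear[OF open_greaterThan bounded_bilinear_mult Suc Suc])
  from Ck_on_bilinear[OF open_greaterThan bounded_bilinear_mult Ck_on_const this]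
  have "Ck_on k {0<..} (\<lambda>x::real. (-1) * (inverse x * inverse x))" .
  then show ?case
    by (rule Ck_on_real_SucI[OF open_greaterThan, rotated]) (auto intro!: derivative_eq_intros)
qed

text \<open>A quotient A / (A + B) with A vanishing to the right of b and B to the left of a; since
  a < b they never vanish together, so the denominator stays positive.\<close>

lemma smooth_step_exists:
  fixes a b :: real
  assumes "a < b"
  obtains \<beta> :: "real \<Rightarrow> real" where "smooth_on_open UNIV \<beta>" "\<And>t. t \<le> a \<Longrightarrow> \<beta> t = 1"
    "\<And>t. t \<ge> b \<Longrightarrow> \<beta> t = 0" "\<And>t. 0 \<le> \<beta> t" "\<And>t. \<beta> t \<le> 1"
proof
  define d where "d t = flat 0 (b - t) + flat 0 (t - a)" for t
  define \<beta> where "\<beta> t = flat 0 (b - t) * inverse (d t)" for t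
  have aff: "smooth_on_open UNIV (\<lambda>t. c *\<^sub>R t + e)" for c e :: real
    by (intro smooth_on_open_add smooth_on_open_const smooth_on_open_linear bounded_linear_scaleR_right) auto
  have flat: "smooth_on_open UNIV (\<lambda>t. flat 0 (c *\<^sub>R t + e))" for c e
    by (rule smooth_on_open_compose[OF aff, of UNIV]) (auto simp: smooth_on_open_def Ck_on_flat)
  have dpos: "d t > 0" for t
    using assms by (auto simp: d_def flat_def intro: add_pos_nonneg add_nonneg_pos)
  have "smooth_on_open UNIV (\<lambda>t. flat 0 ((-1) *\<^sub>R t + b) + flat 0 (1 *\<^sub>R t + (-a)))"
    by (intro smooth_on_open_add flat)
  then have d: "smooth_on_open UNIV d"
    by (rule smooth_on_open_cong) (auto simp: d_def)
  have "smooth_on_open UNIV (\<lambda>t. flat 0 ((-1) *\<^sub>R t + b) * inverse (d t))"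
    using dpos by (intro smooth_on_open_bilinear[OF bounded_bilinear_mult] flat smooth_on_open_compose[OF d, of "{0<..}"])
      (auto simp: smooth_on_open_def Ck_on_inverse)
  then show "smooth_on_open UNIV \<beta>"
    by (rule smooth_on_open_cong) (auto simp: \<beta>_def)
  show "\<beta> t = 1" if "t \<le> a" for t
    using that assms dpos[of t] by (auto simp: \<beta>_def d_def flat_def)
  show "\<beta> t = 0" if "t \<ge> b" for t
    using that by (auto simp: \<beta>_def flat_def)
  have "flat 0 (b - t) \<ge> 0" "flat 0 (t - a) \<ge> 0" for t by (auto simp: flat_def)
  then show "0 \<le> \<beta> t" "\<beta> t \<le> 1" for t
    using dpos[of t] by (auto simp: \<beta>_def d_def field_simps)
qed

text \<open>A step is composed with the squared distance to y, which unlike the distance is smooth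
  at y itself.\<close>

lemma smooth_bump_exists:
  fixes y :: "'a::euclidean_space"
  assumes "0 < a" "a < b"
  shows "\<exists>\<eta> :: 'a \<Rightarrow> real. smooth_on_open UNIV \<eta> \<and> (\<forall>x\<in>cball y a. \<eta> x = 1) \<and>
    (\<forall>x. x \<notin> ball y b \<longrightarrow> \<eta> x = 0) \<and> (\<forall>x. 0 \<le> \<eta> x \<and> \<eta> x \<le> 1)"
proof -
  have "a^2 < b^2" using assms by (simp add: power_strict_mono)
  then obtain \<beta> where \<beta>: "smooth_on_open UNIV \<beta>" "\<And>t. t \<le> a^2 \<Longrightarrow> \<beta> t = (1::real)"
    "\<And>t. t \<ge> b^2 \<Longrightarrow> \<beta> t = 0" "\<And>t. 0 \<le> \<beta> t" "\<And>t. \<beta> t \<le> 1"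
    using smooth_step_exists[of "a^2" "b^2"] by blast
  have aff: "smooth_on_open UNIV (\<lambda>x. x + (- y))"
    by (intro smooth_on_open_add smooth_on_open_const smooth_on_open_linear bounded_linear_ident) auto
  have "smooth_on_open UNIV (\<lambda>x. (x + (- y)) \<bullet> (x + (- y)))"
    by (intro smooth_on_open_bilinear[OF bounded_bilinear_inner] aff)
  then have sm: "smooth_on_open UNIV (\<lambda>x. \<beta> ((x + (- y)) \<bullet> (x + (- y))))"
    by (rule smooth_on_open_compose[OF _ \<beta>(1)]) auto
  have eq: "(x + (- y)) \<bullet> (x + (- y)) = (dist y x)^2" for x
    by (simp add: dist_norm norm_minus_commute power2_norm_eq_inner)
  have "\<beta> ((x + - y) \<bullet> (x + - y)) = 1" if "x \<in> cball y a" for x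
    using that unfolding eq by (intro \<beta>) (simp add: power_mono)
  moreover have "\<beta> ((x + - y) \<bullet> (x + - y)) = 0" if "x \<notin> ball y b" for x
    using that assms unfolding eq by (intro \<beta>) (simp add: power_mono)
  ultimately show ?thesis
    using sm \<beta>(4,5) by (intro exI[of _ "\<lambda>x. \<beta> ((x + (- y)) \<bullet> (x + (- y)))"]) blast
qed

section \<open>Smooth neighbourhood retractions\<close>

definition smooth_retract_on :: "'a::euclidean_space set \<Rightarrow> 'a set \<Rightarrow> ('a \<Rightarrow> 'a) \<Rightarrow> bool" where
  "smooth_retract_on N O' r \<longleftrightarrow> smooth_on_open O' r \<and> r ` O' \<subseteq> N \<and> (\<forall>x\<in>O' \<inter> N. r x = x)"

lemma smooth_retract_on_subset:
  "smooth_retract_on N S r \<Longrightarrow> open T \<Longrightarrow> T \<subseteq> S \<Longrightarrow> smooth_retract_on N T r"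
  unfolding smooth_retract_on_def using smooth_on_open_subset[of S r T] by auto

lemma subspace_linear_projection:
  fixes E :: "'a::euclidean_space set"
  assumes "subspace E"
  obtains P :: "'a \<Rightarrow> 'a" where "linear P" "\<And>x. P x \<in> E" "\<And>x. x \<in> E \<Longrightarrow> P x = x"
proof -
  obtain B where B: "B \<subseteq> E" "pairwise orthogonal B" "\<And>x. x \<in> B \<Longrightarrow> norm x = 1"
    "independent B" "span B = E"
    using orthonormal_basis_subspace[OF assms] by metis
  have fin: "finite B" using B(4) by (rule independent_imp_finite)
  define P where "P x = (\<Sum>b\<in>B. (x \<bullet> b) *\<^sub>R b)" for x
  have lin: "linear P"
    unfolding P_def by (intro linear_compose_sum ballI) (auto intro!: linearI simp: inner_add_left scaleR_add_left)
  have PE: "P x \<in> E" for x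
    unfolding P_def using B(1) by (intro subspace_sum[OF assms] subspace_scale[OF assms]) auto
  have Pb: "P b = b" if "b \<in> B" for b
  proof -
    have "P b = (\<Sum>c\<in>B. if c = b then b else 0)"
      unfolding P_def
    proof (rule sum.cong)
      show "(b \<bullet> c) *\<^sub>R c = (if c = b then b else 0)" if "c \<in> B" for c
        using B(2,3) \<open>b \<in> B\<close> that
        by (auto simp: pairwise_def orthogonal_def dot_square_norm)
    qed simp
    then show ?thesis using fin that by simp
  qed
  have "P x = x" if "x \<in> E" for x
  proof -
    have "x \<in> span B" using that B(5) by simp
    then show ?thesis
      using linear_eq_on_span[OF lin linear_ident, of B x] Pb by simp
  qed
  then show ?thesis using that lin PE by blast
qed

text \<open>In a straightening chart the linear projection onto E is a retraction; conjugating it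
  with the chart gives r. The set W keeps the projected point inside V, where \<Psi> makes
  sense.\<close>

lemma embedded_submanifold_local_retract:
  fixes N :: "'a::euclidean_space set"
  assumes "embedded_submanifold n N" "y \<in> N"
  obtains c r where "c > 0" "smooth_retract_on N (ball y c) r"
proof -
  obtain U V \<Phi> \<Psi> E where *: "y \<in> U" "homeomorphism U V \<Phi> \<Psi>"
        "smooth_on_open U \<Phi>" "smooth_on_open V \<Psi>"
        "subspace (E :: 'a set)" "\<Phi> ` (U \<inter> N) = V \<inter> E"
    using assms(1)[unfolded embedded_submanifold_def, rule_format, OF assms(2)] by blast
  obtain P where P: "linear P" "\<And>x. P x \<in> E" "\<And>x. x \<in> E \<Longrightarrow> P x = x"
    using subspace_linear_projection[OF *(5)] by metis
  have bl: "bounded_linear P" using P(1) by (simp add: linear_conv_bounded_linear)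
  have sm: "smooth_on_open U (\<lambda>x. P (\<Phi> x))"
    by (rule smooth_on_open_compose[OF *(3) smooth_on_open_linear[OF open_UNIV bl]]) auto
  define W where "W = U \<inter> (\<lambda>x. P (\<Phi> x)) -` V"
  have oU: "open U" and oV: "open V" using * by (auto simp: smooth_on_open_def)
  have oW: "open W"
    unfolding W_def using smooth_on_open_continuous[OF sm] oU oV
    by (rule continuous_open_preimage)
  have fixP: "P (\<Phi> x) = \<Phi> x" if "x \<in> U \<inter> N" for x
    using that *(6) P(3) by blast
  have UV: "\<Phi> x \<in> V" "\<Psi> (\<Phi> x) = x" if "x \<in> U" for x
    using *(2) that by (auto simp: homeomorphism_def)
  have smW: "smooth_on_open W (\<lambda>x. \<Psi> (P (\<Phi> x)))"
    by (rule smooth_on_open_compose[OF smooth_on_open_subset[OF sm oW] *(4)]) (auto simp: W_def)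
  have ret: "smooth_retract_on N W (\<lambda>x. \<Psi> (P (\<Phi> x)))"
    unfolding smooth_retract_on_def
  proof (intro conjI smW ballI subsetI)
    fix z assume "z \<in> (\<lambda>x. \<Psi> (P (\<Phi> x))) ` W"
    then obtain x where x: "x \<in> W" "z = \<Psi> (P (\<Phi> x))" by blast
    then have "P (\<Phi> x) \<in> \<Phi> ` (U \<inter> N)" using *(6) P(2) by (auto simp: W_def)
    then obtain w where "w \<in> U \<inter> N" "P (\<Phi> x) = \<Phi> w" by blast
    then show "z \<in> N" using x UV by auto
  next
    fix x assume "x \<in> W \<inter> N"
    then show "\<Psi> (P (\<Phi> x)) = x" using fixP UV by (auto simp: W_def)
  qed
  have "y \<in> W" using *(1) assms(2) fixP UV by (auto simp: W_def)
  then obtain c where "c > 0" "ball y c \<subseteq> W" using oW openE by blast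
  then show ?thesis using that smooth_retract_on_subset[OF ret] by blast
qed

text \<open>The two retractions are blended by a cut-off \<open>\<chi>\<close> as \<open>r2 ((1 - \<chi>) r1 + \<chi> r2)\<close>; this avoids tubular
  neighbourhoods and the inverse function theorem.\<close>

lemma smooth_retract_on_glue:
  fixes N :: "'a::euclidean_space set"
  assumes r1: "smooth_retract_on N S r1" "A \<subseteq> S" "A \<subseteq> N"
    and c: "c > 0" and r2: "smooth_retract_on N (ball y c) r2"
  obtains T r where "smooth_retract_on N T r" "A \<union> (N \<inter> ball y (c/3)) \<subseteq> T"
proof -
  have c3: "0 < c/3" "c/3 < c/2" using c by auto
  obtain \<eta> :: "'a \<Rightarrow> real" where \<eta>: "smooth_on_open UNIV \<eta>" "\<And>x. x \<in> cball y (c/3) \<Longrightarrow> \<eta> x = 1"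
    "\<And>x. x \<notin> ball y (c/2) \<Longrightarrow> \<eta> x = 0"
    using smooth_bump_exists[OF c3, of y] by blast
  let ?B = "ball y c"
  have s1: "smooth_on_open S r1" and s2: "smooth_on_open ?B r2" and oS: "open S"
    using r1(1) r2 by (auto simp: smooth_retract_on_def smooth_on_open_def)
  have oSB: "open (S \<inter> ?B)" using oS by auto
  define g where "g x = r1 x + \<eta> x *\<^sub>R (r2 x + (-1) *\<^sub>R r1 x)" for x
  have s1': "smooth_on_open (S \<inter> ?B) r1" and s2': "smooth_on_open (S \<inter> ?B) r2"
    and \<eta>': "smooth_on_open (S \<inter> ?B) \<eta>"
    using smooth_on_open_subset[OF s1 oSB] smooth_on_open_subset[OF s2 oSB]
      smooth_on_open_subset[OF \<eta>(1) oSB] by auto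
  have m1: "smooth_on_open (S \<inter> ?B) (\<lambda>x. (-1) *\<^sub>R r1 x)"
    by (rule smooth_on_open_bilinear[OF bounded_bilinear_scaleR smooth_on_open_const[OF oSB] s1'])
  have sg: "smooth_on_open (S \<inter> ?B) g"
    unfolding g_def
    by (rule smooth_on_open_add[OF s1' smooth_on_open_bilinear[OF bounded_bilinear_scaleR \<eta>'
          smooth_on_open_add[OF s2' m1]]])
  \<comment> \<open>The transition region: the blend g and both retractions land in the ball on
    which r2 is defined. It contains every point of A near y, because there r1 and r2, and hence g,
    fix the point.\<close>
  define Z where "Z = ((S \<inter> ?B) \<inter> g -` ?B) \<inter> ((S \<inter> ?B) \<inter> r1 -` ?B) \<inter> ((S \<inter> ?B) \<inter> r2 -` ?B)"
  have oZ: "open Z"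
    unfolding Z_def
    using smooth_on_open_continuous[OF sg] smooth_on_open_continuous[OF s1'] smooth_on_open_continuous[OF s2']
    by (intro open_Int continuous_open_preimage[OF _ oSB open_ball])
  define W where "W = ball y (c/3)"
  define D where "D = S - cball y (c/2)"
  have oD: "open D" unfolding D_def using oS by (intro open_Diff) auto
  \<comment> \<open>The three formulas agree on overlaps: \<eta> is 1 on W and 0 on D, so on their
    intersections with Z the blend g equals r2 or r1, already lies in N, and is fixed by the outer
    r2. Hence r is smooth on each of the three open pieces.\<close>
  define r where "r x = (if x \<in> W then r2 x else if x \<in> Z then r2 (g x) else r1 x)" for x
  have WB: "W \<subseteq> ?B" using c by (auto simp: W_def)
  have rW: "r x = r2 x" if "x \<in> W" for x using that by (simp add: r_def)
  have rZ: "r x = r2 (g x)" if "x \<in> Z" for x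
  proof (cases "x \<in> W")
    case True
    then have "g x = r2 x" using \<eta>(2)[of x] by (auto simp: g_def W_def)
    moreover have "r2 x \<in> ?B \<inter> N" using that r2 by (auto simp: Z_def smooth_retract_on_def)
    ultimately show ?thesis using True r2 by (auto simp: r_def smooth_retract_on_def)
  qed (use that in \<open>simp add: r_def\<close>)
  have rD: "r x = r1 x" if "x \<in> D" for x
  proof (cases "x \<in> Z")
    case True
    have "\<eta> x = 0" using that by (intro \<eta>(3)) (auto simp: D_def)
    then have "g x = r1 x" by (simp add: g_def)
    moreover have "r1 x \<in> ?B \<inter> N" using True r1 by (auto simp: Z_def smooth_retract_on_def)
    ultimately show ?thesis using rZ[OF True] r2 by (auto simp: smooth_retract_on_def)
  next
    case False
    then show ?thesis using that c by (auto simp: r_def D_def W_def)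
  qed
  have sW: "smooth_on_open W r"
    by (rule smooth_on_open_cong[OF smooth_on_open_subset[OF s2 _ WB]]) (auto simp: rW, auto simp: W_def)
  have sD: "smooth_on_open D r"
    by (rule smooth_on_open_cong[OF smooth_on_open_subset[OF s1 oD]]) (auto simp: rD, auto simp: D_def)
  have sgZ: "smooth_on_open Z g" by (rule smooth_on_open_subset[OF sg oZ]) (auto simp: Z_def)
  have "smooth_on_open Z (\<lambda>x. r2 (g x))"
    by (rule smooth_on_open_compose[OF sgZ s2]) (auto simp: Z_def)
  then have sZ: "smooth_on_open Z r"
    by (rule smooth_on_open_cong) (simp add: rZ)
  let ?T = "\<Union>{W, D, Z}"
  have "smooth_on_open ?T r"
    by (rule smooth_on_open_Union) (use sW sD sZ in auto)
  moreover have "r ` ?T \<subseteq> N"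
  proof -
    have "r x \<in> N" if "x \<in> W" for x using that rW WB r2 by (auto simp: smooth_retract_on_def)
    moreover have "r x \<in> N" if "x \<in> D" for x using that rD r1 by (auto simp: smooth_retract_on_def D_def)
    moreover have "r x \<in> N" if "x \<in> Z" for x using that rZ r2 by (auto simp: smooth_retract_on_def Z_def)
    ultimately show ?thesis by auto
  qed
  moreover have "r x = x" if "x \<in> ?T \<inter> N" for x
  proof -
    have "r x = x" if "x \<in> W" "x \<in> N" using that rW WB r2 by (auto simp: smooth_retract_on_def)
    moreover have "r x = x" if "x \<in> D" "x \<in> N" using that rD r1 by (auto simp: smooth_retract_on_def D_def)
    moreover have "r x = x" if "x \<in> Z" "x \<in> N"
    proof -
      have "r1 x = x" "r2 x = x" using that r1 r2 by (auto simp: smooth_retract_on_def Z_def)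
      then show ?thesis using rZ[OF that(1)] by (simp add: g_def)
    qed
    ultimately show ?thesis using that by auto
  qed
  ultimately have "smooth_retract_on N ?T r" by (auto simp: smooth_retract_on_def)
  moreover have "A \<union> (N \<inter> ball y (c/3)) \<subseteq> ?T"
  proof -
    have "x \<in> ?T" if "x \<in> A" for x
    proof (cases "x \<in> cball y (c/2)")
      case True
      then have x: "x \<in> S \<inter> ?B" "x \<in> N" using that r1 c by auto
      then have "r1 x = x" "r2 x = x" using r1 r2 by (auto simp: smooth_retract_on_def)
      then have "x \<in> Z" using x by (auto simp: Z_def g_def)
      then show ?thesis by auto
    qed (use that r1 in \<open>auto simp: D_def\<close>)
    then have "A \<subseteq> ?T" by blast
    then show ?thesis unfolding W_def by blast
  qed
  ultimately show ?thesis using that by blast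
qed

text \<open>By compactness finitely many balls of a third of the radius cover N, and the gluing
  lemma, which loses exactly that factor, adds them one by one.\<close>

theorem embedded_submanifold_smooth_retract:
  fixes N :: "'a::euclidean_space set"
  assumes "embedded_submanifold n N" "compact N"
  obtains U r where "N \<subseteq> U" "smooth_retract_on N U r"
proof -
  have "\<forall>y\<in>N. \<exists>c r. c > 0 \<and> smooth_retract_on N (ball y c) r"
    by (meson embedded_submanifold_local_retract[OF assms(1)])
  then obtain c r where cr: "\<And>y. y \<in> N \<Longrightarrow> c y > 0" "\<And>y. y \<in> N \<Longrightarrow> smooth_retract_on N (ball y (c y)) (r y)"
    by metis
  have "N \<subseteq> (\<Union>y\<in>N. ball y (c y / 3))" using cr(1) by force
  then obtain F where F: "F \<subseteq> N" "finite F" "N \<subseteq> (\<Union>y\<in>F. ball y (c y / 3))"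
    using compactE_image[OF assms(2), of N "\<lambda>y. ball y (c y / 3)"] by auto
  have "\<exists>T g. smooth_retract_on N T g \<and> N \<inter> (\<Union>y\<in>F. ball y (c y / 3)) \<subseteq> T"
    using F(2,1)
  proof (induction F)
    case empty
    have "smooth_retract_on N {} (\<lambda>x. x)"
      using smooth_on_open_const[of "{}" "undefined::'a"] by (auto simp: smooth_retract_on_def smooth_on_open_def intro: Ck_on_linear bounded_linear_ident)
    then show ?case by auto
  next
    case (insert y F)
    then obtain T g where T: "smooth_retract_on N T g" "N \<inter> (\<Union>y\<in>F. ball y (c y / 3)) \<subseteq> T" by auto
    have y: "y \<in> N" using insert.prems by auto
    obtain T' g' where "smooth_retract_on N T' g'"
      "(N \<inter> (\<Union>y\<in>F. ball y (c y / 3))) \<union> (N \<inter> ball y (c y / 3)) \<subseteq> T'"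
      by (rule smooth_retract_on_glue[OF T Int_lower1 cr(1)[OF y] cr(2)[OF y]])
    then show ?case by (intro exI[of _ T'] exI[of _ g']) auto
  qed
  then show ?thesis using that F(3) by blast
qed

text \<open>K need not be convex, so the bound on the derivative gives Lipschitz estimates only on
  small balls; compactness makes them global. \<open>local_lipschitz\<close> is about time-dependent
  maps, hence the dummy time 0.\<close>

lemma smooth_lipschitz_on_compact:
  fixes f :: "'a::euclidean_space \<Rightarrow> 'b::euclidean_space"
  assumes "smooth_on_open U f" "compact K" "K \<subseteq> U"
  shows "\<exists>L>0. \<forall>x\<in>K. \<forall>y\<in>K. norm (f x - f y) \<le> L * norm (x - y)"
proof -
  let ?D = "\<lambda>x. frechet_derivative f (at x)"
  have oU: "open U" and C1: "Ck_on (Suc 0) U f" using assms(1) by (auto simp: smooth_on_open_def simp del: Ck_on.simps)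
  have der: "(f has_derivative ?D x) (at x)" if "x \<in> U" for x
    using Ck_on_Suc_has_derivative[OF C1 that] .
  define G where "G x = (\<Sum>b\<in>Basis. norm (?D x b))" for x
  have contG: "continuous_on U G"
    using C1 unfolding G_def by (auto intro!: continuous_intros)
  have loc: "local_lipschitz {0::real} K (\<lambda>_. f)"
  proof (rule local_lipschitzI)
    fix t :: real and x assume "t \<in> {0}" "x \<in> K"
    then have "x \<in> U" using assms(3) by auto
    then obtain u where u: "u > 0" "cball x u \<subseteq> U" using oU open_contains_cball by blast
    have "continuous_on (cball x u) G" using contG u(2) by (rule continuous_on_subset)
    then have "bounded (G ` cball x u)" by (intro compact_imp_bounded compact_continuous_image) auto
    then obtain B where B: "\<And>z. z \<in> cball x u \<Longrightarrow> norm (G z) \<le> B"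
      unfolding bounded_iff by blast
    have "B \<ge> 0" using B[of x] u(1) by (meson centre_in_cball less_imp_le norm_ge_zero order_trans)
    have "norm (f z - f y) \<le> B * norm (z - y)" if "z \<in> cball x u" "y \<in> cball x u" for z y
    proof (rule differentiable_bound[where f'="?D" and S="cball x u"])
      show "(f has_derivative ?D w) (at w within cball x u)" if "w \<in> cball x u" for w
        using der u(2) that has_derivative_at_withinI by blast
      show "onorm (?D w) \<le> B" if "w \<in> cball x u" for w
      proof -
        have "bounded_linear (?D w)" using der u(2) that has_derivative_bounded_linear by blast
        then have "onorm (?D w) \<le> G w" unfolding G_def by (rule onorm_componentwise)
        then show ?thesis using B[OF that] by simp
      qed
    qed (use that in auto)
    then have "B-lipschitz_on (cball x u \<inter> K) f"
      using \<open>B \<ge> 0\<close> by (intro lipschitz_onI) (auto simp: dist_norm)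
    then show "\<exists>u>0. \<exists>L. \<forall>t\<in>cball t u \<inter> {0}. L-lipschitz_on (cball x u \<inter> K) f"
      using u(1) by blast
  qed
  have "\<exists>L. L-lipschitz_on K f"
  proof (rule local_lipschitz_compact_implies_lipschitz[OF loc assms(2) compact_sing])
    show "continuous_on {0::real} (\<lambda>t. f x)" for x by simp
    show "\<exists>L. L-lipschitz_on K f" if "\<And>t. t \<in> {0::real} \<Longrightarrow> L-lipschitz_on K f" for L
      using that[of 0] by blast
  qed
  then obtain L where L: "L-lipschitz_on K f" by blast
  have "norm (f x - f y) \<le> (L + 1) * norm (x - y)" if "x \<in> K" "y \<in> K" for x y
  proof -
    have "norm (f x - f y) \<le> L * norm (x - y)"
      using lipschitz_onD[OF L that] by (simp add: dist_norm)
    also have "\<dots> \<le> (L + 1) * norm (x - y)" by (intro mult_right_mono) auto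
    finally show ?thesis .
  qed
  moreover have "L \<ge> 0" using L lipschitz_on_nonneg by blast
  ultimately show ?thesis by (intro exI[of _ "L + 1"]) auto
qed

section \<open>Mollifiers\<close>

lemma nn_integral_lborel_affine:
  fixes f :: "'a::euclidean_space \<Rightarrow> ennreal"
  assumes [measurable]: "f \<in> borel_measurable borel" and "c \<noteq> 0"
  shows "(\<integral>\<^sup>+x. f x \<partial>lborel) = ennreal (\<bar>c\<bar> ^ DIM('a)) * (\<integral>\<^sup>+x. f (t + c *\<^sub>R x) \<partial>lborel)"
  by (subst lborel_affine[OF assms(2), of t])
    (simp add: nn_integral_density nn_integral_distr nn_integral_cmult)

lemma integral_lborel_affine:
  fixes f :: "'a::euclidean_space \<Rightarrow> 'b::euclidean_space"
  assumes [measurable]: "f \<in> borel_measurable borel" and "c \<noteq> 0"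
  shows "(\<integral>x. f x \<partial>lborel) = (\<bar>c\<bar> ^ DIM('a)) *\<^sub>R (\<integral>x. f (t + c *\<^sub>R x) \<partial>lborel)"
  by (subst lborel_affine[OF assms(2), of t])
    (simp add: integral_density integral_distr)

definition mollifier :: "('a::euclidean_space \<Rightarrow> real) \<Rightarrow> real \<Rightarrow> bool" where
  "mollifier \<phi> L \<longleftrightarrow> smooth_on_open UNIV \<phi> \<and> (\<forall>x. 0 \<le> \<phi> x) \<and> (\<forall>x. norm x \<ge> 1 \<longrightarrow> \<phi> x = 0) \<and>
     (\<integral>\<^sup>+x. ennreal (\<phi> x) \<partial>lborel) = 1 \<and> L > 0 \<and> (\<forall>x y. \<bar>\<phi> x - \<phi> y\<bar> \<le> L * norm (x - y)) \<and> (\<forall>x. \<phi> x \<le> L)"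

lemma mollifier_exists: "\<exists>(\<phi> :: 'a::euclidean_space \<Rightarrow> real) L. mollifier \<phi> L"
proof -
  have "(0::real) < 1/2" "1/2 < (1::real)" by auto
  note half_one = this
  obtain \<eta> :: "'a \<Rightarrow> real" where \<eta>: "smooth_on_open UNIV \<eta>" "\<And>x. x \<in> cball 0 (1/2) \<Longrightarrow> \<eta> x = 1"
    "\<And>x. x \<notin> ball 0 1 \<Longrightarrow> \<eta> x = 0" "\<And>x. 0 \<le> \<eta> x" "\<And>x. \<eta> x \<le> 1"
    using smooth_bump_exists[OF half_one, of "0::'a"] by blast
  have [measurable]: "\<eta> \<in> borel_measurable borel"
    using smooth_on_open_continuous[OF \<eta>(1)] by (rule borel_measurable_continuous_onI)
  have "emeasure lborel (cball (0::'a) (1/2)) = ennreal (Sigma_Algebra.measure lborel (cball (0::'a) (1/2)))"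
    using emeasure_lborel_cball_finite[of "0::'a" "1/2"] by (intro emeasure_eq_ennreal_measure) auto
  then have cball_pos: "emeasure lborel (cball (0::'a) (1/2)) > 0"
    using content_cball_pos[of "1/2" "0::'a"] by simp
  define I where "I = (\<integral>\<^sup>+x. ennreal (\<eta> x) \<partial>lborel)"
  have "I \<ge> (\<integral>\<^sup>+x. indicator (cball 0 (1/2)) x \<partial>(lborel::'a measure))"
    unfolding I_def using \<eta> by (intro nn_integral_mono) (auto simp: indicator_def simp del: mem_cball)
  moreover have "(\<integral>\<^sup>+x. indicator (cball 0 (1/2)) x \<partial>(lborel::'a measure)) > 0"
    by (simp add: cball_pos)
  ultimately have "I > 0" by (rule less_le_trans[rotated])
  have "I \<le> (\<integral>\<^sup>+x. indicator (ball 0 1) x \<partial>(lborel::'a measure))"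
    unfolding I_def using \<eta> by (intro nn_integral_mono) (auto simp: indicator_def simp del: mem_ball)
  also have "\<dots> < \<infinity>" using emeasure_lborel_ball_finite[of "0::'a" 1] by simp
  finally have "I < \<infinity>" .
  define c where "c = enn2real I"
  have c: "c > 0" "I = ennreal c" using \<open>I > 0\<close> \<open>I < \<infinity>\<close> by (auto simp: c_def enn2real_positive_iff)
  define \<phi> where "\<phi> x = (1/c) * \<eta> x" for x
  have sm: "smooth_on_open UNIV \<phi>"
    unfolding \<phi>_def by (rule smooth_on_open_bilinear[OF bounded_bilinear_mult smooth_on_open_const[OF open_UNIV] \<eta>(1)])
  have nonneg: "0 \<le> \<phi> x" and le: "\<phi> x \<le> 1/c" for x using \<eta>(4,5)[of x] c by (auto simp: \<phi>_def field_simps)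
  have zero: "\<phi> x = 0" if "norm x \<ge> 1" for x using \<eta>(3)[of x] that by (auto simp: \<phi>_def)
  have "(\<integral>\<^sup>+x. ennreal (\<phi> x) \<partial>lborel) = ennreal (1/c) * I"
  proof -
    have "ennreal (\<phi> x) = ennreal (1/c) * ennreal (\<eta> x)" for x
      unfolding \<phi>_def using c \<eta>(4)[of x] by (intro ennreal_mult) auto
    then show ?thesis by (simp add: I_def nn_integral_cmult)
  qed
  then have one: "(\<integral>\<^sup>+x. ennreal (\<phi> x) \<partial>lborel) = 1"
    using c by (simp add: ennreal_mult[symmetric])
  obtain L where L: "L > 0" "\<And>x y. x \<in> cball 0 2 \<Longrightarrow> y \<in> cball 0 2 \<Longrightarrow> norm (\<phi> x - \<phi> y) \<le> L * norm (x - y)"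
    using smooth_lipschitz_on_compact[OF sm compact_cball subset_UNIV, of 0 2] by blast
  \<comment> \<open>L is valid only inside the ball of radius 2. A point of the unit ball and a
    point outside that larger ball are more than 1 apart, and there the sup bound 1/c takes
    over.\<close>
  define L' where "L' = L + 1/c"
  have "L' > 0" "L' \<ge> 1/c" "L' \<ge> L" using L(1) c(1) by (auto simp: L'_def add_pos_pos)
  have half: "\<bar>\<phi> x - \<phi> y\<bar> \<le> L' * norm (x - y)" if "norm x < 1" for x y
  proof (cases "norm y \<le> 2")
    case True
    then have "\<bar>\<phi> x - \<phi> y\<bar> \<le> L * norm (x - y)" using L(2)[of x y] that by simp
    also have "\<dots> \<le> L' * norm (x - y)" using \<open>L' \<ge> L\<close> by (intro mult_right_mono) auto
    finally show ?thesis .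
  next
    case False
    then have "norm (x - y) \<ge> 1" using that norm_triangle_ineq2[of y x] by (simp add: norm_minus_commute)
    have "\<bar>\<phi> x - \<phi> y\<bar> \<le> 1/c" using zero[of y] False nonneg[of x] le[of x] by simp
    also have "\<dots> \<le> L' * 1" using \<open>L' \<ge> 1/c\<close> by simp
    also have "\<dots> \<le> L' * norm (x - y)" using \<open>norm (x - y) \<ge> 1\<close> \<open>L' > 0\<close> by (intro mult_left_mono) auto
    finally show ?thesis .
  qed
  have lip: "\<bar>\<phi> x - \<phi> y\<bar> \<le> L' * norm (x - y)" for x y
  proof -
    consider "norm x < 1" | "norm y < 1" | "norm x \<ge> 1" "norm y \<ge> 1" by linarith
    then show ?thesis
      using half[of x y] half[of y x] zero[of x] zero[of y] \<open>L' > 0\<close>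
      by cases (auto simp: norm_minus_commute abs_minus_commute)
  qed
  have "\<phi> x \<le> L'" for x using le[of x] \<open>L' \<ge> 1/c\<close> by linarith
  then have "mollifier \<phi> L'"
    unfolding mollifier_def using sm nonneg zero one \<open>L' > 0\<close> lip by simp
  then show ?thesis by blast
qed

text \<open>Differentiation under the integral over a fixed box falls on \<psi> alone, so continuity
  of f suffices. The induction varies \<psi>: a directional derivative of the convolution is the
  convolution with a directional derivative of \<psi>.\<close>

lemma Ck_on_convolution:
  fixes f :: "'a::euclidean_space \<Rightarrow> 'b::euclidean_space" and \<psi> :: "'a \<Rightarrow> real"
  assumes "continuous_on UNIV f" "smooth_on_open UNIV \<psi>"
  shows "Ck_on k UNIV (\<lambda>x. integral (cbox a b) (\<lambda>y. \<psi> (x - y) *\<^sub>R f y))"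
  using assms(2)
proof (induction k arbitrary: \<psi>)
  case 0
  have "continuous_on UNIV \<psi>" using 0 by (rule smooth_on_open_continuous)
  then have "continuous_on (UNIV \<times> cbox a b) (\<lambda>(x, y). \<psi> (x - y) *\<^sub>R f y)"
    using assms(1) by (auto simp: case_prod_beta intro!: continuous_intros intro: continuous_on_compose2)
  then show ?case by (simp add: integral_continuous_on_param)
next
  case (Suc k)
  let ?D = "\<lambda>x. frechet_derivative \<psi> (at x)"
  have C: "Ck_on j UNIV \<psi>" for j using Suc.prems by (simp add: smooth_on_open_def)
  have der: "(\<psi> has_derivative ?D x) (at x)" for x
    using Ck_on_Suc_has_derivative[OF C[of "Suc 0"]] by simp
  have bl: "bounded_linear (?D x)" for x using der has_derivative_bounded_linear by blast
  have smD: "smooth_on_open UNIV (\<lambda>x. ?D x v)" for v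
    using C[of "Suc _"] by (auto simp: smooth_on_open_def)
  have contD: "continuous_on UNIV (\<lambda>x. ?D x v)" for v using smD by (rule smooth_on_open_continuous)
  have cont\<psi>: "continuous_on UNIV \<psi>" using Suc.prems by (rule smooth_on_open_continuous)
  define fx where "fx x t = Blinfun (\<lambda>v. ?D (x - t) v *\<^sub>R f t)" for x t
  have fx: "blinfun_apply (fx x t) v = ?D (x - t) v *\<^sub>R f t" for x t v
    unfolding fx_def by (subst bounded_linear_Blinfun_apply) (auto intro: bounded_linear_scaleR_const bl)
  have contfx: "continuous_on (UNIV \<times> cbox a b) (\<lambda>(x, t). fx x t)"
    unfolding case_prod_beta
    by (rule continuous_on_blinfun_componentwise)
      (auto simp: fx intro!: continuous_intros continuous_on_compose2[OF contD] continuous_on_compose2[OF assms(1)])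
  have d: "((\<lambda>x. integral (cbox a b) (\<lambda>y. \<psi> (x - y) *\<^sub>R f y)) has_derivative integral (cbox a b) (fx x)) (at x)" for x
  proof (rule leibniz_rule[of UNIV a b "\<lambda>x y. \<psi> (x - y) *\<^sub>R f y" fx x])
    fix x t :: 'a
    have "((\<lambda>x. x - t) has_derivative (\<lambda>v. v)) (at x)" by (auto intro!: derivative_eq_intros)
    from has_derivative_compose[OF this der[of "x - t"]]
    have "((\<lambda>x. \<psi> (x - t)) has_derivative (\<lambda>v. ?D (x - t) v)) (at x)" .
    then have "((\<lambda>x. \<psi> (x - t) *\<^sub>R f t) has_derivative (\<lambda>v. ?D (x - t) v *\<^sub>R f t)) (at x)"
      by (rule has_derivative_scaleR_left)
    then show "((\<lambda>x. \<psi> (x - t) *\<^sub>R f t) has_derivative blinfun_apply (fx x t)) (at x)"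
      by (simp add: fx[abs_def])
  next
    fix x
    show "(\<lambda>y. \<psi> (x - y) *\<^sub>R f y) integrable_on cbox a b"
      by (intro integrable_continuous continuous_intros continuous_on_compose2[OF cont\<psi>] continuous_on_subset[OF assms(1)]) auto
  qed (use contfx in auto)
  show ?case
  proof (rule Ck_on_SucI'[OF open_UNIV d])
    fix v
    have int: "fx x integrable_on cbox a b" for x
    proof (rule integrable_continuous)
      have "continuous_on (cbox a b) (\<lambda>t. (\<lambda>(x, t). fx x t) (x, t))"
        by (rule continuous_on_compose2[OF contfx]) (auto intro!: continuous_intros)
      then show "continuous_on (cbox a b) (fx x)" by simp
    qed
    have "blinfun_apply (integral (cbox a b) (fx x)) v = integral (cbox a b) (\<lambda>y. ?D (x - y) v *\<^sub>R f y)" for x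
      by (simp add: blinfun_apply_integral[OF int] fx)
    then show "Ck_on k UNIV (\<lambda>x. blinfun_apply (integral (cbox a b) (fx x)) v)"
      using Suc.IH[OF smD[of v]] by simp
  qed
qed

section \<open>Homotopies over skeleta of a cubical grid\<close>

lemma continuous_on_Max_finite:
  fixes f :: "'i \<Rightarrow> 'a::topological_space \<Rightarrow> 'b::linorder_topology"
  assumes "finite I" "I \<noteq> {}" "\<And>i. i \<in> I \<Longrightarrow> continuous_on S (f i)"
  shows "continuous_on S (\<lambda>x. Max ((\<lambda>i. f i x) ` I))"
  using assms
proof (induction I rule: finite_ne_induct)
  case (singleton i)
  then show ?case by simp
next
  case (insert i I)
  then have "continuous_on S (\<lambda>x. max (f i x) (Max ((\<lambda>i. f i x) ` I)))"
    by (intro continuous_on_max) auto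
  then show ?case using insert by simp
qed

lemma nsphere_eq_top_of_set:
  "nsphere l = top_of_set {w. (\<Sum>i\<le>l. (w i)\<^sup>2) = 1 \<and> (\<forall>i>l. w i = 0)}"
  unfolding nsphere euclidean_product_topology
  by (auto intro!: arg_cong2[where f=subtopology])

lemma nsphere_nullhomotopy:
  fixes M :: "'a::euclidean_space set" and S :: "(nat \<Rightarrow> real) set"
  assumes "trivial_homotopy_group l M" "continuous_on S f" "f ` S \<subseteq> M"
    and S: "S = {w. (\<Sum>i\<le>l. (w i)\<^sup>2) = 1 \<and> (\<forall>i>l. w i = 0)}"
  shows "\<exists>h. \<exists>k\<in>M. continuous_on ({0..1::real} \<times> S) h \<and> h ` ({0..1} \<times> S) \<subseteq> M \<and>
    (\<forall>w. h (0, w) = f w) \<and> (\<forall>w. h (1, w) = k)"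
proof -
  have "continuous_map (nsphere l) (top_of_set M) f"
    using assms(2,3) by (auto simp: nsphere_eq_top_of_set S[symmetric])
  then have "\<exists>k\<in>M. homotopic_with (\<lambda>h. True) (nsphere l) (top_of_set M) f (\<lambda>x. k)"
    using assms(1) unfolding trivial_homotopy_group_def by simp
  then obtain k where k: "k \<in> M" "homotopic_with (\<lambda>h. True) (nsphere l) (top_of_set M) f (\<lambda>x. k)"
    by (elim bexE)
  have "\<exists>h. continuous_map (prod_topology (top_of_set {0..1::real}) (nsphere l)) (top_of_set M) h \<and>
    (\<forall>x. h (0, x) = f x) \<and> (\<forall>x. h (1, x) = k)"
    using k(2) unfolding homotopic_with_def by simp
  then obtain h where h: "continuous_map (prod_topology (top_of_set {0..1::real}) (nsphere l)) (top_of_set M) h"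
    "\<And>x. h (0, x) = f x" "\<And>x. h (1, x) = k"
    by (elim exE conjE) auto
  have "nsphere l = top_of_set S" unfolding S by (rule nsphere_eq_top_of_set)
  then have "continuous_map (top_of_set ({0..1} \<times> S)) (top_of_set M) h"
    using h(1) by (metis prod_topology_subtopology_eu)
  then have "continuous_on ({0..1::real} \<times> S) h" "h ` ({0..1} \<times> S) \<subseteq> M"
    by (auto simp: continuous_map_in_subtopology)
  then show ?thesis using k(1) h(2,3) by blast
qed

text \<open>A nullhomotopy of the boundary sphere fills the cube: the distance from the boundary, in
  the sup norm, serves as homotopy time. The cube has dimension l + 1 and may sit in a larger space,
  so that cells of every dimension can be treated alike.\<close>

lemma continuous_extension_cube:
  fixes b :: "nat \<Rightarrow> 'a::euclidean_space" and f :: "'a \<Rightarrow> 'b::euclidean_space"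
  assumes M: "trivial_homotopy_group l M"
    and inj: "inj_on b {..l}" and bB: "b ` {..l} \<subseteq> Basis"
    and C: "C = {z. (\<forall>i\<le>l. \<bar>(z - c) \<bullet> b i\<bar> \<le> 1/2) \<and> (\<forall>e\<in>Basis. e \<notin> b ` {..l} \<longrightarrow> (z - c) \<bullet> e = 0)}"
    and D: "D = {z\<in>C. \<exists>i\<le>l. \<bar>(z - c) \<bullet> b i\<bar> = 1/2}"
    and f: "continuous_on D f" "f ` D \<subseteq> M"
  shows "\<exists>g. continuous_on C g \<and> g ` C \<subseteq> M \<and> (\<forall>z\<in>D. g z = f z)"
proof -
  define S where "S = {w::nat \<Rightarrow> real. (\<Sum>i\<le>l. (w i)\<^sup>2) = 1 \<and> (\<forall>i>l. w i = 0)}"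
  define m where "m w = Max ((\<lambda>i. \<bar>w i\<bar>) ` {..l})" for w :: "nat \<Rightarrow> real"
  define vec where "vec w = (\<Sum>i\<le>l. w i *\<^sub>R b i)" for w
  \<comment> \<open>The radial map from the round sphere to the boundary of the cube: the largest
    coordinate is rescaled to 1/2.\<close>
  define \<beta> where "\<beta> w = c + (1 / (2 * m w)) *\<^sub>R vec w" for w
  have bb: "b i \<bullet> b j = (if i = j then 1 else 0)" if "i \<le> l" "j \<le> l" for i j
    using inj bB that by (auto simp: inner_Basis inj_on_def image_subset_iff)
  have vecb: "vec w \<bullet> b j = w j" if "j \<le> l" for w j
    using that by (simp add: vec_def inner_sum_left bb if_distrib[of "\<lambda>x. _ * x"] cong: if_cong)
  have vece: "vec w \<bullet> e = 0" if "e \<in> Basis" "e \<notin> b ` {..l}" for w e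
    using that bB unfolding vec_def inner_sum_left
    by (intro sum.neutral ballI) (auto simp: inner_Basis image_subset_iff)
  have mge: "\<bar>w i\<bar> \<le> m w" if "i \<le> l" for w i
    using that by (auto simp: m_def)
  have mex: "\<exists>i\<le>l. \<bar>w i\<bar> = m w" for w
  proof -
    have "m w \<in> (\<lambda>i. \<bar>w i\<bar>) ` {..l}" unfolding m_def by (intro Max_in) auto
    then show ?thesis by force
  qed
  have mpos: "m w > 0" if "w \<in> S" for w
  proof (rule ccontr)
    assume "\<not> m w > 0"
    then have "w i = 0" if "i \<le> l" for i using mge[OF that, of w] by simp
    then show False using \<open>w \<in> S\<close> by (simp add: S_def)
  qed
  have \<beta>D: "\<beta> w \<in> D" if "w \<in> S" for w
  proof -
    have m0: "m w > 0" using mpos[OF that] .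
    have eq: "(\<beta> w - c) \<bullet> b i = w i / (2 * m w)" if "i \<le> l" for i
      by (simp add: \<beta>_def vecb[OF that])
    have "\<bar>(\<beta> w - c) \<bullet> b i\<bar> \<le> 1/2" if "i \<le> l" for i
      using m0 mge[OF that, of w] by (simp add: eq[OF that] abs_mult field_simps)
    moreover have "(\<beta> w - c) \<bullet> e = 0" if "e \<in> Basis" "e \<notin> b ` {..l}" for e
      using vece[OF that] by (simp add: \<beta>_def)
    moreover obtain i where i: "i \<le> l" "\<bar>w i\<bar> = m w" using mex by blast
    then have "\<bar>(\<beta> w - c) \<bullet> b i\<bar> = 1/2"
      using m0 by (simp add: eq)
    ultimately show ?thesis using i(1) by (auto simp: C D)
  qed
  have contm: "continuous_on UNIV m"
    unfolding m_def by (rule continuous_on_Max_finite) (auto intro!: continuous_intros continuous_on_coordinatewise_then_product)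
  have cont\<beta>: "continuous_on S \<beta>"
    unfolding \<beta>_def vec_def
    by (intro continuous_intros continuous_on_subset[OF contm] continuous_on_subset[OF continuous_on_product_coordinates])
      (use mpos in force)+
  have "continuous_on S (\<lambda>w. f (\<beta> w))"
    by (rule continuous_on_compose2[OF f(1) cont\<beta>]) (use \<beta>D in auto)
  moreover have "(\<lambda>w. f (\<beta> w)) ` S \<subseteq> M" using f(2) \<beta>D by auto
  ultimately obtain h k where h: "k \<in> M" "continuous_on ({0..1::real} \<times> S) h" "h ` ({0..1} \<times> S) \<subseteq> M"
    "\<And>w. h (0, w) = f (\<beta> w)" "\<And>w. h (1, w) = k"
    using nsphere_nullhomotopy[OF M _ _ S_def, of "\<lambda>w. f (\<beta> w)"] by blast
  define y where "y z = (\<lambda>i. if i \<le> l then (z - c) \<bullet> b i else 0)" for z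
  define \<mu> where "\<mu> z = m (y z)" for z
  define r where "r z = sqrt (\<Sum>i\<le>l. (y z i)\<^sup>2)" for z
  define \<omega> where "\<omega> z = (\<lambda>i. y z i / r z)" for z
  have conty: "continuous_on UNIV (\<lambda>z. y z i)" for i
    unfolding y_def by (cases "i \<le> l") (auto intro!: continuous_intros)
  then have conty': "continuous_on UNIV y"
    by (rule continuous_on_coordinatewise_then_product)
  have cont\<mu>: "continuous_on UNIV \<mu>"
    unfolding \<mu>_def by (rule continuous_on_compose2[OF contm conty']) auto
  have rpos: "r z > 0" if "\<mu> z > 0" for z
  proof -
    obtain i where i: "i \<le> l" "\<bar>y z i\<bar> = \<mu> z" using mex[of "y z"] by (auto simp: \<mu>_def)
    then have "(y z i)\<^sup>2 > 0" using that by auto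
    also have "(y z i)\<^sup>2 \<le> (\<Sum>i\<le>l. (y z i)\<^sup>2)"
      using i by (intro member_le_sum) auto
    finally show ?thesis by (simp add: r_def)
  qed
  have \<omega>S: "\<omega> z \<in> S" if "\<mu> z > 0" for z
  proof -
    have r0: "r z > 0" using rpos[OF that] .
    have "(\<Sum>i\<le>l. (\<omega> z i)\<^sup>2) = (\<Sum>i\<le>l. (y z i)\<^sup>2) / (r z)\<^sup>2"
      by (simp add: \<omega>_def power_divide sum_divide_distrib)
    also have "(r z)\<^sup>2 = (\<Sum>i\<le>l. (y z i)\<^sup>2)"
      by (simp add: r_def sum_nonneg)
    also have "(\<Sum>i\<le>l. (y z i)\<^sup>2) / (\<Sum>i\<le>l. (y z i)\<^sup>2) = 1"
      using r0 by (simp add: r_def)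
    finally show ?thesis by (simp add: S_def \<omega>_def y_def)
  qed
  have cont\<omega>: "continuous_on {z. \<mu> z > 0} \<omega>"
  proof (rule continuous_on_coordinatewise_then_product)
    have "r z \<noteq> 0" if "\<mu> z > 0" for z using rpos[OF that] by simp
    then show "continuous_on {z. \<mu> z > 0} (\<lambda>z. \<omega> z i)" for i
      unfolding \<omega>_def
      by (intro continuous_intros continuous_on_subset[OF conty])
        (auto simp: r_def intro!: continuous_intros continuous_on_subset[OF conty])
  qed
  define C1 where "C1 = {z\<in>C. \<mu> z \<le> 1/4}"
  define C2 where "C2 = {z\<in>C. \<mu> z \<ge> 1/4}"
  \<comment> \<open>As \<mu> falls from 1/2 on the boundary to 1/4, the time 2 - 4 \<mu> rises from
    0 to 1, where the homotopy has become constant. Stopping at 1/4 avoids the centre, where the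
    direction \<omega> is undefined.\<close>
  define g where "g z = (if \<mu> z \<le> 1/4 then k else h (2 - 4 * \<mu> z, \<omega> z))" for z
  have \<mu>C: "\<mu> z \<le> 1/2" if "z \<in> C" for z
    using that unfolding \<mu>_def m_def by (intro Max.boundedI) (auto simp: C y_def)
  have maps: "(2 - 4 * \<mu> z, \<omega> z) \<in> {0..1} \<times> S" if "z \<in> C2" for z
    using that \<mu>C[of z] \<omega>S[of z] by (auto simp: C2_def)
  have "continuous_on (C1 \<union> C2) (\<lambda>z. if \<mu> z \<le> 1/4 then k else h (2 - 4 * \<mu> z, \<omega> z))"
  proof (rule continuous_on_cases_le)
    show "continuous_on {z \<in> C1 \<union> C2. \<mu> z \<le> 1/4} (\<lambda>z. k)" by simp
    show "continuous_on (C1 \<union> C2) \<mu>" using cont\<mu> by (rule continuous_on_subset) auto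
    show "continuous_on {z \<in> C1 \<union> C2. 1/4 \<le> \<mu> z} (\<lambda>z. h (2 - 4 * \<mu> z, \<omega> z))"
    proof (rule continuous_on_compose2[OF h(2)])
      show "continuous_on {z \<in> C1 \<union> C2. 1/4 \<le> \<mu> z} (\<lambda>z. (2 - 4 * \<mu> z, \<omega> z))"
        by (intro continuous_intros continuous_on_subset[OF cont\<mu>] continuous_on_subset[OF cont\<omega>]) auto
      show "(\<lambda>z. (2 - 4 * \<mu> z, \<omega> z)) ` {z \<in> C1 \<union> C2. 1/4 \<le> \<mu> z} \<subseteq> {0..1} \<times> S"
        using maps by (force simp: C1_def C2_def)
    qed
    show "k = h (2 - 4 * \<mu> z, \<omega> z)" if "z \<in> C1 \<union> C2" "\<mu> z = 1/4" for z
      using h(5)[of "\<omega> z"] that(2) by (simp add: algebra_simps)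
  qed
  moreover have "C1 \<union> C2 = C" by (auto simp: C1_def C2_def)
  ultimately have "continuous_on C g" unfolding g_def[abs_def] by simp
  moreover have "g ` C \<subseteq> M"
  proof
    fix v assume "v \<in> g ` C"
    then obtain z where z: "z \<in> C" "v = g z" by blast
    show "v \<in> M"
    proof (cases "\<mu> z \<le> 1/4")
      case True
      then show ?thesis using z h(1) by (simp add: g_def)
    next
      case False
      then have "z \<in> C2" using z by (simp add: C2_def)
      then show ?thesis using z False maps[of z] h(3) by (auto simp: g_def)
    qed
  qed
  moreover have "g z = f z" if "z \<in> D" for z
  proof -
    have zC: "z \<in> C" using that by (simp add: D)
    obtain i where i: "i \<le> l" "\<bar>(z - c) \<bullet> b i\<bar> = 1/2" using \<open>z \<in> D\<close> by (auto simp: D)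
    then have "\<mu> z \<ge> 1/2" using mge[of i "y z"] by (simp add: \<mu>_def y_def)
    then have \<mu>: "\<mu> z = 1/2" using \<mu>C[OF zC] by simp
    have r0: "r z > 0" using rpos[of z] \<mu> by simp
    \<comment> \<open>Homogeneity of the sup norm; it shows that \<beta> inverts \<omega> on the
      boundary, so that at time 0 the filling reproduces f.\<close>
    have "m (\<omega> z) = \<mu> z / r z"
    proof (rule antisym)
      obtain j where j: "j \<le> l" "\<bar>\<omega> z j\<bar> = m (\<omega> z)" using mex by blast
      have "\<bar>\<omega> z j\<bar> = \<bar>y z j\<bar> / r z" using r0 by (simp add: \<omega>_def)
      also have "\<dots> \<le> \<mu> z / r z" using mge[OF j(1), of "y z"] r0 by (simp add: \<mu>_def divide_right_mono)
      finally show "m (\<omega> z) \<le> \<mu> z / r z" using j(2) by simp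
      obtain j where j: "j \<le> l" "\<bar>y z j\<bar> = \<mu> z" using mex[of "y z"] by (auto simp: \<mu>_def)
      then show "\<mu> z / r z \<le> m (\<omega> z)"
        using mge[of j "\<omega> z"] r0 by (simp add: \<omega>_def)
    qed
    then have "\<beta> (\<omega> z) = c + r z *\<^sub>R vec (\<omega> z)" using \<mu> by (simp add: \<beta>_def)
    also have "r z *\<^sub>R vec (\<omega> z) = vec (y z)"
      using r0 by (simp add: vec_def scaleR_sum_right \<omega>_def)
    also have "vec (y z) = z - c"
    proof (rule euclidean_eqI)
      fix e :: 'a assume e: "e \<in> Basis"
      show "vec (y z) \<bullet> e = (z - c) \<bullet> e"
      proof (cases "e \<in> b ` {..l}")
        case True
        then show ?thesis using vecb by (auto simp: y_def)
      next
        case False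
        then show ?thesis using vece[OF e False] e zC by (auto simp: C)
      qed
    qed
    finally have "\<beta> (\<omega> z) = z" by simp
    moreover have "g z = h (2 - 4 * \<mu> z, \<omega> z)" using \<mu> unfolding g_def by argo
    moreover have "2 - 4 * \<mu> z = 0" using \<mu> by simp
    ultimately show ?thesis using h(4)[of "\<omega> z"] by metis
  qed
  ultimately show ?thesis by blast
qed

section \<open>Cells and skeleta of the unit grid\<close>

definition nonint :: "real^'v \<Rightarrow> 'v set" where
  "nonint x = {i. x $ i \<notin> \<int>}"

text \<open>The closed face with lower corner n spanned by the directions in I. Every x lies in the
  relative interior of exactly one of them, its carrier \<open>cell (floors x) (nonint x)\<close>; a
  function of the carrier is thus a function of the point.\<close>

definition cell :: "('v \<Rightarrow> int) \<Rightarrow> 'v set \<Rightarrow> (real^'v) set" where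
  "cell n I = {x. \<forall>i. if i \<in> I then of_int (n i) \<le> x $ i \<and> x $ i \<le> of_int (n i) + 1
                       else x $ i = of_int (n i)}"

definition floors :: "real^'v \<Rightarrow> 'v \<Rightarrow> int" where
  "floors x i = \<lfloor>x $ i\<rfloor>"

text \<open>The union of the cells of dimension less than \<open>l\<close> (not at most \<open>l\<close>) contained in \<open>B\<close>, so that
  \<open>l = 0\<close> gives the empty set.\<close>

definition skel :: "(real^'v) set \<Rightarrow> nat \<Rightarrow> (real^'v) set" where
  "skel B l = {x. card (nonint x) < l \<and> cell (floors x) (nonint x) \<subseteq> B}"

lemma mem_cell_self: "x \<in> cell (floors x) (nonint x)"
proof -
  have "x $ i = of_int \<lfloor>x $ i\<rfloor>" if "x $ i \<in> \<int>" for i using that by (auto elim: Ints_cases)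
  moreover have "x $ i \<le> of_int \<lfloor>x $ i\<rfloor> + 1" for i by linarith
  ultimately show ?thesis by (auto simp: cell_def nonint_def floors_def)
qed

lemma cell_inD:
  "x \<in> cell n I \<Longrightarrow> i \<in> I \<Longrightarrow> of_int (n i) \<le> x $ i"
  "x \<in> cell n I \<Longrightarrow> i \<in> I \<Longrightarrow> x $ i \<le> of_int (n i) + 1"
  by (simp_all add: cell_def)

lemma cell_notinD: "x \<in> cell n I \<Longrightarrow> i \<notin> I \<Longrightarrow> x $ i = of_int (n i)"
  by (simp add: cell_def)

lemma nonint_subset_cell: "x \<in> cell n I \<Longrightarrow> nonint x \<subseteq> I"
proof (rule subsetI, rule ccontr)
  fix i assume "x \<in> cell n I" "i \<in> nonint x" "i \<notin> I"
  then show False using cell_notinD[of x n I i] by (simp add: nonint_def)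
qed

lemma floors_cell_nonint:
  assumes "x \<in> cell n I" "i \<in> nonint x"
  shows "floors x i = n i"
proof -
  have i: "i \<in> I" using nonint_subset_cell assms by blast
  then have b: "of_int (n i) \<le> x $ i" "x $ i \<le> of_int (n i) + 1"
    using assms(1) by (auto simp: cell_def)
  have "x $ i \<noteq> of_int (n i + 1)" using assms(2) unfolding nonint_def by (metis Ints_of_int mem_Collect_eq)
  then have "x $ i < of_int (n i) + 1" using b by simp
  then show ?thesis using b by (simp add: floors_def floor_unique)
qed

text \<open>The carrier of a point is the smallest cell containing it, hence a face of any other
  cell through it.\<close>

lemma cell_subset_cell:
  assumes "x \<in> cell n I"
  shows "cell (floors x) (nonint x) \<subseteq> cell n I"
proof
  fix z assume z: "z \<in> cell (floors x) (nonint x)"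
  have "if i \<in> I then of_int (n i) \<le> z $ i \<and> z $ i \<le> of_int (n i) + 1 else z $ i = of_int (n i)" for i
  proof (cases "i \<in> nonint x")
    case True
    then show ?thesis
      using cell_inD[OF z True] floors_cell_nonint[OF assms True] nonint_subset_cell[OF assms] by auto
  next
    case False
    then have "x $ i = of_int (floors x i)" using mem_cell_self[of x] by (simp add: cell_def)
    moreover have "z $ i = of_int (floors x i)" using z False by (simp add: cell_def)
    ultimately have "z $ i = x $ i" by simp
    then show ?thesis using assms by (simp add: cell_def)
  qed
  then show "z \<in> cell n I" by (simp add: cell_def)
qed

lemma floors_cell_eq:
  assumes "x \<in> cell n (nonint x)"
  shows "floors x = n"
proof
  fix i
  show "floors x i = n i"
  proof (cases "i \<in> nonint x")
    case True
    then show ?thesis by (rule floors_cell_nonint[OF assms])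
  next
    case False
    then show ?thesis using assms by (simp add: cell_def floors_def)
  qed
qed

lemma compact_cell: "compact (cell n I :: (real^'v) set)"
proof -
  have "cell n I = cbox (\<chi> i. of_int (n i)) (\<chi> i. if i \<in> I then of_int (n i) + 1 else of_int (n i))"
    by (auto simp: cell_def mem_box_cart split: if_splits)
  then show ?thesis by simp
qed

lemma finite_cells_in_bounded:
  fixes B :: "(real^'v) set"
  assumes "bounded B"
  shows "finite {(n, I). cell n I \<subseteq> B}"
proof -
  obtain R where R: "\<And>x. x \<in> B \<Longrightarrow> norm x \<le> R" using assms by (auto simp: bounded_iff)
  let ?A = "{-\<lceil>R\<rceil>..\<lceil>R\<rceil>}"
  have "n i \<in> ?A" if "cell n I \<subseteq> B" for n I i
  proof -
    have "(\<chi> i. real_of_int (n i)) \<in> cell n I" by (simp add: cell_def)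
    then have "norm (\<chi> i. real_of_int (n i)) \<le> R" using that R by auto
    then have "\<bar>of_int (n i) :: real\<bar> \<le> R"
      using component_le_norm_cart[of "\<chi> i. real_of_int (n i)" i] by simp
    then have "\<bar>n i\<bar> \<le> \<lceil>R\<rceil>" by linarith
    then show ?thesis by auto
  qed
  then have "{(n, I). cell n I \<subseteq> B} \<subseteq> (UNIV \<rightarrow>\<^sub>E ?A) \<times> UNIV"
    by (auto simp: PiE_def)
  moreover have "finite (((UNIV :: 'v set) \<rightarrow>\<^sub>E ?A) \<times> (UNIV :: 'v set set))"
  proof (rule finite_cartesian_product)
    show "finite (UNIV \<rightarrow>\<^sub>E ?A :: ('v \<Rightarrow> int) set)" by (rule finite_PiE) simp_all
    show "finite (UNIV :: 'v set set)" by simp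
  qed
  ultimately show ?thesis by (rule finite_subset)
qed

lemma skel_eq_Union_cells: "skel B l = (\<Union>(n, I)\<in>{(n, I). cell n I \<subseteq> B \<and> card I < l}. cell n I)"
proof (intro set_eqI iffI)
  fix x assume "x \<in> skel B l"
  then show "x \<in> (\<Union>(n, I)\<in>{(n, I). cell n I \<subseteq> B \<and> card I < l}. cell n I)"
    using mem_cell_self[of x] by (auto simp: skel_def)
next
  fix x assume "x \<in> (\<Union>(n, I)\<in>{(n, I). cell n I \<subseteq> B \<and> card I < l}. cell n I)"
  then obtain n I where nI: "x \<in> cell n I" "cell n I \<subseteq> B" "card I < l" by auto
  have "card (nonint x) \<le> card I" using nonint_subset_cell[OF nI(1)] by (intro card_mono) auto
  then show "x \<in> skel B l" using nI cell_subset_cell[OF nI(1)] by (auto simp: skel_def)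
qed

lemma compact_skel:
  assumes "bounded B"
  shows "compact (skel B l)"
proof -
  have "finite {(n, I). cell n I \<subseteq> B \<and> card I < l}"
    using finite_cells_in_bounded[OF assms] by (rule rev_finite_subset) auto
  then show ?thesis unfolding skel_eq_Union_cells by (intro compact_UN) (auto intro: compact_cell)
qed

text \<open>The product of an l-dimensional cell with the time interval is a cube of dimension l +
  1, which is why \<open>trivial_homotopy_group l M\<close> is the right hypothesis. D is its full
  boundary: bottom, top and sides. In the basis b, index 0 is time and the others run through I; c
  is the centre of the product.\<close>

lemma continuous_extension_cell:
  fixes f :: "(real^'v) \<times> real \<Rightarrow> 'b::euclidean_space"
  assumes M: "trivial_homotopy_group l M" and I: "card I = l"
    and D: "D = {z \<in> cell n I \<times> {0..1}. snd z = 0 \<or> snd z = 1 \<or> nonint (fst z) \<noteq> I}"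
    and f: "continuous_on D f" "f ` D \<subseteq> M"
  shows "\<exists>g. continuous_on (cell n I \<times> {0..1}) g \<and> g ` (cell n I \<times> {0..1}) \<subseteq> M \<and> (\<forall>z\<in>D. g z = f z)"
proof -
  obtain e where e: "bij_betw e {..<l} I"
    using ex_bij_betw_nat_finite[OF finite[of I]] unfolding I atLeast0LessThan by (elim exE)
  define b :: "nat \<Rightarrow> (real^'v) \<times> real" where "b j = (case j of 0 \<Rightarrow> (0, 1) | Suc j \<Rightarrow> (axis (e j) 1, 0))" for j
  define c :: "(real^'v) \<times> real" where "c = ((\<chi> i. of_int (n i) + (if i \<in> I then 1/2 else 0)), 1/2)"
  have split: "{..l} = insert 0 (Suc ` {..<l})"
    by (simp only: lessThan_Suc_atMost[symmetric] lessThan_Suc_eq_insert_0)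
  have bim: "b ` {..l} = insert (0, 1) ((\<lambda>i. (axis i 1, 0)) ` I)"
    unfolding split using e by (auto simp: b_def bij_betw_def image_image)
  have all_b: "(\<forall>i\<le>l. Q (b i)) \<longleftrightarrow> Q (0, 1) \<and> (\<forall>i\<in>I. Q (axis i 1, 0))" for Q
  proof -
    have "(\<forall>i\<le>l. Q (b i)) \<longleftrightarrow> (\<forall>w\<in>b ` {..l}. Q w)" by auto
    then show ?thesis unfolding bim by auto
  qed
  have ex_b: "(\<exists>i\<le>l. Q (b i)) \<longleftrightarrow> Q (0, 1) \<or> (\<exists>i\<in>I. Q (axis i 1, 0))" for Q
    using all_b[of "\<lambda>w. \<not> Q w"] by blast
  have inj: "inj_on b {..l}"
    using e unfolding split by (auto simp: inj_on_def b_def bij_betw_def axis_eq_axis)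
  have bB: "b ` {..l} \<subseteq> Basis"
    unfolding bim by (auto simp: Basis_prod_def Basis_vec_def)
  have basis: "(\<forall>w\<in>Basis. w \<notin> b ` {..l} \<longrightarrow> Q w) \<longleftrightarrow> (\<forall>i. i \<notin> I \<longrightarrow> Q (axis i 1, 0))" for Q :: "(real^'v) \<times> real \<Rightarrow> bool"
    unfolding bim by (auto simp: Basis_prod_def Basis_vec_def axis_eq_axis)
  have C: "cell n I \<times> {0..1} = {z. (\<forall>i\<le>l. \<bar>(z - c) \<bullet> b i\<bar> \<le> 1/2) \<and>
      (\<forall>e\<in>Basis. e \<notin> b ` {..l} \<longrightarrow> (z - c) \<bullet> e = 0)}" (is "_ = ?C")
  proof (rule set_eqI)
    fix z :: "(real^'v) \<times> real"
    obtain x t where z: "z = (x, t)" by (cases z)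
    have "z \<in> ?C \<longleftrightarrow> \<bar>t - 1/2\<bar> \<le> 1/2 \<and> (\<forall>i\<in>I. \<bar>x $ i - (of_int (n i) + 1/2)\<bar> \<le> 1/2) \<and>
        (\<forall>i. i \<notin> I \<longrightarrow> x $ i = of_int (n i))"
      unfolding mem_Collect_eq all_b[of "\<lambda>w. \<bar>(z - c) \<bullet> w\<bar> \<le> 1/2"] basis
      by (auto simp: z c_def inner_axis)
    also have "\<dots> \<longleftrightarrow> z \<in> cell n I \<times> {0..1}"
    proof -
      have "\<bar>x $ i - (of_int (n i) + 1/2)\<bar> \<le> 1/2 \<longleftrightarrow> of_int (n i) \<le> x $ i \<and> x $ i \<le> of_int (n i) + 1" for i
        by (simp add: abs_le_iff) argo
      moreover have "\<bar>t - 1/2\<bar> \<le> 1/2 \<longleftrightarrow> t \<in> {0..1}" by (simp add: abs_le_iff) argo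
      ultimately show ?thesis by (auto simp: z cell_def split: if_splits)
    qed
    finally show "z \<in> cell n I \<times> {0..1} \<longleftrightarrow> z \<in> ?C" by simp
  qed
  have D': "D = {z \<in> cell n I \<times> {0..1}. \<exists>i\<le>l. \<bar>(z - c) \<bullet> b i\<bar> = 1/2}"
    unfolding D
  proof (intro Collect_cong conj_cong refl)
    fix z :: "(real^'v) \<times> real" assume zc: "z \<in> cell n I \<times> {0..1}"
    obtain x t where z: "z = (x, t)" by (cases z)
    then have x: "x \<in> cell n I" and t: "0 \<le> t" "t \<le> 1" using zc by auto
    have "(\<exists>i\<le>l. \<bar>(z - c) \<bullet> b i\<bar> = 1/2) \<longleftrightarrow> \<bar>t - 1/2\<bar> = 1/2 \<or> (\<exists>i\<in>I. \<bar>x $ i - (of_int (n i) + 1/2)\<bar> = 1/2)"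
      unfolding ex_b[of "\<lambda>w. \<bar>(z - c) \<bullet> w\<bar> = 1/2"] by (auto simp: z c_def inner_axis)
    also have "\<bar>t - 1/2\<bar> = 1/2 \<longleftrightarrow> t = 0 \<or> t = 1" using t by (auto simp: abs_if)
    also have "(\<exists>i\<in>I. \<bar>x $ i - (of_int (n i) + 1/2)\<bar> = 1/2) \<longleftrightarrow> nonint x \<noteq> I"
    proof -
      have "\<bar>x $ i - (of_int (n i) + 1/2)\<bar> = 1/2 \<longleftrightarrow> i \<notin> nonint x" if "i \<in> I" for i
      proof
        assume "\<bar>x $ i - (of_int (n i) + 1/2)\<bar> = 1/2"
        then have "x $ i = of_int (n i) \<or> x $ i = of_int (n i + 1)" by (auto simp: abs_if split: if_splits)
        then show "i \<notin> nonint x" unfolding nonint_def by (metis (mono_tags) Ints_of_int mem_Collect_eq)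
      next
        assume "i \<notin> nonint x"
        then obtain k where k: "x $ i = of_int k" by (auto simp: nonint_def elim: Ints_cases)
        have "of_int (n i) \<le> x $ i" "x $ i \<le> of_int (n i) + 1" using x that by (auto simp: cell_def)
        then have "k = n i \<or> k = n i + 1" unfolding k by linarith
        then show "\<bar>x $ i - (of_int (n i) + 1/2)\<bar> = 1/2" using k by auto
      qed
      then show ?thesis using nonint_subset_cell[OF x] by blast
    qed
    finally show "(snd z = 0 \<or> snd z = 1 \<or> nonint (fst z) \<noteq> I) \<longleftrightarrow> (\<exists>i\<le>l. \<bar>(z - c) \<bullet> b i\<bar> = 1/2)"
      by (simp add: z)
  qed
  show ?thesis
    by (rule continuous_extension_cube[OF M inj bB C D' f])
qed

definition skel_homotopy ::
    "(real^'v) set \<Rightarrow> (real^'v \<Rightarrow> 'b) \<Rightarrow> 'b::euclidean_space set \<Rightarrow> 'b \<Rightarrow> nat \<Rightarrow> ((real^'v) \<times> real \<Rightarrow> 'b) \<Rightarrow> bool" where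
  "skel_homotopy B P M c l H \<longleftrightarrow> continuous_on (skel B l \<times> {0..1}) H \<and> H ` (skel B l \<times> {0..1}) \<subseteq> M \<and>
     (\<forall>x\<in>skel B l. H (x, 0) = P x \<and> H (x, 1) = c)"

text \<open>Over each new cell the homotopy is prescribed on the boundary of cell times interval: P
  at the bottom, the constant c at the top, and the homotopy already built on the sides, which lie
  over cells of lower dimension. The extension lemma fills the inside.\<close>

lemma skel_homotopy_Suc:
  fixes P :: "real^'v \<Rightarrow> 'b::euclidean_space"
  assumes B: "bounded B" and P: "continuous_on B P" "P ` B \<subseteq> M" and c: "c \<in> M"
    and M: "trivial_homotopy_group l M" and H: "skel_homotopy B P M c l H"
  shows "\<exists>H'. skel_homotopy B P M c (Suc l) H'"
proof -
  define D where "D n I = {z \<in> cell n I \<times> {0..1::real}. snd z = 0 \<or> snd z = 1 \<or> nonint (fst z) \<noteq> I}" for n and I :: "'v set"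
  define F where "F z = (if snd z = 0 then P (fst z) else if snd z = 1 then c else H z)" for z
  have Hc: "continuous_on (skel B l \<times> {0..1}) H" and HM: "\<And>z. z \<in> skel B l \<times> {0..1} \<Longrightarrow> H z \<in> M"
    and H0: "\<And>x. x \<in> skel B l \<Longrightarrow> H (x, 0) = P x" and H1: "\<And>x. x \<in> skel B l \<Longrightarrow> H (x, 1) = c"
    using H by (auto simp: skel_homotopy_def)
  have cl: "closed (cell n I)" for n and I :: "'v set" by (rule compact_imp_closed[OF compact_cell])
  have skcl: "closed (skel B l)" by (rule compact_imp_closed[OF compact_skel[OF B]])
  have ext: "\<exists>g. continuous_on (cell n I \<times> {0..1}) g \<and> g ` (cell n I \<times> {0..1}) \<subseteq> M \<and> (\<forall>z\<in>D n I. g z = F z)"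
    if nI: "card I = l" "cell n I \<subseteq> B" for n I
  proof (rule continuous_extension_cell[OF M nI(1) D_def])
    have sk: "x \<in> skel B l \<longleftrightarrow> nonint x \<noteq> I" if x: "x \<in> cell n I" for x
    proof
      assume "nonint x \<noteq> I"
      then have "nonint x \<subset> I" using nonint_subset_cell[OF x] by auto
      then have "card (nonint x) < l" using nI(1) by (metis finite psubset_card_mono)
      then show "x \<in> skel B l" using cell_subset_cell[OF x] nI(2) by (auto simp: skel_def)
    qed (use nI in \<open>auto simp: skel_def\<close>)
    have Deq: "D n I = (cell n I \<times> {0}) \<union> ((cell n I \<times> {1}) \<union> ((cell n I \<inter> skel B l) \<times> {0..1}))"
      using sk by (auto simp: D_def)
    have "continuous_on (cell n I \<times> {0}) F"
    proof (rule continuous_on_eq)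
      show "continuous_on (cell n I \<times> {0::real}) (\<lambda>z. P (fst z))"
        by (rule continuous_on_compose2[OF P(1)]) (use nI in \<open>auto intro!: continuous_intros\<close>)
    qed (auto simp: F_def)
    moreover have "continuous_on (cell n I \<times> {1}) F"
      by (rule continuous_on_eq[of _ "\<lambda>z. c"]) (auto simp: F_def)
    moreover have "continuous_on ((cell n I \<inter> skel B l) \<times> {0..1}) F"
      by (rule continuous_on_eq[of _ H]) (auto intro: continuous_on_subset[OF Hc] simp: F_def H0 H1)
    ultimately show "continuous_on (D n I) F"
      unfolding Deq using cl skcl by (intro continuous_on_closed_Un closed_Un closed_Times closed_Int) auto
    show "F ` D n I \<subseteq> M"
    proof -
      have "P a \<in> M" if "a \<in> cell n I" for a using P(2) nI(2) that by auto
      then show ?thesis unfolding Deq using c HM by (auto simp: F_def)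
    qed
  qed
  define e where "e n I = (SOME g. continuous_on (cell n I \<times> {0..1}) g \<and> g ` (cell n I \<times> {0..1}) \<subseteq> M \<and> (\<forall>z\<in>D n I. g z = F z))" for n I
  have e: "continuous_on (cell n I \<times> {0..1}) (e n I)" "e n I ` (cell n I \<times> {0..1}) \<subseteq> M" "\<And>z. z \<in> D n I \<Longrightarrow> e n I z = F z"
    if nI: "card I = l" "cell n I \<subseteq> B" for n I
    using someI_ex[OF ext[OF nI]] unfolding e_def[symmetric] by auto
  \<comment> \<open>The carrier of the point selects the extension, so no choice is ambiguous.
    \<open>H'e\<close> shows that the chosen extension is reproduced on the whole closed cell, and
    continuity follows from a finite closed cover.\<close>
  define H' where "H' z = (if card (nonint (fst z)) < l then H z else e (floors (fst z)) (nonint (fst z)) z)" for z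
  have H'e: "H' z = e n I z" if nI: "card I = l" "cell n I \<subseteq> B" and z: "z \<in> cell n I \<times> {0..1}" for n I z
  proof (cases "nonint (fst z) = I")
    case True
    then have "floors (fst z) = n" using z floors_cell_eq by auto
    then show ?thesis using True nI by (simp add: H'_def)
  next
    case False
    then have zD: "z \<in> D n I" using z by (auto simp: D_def)
    have x: "fst z \<in> cell n I" using z by auto
    have "nonint (fst z) \<subset> I" using nonint_subset_cell[OF x] False by auto
    then have "card (nonint (fst z)) < l" using nI(1) by (metis finite psubset_card_mono)
    moreover have "fst z \<in> skel B l" using calculation cell_subset_cell[OF x] nI(2) by (auto simp: skel_def)
    ultimately show ?thesis using e(3)[OF nI zD] H0[of "fst z"] H1[of "fst z"]
      by (cases z) (auto simp: H'_def F_def)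
  qed
  have H'H: "H' z = H z" if "z \<in> skel B l \<times> {0..1}" for z
    using that by (auto simp: H'_def skel_def)
  let ?codes = "{(n, I). cell n I \<subseteq> B \<and> card I < Suc l}"
  have fin: "finite ?codes"
    using finite_cells_in_bounded[OF B] by (rule rev_finite_subset) auto
  have cont: "continuous_on (cell n I \<times> {0..1}) H' \<and> H' ` (cell n I \<times> {0..1}) \<subseteq> M"
    if nI: "cell n I \<subseteq> B" "card I < Suc l" for n I
  proof (cases "card I = l")
    case True
    have "continuous_on (cell n I \<times> {0..1}) H'"
      by (rule continuous_on_eq[OF e(1)[OF True nI(1)]]) (simp add: H'e[OF True nI(1)])
    moreover have "H' ` (cell n I \<times> {0..1}) \<subseteq> M"
      using e(2)[OF True nI(1)] H'e[OF True nI(1)] by (simp add: image_subset_iff)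
    ultimately show ?thesis by simp
  next
    case False
    then have "card I < l" using nI by simp
    then have "cell n I \<subseteq> skel B l" using nI unfolding skel_eq_Union_cells by blast
    then have sub: "cell n I \<times> {0..1} \<subseteq> skel B l \<times> {0..1}" by auto
    have "continuous_on (cell n I \<times> {0..1}) H'"
      by (rule continuous_on_eq[OF continuous_on_subset[OF Hc sub]]) (use H'H sub in auto)
    moreover have "H' ` (cell n I \<times> {0..1}) \<subseteq> M"
    proof
      fix w assume "w \<in> H' ` (cell n I \<times> {0..1})"
      then obtain z where z: "z \<in> cell n I \<times> {0..1}" "w = H' z" by blast
      then have "z \<in> skel B l \<times> {0..1}" using sub by blast
      then show "w \<in> M" using H'H[of z] HM[of z] z(2) by simp
    qed
    ultimately show ?thesis by simp
  qed
  have eq: "skel B (Suc l) \<times> {0..1::real} = (\<Union>c\<in>?codes. cell (fst c) (snd c) \<times> {0..1})"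
    unfolding skel_eq_Union_cells by (auto simp del: atLeastAtMost_iff) blast+
  have "continuous_on (\<Union>c\<in>?codes. cell (fst c) (snd c) \<times> {0..1::real}) H'"
    using fin cont cl by (intro continuous_on_closed_Union closed_Times) auto
  moreover have "H' ` (\<Union>c\<in>?codes. cell (fst c) (snd c) \<times> {0..1::real}) \<subseteq> M"
  proof -
    have "H' ` (cell (fst c) (snd c) \<times> {0..1}) \<subseteq> M" if "c \<in> ?codes" for c
      using cont[of "fst c" "snd c"] that by (simp add: case_prod_beta)
    then show ?thesis by (simp only: image_UN) blast
  qed
  moreover have "H' (x, 0) = P x \<and> H' (x, 1) = c" if x: "x \<in> skel B (Suc l)" for x
  proof (cases "card (nonint x) < l")
    case True
    then have "x \<in> skel B l" using x by (auto simp: skel_def)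
    then show ?thesis using H'H H0 H1 by auto
  next
    case False
    then have I: "card (nonint x) = l" "cell (floors x) (nonint x) \<subseteq> B" using x by (auto simp: skel_def)
    have "(x, t) \<in> D (floors x) (nonint x)" if "t = 0 \<or> t = 1" for t
      using that mem_cell_self[of x] by (auto simp: D_def)
    then show ?thesis
      using e(3)[OF I] I by (auto simp: H'_def F_def)
  qed
  ultimately have "skel_homotopy B P M c (Suc l) H'"
    unfolding skel_homotopy_def eq by blast
  then show ?thesis by blast
qed

theorem skel_homotopy_exists:
  fixes P :: "real^'v \<Rightarrow> 'b::euclidean_space"
  assumes "bounded B" "continuous_on B P" "P ` B \<subseteq> M" "c \<in> M"
    and "\<And>j. j < l \<Longrightarrow> trivial_homotopy_group j M"
  shows "\<exists>H. skel_homotopy B P M c l H"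
  using assms(5)
proof (induction l)
  case 0
  then show ?case by (auto simp: skel_homotopy_def skel_def)
next
  case (Suc l)
  then show ?case using skel_homotopy_Suc[OF assms(1-4)] by (metis less_Suc_eq)
qed

section \<open>The dual skeleton and the radial retraction\<close>

text \<open>The distance from t to the nearest half-integer, that is, to the centre of its unit
  interval.\<close>

definition cdist :: "real \<Rightarrow> real" where
  "cdist t = \<bar>frac t - 1/2\<bar>"

text \<open>Zero exactly where \<open>k + 1\<close> coordinates are half-integers, that is, on the dual skeleton of
  codimension \<open>k + 1\<close>; in general the sup-norm distance to it, truncated at \<open>1/2\<close>.\<close>

definition gap :: "nat \<Rightarrow> real^'v \<Rightarrow> real" where
  "gap k x = Min (insert (1/2) ((\<lambda>I. Max ((\<lambda>i. cdist (x $ i)) ` I)) ` {I. card I = Suc k}))"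

definition clamp_half :: "real \<Rightarrow> real" where
  "clamp_half w = max (-1/2) (min (1/2) w)"

text \<open>Dilation of each unit interval about its centre by the factor 1 / (2 \<mu>), cut off at
  the ends. Points at distance at least \<mu> from the centre go to integers, and \<mu> = 1/2 gives
  the identity.\<close>

definition retr :: "real \<Rightarrow> real \<Rightarrow> real" where
  "retr \<mu> t = of_int \<lfloor>t\<rfloor> + 1/2 + clamp_half ((frac t - 1/2) / (2 * \<mu>))"

text \<open>Away from the dual skeleton at most \<open>k\<close> coordinates of \<open>x\<close> are closer than the gap to a
  half-integer; all the others are pushed to an integer. The scaling by the gap makes the
  Lipschitz constant the inverse of the gap.\<close>

definition rho :: "nat \<Rightarrow> real^'v \<Rightarrow> real^'v" where
  "rho k x = (\<chi> i. retr (gap k x) (x $ i))"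

lemma cdist_bounds: "0 \<le> cdist t" "cdist t \<le> 1/2"
  using frac_ge_0[of t] frac_lt_1[of t] by (auto simp: cdist_def abs_if)

lemma cdist_lipschitz: "\<bar>cdist s - cdist t\<bar> \<le> \<bar>s - t\<bar>"
proof -
  have *: "\<bar>cdist s - cdist t\<bar> \<le> t - s" if "s \<le> t" for s t :: real
  proof (cases "\<lfloor>s\<rfloor> = \<lfloor>t\<rfloor>")
    case True
    then show ?thesis using that by (auto simp: cdist_def frac_def)
  next
    case False
    then have "\<lfloor>s\<rfloor> + 1 \<le> \<lfloor>t\<rfloor>" using that floor_mono[OF that] by linarith
    then have f: "of_int \<lfloor>s\<rfloor> + 1 \<le> (of_int \<lfloor>t\<rfloor> :: real)" by linarith
    have "1/2 - cdist s \<le> 1 - frac s" "1/2 - cdist t \<le> frac t"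
      by (auto simp: cdist_def abs_if)
    moreover have "1 - frac s + frac t \<le> t - s" using f by (simp add: frac_def)
    ultimately show ?thesis using cdist_bounds[of s] cdist_bounds[of t] by linarith
  qed
  show ?thesis
  proof (cases "s \<le> t")
    case True
    then show ?thesis using *[OF True] by linarith
  next
    case False
    then show ?thesis using *[of t s] by linarith
  qed
qed

lemma gap_le_half: "gap k (x :: real^'v) \<le> 1/2"
  unfolding gap_def by (intro Min_le) auto

lemma gap_le_Max: "card I = Suc k \<Longrightarrow> gap k (x :: real^'v) \<le> Max ((\<lambda>i. cdist (x $ i)) ` I)"
  unfolding gap_def by (intro Min_le) auto

lemma gap_cases:
  fixes x :: "real^'v"
  obtains "gap k x = 1/2" | I where "card I = Suc k" "gap k x = Max ((\<lambda>i. cdist (x $ i)) ` I)"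
proof -
  have "gap k x \<in> insert (1/2) ((\<lambda>I. Max ((\<lambda>i. cdist (x $ i)) ` I)) ` {I. card I = Suc k})"
    unfolding gap_def by (intro Min_in) auto
  then show ?thesis using that by auto
qed

lemma gap_nonneg: "0 \<le> gap k (x :: real^'v)"
proof (cases rule: gap_cases[of k x])
  case (2 I)
  then have "finite I" "I \<noteq> {}" by auto
  then obtain i where "i \<in> I" by blast
  then have "cdist (x $ i) \<le> gap k x" using 2 by simp
  then show ?thesis using cdist_bounds(1)[of "x $ i"] by linarith
qed simp

lemma gap_mono_add:
  fixes x y :: "real^'v"
  assumes "\<And>i. \<bar>x $ i - y $ i\<bar> \<le> r"
  shows "gap k x \<le> gap k y + r"
proof (cases rule: gap_cases[of k y])
  case 1
  have "0 \<le> r" using assms[of undefined] by linarith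
  then show ?thesis using 1 gap_le_half[of k x] by simp
next
  case (2 I)
  then have I: "finite I" "I \<noteq> {}" by auto
  have "gap k x \<le> Max ((\<lambda>i. cdist (x $ i)) ` I)" using 2 by (intro gap_le_Max)
  also have "\<dots> \<le> gap k y + r"
  proof (rule Max.boundedI)
    fix a assume "a \<in> (\<lambda>i. cdist (x $ i)) ` I"
    then obtain i where i: "i \<in> I" "a = cdist (x $ i)" by blast
    have "cdist (y $ i) \<le> gap k y" using 2 i I by simp
    moreover have "cdist (x $ i) \<le> cdist (y $ i) + r"
      using cdist_lipschitz[of "x $ i" "y $ i"] assms[of i] by linarith
    ultimately show "a \<le> gap k y + r" using i by linarith
  qed (use I in auto)
  finally show ?thesis .
qed

lemma gap_lipschitz: "\<bar>gap k x - gap k y\<bar> \<le> norm (x - y :: real^'v)"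
proof -
  have a: "\<bar>x $ i - y $ i\<bar> \<le> norm (x - y)" for i
    using component_le_norm_cart[of "x - y" i] by simp
  then have b: "\<bar>y $ i - x $ i\<bar> \<le> norm (x - y)" for i
    by (simp add: abs_minus_commute)
  show ?thesis
    using gap_mono_add[of x y "norm (x - y)" k, OF a] gap_mono_add[of y x "norm (x - y)" k, OF b] by linarith
qed

lemma clamp_half_bounds: "-1/2 \<le> clamp_half w" "clamp_half w \<le> 1/2"
  by (auto simp: clamp_half_def)

lemma clamp_half_lipschitz: "\<bar>clamp_half v - clamp_half w\<bar> \<le> \<bar>v - w\<bar>"
  by (auto simp: clamp_half_def)

text \<open>At the right endpoint the floor jumps, but the formulas of the two adjacent intervals
  agree there: since \<mu> \<le> 1/2, each endpoint is cut off to itself. This gives continuity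
  across integers.\<close>

lemma retr_eq:
  assumes \<mu>: "0 < \<mu>" "\<mu> \<le> 1/2" and n: "of_int n \<le> t" "t \<le> of_int n + 1"
  shows "retr \<mu> t = of_int n + 1/2 + clamp_half ((t - of_int n - 1/2) / (2 * \<mu>))"
proof (cases "t = of_int n + 1")
  case True
  have "\<lfloor>t\<rfloor> = n + 1" unfolding True by linarith
  then have "frac t = 0" using True by (simp add: frac_def)
  have q: "1/2 / (2 * \<mu>) \<ge> 1/2" using \<mu> by (simp add: field_simps)
  have "clamp_half ((0 - 1/2) / (2 * \<mu>)) = -1/2" "clamp_half (1/2 / (2 * \<mu>)) = 1/2"
    using q by (auto simp: clamp_half_def)
  then show ?thesis using \<open>\<lfloor>t\<rfloor> = n + 1\<close> \<open>frac t = 0\<close> True by (simp add: retr_def)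
next
  case False
  then have "\<lfloor>t\<rfloor> = n" using n by linarith
  then show ?thesis by (simp add: retr_def frac_def)
qed

lemma retr_bounds: "of_int \<lfloor>t\<rfloor> \<le> retr \<mu> t" "retr \<mu> t \<le> of_int \<lfloor>t\<rfloor> + 1"
  using clamp_half_bounds[of "(frac t - 1/2) / (2 * \<mu>)"] by (auto simp: retr_def)

lemma retr_of_int:
  assumes "0 < \<mu>" "\<mu> \<le> 1/2"
  shows "retr \<mu> (of_int n) = of_int n"
proof -
  have "1/2 / (2 * \<mu>) \<ge> 1/2" using assms by (simp add: field_simps)
  then have "clamp_half ((0 - 1/2) / (2 * \<mu>)) = -1/2" by (auto simp: clamp_half_def)
  then show ?thesis by (simp add: retr_def)
qed

lemma retr_lipschitz:
  assumes \<mu>: "0 < \<mu>" "\<mu> \<le> 1/2"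
  shows "\<bar>retr \<mu> s - retr \<mu> t\<bar> \<le> \<bar>s - t\<bar> / (2 * \<mu>)"
proof -
  have same: "\<bar>retr \<mu> s - retr \<mu> t\<bar> \<le> \<bar>s - t\<bar> / (2 * \<mu>)"
    if n: "of_int n \<le> s" "s \<le> of_int n + 1" "of_int n \<le> t" "t \<le> of_int n + 1" for s t n
  proof -
    have "\<bar>retr \<mu> s - retr \<mu> t\<bar> = \<bar>clamp_half ((s - of_int n - 1/2) / (2 * \<mu>)) - clamp_half ((t - of_int n - 1/2) / (2 * \<mu>))\<bar>"
      using retr_eq[OF \<mu> n(1,2)] retr_eq[OF \<mu> n(3,4)] by simp
    also have "\<dots> \<le> \<bar>(s - of_int n - 1/2) / (2 * \<mu>) - (t - of_int n - 1/2) / (2 * \<mu>)\<bar>"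
      by (rule clamp_half_lipschitz)
    also have "\<dots> = \<bar>s - t\<bar> / (2 * \<mu>)"
      using \<mu> by (simp add: diff_divide_distrib[symmetric] abs_divide)
    finally show ?thesis .
  qed
  have *: "\<bar>retr \<mu> s - retr \<mu> t\<bar> \<le> (t - s) / (2 * \<mu>)" if st: "s \<le> t" for s t
  proof (cases "\<lfloor>s\<rfloor> = \<lfloor>t\<rfloor>")
    case True
    have "\<bar>retr \<mu> s - retr \<mu> t\<bar> \<le> \<bar>s - t\<bar> / (2 * \<mu>)"
      by (rule same[of "\<lfloor>s\<rfloor>"]) (use True in linarith)+
    then show ?thesis using st by simp
  next
    case False
    \<comment> \<open>The two end pieces each lie in one unit interval. The integers between them
      are fixed by \<open>retr\<close>, at unit cost per unit length, and 1 \<le> 1 / (2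
      \<mu>).\<close>
    let ?m = "\<lfloor>s\<rfloor> + 1" and ?n = "\<lfloor>t\<rfloor>"
    have mn: "?m \<le> ?n" using False st floor_mono[OF st] by linarith
    have 1: "\<bar>retr \<mu> s - retr \<mu> (of_int ?m)\<bar> \<le> \<bar>s - of_int ?m\<bar> / (2 * \<mu>)"
      by (rule same[of "\<lfloor>s\<rfloor>"]) linarith+
    have 2: "\<bar>retr \<mu> (of_int ?n) - retr \<mu> t\<bar> \<le> \<bar>of_int ?n - t\<bar> / (2 * \<mu>)"
      by (rule same[of "\<lfloor>t\<rfloor>"]) linarith+
    have 3: "(of_int ?n - of_int ?m :: real) \<le> (of_int ?n - of_int ?m) / (2 * \<mu>)"
    proof -
      have "0 \<le> (of_int ?n - of_int ?m :: real)" using mn by (simp add: of_int_le_iff del: of_int_add)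
      moreover have "1 \<le> 1 / (2 * \<mu>)" using \<mu> by (simp add: field_simps)
      ultimately show ?thesis using mult_left_mono[of 1 "1/(2*\<mu>)" "of_int ?n - of_int ?m"] by simp
    qed
    have s: "s \<le> of_int ?m" and t: "of_int ?n \<le> t" by linarith+
    have "\<bar>retr \<mu> s - retr \<mu> t\<bar> \<le> \<bar>retr \<mu> s - retr \<mu> (of_int ?m)\<bar> + (of_int ?n - of_int ?m) + \<bar>retr \<mu> (of_int ?n) - retr \<mu> t\<bar>"
      unfolding retr_of_int[OF \<mu>] using mn by linarith
    also have "\<dots> \<le> (of_int ?m - s) / (2 * \<mu>) + (of_int ?n - of_int ?m) / (2 * \<mu>) + (t - of_int ?n) / (2 * \<mu>)"
      using 1 2 3 s t by simp
    also have "\<dots> = (t - s) / (2 * \<mu>)" by (simp add: add_divide_distrib[symmetric])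
    finally show ?thesis .
  qed
  show ?thesis
  proof (cases "s \<le> t")
    case True
    then show ?thesis using *[OF True] by simp
  next
    case False
    then have "\<bar>retr \<mu> t - retr \<mu> s\<bar> \<le> \<bar>s - t\<bar> / (2 * \<mu>)" using *[of t s] by simp
    then show ?thesis by (simp only: abs_minus_commute[of "retr \<mu> s"])
  qed
qed

text \<open>The larger parameter stands in the denominator, although the maps vary fastest for the
  smaller one: where the dilation is active for both, |frac t - 1/2| is below \<mu>', which cancels
  one factor 1 / \<mu>'. This allows a weighted Lipschitz estimate with the larger of two
  gaps.\<close>

lemma retr_scale_lipschitz:
  assumes "0 < \<mu>'" "\<mu>' \<le> \<mu>"
  shows "\<bar>retr \<mu> t - retr \<mu>' t\<bar> \<le> (\<mu> - \<mu>') / (2 * \<mu>)"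
proof -
  have pos: "\<bar>clamp_half (y / (2 * \<mu>)) - clamp_half (y / (2 * \<mu>'))\<bar> \<le> (\<mu> - \<mu>') / (2 * \<mu>)" if y: "0 \<le> y" for y
  proof -
    have \<mu>: "0 < \<mu>" using assms by simp
    have rhs: "0 \<le> (\<mu> - \<mu>') / (2 * \<mu>)" using assms by simp
    have c: "clamp_half (y / (2 * \<nu>)) = (if y \<ge> \<nu> then 1/2 else y / (2 * \<nu>))" if "\<nu> > 0" for \<nu>
    proof -
      have "y / (2 * \<nu>) \<ge> 0" using y that by simp
      moreover have "y / (2 * \<nu>) \<le> 1/2 \<longleftrightarrow> y \<le> \<nu>" "1/2 \<le> y / (2 * \<nu>) \<longleftrightarrow> \<nu> \<le> y"
        using that by (auto simp: field_simps)
      ultimately show ?thesis by (auto simp: clamp_half_def max_def min_def)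
    qed
    consider "y \<ge> \<mu>" | "y < \<mu>'" | "\<mu>' \<le> y" "y < \<mu>" by linarith
    then show ?thesis
    proof cases
      case 1
      then show ?thesis unfolding c[OF \<mu>] c[OF assms(1)] using assms rhs by simp
    next
      case 2
      have "y / (2 * \<mu>') - y / (2 * \<mu>) = (y / \<mu>') * ((\<mu> - \<mu>') / (2 * \<mu>))"
        using assms \<mu> by (simp add: field_simps)
      moreover have "0 \<le> y / \<mu>'" "y / \<mu>' \<le> 1" using 2 y assms by auto
      ultimately have "0 \<le> y / (2 * \<mu>') - y / (2 * \<mu>)" "y / (2 * \<mu>') - y / (2 * \<mu>) \<le> (\<mu> - \<mu>') / (2 * \<mu>)"
        using rhs mult_right_mono[of "y / \<mu>'" 1 "(\<mu> - \<mu>') / (2 * \<mu>)"] mult_nonneg_nonneg[of "y / \<mu>'" "(\<mu> - \<mu>') / (2 * \<mu>)"]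
        by (simp_all only: mult_1)
      then show ?thesis using c[OF \<mu>] c[OF assms(1)] 2 assms by simp
    next
      case 3
      have "1/2 - y / (2 * \<mu>) = (\<mu> - y) / (2 * \<mu>)" using \<mu> by (simp add: field_simps)
      moreover have "0 \<le> (\<mu> - y) / (2 * \<mu>)" "(\<mu> - y) / (2 * \<mu>) \<le> (\<mu> - \<mu>') / (2 * \<mu>)"
        using 3 \<mu> by (auto intro!: divide_right_mono)
      ultimately show ?thesis using c[OF \<mu>] c[OF assms(1)] 3 by simp
    qed
  qed
  have neg: "clamp_half (- w) = - clamp_half w" for w by (auto simp: clamp_half_def)
  let ?y = "frac t - 1/2"
  have "\<bar>clamp_half (?y / (2 * \<mu>)) - clamp_half (?y / (2 * \<mu>'))\<bar> \<le> (\<mu> - \<mu>') / (2 * \<mu>)"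
  proof (cases "?y \<ge> 0")
    case True
    then show ?thesis by (rule pos)
  next
    case False
    then have "\<bar>clamp_half ((- ?y) / (2 * \<mu>)) - clamp_half ((- ?y) / (2 * \<mu>'))\<bar> \<le> (\<mu> - \<mu>') / (2 * \<mu>)"
      by (intro pos) simp
    then show ?thesis unfolding minus_divide_left[symmetric] neg by linarith
  qed
  then show ?thesis by (simp add: retr_def)
qed

text \<open>Moving the point at fixed gap costs 1 / (2 gap), and changing the gap, which is itself
  1-Lipschitz, costs as much again. The estimate is proved for the larger gap and so holds with the
  gap of either point.\<close>

lemma rho_component_lipschitz:
  fixes x y :: "real^'v"
  assumes "0 < gap k x" "0 < gap k y"
  shows "gap k x * \<bar>rho k x $ i - rho k y $ i\<bar> \<le> norm (x - y)"
proof -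
  have *: "gap k x * \<bar>rho k x $ i - rho k y $ i\<bar> \<le> norm (x - y)"
    if g: "0 < gap k y" "gap k y \<le> gap k x" for x y :: "real^'v"
  proof -
    let ?\<mu> = "gap k x" and ?\<nu> = "gap k y"
    have \<mu>: "0 < ?\<mu>" "?\<mu> \<le> 1/2" using g gap_le_half[of k x] by auto
    have comp: "\<bar>x $ i - y $ i\<bar> \<le> norm (x - y)"
      using component_le_norm_cart[of "x - y" i] by simp
    have "\<bar>rho k x $ i - rho k y $ i\<bar> \<le> \<bar>retr ?\<mu> (x $ i) - retr ?\<mu> (y $ i)\<bar> + \<bar>retr ?\<mu> (y $ i) - retr ?\<nu> (y $ i)\<bar>"
      by (simp add: rho_def)
    also have "\<dots> \<le> \<bar>x $ i - y $ i\<bar> / (2 * ?\<mu>) + (?\<mu> - ?\<nu>) / (2 * ?\<mu>)"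
      by (intro add_mono retr_lipschitz \<mu> retr_scale_lipschitz g)
    also have "\<dots> \<le> norm (x - y) / (2 * ?\<mu>) + norm (x - y) / (2 * ?\<mu>)"
      using comp gap_lipschitz[of k x y] \<mu> by (intro add_mono divide_right_mono) auto
    also have "\<dots> = norm (x - y) / ?\<mu>" using \<mu> by (simp add: field_simps)
    finally show ?thesis using \<mu> by (simp add: field_simps)
  qed
  show ?thesis
  proof (cases "gap k y \<le> gap k x")
    case True
    then show ?thesis using * assms by blast
  next
    case False
    then have "gap k y * \<bar>rho k y $ i - rho k x $ i\<bar> \<le> norm (y - x)" using *[of x y] assms by simp
    moreover have "gap k x * \<bar>rho k x $ i - rho k y $ i\<bar> \<le> gap k y * \<bar>rho k x $ i - rho k y $ i\<bar>"
      using False by (intro mult_right_mono) auto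
    ultimately show ?thesis by (simp add: abs_minus_commute norm_minus_commute)
  qed
qed

lemma rho_lipschitz:
  fixes x y :: "real^'v"
  assumes "0 < gap k x" "0 < gap k y"
  shows "gap k x * norm (rho k x - rho k y) \<le> CARD('v) * norm (x - y)"
proof -
  have "gap k x * norm (rho k x - rho k y) \<le> gap k x * (\<Sum>i\<in>UNIV. \<bar>(rho k x - rho k y) $ i\<bar>)"
    using assms by (intro mult_left_mono norm_le_l1_cart) auto
  also have "\<dots> = (\<Sum>i\<in>UNIV. gap k x * \<bar>rho k x $ i - rho k y $ i\<bar>)"
    by (simp add: sum_distrib_left)
  also have "\<dots> \<le> (\<Sum>i\<in>(UNIV :: 'v set). norm (x - y))"
    using assms by (intro sum_mono rho_component_lipschitz)
  finally show ?thesis by simp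
qed

lemma rho_near: "\<bar>rho k x $ i - x $ i\<bar> \<le> 1"
proof -
  have "rho k x $ i = retr (gap k x) (x $ i)" by (simp add: rho_def)
  then show ?thesis using retr_bounds[where t="x $ i" and \<mu>="gap k x"] by linarith
qed

lemma card_nonint_rho:
  fixes x :: "real^'v"
  assumes "0 < gap k x"
  shows "card (nonint (rho k x)) < Suc k"
proof (rule ccontr)
  assume "\<not> card (nonint (rho k x)) < Suc k"
  then obtain I where I: "I \<subseteq> nonint (rho k x)" "card I = Suc k"
    by (meson not_less obtain_subset_with_card_n)
  then have fin: "finite I" "I \<noteq> {}" by auto
  have "cdist (x $ i) < gap k x" if "i \<in> I" for i
  proof (rule ccontr)
    assume "\<not> cdist (x $ i) < gap k x"
    then have ge: "\<bar>frac (x $ i) - 1/2\<bar> \<ge> gap k x" by (simp add: cdist_def)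
    let ?w = "(frac (x $ i) - 1/2) / (2 * gap k x)"
    have "?w \<ge> 1/2 \<or> ?w \<le> -1/2"
      using ge assms by (auto simp: field_simps abs_if split: if_splits)
    then have "clamp_half ?w = 1/2 \<or> clamp_half ?w = -1/2" by (auto simp: clamp_half_def)
    then have "retr (gap k x) (x $ i) = of_int (\<lfloor>x $ i\<rfloor> + 1) \<or> retr (gap k x) (x $ i) = of_int \<lfloor>x $ i\<rfloor>"
      by (auto simp: retr_def)
    then have "rho k x $ i \<in> \<int>" by (auto simp: rho_def)
    then show False using I(1) that by (auto simp: nonint_def)
  qed
  then have "Max ((\<lambda>i. cdist (x $ i)) ` I) < gap k x"
    using fin by (subst Max_less_iff) auto
  then show False using gap_le_Max[OF I(2), of x] by simp
qed

text \<open>The 2 is one unit for the move from x to \<open>rho k x\<close> and one for the width of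
  the carrier of \<open>rho k x\<close>.\<close>

lemma rho_in_skel:
  fixes x :: "real^'v"
  assumes "0 < gap k x" and B: "\<And>z. (\<And>i. \<bar>z $ i - x $ i\<bar> \<le> 2) \<Longrightarrow> z \<in> B"
  shows "rho k x \<in> skel B (Suc k)"
proof -
  have "z \<in> B" if z: "z \<in> cell (floors (rho k x)) (nonint (rho k x))" for z
  proof (rule B)
    fix i
    have "\<bar>z $ i - rho k x $ i\<bar> \<le> 1"
      using cell_inD[OF z, of i] cell_notinD[OF z, of i]
        cell_inD[OF mem_cell_self, of i "rho k x"] cell_notinD[OF mem_cell_self, of i "rho k x"]
      by (cases "i \<in> nonint (rho k x)") auto
    then show "\<bar>z $ i - x $ i\<bar> \<le> 2" using rho_near[of k x i] by linarith
  qed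
  then show ?thesis using card_nonint_rho[OF assms(1)] by (auto simp: skel_def)
qed

section \<open>Lipschitz bounds for polynomials and cut-offs\<close>

lemma real_polynomial_lipschitz:
  fixes f :: "'a::euclidean_space \<Rightarrow> real"
  assumes "real_polynomial_function f" "compact K"
  shows "\<exists>L\<ge>0. \<forall>x\<in>K. \<forall>y\<in>K. \<bar>f x - f y\<bar> \<le> L * norm (x - y)"
  using assms(1)
proof induction
  case (linear f)
  then interpret bounded_linear f by simp
  obtain B where "B > 0" "\<And>x. norm (f x) \<le> norm x * B" using pos_bounded by blast
  then show ?case by (intro exI[of _ B]) (auto simp: diff[symmetric] mult.commute)
next
  case (const c)
  then show ?case by (intro exI[of _ 0]) auto
next
  case (add f g)
  then obtain L L' where L: "L \<ge> 0" "\<And>x y. x\<in>K \<Longrightarrow> y\<in>K \<Longrightarrow> \<bar>f x - f y\<bar> \<le> L * norm (x - y)"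
    "L' \<ge> 0" "\<And>x y. x\<in>K \<Longrightarrow> y\<in>K \<Longrightarrow> \<bar>g x - g y\<bar> \<le> L' * norm (x - y)" by blast
  have "\<bar>(f x + g x) - (f y + g y)\<bar> \<le> (L + L') * norm (x - y)" if "x \<in> K" "y \<in> K" for x y
    using L(2,4)[OF that] by (simp add: algebra_simps abs_le_iff)
  then show ?case using L(1,3) by (intro exI[of _ "L + L'"]) auto
next
  case (mult f g)
  then obtain L L' where L: "L \<ge> 0" "\<And>x y. x\<in>K \<Longrightarrow> y\<in>K \<Longrightarrow> \<bar>f x - f y\<bar> \<le> L * norm (x - y)"
    "L' \<ge> 0" "\<And>x y. x\<in>K \<Longrightarrow> y\<in>K \<Longrightarrow> \<bar>g x - g y\<bar> \<le> L' * norm (x - y)" by blast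
  have bd: "\<exists>B\<ge>0. \<forall>x\<in>K. \<bar>h x\<bar> \<le> B" if "real_polynomial_function h" for h :: "'a \<Rightarrow> real"
  proof -
    have "continuous_on K h" using that
      by (intro continuous_at_imp_continuous_on) (simp add: continuous_real_polymonial_function)
    then have "bounded (h ` K)" using assms(2) by (intro compact_imp_bounded compact_continuous_image)
    then obtain B where "\<And>x. x \<in> K \<Longrightarrow> \<bar>h x\<bar> \<le> B" by (auto simp: bounded_iff)
    then show ?thesis by (intro exI[of _ "max 0 B"]) (auto simp: le_max_iff_disj)
  qed
  obtain A B where A: "A \<ge> 0" "\<And>x. x \<in> K \<Longrightarrow> \<bar>f x\<bar> \<le> A" and B: "B \<ge> 0" "\<And>x. x \<in> K \<Longrightarrow> \<bar>g x\<bar> \<le> B"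
    using bd[OF mult.hyps(1)] bd[OF mult.hyps(2)] by blast
  have "\<bar>f x * g x - f y * g y\<bar> \<le> (L * B + A * L') * norm (x - y)" if "x \<in> K" "y \<in> K" for x y
  proof -
    have "f x * g x - f y * g y = (f x - f y) * g x + f y * (g x - g y)" by (simp add: algebra_simps)
    then have "\<bar>f x * g x - f y * g y\<bar> \<le> \<bar>f x - f y\<bar> * \<bar>g x\<bar> + \<bar>f y\<bar> * \<bar>g x - g y\<bar>"
      by (metis abs_mult abs_triangle_ineq)
    also have "\<dots> \<le> (L * norm (x - y)) * B + A * (L' * norm (x - y))"
      using L A B that by (intro add_mono mult_mono) auto
    finally show ?thesis by (simp add: algebra_simps)
  qed
  then show ?case using L(1,3) A(1) B(1) by (intro exI[of _ "L * B + A * L'"]) auto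
qed

text \<open>With the Stone-Weierstrass theorem this replaces a merely continuous homotopy on a
  compact skeleton by a Lipschitz one.\<close>

lemma polynomial_lipschitz:
  fixes f :: "'a::euclidean_space \<Rightarrow> 'b::euclidean_space"
  assumes "polynomial_function f" "compact K"
  shows "\<exists>L\<ge>0. \<forall>x\<in>K. \<forall>y\<in>K. norm (f x - f y) \<le> L * norm (x - y)"
proof -
  have "\<forall>b\<in>Basis. \<exists>L\<ge>0. \<forall>x\<in>K. \<forall>y\<in>K. \<bar>f x \<bullet> b - f y \<bullet> b\<bar> \<le> L * norm (x - y)"
  proof
    fix b :: 'b assume "b \<in> Basis"
    have "real_polynomial_function ((\<lambda>v. v \<bullet> b) \<circ> f)"
      using assms(1) bounded_linear_inner_left unfolding polynomial_function_def by blast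
    then show "\<exists>L\<ge>0. \<forall>x\<in>K. \<forall>y\<in>K. \<bar>f x \<bullet> b - f y \<bullet> b\<bar> \<le> L * norm (x - y)"
      using real_polynomial_lipschitz[OF _ assms(2)] by (fastforce simp: o_def)
  qed
  then obtain L where L: "\<And>b. b \<in> Basis \<Longrightarrow> L b \<ge> 0"
    "\<And>b x y. b \<in> Basis \<Longrightarrow> x \<in> K \<Longrightarrow> y \<in> K \<Longrightarrow> \<bar>f x \<bullet> b - f y \<bullet> b\<bar> \<le> L b * norm (x - y)"
    by metis
  have "norm (f x - f y) \<le> (\<Sum>b\<in>Basis. L b) * norm (x - y)" if "x \<in> K" "y \<in> K" for x y
  proof -
    have "norm (f x - f y) \<le> (\<Sum>b\<in>Basis. \<bar>(f x - f y) \<bullet> b\<bar>)" by (rule norm_le_l1)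
    also have "\<dots> \<le> (\<Sum>b\<in>Basis. L b * norm (x - y))"
      using L(2) that by (intro sum_mono) (simp add: inner_diff_left)
    finally show ?thesis by (simp add: sum_distrib_right)
  qed
  moreover have "(\<Sum>b\<in>Basis. L b) \<ge> 0" using L(1) by (simp add: sum_nonneg)
  ultimately show ?thesis by blast
qed

definition clamp01 :: "real \<Rightarrow> real" where
  "clamp01 t = max 0 (min 1 t)"

lemma clamp01_bounds: "0 \<le> clamp01 t" "clamp01 t \<le> 1"
  by (auto simp: clamp01_def)

lemma clamp01_lipschitz: "\<bar>clamp01 s - clamp01 t\<bar> \<le> \<bar>s - t\<bar>"
  by (auto simp: clamp01_def)

lemma clamp01_eq: "t \<le> 0 \<Longrightarrow> clamp01 t = 0" "t \<ge> 1 \<Longrightarrow> clamp01 t = 1"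
  by (auto simp: clamp01_def)

text \<open>The source of constants independent of \<delta>. The cut-off alone has Lipschitz
  constant 1 / \<delta>, but multiplied by m it is harmless: if m \<le> 4 \<delta> the factor m /
  \<delta> is at most 4, and otherwise either both values are 0 or m' < 2 \<delta>, so that m is
  comparable to |m - m'|.\<close>

lemma clamp01_ratio:
  assumes "\<delta> > 0" "m \<ge> 0" "m' \<ge> 0"
  shows "m * \<bar>clamp01 (2 - m / \<delta>) - clamp01 (2 - m' / \<delta>)\<bar> \<le> 4 * \<bar>m - m'\<bar>"
proof (cases "m \<le> 4 * \<delta>")
  case True
  have "\<bar>clamp01 (2 - m / \<delta>) - clamp01 (2 - m' / \<delta>)\<bar> \<le> \<bar>(2 - m / \<delta>) - (2 - m' / \<delta>)\<bar>"
    by (rule clamp01_lipschitz)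
  also have "\<dots> = \<bar>m - m'\<bar> / \<delta>"
    using assms(1) by (simp add: diff_divide_distrib[symmetric] abs_divide abs_minus_commute)
  finally have "m * \<bar>clamp01 (2 - m / \<delta>) - clamp01 (2 - m' / \<delta>)\<bar> \<le> (4 * \<delta>) * (\<bar>m - m'\<bar> / \<delta>)"
    using True assms by (intro mult_mono) auto
  then show ?thesis using assms(1) by simp
next
  case False
  then have m0: "clamp01 (2 - m / \<delta>) = 0" using assms(1) by (intro clamp01_eq) (simp add: field_simps)
  show ?thesis
  proof (cases "m' \<ge> 2 * \<delta>")
    case True
    then have "clamp01 (2 - m' / \<delta>) = 0" using assms(1) by (intro clamp01_eq) (simp add: field_simps)
    then show ?thesis using m0 by simp
  next
    case m': False
    have "m * \<bar>clamp01 (2 - m / \<delta>) - clamp01 (2 - m' / \<delta>)\<bar> \<le> m * 1"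
      using clamp01_bounds[of "2 - m' / \<delta>"] m0 assms by (intro mult_left_mono) auto
    moreover have "m \<le> 4 * \<bar>m - m'\<bar>" using False m' assms abs_ge_self[of "m - m'"] by argo
    ultimately show ?thesis by linarith
  qed
qed

text \<open>\<open>F x\<close> is a path from \<open>x\<close> to \<open>c\<close> in the domain of the smooth retraction \<open>r\<close> onto \<open>N\<close>, singular at the
  dual skeleton of the grid of mesh \<open>h\<close>.\<close>

definition nullhomotopy_field :: "(real^'v) set \<Rightarrow> (real^'v) set \<Rightarrow> (real^'v \<Rightarrow> real^'v) \<Rightarrow> real^'v \<Rightarrow> nat \<Rightarrow>
    (real^'v \<Rightarrow> real \<Rightarrow> real^'v) \<Rightarrow> real \<Rightarrow> real \<Rightarrow> real \<Rightarrow> real \<Rightarrow> real \<Rightarrow> bool" where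
  "nullhomotopy_field N U r c k F h \<iota> \<iota>0 C L \<longleftrightarrow> h > 0 \<and> \<iota> > 0 \<and> \<iota> \<le> \<iota>0 \<and> C \<ge> 0 \<and> L > 0 \<and>
    {x. infdist x N \<le> \<iota>0} \<subseteq> U \<and>
    (\<forall>x y. infdist x N \<le> \<iota>0 \<longrightarrow> infdist y N \<le> \<iota>0 \<longrightarrow> norm (r x - r y) \<le> L * norm (x - y)) \<and>
    (\<forall>x t. infdist x N \<le> \<iota> \<longrightarrow> 0 < gap k ((1/h) *\<^sub>R x) \<longrightarrow> t \<in> {0..1} \<longrightarrow> infdist (F x t) N \<le> \<iota>0) \<and>
    (\<forall>x. F x 0 = x \<and> F x 1 = c) \<and>
    (\<forall>x y s t. infdist x N \<le> \<iota> \<longrightarrow> infdist y N \<le> \<iota> \<longrightarrow> 0 < gap k ((1/h) *\<^sub>R x) \<longrightarrow> 0 < gap k ((1/h) *\<^sub>R y) \<longrightarrow>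
       s \<in> {0..1} \<longrightarrow> t \<in> {0..1} \<longrightarrow>
       gap k ((1/h) *\<^sub>R x) * norm (F x s - F y t) \<le> C * (norm (x - y) + gap k ((1/h) *\<^sub>R x) * \<bar>s - t\<bar>))"

text \<open>The path of x follows the skeleton homotopy at the point \<open>rho k\<close> of the
  rescaled x. The homotopy can be made Lipschitz, so the only singularity is that of
  \<open>rho\<close>, namely the inverse of the gap.\<close>

lemma nullhomotopy_field_exists:
  fixes N :: "(real^'v) set"
  assumes N: "compact N" "c \<in> N" and triv: "\<And>j. j \<le> k \<Longrightarrow> trivial_homotopy_group j N"
    and r: "smooth_retract_on N U r" "N \<subseteq> U"
  shows "\<exists>F h \<iota> \<iota>0 C L. nullhomotopy_field N U r c k F h \<iota> \<iota>0 C L"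
proof -
  have Nne: "N \<noteq> {}" using N(2) by auto
  have sr: "smooth_on_open U r" and rN: "\<And>x. x \<in> U \<Longrightarrow> r x \<in> N" and rid: "\<And>x. x \<in> N \<Longrightarrow> r x = x"
    using r by (auto simp: smooth_retract_on_def)
  have oU: "open U" using sr by (simp add: smooth_on_open_def)
  obtain \<iota>0 where \<iota>0: "\<iota>0 > 0" "{x. infdist x N \<le> \<iota>0} \<subseteq> U"
    by (rule compact_in_open_separated[OF Nne N(1) oU r(2)])
  let ?K = "{x. infdist x N \<le> \<iota>0}"
  have K: "compact ?K" by (rule compact_infdist_le[OF Nne N(1) \<iota>0(1)])
  obtain L0 where L0: "L0 > 0" "\<And>x y. x \<in> ?K \<Longrightarrow> y \<in> ?K \<Longrightarrow> norm (r x - r y) \<le> L0 * norm (x - y)"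
    using smooth_lipschitz_on_compact[OF sr K \<iota>0(2)] by blast
  define L where "L = max 1 L0"
  have L1: "L \<ge> 1" by (simp add: L_def)
  have Lr: "norm (r x - r y) \<le> L * norm (x - y)" if "infdist x N \<le> \<iota>0" "infdist y N \<le> \<iota>0" for x y
  proof -
    have "norm (r x - r y) \<le> L0 * norm (x - y)" using L0(2) that by simp
    also have "\<dots> \<le> L * norm (x - y)" by (intro mult_right_mono) (auto simp: L_def)
    finally show ?thesis .
  qed
  define \<nu> where "\<nu> = real CARD('v)"
  have \<nu>: "\<nu> \<ge> 1" by (simp add: \<nu>_def Suc_leI)
  \<comment> \<open>The constants are chosen so that the move to the grid, after r, costs at most
    \<iota>0 / 8 and the distance of x from its projection at most \<iota>0 / 4; \<nu> converts
    coordinate bounds into norm bounds.\<close>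
  define h where "h = \<iota>0 / (8 * L * \<nu>)"
  define \<iota> where "\<iota> = \<iota>0 / (4 * (1 + L))"
  have hpos: "h > 0" using \<iota>0(1) L1 \<nu> by (simp add: h_def)
  have Lh: "L * (\<nu> * h) = \<iota>0 / 8" using L1 \<nu> by (simp add: h_def)
  have \<nu>h: "\<nu> * h \<le> \<iota>0 / 8"
  proof -
    have "\<nu> * h \<le> L * (\<nu> * h)" using L1 \<nu> hpos mult_right_mono[of 1 L "\<nu> * h"] by simp
    then show ?thesis using Lh by simp
  qed
  have \<iota>pos: "\<iota> > 0" using \<iota>0(1) L1 by (simp add: \<iota>_def)
  have L\<iota>: "(1 + L) * \<iota> = \<iota>0 / 4"
  proof -
    have "1 + L \<noteq> 0" using L1 by simp
    then show ?thesis unfolding \<iota>_def by (simp add: field_simps)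
  qed
  have \<iota>4: "\<iota> \<le> \<iota>0 / 4"
  proof -
    have "1 * \<iota> \<le> (1 + L) * \<iota>" using L1 \<iota>pos by (intro mult_right_mono) auto
    then show ?thesis using L\<iota> by linarith
  qed
  have norm_bd: "norm z \<le> \<nu> * a" if "\<And>i. \<bar>z $ i\<bar> \<le> a" for z :: "real^'v" and a
  proof -
    have "norm z \<le> (\<Sum>i\<in>UNIV. \<bar>z $ i\<bar>)" by (rule norm_le_l1_cart)
    also have "\<dots> \<le> (\<Sum>i\<in>(UNIV :: 'v set). a)" using that by (intro sum_mono)
    finally show ?thesis by (simp add: \<nu>_def)
  qed
  \<comment> \<open>The neighbourhood of N seen at scale h, so that a grid of mesh 1 can be
    used.\<close>
  define B where "B = {z. infdist (h *\<^sub>R z) N \<le> \<iota>0}"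
  have "bounded B"
  proof -
    have "bounded ((\<lambda>x. (1/h) *\<^sub>R x) ` ?K)"
      using K by (intro bounded_scaling compact_imp_bounded)
    moreover have "B \<subseteq> (\<lambda>x. (1/h) *\<^sub>R x) ` ?K"
    proof
      fix z assume "z \<in> B"
      then have "h *\<^sub>R z \<in> ?K" by (simp add: B_def)
      moreover have "z = (1/h) *\<^sub>R (h *\<^sub>R z)" using hpos by simp
      ultimately show "z \<in> (\<lambda>x. (1/h) *\<^sub>R x) ` ?K" by blast
    qed
    ultimately show ?thesis by (rule bounded_subset)
  qed
  moreover have "continuous_on B (\<lambda>z. r (h *\<^sub>R z))"
    by (rule continuous_on_compose2[OF smooth_on_open_continuous[OF sr]])
      (use \<iota>0(2) in \<open>auto simp: B_def intro!: continuous_intros\<close>)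
  moreover have "(\<lambda>z. r (h *\<^sub>R z)) ` B \<subseteq> N" using rN \<iota>0(2) by (auto simp: B_def)
  ultimately have "\<exists>H. skel_homotopy B (\<lambda>z. r (h *\<^sub>R z)) N c (Suc k) H"
    using N(2) triv by (intro skel_homotopy_exists) auto
  then obtain H where H: "skel_homotopy B (\<lambda>z. r (h *\<^sub>R z)) N c (Suc k) H" by blast
  let ?Z = "skel B (Suc k) \<times> {0..1::real}"
  have Hc: "continuous_on ?Z H" and HN: "\<And>z. z \<in> ?Z \<Longrightarrow> H z \<in> N"
    and H0: "\<And>x. x \<in> skel B (Suc k) \<Longrightarrow> H (x, 0) = r (h *\<^sub>R x)"
    and H1: "\<And>x. x \<in> skel B (Suc k) \<Longrightarrow> H (x, 1) = c"
    using H by (auto simp: skel_homotopy_def)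
  have Z: "compact ?Z" using \<open>bounded B\<close> by (intro compact_Times compact_skel) auto
  have e0: "\<iota>0 / 8 > 0" using \<iota>0(1) by simp
  \<comment> \<open>H is only continuous; g is Lipschitz but leaves N and misses the prescribed
    ends. The first defect is repaired by r, the second by the correction terms in F.\<close>
  obtain g where g: "polynomial_function g" "\<And>z. z \<in> ?Z \<Longrightarrow> norm (H z - g z) < \<iota>0 / 8"
    using Stone_Weierstrass_polynomial_function[OF Z Hc e0] by blast
  obtain A where A: "A \<ge> 0" "\<And>x y. x \<in> ?Z \<Longrightarrow> y \<in> ?Z \<Longrightarrow> norm (g x - g y) \<le> A * norm (x - y)"
    using polynomial_lipschitz[OF g(1) Z] by blast
  have "bounded N" using N(1) by (rule compact_imp_bounded)
  then obtain b where b: "\<And>x. x \<in> N \<Longrightarrow> norm x \<le> b" by (auto simp: bounded_iff)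
  have b0: "b \<ge> 0" using b[OF N(2)] norm_ge_zero order_trans by blast
  define D where "D = b + \<iota>0"
  have D0: "D \<ge> 0" using b0 \<iota>0(1) by (simp add: D_def)
  have gD: "norm (g z) \<le> D" if "z \<in> ?Z" for z
  proof -
    have "norm (g z) \<le> norm (H z) + norm (H z - g z)"
      using norm_triangle_ineq4[of "H z" "H z - g z"] by simp
    then show ?thesis using b[OF HN[OF that]] g(2)[OF that] \<iota>0(1) by (simp add: D_def)
  qed
  have nearest: "\<exists>y\<in>N. infdist x N = norm (x - y)" for x
    by (rule infdist_attains_inf[OF compact_imp_closed[OF N(1)] Nne, of x]) (auto simp: dist_norm)
  have near_D: "norm x \<le> D" if "infdist x N \<le> \<iota>0" for x
  proof -
    obtain y where y: "y \<in> N" "infdist x N = norm (x - y)" using nearest by blast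
    then show ?thesis using that b[OF y(1)] norm_triangle_sub[of x y] by (simp add: D_def)
  qed
  define \<rho> where "\<rho> x = rho k ((1/h) *\<^sub>R x)" for x :: "real^'v"
  define G where "G x = gap k ((1/h) *\<^sub>R x)" for x :: "real^'v"
  \<comment> \<open>The linear interpolation of the end values of g is subtracted and that of x and
    c is added, so the path runs exactly from x to c.\<close>
  define F where "F x t = (g (\<rho> x, t) - (1 - t) *\<^sub>R g (\<rho> x, 0) - t *\<^sub>R g (\<rho> x, 1)) + (1 - t) *\<^sub>R x + t *\<^sub>R c" for x t
  have \<rho>near: "norm (h *\<^sub>R \<rho> x - x) \<le> \<nu> * h" for x
  proof (rule norm_bd)
    fix i
    have "\<bar>\<rho> x $ i - x $ i / h\<bar> \<le> 1" using rho_near[of k "(1/h) *\<^sub>R x" i] by (simp add: \<rho>_def)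
    then have "h * \<bar>\<rho> x $ i - x $ i / h\<bar> \<le> h * 1" using hpos by (intro mult_left_mono) auto
    moreover have "h * \<bar>\<rho> x $ i - x $ i / h\<bar> = \<bar>h * (\<rho> x $ i - x $ i / h)\<bar>" using hpos by (simp add: abs_mult)
    moreover have "h * (\<rho> x $ i - x $ i / h) = (h *\<^sub>R \<rho> x - x) $ i" using hpos by (simp add: algebra_simps)
    ultimately show "\<bar>(h *\<^sub>R \<rho> x - x) $ i\<bar> \<le> h" by simp
  qed
  have \<rho>skel: "\<rho> x \<in> skel B (Suc k)" if x: "infdist x N \<le> \<iota>" "0 < G x" for x
    unfolding \<rho>_def
  proof (rule rho_in_skel)
    show "0 < gap k ((1/h) *\<^sub>R x)" using x(2) by (simp add: G_def)
    fix z assume z: "\<And>i. \<bar>z $ i - ((1/h) *\<^sub>R x) $ i\<bar> \<le> 2"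
    have "norm (h *\<^sub>R z - x) \<le> \<nu> * (2 * h)"
    proof (rule norm_bd)
      fix i
      have "h * \<bar>z $ i - x $ i / h\<bar> \<le> h * 2" using z[of i] hpos by (intro mult_left_mono) auto
      moreover have "h * \<bar>z $ i - x $ i / h\<bar> = \<bar>h * (z $ i - x $ i / h)\<bar>" using hpos by (simp add: abs_mult)
      moreover have "h * (z $ i - x $ i / h) = (h *\<^sub>R z - x) $ i" using hpos by (simp add: algebra_simps)
      ultimately show "\<bar>(h *\<^sub>R z - x) $ i\<bar> \<le> 2 * h" by simp
    qed
    then have "infdist (h *\<^sub>R z) N \<le> infdist x N + 2 * (\<nu> * h)"
      using infdist_triangle[of "h *\<^sub>R z" N x] by (simp add: dist_norm)
    then show "z \<in> B" using x(1) \<iota>4 \<nu>h \<iota>0(1) by (simp add: B_def)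
  qed
  have skelB: "skel B (Suc k) \<subseteq> B" using mem_cell_self by (force simp: skel_def)
  have Fin: "infdist (F x t) N \<le> \<iota>0" if x: "infdist x N \<le> \<iota>" "0 < G x" and t: "t \<in> {0..1}" for x t
  proof -
    let ?z = "\<rho> x"
    have z: "?z \<in> skel B (Suc k)" using \<rho>skel[OF x] .
    have "norm (x - r (h *\<^sub>R ?z)) \<le> \<iota>0 / 4 + \<iota>0 / 8"
    proof -
      obtain y where y: "y \<in> N" "infdist x N = norm (x - y)" using nearest by blast
      have xK: "infdist x N \<le> \<iota>0" using x(1) \<iota>4 \<iota>0(1) by simp
      have hz: "infdist (h *\<^sub>R ?z) N \<le> \<iota>0" using z skelB by (auto simp: B_def)
      have "norm (r y - r x) \<le> L * norm (y - x)" using y(1) xK by (intro Lr) (auto simp: \<iota>0(1) less_imp_le)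
      then have "norm (x - r x) \<le> (1 + L) * norm (x - y)"
        using norm_triangle_ineq[of "x - y" "y - r x"] rid[OF y(1)] by (simp add: algebra_simps norm_minus_commute)
      also have "\<dots> \<le> (1 + L) * \<iota>" using x(1) y(2) L1 by (intro mult_left_mono) auto
      finally have 1: "norm (x - r x) \<le> \<iota>0 / 4" using L\<iota> by simp
      have "norm (r x - r (h *\<^sub>R ?z)) \<le> L * norm (x - h *\<^sub>R ?z)" by (rule Lr[OF xK hz])
      also have "\<dots> \<le> L * (\<nu> * h)"
        using \<rho>near[of x] L1 by (intro mult_left_mono) (auto simp: norm_minus_commute)
      finally have 2: "norm (r x - r (h *\<^sub>R ?z)) \<le> \<iota>0 / 8" using Lh by simp
      show ?thesis using 1 2 norm_triangle_ineq[of "x - r x" "r x - r (h *\<^sub>R ?z)"] by simp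
    qed
    note xr = this
    define d where "d s = g (?z, s) - H (?z, s)" for s
    have d: "norm (d s) \<le> \<iota>0 / 8" if "s \<in> {0..1}" for s
      using g(2)[of "(?z, s)"] z that by (auto simp: d_def norm_minus_commute)
    \<comment> \<open>Three approximation errors of g, two of them weighted by 1 - t and t, and the
      distance from x to r of its grid point: 1/8 + 1/8 + 3/8 = 5/8 of \<iota>0, so the path stays
      where r is available.\<close>
    have "F x t - H (?z, t) = d t - (1 - t) *\<^sub>R d 0 - t *\<^sub>R d 1 + (1 - t) *\<^sub>R (x - r (h *\<^sub>R ?z))"
      using H0[OF z] H1[OF z] by (simp add: F_def d_def algebra_simps)
    also have "norm \<dots> \<le> norm (d t) + norm ((1 - t) *\<^sub>R d 0) + norm (t *\<^sub>R d 1) + norm ((1 - t) *\<^sub>R (x - r (h *\<^sub>R ?z)))"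
      by (rule norm_triangle_mono[OF order_trans[OF norm_triangle_ineq4 add_mono[OF
        norm_triangle_ineq4 order_refl]] order_refl])
    also have "\<dots> \<le> \<iota>0 / 8 + (1 - t) * (\<iota>0 / 8) + t * (\<iota>0 / 8) + 1 * (\<iota>0 / 4 + \<iota>0 / 8)"
    proof -
      have "norm ((1 - t) *\<^sub>R (x - r (h *\<^sub>R ?z))) \<le> 1 * (\<iota>0 / 4 + \<iota>0 / 8)"
        unfolding norm_scaleR using t xr by (intro mult_mono) auto
      moreover have "norm ((1 - t) *\<^sub>R d 0) \<le> (1 - t) * (\<iota>0 / 8)"
      proof -
        have "(1 - t) * norm (d 0) \<le> (1 - t) * (\<iota>0 / 8)" using t by (intro mult_left_mono d) auto
        then show ?thesis using t by simp
      qed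
      moreover have "norm (t *\<^sub>R d 1) \<le> t * (\<iota>0 / 8)"
      proof -
        have "t * norm (d 1) \<le> t * (\<iota>0 / 8)" using t by (intro mult_left_mono d) auto
        then show ?thesis using t by simp
      qed
      ultimately show ?thesis using d[OF t] by linarith
    qed
    also have "\<dots> = \<iota>0 * (5/8)" by (simp add: field_simps)
    also have "\<dots> \<le> \<iota>0" using \<iota>0(1) by simp
    finally have "dist (F x t) (H (?z, t)) \<le> \<iota>0" by (simp add: dist_norm)
    moreover have "H (?z, t) \<in> N" using HN z t by auto
    ultimately show ?thesis using infdist_le order_trans by blast
  qed
  \<comment> \<open>Three increments of g each pass through \<open>rho\<close> at mesh h and give A
    \<nu> / h; the term in x gives 1. A change of time costs A in g and D in each of the four
    interpolated terms.\<close>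
  define C where "C = 3 * A * (\<nu> / h) + 1 + (A + 4 * D)"
  have C0: "C \<ge> 0" using A(1) \<nu> hpos D0 by (auto simp: C_def intro!: add_nonneg_nonneg)
  have Flip: "G x * norm (F x s - F y t) \<le> C * (norm (x - y) + G x * \<bar>s - t\<bar>)"
    if xy: "infdist x N \<le> \<iota>" "infdist y N \<le> \<iota>" "0 < G x" "0 < G y" and st: "s \<in> {0..1}" "t \<in> {0..1}" for x y s t
  proof -
    let ?z = "\<rho> x" and ?w = "\<rho> y"
    have zw: "?z \<in> skel B (Suc k)" "?w \<in> skel B (Suc k)" using \<rho>skel xy by auto
    have scale: "norm (a *\<^sub>R v - b *\<^sub>R w) \<le> norm (v - w) + \<bar>a - b\<bar> * norm w" if "\<bar>a\<bar> \<le> 1" for a b and v w :: "real^'v"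
    proof -
      have "a *\<^sub>R v - b *\<^sub>R w = a *\<^sub>R (v - w) + (a - b) *\<^sub>R w" by (simp add: algebra_simps)
      then have "norm (a *\<^sub>R v - b *\<^sub>R w) \<le> \<bar>a\<bar> * norm (v - w) + \<bar>a - b\<bar> * norm w"
        using norm_triangle_ineq[of "a *\<^sub>R (v - w)" "(a - b) *\<^sub>R w"] by simp
      moreover have "\<bar>a\<bar> * norm (v - w) \<le> norm (v - w)" using that mult_right_mono[of "\<bar>a\<bar>" 1 "norm (v - w)"] by simp
      ultimately show ?thesis by linarith
    qed
    have g1: "norm (g (?z, s) - g (?w, t)) \<le> A * (norm (?z - ?w) + \<bar>s - t\<bar>)"
    proof -
      have "norm (g (?z, s) - g (?w, t)) \<le> A * norm ((?z, s) - (?w, t))" using zw st by (intro A(2)) auto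
      also have "\<dots> \<le> A * (norm (?z - ?w) + \<bar>s - t\<bar>)"
        using A(1) norm_Pair_le[of "?z - ?w" "s - t"] by (intro mult_left_mono) auto
      finally show ?thesis .
    qed
    have gs: "norm (g (?z, a) - g (?w, a)) \<le> A * norm (?z - ?w)" if "a \<in> {0..1}" for a
    proof -
      have "norm (g (?z, a) - g (?w, a)) \<le> A * norm ((?z, a) - (?w, a))" using zw that by (intro A(2)) auto
      then show ?thesis by (simp add: norm_Pair)
    qed
    have g2: "norm ((1 - s) *\<^sub>R g (?z, 0) - (1 - t) *\<^sub>R g (?w, 0)) \<le> A * norm (?z - ?w) + \<bar>s - t\<bar> * D"
    proof -
      have "norm ((1 - s) *\<^sub>R g (?z, 0) - (1 - t) *\<^sub>R g (?w, 0)) \<le> norm (g (?z, 0) - g (?w, 0)) + \<bar>(1 - s) - (1 - t)\<bar> * norm (g (?w, 0))"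
        using st by (intro scale) auto
      also have "\<dots> \<le> A * norm (?z - ?w) + \<bar>s - t\<bar> * D"
        using gs[of 0] gD[of "(?w, 0)"] zw by (intro add_mono mult_mono) auto
      finally show ?thesis .
    qed
    have g3: "norm (s *\<^sub>R g (?z, 1) - t *\<^sub>R g (?w, 1)) \<le> A * norm (?z - ?w) + \<bar>s - t\<bar> * D"
    proof -
      have "norm (s *\<^sub>R g (?z, 1) - t *\<^sub>R g (?w, 1)) \<le> norm (g (?z, 1) - g (?w, 1)) + \<bar>s - t\<bar> * norm (g (?w, 1))"
        using st by (intro scale) auto
      also have "\<dots> \<le> A * norm (?z - ?w) + \<bar>s - t\<bar> * D"
        using gs[of 1] gD[of "(?w, 1)"] zw by (intro add_mono mult_mono) auto
      finally show ?thesis .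
    qed
    have g4: "norm ((1 - s) *\<^sub>R x - (1 - t) *\<^sub>R y) \<le> norm (x - y) + \<bar>s - t\<bar> * D"
    proof -
      have "norm ((1 - s) *\<^sub>R x - (1 - t) *\<^sub>R y) \<le> norm (x - y) + \<bar>(1 - s) - (1 - t)\<bar> * norm y"
        using st by (intro scale) auto
      also have "\<dots> \<le> norm (x - y) + \<bar>s - t\<bar> * D"
        using near_D[of y] xy(2) \<iota>4 \<iota>0(1) by (intro add_mono mult_mono) auto
      finally show ?thesis .
    qed
    have g5: "norm (s *\<^sub>R c - t *\<^sub>R c) \<le> \<bar>s - t\<bar> * D"
      using b[OF N(2)] \<iota>0(1) by (simp add: scaleR_left_diff_distrib[symmetric] D_def mult_left_mono)
    have "F x s - F y t = (g (?z, s) - g (?w, t)) - ((1 - s) *\<^sub>R g (?z, 0) - (1 - t) *\<^sub>R g (?w, 0))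
        - (s *\<^sub>R g (?z, 1) - t *\<^sub>R g (?w, 1)) + ((1 - s) *\<^sub>R x - (1 - t) *\<^sub>R y) + (s *\<^sub>R c - t *\<^sub>R c)"
      by (simp add: F_def)
    also have "norm \<dots> \<le> A * (norm (?z - ?w) + \<bar>s - t\<bar>) + (A * norm (?z - ?w) + \<bar>s - t\<bar> * D)
        + (A * norm (?z - ?w) + \<bar>s - t\<bar> * D) + (norm (x - y) + \<bar>s - t\<bar> * D) + \<bar>s - t\<bar> * D"
      by (rule norm_triangle_mono[OF norm_triangle_mono[OF order_trans[OF norm_triangle_ineq4 add_mono[OF
        order_trans[OF norm_triangle_ineq4 add_mono[OF g1 g2]] g3]] g4] g5])
    also have "\<dots> = 3 * A * norm (?z - ?w) + norm (x - y) + (A + 4 * D) * \<bar>s - t\<bar>"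
      by (simp add: algebra_simps)
    finally have "G x * norm (F x s - F y t) \<le> G x * (3 * A * norm (?z - ?w) + norm (x - y) + (A + 4 * D) * \<bar>s - t\<bar>)"
      using xy(3) by (intro mult_left_mono) auto
    also have "\<dots> = 3 * A * (G x * norm (?z - ?w)) + G x * norm (x - y) + (A + 4 * D) * (G x * \<bar>s - t\<bar>)"
      by (simp add: algebra_simps)
    also have "\<dots> \<le> 3 * A * (\<nu> / h * norm (x - y)) + 1 * norm (x - y) + (A + 4 * D) * (G x * \<bar>s - t\<bar>)"
    proof -
      have "G x * norm (?z - ?w) \<le> \<nu> * norm ((1/h) *\<^sub>R x - (1/h) *\<^sub>R y)"
        unfolding G_def \<rho>_def \<nu>_def using xy by (intro rho_lipschitz) (auto simp: G_def)
      also have "norm ((1/h) *\<^sub>R x - (1/h) *\<^sub>R y) = norm (x - y) / h"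
        using hpos by (simp add: scaleR_right_diff_distrib[symmetric])
      finally have "G x * norm (?z - ?w) \<le> \<nu> / h * norm (x - y)" by simp
      moreover have "G x \<le> 1" using gap_le_half[of k "(1/h) *\<^sub>R x"] by (simp add: G_def)
      ultimately show ?thesis using A(1) D0 xy(3) by (intro add_mono mult_left_mono mult_right_mono) auto
    qed
    also have "\<dots> \<le> C * norm (x - y) + C * (G x * \<bar>s - t\<bar>)"
    proof -
      have "3 * A * (\<nu> / h) + 1 \<le> C" "A + 4 * D \<le> C"
        using A(1) D0 \<nu> hpos by (auto simp: C_def)
      then have "(3 * A * (\<nu> / h) + 1) * norm (x - y) \<le> C * norm (x - y)"
        "(A + 4 * D) * (G x * \<bar>s - t\<bar>) \<le> C * (G x * \<bar>s - t\<bar>)"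
        using xy(3) by (auto intro!: mult_right_mono)
      then show ?thesis by (simp add: algebra_simps)
    qed
    finally show ?thesis by (simp add: algebra_simps)
  qed
  have F01: "F x 0 = x \<and> F x 1 = c" for x by (simp add: F_def)
  have \<iota>le: "\<iota> \<le> \<iota>0" using \<iota>4 \<iota>0(1) by simp
  have Lpos: "L > 0" using L1 by simp
  have aLr: "\<forall>x y. infdist x N \<le> \<iota>0 \<longrightarrow> infdist y N \<le> \<iota>0 \<longrightarrow> norm (r x - r y) \<le> L * norm (x - y)"
    using Lr by simp
  have aFin: "\<forall>x t. infdist x N \<le> \<iota> \<longrightarrow> 0 < G x \<longrightarrow> t \<in> {0..1} \<longrightarrow> infdist (F x t) N \<le> \<iota>0"
    using Fin by simp
  have aF01: "\<forall>x. F x 0 = x \<and> F x 1 = c" using F01 by simp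
  have aFlip: "\<forall>x y s t. infdist x N \<le> \<iota> \<longrightarrow> infdist y N \<le> \<iota> \<longrightarrow> 0 < G x \<longrightarrow> 0 < G y \<longrightarrow>
       s \<in> {0..1} \<longrightarrow> t \<in> {0..1} \<longrightarrow> G x * norm (F x s - F y t) \<le> C * (norm (x - y) + G x * \<bar>s - t\<bar>)"
    by (intro allI impI) (rule Flip)
  have "nullhomotopy_field N U r c k F h \<iota> \<iota>0 C L"
    unfolding nullhomotopy_field_def G_def[symmetric]
    by (intro conjI) (rule hpos \<iota>pos \<iota>le C0 Lpos \<iota>0(2) aLr aFin aF01 aFlip)+
  then show ?thesis by blast
qed

section \<open>Singular retractions onto the target\<close>

text \<open>\<open>\<kappa> \<delta>\<close> is a Lipschitz truncation of a singular retraction at distance about \<open>\<delta>\<close> from the dual skeleton;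
  the point is that \<open>C\<close> does not depend on \<open>\<delta>\<close>.\<close>

definition singular_retraction :: "(real^'v) set \<Rightarrow> nat \<Rightarrow> (real \<Rightarrow> real^'v \<Rightarrow> real^'v) \<Rightarrow>
    (real^'v \<Rightarrow> real^'v) \<Rightarrow> real \<Rightarrow> real \<Rightarrow> real \<Rightarrow> bool" where
  "singular_retraction N k \<kappa> P C \<iota> h \<longleftrightarrow> C > 0 \<and> \<iota> > 0 \<and> h > 0 \<and>
    (\<forall>x\<in>N. P x = x) \<and> (\<forall>x y. norm (P x - P y) \<le> C * norm (x - y)) \<and>
    (\<forall>\<delta>>0. \<forall>x. \<kappa> \<delta> x \<in> N) \<and>
    (\<forall>\<delta>>0. \<exists>L. \<forall>x y. norm (\<kappa> \<delta> x - \<kappa> \<delta> y) \<le> L * norm (x - y)) \<and>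
    (\<forall>\<delta>>0. \<forall>x y. gap k ((1/h) *\<^sub>R x) * norm (\<kappa> \<delta> x - \<kappa> \<delta> y) \<le> C * norm (x - y)) \<and>
    (\<forall>\<delta>>0. \<forall>x. infdist x N \<le> \<iota> \<longrightarrow> gap k ((1/h) *\<^sub>R x) \<ge> 2 * \<delta> \<longrightarrow> \<kappa> \<delta> x = P x)"

theorem singular_retraction_exists:
  fixes N :: "(real^'v) set"
  assumes N: "compact N" "N \<noteq> {}" "embedded_submanifold n N"
    and triv: "\<And>j. j \<le> k \<Longrightarrow> trivial_homotopy_group j N"
  shows "\<exists>\<kappa> P C \<iota> h. singular_retraction N k \<kappa> P C \<iota> h"
proof -
  obtain c where c: "c \<in> N" using N(2) by blast
  obtain U r where r: "N \<subseteq> U" "smooth_retract_on N U r"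
    by (rule embedded_submanifold_smooth_retract[OF N(3,1)])
  have rN: "\<And>x. x \<in> U \<Longrightarrow> r x \<in> N" and rid: "\<And>x. x \<in> N \<Longrightarrow> r x = x"
    using r by (auto simp: smooth_retract_on_def)
  obtain F h \<iota> \<iota>0 C L where nf: "nullhomotopy_field N U r c k F h \<iota> \<iota>0 C L"
    using nullhomotopy_field_exists[of N c k U r, OF N(1) c triv r(2,1)] by blast
  have hpos: "h > 0" and \<iota>: "\<iota> > 0" "\<iota> \<le> \<iota>0" and C: "C \<ge> 0" and L: "L > 0" and \<iota>U: "{x. infdist x N \<le> \<iota>0} \<subseteq> U"
    and Lr: "\<And>x y. infdist x N \<le> \<iota>0 \<Longrightarrow> infdist y N \<le> \<iota>0 \<Longrightarrow> norm (r x - r y) \<le> L * norm (x - y)"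
    and Fin: "\<And>x t. infdist x N \<le> \<iota> \<Longrightarrow> 0 < gap k ((1/h) *\<^sub>R x) \<Longrightarrow> t \<in> {0..1} \<Longrightarrow> infdist (F x t) N \<le> \<iota>0"
    and F01: "\<And>x. F x 0 = x" "\<And>x. F x 1 = c"
    and Flip: "\<And>x y s t. infdist x N \<le> \<iota> \<Longrightarrow> infdist y N \<le> \<iota> \<Longrightarrow> 0 < gap k ((1/h) *\<^sub>R x) \<Longrightarrow> 0 < gap k ((1/h) *\<^sub>R y) \<Longrightarrow>
       s \<in> {0..1} \<Longrightarrow> t \<in> {0..1} \<Longrightarrow>
       gap k ((1/h) *\<^sub>R x) * norm (F x s - F y t) \<le> C * (norm (x - y) + gap k ((1/h) *\<^sub>R x) * \<bar>s - t\<bar>)"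
    using nf unfolding nullhomotopy_field_def by simp_all
  have rnear: "r x \<in> N" if "infdist x N < \<iota>" for x
  proof -
    have "x \<in> U" using that \<iota>(2) \<iota>U by force
    then show ?thesis by (rule rN)
  qed
  define G where "G x = gap k ((1/h) *\<^sub>R x)" for x :: "real^'v"
  have G: "0 \<le> G x" "G x \<le> 1/2" for x unfolding G_def by (rule gap_nonneg, rule gap_le_half)
  have Glip: "\<bar>G x - G y\<bar> \<le> norm (x - y) / h" for x y
    using gap_lipschitz[of k "(1/h) *\<^sub>R x" "(1/h) *\<^sub>R y"] hpos
    by (simp add: G_def scaleR_right_diff_distrib[symmetric])
  obtain b where b: "\<And>x. x \<in> N \<Longrightarrow> norm x \<le> b"
    using compact_imp_bounded[OF N(1)] by (auto simp: bounded_iff)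
  have b0: "b \<ge> 0" using b[OF c] norm_ge_zero order_trans by blast
  \<comment> \<open>A cut-off in the distance from N: 0 up to \<iota>/3 and 1 beyond 2 \<iota>/3,
    which leaves a margin of \<iota>/3 before F ceases to be controlled.\<close>
  define \<sigma> where "\<sigma> x = clamp01 ((infdist x N - \<iota>/3) * (3/\<iota>))" for x :: "real^'v"
  have \<sigma>01: "\<sigma> x \<in> {0..1}" for x using clamp01_bounds by (auto simp: \<sigma>_def)
  have \<sigma>lip: "\<bar>\<sigma> x - \<sigma> y\<bar> \<le> 3/\<iota> * norm (x - y)" for x y
  proof -
    have "\<bar>\<sigma> x - \<sigma> y\<bar> \<le> \<bar>(infdist x N - \<iota>/3) * (3/\<iota>) - (infdist y N - \<iota>/3) * (3/\<iota>)\<bar>"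
      unfolding \<sigma>_def by (rule clamp01_lipschitz)
    also have "(infdist x N - \<iota>/3) * (3/\<iota>) - (infdist y N - \<iota>/3) * (3/\<iota>) = (infdist x N - infdist y N) * (3/\<iota>)"
      by algebra
    also have "\<bar>\<dots>\<bar> = \<bar>infdist x N - infdist y N\<bar> * (3/\<iota>)"
      unfolding abs_mult using \<iota>(1) by simp
    also have "\<dots> \<le> norm (x - y) * (3/\<iota>)"
      using infdist_triangle_abs[of x N y] \<iota>(1) by (intro mult_right_mono) (auto simp: dist_norm)
    finally show ?thesis by (simp add: mult.commute)
  qed
  have \<sigma>0: "\<sigma> x = 0" if "infdist x N \<le> \<iota>/3" for x
    unfolding \<sigma>_def using that \<iota>(1) by (intro clamp01_eq mult_nonpos_nonneg) auto
  have \<sigma>1: "\<sigma> x = 1" if "infdist x N \<ge> 2 * \<iota>/3" for x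
    unfolding \<sigma>_def
  proof (rule clamp01_eq(2))
    have "(\<iota>/3) * (3/\<iota>) \<le> (infdist x N - \<iota>/3) * (3/\<iota>)" using that \<iota>(1) by (intro mult_right_mono) auto
    then show "1 \<le> (infdist x N - \<iota>/3) * (3/\<iota>)" using \<iota>(1) by simp
  qed
  \<comment> \<open>The time at which the path of x is evaluated: the end time 1 where the gap is at
    most \<delta> or x is far from N, and the start time 0 near N where the gap is at least 2
    \<delta>.\<close>
  define \<theta> where "\<theta> \<delta> x = max (clamp01 (2 - G x / \<delta>)) (\<sigma> x)" for \<delta> x
  have \<theta>01: "\<theta> \<delta> x \<in> {0..1}" for \<delta> x
    using clamp01_bounds[of "2 - G x / \<delta>"] \<sigma>01[of x] by (auto simp: \<theta>_def)
  have G\<theta>: "G x * \<bar>\<theta> \<delta> x - \<theta> \<delta> y\<bar> \<le> (4/h + 3/\<iota>) * norm (x - y)" if "\<delta> > 0" for \<delta> x y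
  proof -
    have "\<bar>\<theta> \<delta> x - \<theta> \<delta> y\<bar> \<le> \<bar>clamp01 (2 - G x / \<delta>) - clamp01 (2 - G y / \<delta>)\<bar> + \<bar>\<sigma> x - \<sigma> y\<bar>"
      unfolding \<theta>_def by linarith
    then have "G x * \<bar>\<theta> \<delta> x - \<theta> \<delta> y\<bar> \<le> G x * (\<bar>clamp01 (2 - G x / \<delta>) - clamp01 (2 - G y / \<delta>)\<bar> + \<bar>\<sigma> x - \<sigma> y\<bar>)"
      using G by (intro mult_left_mono) auto
    also have "\<dots> = G x * \<bar>clamp01 (2 - G x / \<delta>) - clamp01 (2 - G y / \<delta>)\<bar> + G x * \<bar>\<sigma> x - \<sigma> y\<bar>"
      by (simp add: algebra_simps)
    also have "\<dots> \<le> 4 * \<bar>G x - G y\<bar> + 1 * (3/\<iota> * norm (x - y))"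
      using G[of x] G[of y] \<sigma>lip[of x y] that by (intro add_mono clamp01_ratio mult_mono) auto
    also have "\<dots> \<le> 4 * (norm (x - y) / h) + 1 * (3/\<iota> * norm (x - y))"
      using Glip[of x y] by simp
    finally show ?thesis by (simp add: algebra_simps)
  qed
  define good where "good x \<longleftrightarrow> infdist x N < \<iota> \<and> 0 < G x" for x
  \<comment> \<open>The two branches match because \<theta> is already 1, and the path already at c,
    before x leaves the good set. The singularity is thereby removed while the weighted Lipschitz
    bound is kept.\<close>
  define \<kappa> where "\<kappa> \<delta> x = (if good x then r (F x (\<theta> \<delta> x)) else c)" for \<delta> x
  have FK: "infdist (F x (\<theta> \<delta> x)) N \<le> \<iota>0" if "good x" for \<delta> x
    using that Fin[of x] \<theta>01 by (auto simp: good_def G_def)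
  have \<kappa>N: "\<kappa> \<delta> x \<in> N" for \<delta> x
    using FK[of x \<delta>] rN \<iota>U c by (auto simp: \<kappa>_def)
  have \<kappa>c: "\<kappa> \<delta> x = c" if "\<theta> \<delta> x = 1" for \<delta> x
    using that F01 rid[OF c] by (simp add: \<kappa>_def)
  have \<kappa>bd: "norm (\<kappa> \<delta> x - \<kappa> \<delta> y) \<le> 2 * b" for \<delta> x y
    using norm_triangle_ineq4[of "\<kappa> \<delta> x" "\<kappa> \<delta> y"] b[OF \<kappa>N[of \<delta> x]] b[OF \<kappa>N[of \<delta> y]] by linarith
  \<comment> \<open>The sum of the constants of all cases below, so that a single one serves for
    \<kappa> and P.\<close>
  define C1 where "C1 = L * C * (1 + (4/h + 3/\<iota>)) + 2 * b / h + 3 * b / \<iota> + L * (1 + 3/\<iota>) + (2 * b) * (3/\<iota>) + 1"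
  have C1: "C1 \<ge> L * C * (1 + (4/h + 3/\<iota>))" "C1 \<ge> 2 * b / h" "C1 \<ge> 3 * b / \<iota>" "C1 \<ge> L + (2 * b) * (3/\<iota>)" "C1 > 0" "C1 \<ge> (2 * b) * (3/\<iota>)"
  proof -
    have "0 \<le> L * C * (1 + (4/h + 3/\<iota>))" "0 \<le> 2 * b / h" "0 \<le> 3 * b / \<iota>" "0 \<le> (2 * b) * (3/\<iota>)" "L * (1 + 3/\<iota>) \<ge> L"
      using L C b0 \<iota> hpos by (auto simp: distrib_left intro!: mult_nonneg_nonneg add_nonneg_nonneg)
    then show "C1 \<ge> L * C * (1 + (4/h + 3/\<iota>))" "C1 \<ge> 2 * b / h" "C1 \<ge> 3 * b / \<iota>" "C1 \<ge> L + (2 * b) * (3/\<iota>)" "C1 > 0" "C1 \<ge> (2 * b) * (3/\<iota>)"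
      using L unfolding C1_def by linarith+
  qed
  have far: "norm (x - y) \<ge> \<iota>/3" if "infdist x N \<ge> \<iota>" "infdist y N < 2 * \<iota>/3" for x y
    using infdist_triangle_abs[of x N y] that by (simp add: dist_norm)
  have \<kappa>G: "G x * norm (\<kappa> \<delta> x - \<kappa> \<delta> y) \<le> C1 * norm (x - y)" if \<delta>: "\<delta> > 0" for \<delta> x y
  proof (cases "G x = 0")
    case True
    then show ?thesis using C1(5) by simp
  next
    case False
    then have Gx: "G x > 0" using G[of x] by simp
    have dist_case: "G x * norm (\<kappa> \<delta> x - \<kappa> \<delta> y) \<le> C1 * norm (x - y)" if "norm (x - y) \<ge> \<iota>/3"
    proof -
      have "G x * norm (\<kappa> \<delta> x - \<kappa> \<delta> y) \<le> 1/2 * (2 * b)"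
        using G[of x] \<kappa>bd by (intro mult_mono) auto
      also have "\<dots> = 3 * b / \<iota> * (\<iota>/3)" using \<iota>(1) by simp
      also have "\<dots> \<le> C1 * norm (x - y)"
        using C1 that \<iota>(1) by (intro mult_mono) auto
      finally show ?thesis .
    qed
    \<comment> \<open>Here w is far from N and z is the other point, in either order. If z is beyond
      2 \<iota>/3 both values are c; otherwise the points are at least \<iota>/3 apart and
      boundedness of N suffices.\<close>
    have far_case: "G x * norm (\<kappa> \<delta> x - \<kappa> \<delta> y) \<le> C1 * norm (x - y)"
      if "\<kappa> \<delta> w = c" "infdist w N \<ge> \<iota>" "{w, z} = {x, y}" for w z
    proof (cases "infdist z N \<ge> 2 * \<iota>/3")
      case True
      then have "\<theta> \<delta> z = 1" using \<sigma>1 clamp01_bounds(2)[of "2 - G z / \<delta>"] by (simp add: \<theta>_def max_def)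
      then have "\<kappa> \<delta> x = \<kappa> \<delta> y" using \<kappa>c that by (metis doubleton_eq_iff)
      then show ?thesis using C1(5) by simp
    next
      case False
      then have "norm (w - z) \<ge> \<iota>/3" using far that by simp
      then have "norm (x - y) \<ge> \<iota>/3" using that(3) by (auto simp: doubleton_eq_iff norm_minus_commute)
      then show ?thesis by (rule dist_case)
    qed
    show ?thesis
    proof (cases "good x")
      case True
      show ?thesis
      proof (cases "good y")
        case gy: True
        have "norm (\<kappa> \<delta> x - \<kappa> \<delta> y) \<le> L * norm (F x (\<theta> \<delta> x) - F y (\<theta> \<delta> y))"
          using Lr[OF FK[OF True] FK[OF gy]] True gy by (simp add: \<kappa>_def)
        then have "G x * norm (\<kappa> \<delta> x - \<kappa> \<delta> y) \<le> G x * (L * norm (F x (\<theta> \<delta> x) - F y (\<theta> \<delta> y)))"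
          using G by (intro mult_left_mono) auto
        also have "\<dots> = L * (G x * norm (F x (\<theta> \<delta> x) - F y (\<theta> \<delta> y)))" by simp
        also have "\<dots> \<le> L * (C * (norm (x - y) + G x * \<bar>\<theta> \<delta> x - \<theta> \<delta> y\<bar>))"
          using True gy L \<theta>01 unfolding G_def good_def
          by (intro mult_left_mono[OF Flip]) auto
        also have "\<dots> \<le> L * (C * (norm (x - y) + (4/h + 3/\<iota>) * norm (x - y)))"
          using G\<theta>[OF \<delta>] L C by (intro mult_left_mono add_mono) auto
        also have "\<dots> = (L * C * (1 + (4/h + 3/\<iota>))) * norm (x - y)" by (simp add: algebra_simps)
        also have "\<dots> \<le> C1 * norm (x - y)" using C1 by (intro mult_right_mono) auto
        finally show ?thesis .
      next
        case ngy: False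
        then have cy: "\<kappa> \<delta> y = c" by (simp add: \<kappa>_def)
        show ?thesis
        proof (cases "infdist y N \<ge> \<iota>")
          case True
          then show ?thesis using far_case[of y x] cy by auto
        next
          case False
          \<comment> \<open>The remaining y lies on the dual skeleton, so the gap of x itself is at
            most |x - y| / h and boundedness of N again suffices.\<close>
          then have "G y = 0" using ngy G[of y] by (auto simp: good_def)
          then have "G x \<le> norm (x - y) / h" using Glip[of x y] G[of x] by simp
          then have "G x * norm (\<kappa> \<delta> x - \<kappa> \<delta> y) \<le> norm (x - y) / h * (2 * b)"
            using \<kappa>bd hpos by (intro mult_mono) auto
          also have "\<dots> = 2 * b / h * norm (x - y)" by simp
          also have "\<dots> \<le> C1 * norm (x - y)" using C1 by (intro mult_right_mono) auto
          finally show ?thesis .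
        qed
      qed
    next
      case False
      then have "\<kappa> \<delta> x = c" "infdist x N \<ge> \<iota>" using Gx by (auto simp: \<kappa>_def good_def)
      then show ?thesis using far_case[of x y] by auto
    qed
  qed
  have \<kappa>L: "\<exists>L. \<forall>x y. norm (\<kappa> \<delta> x - \<kappa> \<delta> y) \<le> L * norm (x - y)" if \<delta>: "\<delta> > 0" for \<delta>
  proof (intro exI allI)
    fix x y
    have *: "norm (\<kappa> \<delta> x - \<kappa> \<delta> y) \<le> C1 / \<delta> * norm (x - y)" if "G x \<ge> \<delta>" for x y
    proof -
      have "\<delta> * norm (\<kappa> \<delta> x - \<kappa> \<delta> y) \<le> G x * norm (\<kappa> \<delta> x - \<kappa> \<delta> y)" using that by (intro mult_right_mono) auto
      then have "\<delta> * norm (\<kappa> \<delta> x - \<kappa> \<delta> y) \<le> C1 * norm (x - y)" using \<kappa>G[OF \<delta>, of x y] by simp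
      then show ?thesis using \<delta> by (simp add: field_simps)
    qed
    have small: "\<kappa> \<delta> x = c" if "G x < \<delta>" for x
    proof (rule \<kappa>c)
      have "clamp01 (2 - G x / \<delta>) = 1" using that \<delta> by (intro clamp01_eq) (simp add: field_simps)
      then show "\<theta> \<delta> x = 1" using \<sigma>01[of x] by (simp add: \<theta>_def max_def)
    qed
    consider "G x \<ge> \<delta>" | "G y \<ge> \<delta>" | "G x < \<delta>" "G y < \<delta>" by linarith
    then show "norm (\<kappa> \<delta> x - \<kappa> \<delta> y) \<le> C1 / \<delta> * norm (x - y)"
    proof cases
      case 1
      then show ?thesis by (rule *)
    next
      case 2
      then show ?thesis using *[of y x] by (simp add: norm_minus_commute)
    next
      case 3
      then show ?thesis using small C1(5) \<delta> by simp
    qed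
  qed
  \<comment> \<open>A globally Lipschitz map that is the identity on N. Its values may leave N in
    the transition zone, which is harmless: it is only a reference map, and the limit u lies where P
    fixes it.\<close>
  define P where "P x = (if infdist x N < \<iota> then (1 - \<sigma> x) *\<^sub>R r x + \<sigma> x *\<^sub>R c else c)" for x
  have Pid: "P x = x" if "x \<in> N" for x
    using that \<iota>(1) \<sigma>0[of x] rid by (simp add: P_def)
  have P1: "P x = c" if "infdist x N \<ge> 2 * \<iota>/3" for x
    using \<sigma>1[OF that] by (simp add: P_def)
  have Pbd: "norm (P x - c) \<le> 2 * b" for x
  proof (cases "infdist x N < \<iota>")
    case True
    then have "r x \<in> N" by (rule rnear)
    then have "norm (r x - c) \<le> 2 * b" using norm_triangle_ineq4[of "r x" c] b[of "r x"] b[OF c] by simp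
    moreover have "P x - c = (1 - \<sigma> x) *\<^sub>R (r x - c)" using True by (simp add: P_def algebra_simps)
    ultimately show ?thesis using \<sigma>01[of x] mult_mono[of "1 - \<sigma> x" 1 "norm (r x - c)" "2 * b"] by simp
  qed (use b0 in \<open>simp add: P_def\<close>)
  have Pfar: "norm (P x - P y) \<le> C1 * norm (x - y)" if "infdist x N \<ge> \<iota>" for x y
  proof (cases "infdist y N \<ge> 2 * \<iota>/3")
    case True
    then show ?thesis using P1[of x] P1[of y] that \<iota>(1) C1(5) by simp
  next
    case False
    have "norm (P x - P y) = norm (P y - c)" using P1[of x] that \<iota>(1) by (simp add: norm_minus_commute)
    also have "\<dots> \<le> 2 * b" by (rule Pbd)
    also have "\<dots> = (2 * b) * (3/\<iota>) * (\<iota>/3)" using \<iota>(1) by simp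
    also have "\<dots> \<le> C1 * norm (x - y)"
      using C1 far[OF that, of y] False \<iota>(1) by (intro mult_mono) auto
    finally show ?thesis .
  qed
  have Plip: "norm (P x - P y) \<le> C1 * norm (x - y)" for x y
  proof -
    consider "infdist x N \<ge> \<iota>" | "infdist y N \<ge> \<iota>" | "infdist x N < \<iota>" "infdist y N < \<iota>" by linarith
    then show ?thesis
    proof cases
      case 1
      then show ?thesis by (rule Pfar)
    next
      case 2
      then show ?thesis using Pfar[of y x] by (simp add: norm_minus_commute)
    next
      case 3
      then have "r y \<in> N" using rnear by simp
      then have bd: "norm (r y - c) \<le> 2 * b" using norm_triangle_ineq4[of "r y" c] b[of "r y"] b[OF c] by simp
      have "P x - P y = (1 - \<sigma> x) *\<^sub>R (r x - r y) + (\<sigma> y - \<sigma> x) *\<^sub>R (r y - c)"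
        using 3 by (simp add: P_def algebra_simps)
      then have "norm (P x - P y) \<le> \<bar>1 - \<sigma> x\<bar> * norm (r x - r y) + \<bar>\<sigma> y - \<sigma> x\<bar> * norm (r y - c)"
        by (metis norm_scaleR norm_triangle_ineq)
      also have "\<dots> \<le> 1 * (L * norm (x - y)) + (3/\<iota> * norm (x - y)) * (2 * b)"
        using \<sigma>01[of x] Lr[of x y] 3 \<iota> L \<sigma>lip[of y x] bd
        by (intro add_mono mult_mono) (auto simp: norm_minus_commute)
      also have "\<dots> = (L + (2 * b) * (3/\<iota>)) * norm (x - y)" by (simp add: algebra_simps)
      also have "\<dots> \<le> C1 * norm (x - y)" using C1 by (intro mult_right_mono) auto
      finally show ?thesis .
    qed
  qed
  have \<kappa>P: "\<kappa> \<delta> x = P x" if "\<delta> > 0" "infdist x N \<le> \<iota>/3" "G x \<ge> 2 * \<delta>" for \<delta> x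
  proof -
    have "clamp01 (2 - G x / \<delta>) = 0" using that by (intro clamp01_eq) (simp add: field_simps)
    then have "\<theta> \<delta> x = 0" using \<sigma>0 that by (simp add: \<theta>_def)
    moreover have "good x" using that \<iota>(1) by (auto simp: good_def)
    ultimately show ?thesis using that \<sigma>0 \<iota>(1) F01 by (simp add: \<kappa>_def P_def)
  qed
  have \<iota>3: "\<iota>/3 > 0" using \<iota>(1) by simp
  have aPid: "\<forall>x\<in>N. P x = x" using Pid by simp
  have aPlip: "\<forall>x y. norm (P x - P y) \<le> C1 * norm (x - y)" using Plip by simp
  have a\<kappa>N: "\<forall>\<delta>>0. \<forall>x. \<kappa> \<delta> x \<in> N" using \<kappa>N by simp
  have a\<kappa>L: "\<forall>\<delta>>0. \<exists>L. \<forall>x y. norm (\<kappa> \<delta> x - \<kappa> \<delta> y) \<le> L * norm (x - y)"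
    by (intro allI impI \<kappa>L)
  have a\<kappa>G: "\<forall>\<delta>>0. \<forall>x y. G x * norm (\<kappa> \<delta> x - \<kappa> \<delta> y) \<le> C1 * norm (x - y)"
    by (intro allI impI \<kappa>G)
  have a\<kappa>P: "\<forall>\<delta>>0. \<forall>x. infdist x N \<le> \<iota>/3 \<longrightarrow> G x \<ge> 2 * \<delta> \<longrightarrow> \<kappa> \<delta> x = P x"
    by (intro allI impI \<kappa>P)
  \<comment> \<open>The radius shrinks to \<iota>/3 because only there is \<sigma> equal to 0, so
    that both maps reduce to r.\<close>
  have "singular_retraction N k \<kappa> P C1 (\<iota>/3) h"
    unfolding singular_retraction_def G_def[symmetric]
    by (intro conjI) (rule C1(5) \<iota>3 hpos aPid aPlip a\<kappa>N a\<kappa>L a\<kappa>G a\<kappa>P)+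
  then show ?thesis by blast
qed

section \<open>Smoothing Lipschitz maps\<close>

lemma nn_integral_1_imp_integral:
  fixes \<phi> :: "'a::euclidean_space \<Rightarrow> real"
  assumes "\<phi> \<in> borel_measurable borel" "\<And>x. 0 \<le> \<phi> x" "(\<integral>\<^sup>+x. ennreal (\<phi> x) \<partial>lborel) = 1"
  shows "integrable lborel \<phi>" "(\<integral>x. \<phi> x \<partial>lborel) = 1"
proof -
  show "integrable lborel \<phi>"
    using assms by (intro integrableI_nonneg) auto
  show "(\<integral>x. \<phi> x \<partial>lborel) = 1"
    using assms by (subst integral_eq_nn_integral) auto
qed

lemma integral_average_bound:
  fixes \<phi> :: "'a::euclidean_space \<Rightarrow> real" and g :: "'a \<Rightarrow> 'b::euclidean_space"
  assumes [measurable]: "\<phi> \<in> borel_measurable borel" "g \<in> borel_measurable borel"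
    and \<phi>: "\<And>x. 0 \<le> \<phi> x" "(\<integral>\<^sup>+x. ennreal (\<phi> x) \<partial>lborel) = 1"
    and B: "\<And>x. \<phi> x \<noteq> 0 \<Longrightarrow> norm (g x) \<le> B"
  shows "integrable lborel (\<lambda>x. \<phi> x *\<^sub>R g x)" "norm (\<integral>x. \<phi> x *\<^sub>R g x \<partial>lborel) \<le> B"
proof -
  note int = nn_integral_1_imp_integral[OF assms(1) \<phi>]
  have bd: "norm (\<phi> x *\<^sub>R g x) \<le> \<phi> x * B" for x
    using \<phi>(1)[of x] B[of x] by (cases "\<phi> x = 0") (auto intro: mult_left_mono)
  have intB: "integrable lborel (\<lambda>x. \<phi> x * B)" using int(1) by simp
  show i: "integrable lborel (\<lambda>x. \<phi> x *\<^sub>R g x)"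
  proof (rule Bochner_Integration.integrable_bound[OF intB])
    show "AE x in lborel. norm (\<phi> x *\<^sub>R g x) \<le> norm (\<phi> x * B)"
    proof (rule AE_I2)
      fix x
      have "\<phi> x * B \<le> norm (\<phi> x * B)" by simp
      then show "norm (\<phi> x *\<^sub>R g x) \<le> norm (\<phi> x * B)" using bd[of x] by linarith
    qed
  qed simp
  have "norm (\<integral>x. \<phi> x *\<^sub>R g x \<partial>lborel) \<le> (\<integral>x. norm (\<phi> x *\<^sub>R g x) \<partial>lborel)" by (rule integral_norm_bound)
  also have "\<dots> \<le> (\<integral>x. \<phi> x * B \<partial>lborel)"
    using i intB bd by (intro integral_mono integrable_norm)
  also have "\<dots> = B" using int by simp
  finally show "norm (\<integral>x. \<phi> x *\<^sub>R g x \<partial>lborel) \<le> B" .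
qed

lemma mem_open_cube_iff: "x \<in> open_cube \<longleftrightarrow> (\<forall>i. \<bar>x $ i\<bar> < 1)"
  unfolding open_cube_def abs_less_iff minus_less_iff[of _ 1] by auto

lemma closure_open_cube_le:
  assumes "x \<in> closure (open_cube :: (real^'m) set)"
  shows "\<bar>x $ i\<bar> \<le> 1"
proof -
  have "closed {x :: real^'m. \<bar>x $ i\<bar> \<le> 1}"
    by (intro closed_Collect_le continuous_intros)
  moreover have "open_cube \<subseteq> {x :: real^'m. \<bar>x $ i\<bar> \<le> 1}"
    by (auto simp: mem_open_cube_iff less_imp_le)
  ultimately show ?thesis using assms closure_minimal by blast
qed

text \<open>Convolution at scale \<eta> keeps the Lipschitz constant and moves f by at most K
  \<eta>; applying r costs a fixed factor. That C does not depend on \<eta> is what later makes the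
  energy of the difference tend to 0.\<close>

lemma lipschitz_smooth_approximation:
  fixes f :: "real^'m \<Rightarrow> real^'v"
  assumes N: "compact N" "N \<noteq> {}" "embedded_submanifold n N"
    and f: "\<And>x. f x \<in> N" "\<And>x y. norm (f x - f y) \<le> K * norm (x - y)"
  shows "\<exists>C>0. \<exists>\<eta>0>0. \<forall>\<eta>. 0 < \<eta> \<longrightarrow> \<eta> < \<eta>0 \<longrightarrow>
    (\<exists>w. w \<in> smooth_maps N \<and> continuous_on open_cube w \<and> (\<forall>x\<in>open_cube. norm (w x - f x) \<le> C * \<eta>) \<and>
       (\<forall>x\<in>open_cube. \<forall>y\<in>open_cube. norm (w x - w y) \<le> C * norm (x - y)))"
proof -
  obtain U r where r: "N \<subseteq> U" "smooth_retract_on N U r"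
    by (rule embedded_submanifold_smooth_retract[OF N(3,1)])
  have sr: "smooth_on_open U r" and rN: "\<And>x. x \<in> U \<Longrightarrow> r x \<in> N" and rid: "\<And>x. x \<in> N \<Longrightarrow> r x = x"
    using r by (auto simp: smooth_retract_on_def)
  have oU: "open U" using sr by (simp add: smooth_on_open_def)
  obtain \<iota>0 where \<iota>0: "\<iota>0 > 0" "{x. infdist x N \<le> \<iota>0} \<subseteq> U"
    by (rule compact_in_open_separated[OF N(2,1) oU r(1)])
  have KK: "compact {x. infdist x N \<le> \<iota>0}" by (rule compact_infdist_le[OF N(2,1) \<iota>0(1)])
  obtain L where L: "L > 0" "\<And>x y. infdist x N \<le> \<iota>0 \<Longrightarrow> infdist y N \<le> \<iota>0 \<Longrightarrow> norm (r x - r y) \<le> L * norm (x - y)"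
    using smooth_lipschitz_on_compact[OF sr KK \<iota>0(2)] by blast
  have K0: "K \<ge> 0"
  proof -
    have "norm (f (axis undefined 1) - f 0) \<le> K * norm (axis undefined 1 - (0 :: real^'m))" by (rule f)
    moreover have "norm (axis undefined 1 - (0 :: real^'m)) = 1" by (simp add: norm_axis_1)
    ultimately show ?thesis using norm_ge_zero[of "f (axis undefined 1) - f 0"] by (metis mult.right_neutral order_trans)
  qed
  have contf: "continuous_on UNIV f"
  proof (rule lipschitz_on_continuous_on)
    show "K-lipschitz_on UNIV f" using f(2) K0 by (intro lipschitz_onI) (auto simp: dist_norm)
  qed
  have [measurable]: "f \<in> borel_measurable borel" using contf by (rule borel_measurable_continuous_onI)
  obtain \<phi> :: "real^'m \<Rightarrow> real" and A where "mollifier \<phi> A" using mollifier_exists by blast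
  then have \<phi>: "smooth_on_open UNIV \<phi>" "\<And>x. 0 \<le> \<phi> x"
    "\<And>x. norm x \<ge> 1 \<Longrightarrow> \<phi> x = 0" "(\<integral>\<^sup>+x. ennreal (\<phi> x) \<partial>lborel) = 1"
    by (simp_all add: mollifier_def)
  have cont\<phi>: "continuous_on UNIV \<phi>" using \<phi>(1) by (rule smooth_on_open_continuous)
  have [measurable]: "\<phi> \<in> borel_measurable borel" using cont\<phi> by (rule borel_measurable_continuous_onI)
  \<comment> \<open>The bound \<iota>0 / (K + 1) keeps the mollified map in the domain of r; the
    bound 1 keeps the support of the kernel in a fixed box.\<close>
  define \<eta>0 where "\<eta>0 = min 1 (\<iota>0 / (K + 1))"
  have \<eta>0: "\<eta>0 > 0" "\<eta>0 \<le> 1" "\<eta>0 \<le> \<iota>0 / (K + 1)" using \<iota>0(1) K0 by (auto simp: \<eta>0_def)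
  define C where "C = L * K + 1"
  have C: "C > 0" "C \<ge> L * K" using L(1) K0 by (auto simp: C_def intro: add_nonneg_pos)
  have main: "\<exists>w. w \<in> smooth_maps N \<and> continuous_on open_cube w \<and> (\<forall>x\<in>open_cube. norm (w x - f x) \<le> C * \<eta>) \<and>
       (\<forall>x\<in>open_cube. \<forall>y\<in>open_cube. norm (w x - w y) \<le> C * norm (x - y))"
    if \<eta>: "0 < \<eta>" "\<eta> < \<eta>0" for \<eta>
  proof -
    let ?m = "CARD('m)"
    define \<psi> where "\<psi> z = (1/\<eta>) ^ ?m * \<phi> ((1/\<eta>) *\<^sub>R z)" for z
    have sm\<psi>: "smooth_on_open UNIV \<psi>"
    proof -
      have "smooth_on_open UNIV (\<lambda>z :: real^'m. (1/\<eta>) *\<^sub>R z)"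
        by (rule smooth_on_open_linear[OF open_UNIV bounded_linear_scaleR_right])
      then have "smooth_on_open UNIV (\<lambda>z. \<phi> ((1/\<eta>) *\<^sub>R z))"
        by (rule smooth_on_open_compose[OF _ \<phi>(1)]) simp
      from smooth_on_open_bilinear[OF bounded_bilinear_mult smooth_on_open_const[OF open_UNIV] this]
      show ?thesis unfolding \<psi>_def .
    qed
    \<comment> \<open>Points of W0 have coordinates below 2 in size and the kernel has radius \<eta>
      < 1, so the box of half-width 3 contains the whole support.\<close>
    define a b :: "real^'m" where "a = (\<chi> i. -3)" and "b = (\<chi> i. 3)"
    define g where "g x = integral (cbox a b) (\<lambda>y. \<psi> (x - y) *\<^sub>R f y)" for x
    have smg: "smooth_on_open UNIV g"
      unfolding smooth_on_open_def g_def using Ck_on_convolution[OF contf sm\<psi>] by simp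
    define W0 where "W0 = {x :: real^'m. \<forall>i. \<bar>x $ i\<bar> < 2}"
    have oW0: "open W0"
    proof -
      have "W0 = (\<Inter>i. {x. \<bar>x $ i\<bar> < 2})" by (auto simp: W0_def)
      moreover have "open {x :: real^'m. \<bar>x $ i\<bar> < 2}" for i
        by (intro open_Collect_less continuous_intros)
      ultimately show ?thesis by (simp add: open_INT)
    qed
    have int: "integrable lborel (\<lambda>z. \<phi> z *\<^sub>R f (x - \<eta> *\<^sub>R z))" for x
    proof -
      obtain B where B: "\<And>y. y \<in> N \<Longrightarrow> norm y \<le> B"
        using compact_imp_bounded[OF N(1)] by (auto simp: bounded_iff)
      show ?thesis by (rule integral_average_bound(1)[where B=B]) (use \<phi> B f in auto)
    qed
    \<comment> \<open>Two forms of one convolution: the kernel form is the one that can be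
      differentiated, the translation form is the one that inherits estimates from f.\<close>
    have geq: "g x = (\<integral>z. \<phi> z *\<^sub>R f (x - \<eta> *\<^sub>R z) \<partial>lborel)" if x: "x \<in> W0" for x
    proof -
      let ?h = "\<lambda>y. \<psi> (x - y) *\<^sub>R f y"
      have cont\<psi>: "continuous_on UNIV \<psi>" using sm\<psi> by (rule smooth_on_open_continuous)
      have conth: "continuous_on UNIV ?h"
        by (intro continuous_intros continuous_on_compose2[OF cont\<psi>] contf) auto
      have zero: "?h y = 0" if "y \<notin> cbox a b" for y
      proof -
        obtain i where i: "\<not> \<bar>y $ i\<bar> \<le> 3"
          using \<open>y \<notin> cbox a b\<close> by (auto simp: mem_box_cart a_def b_def abs_le_iff minus_le_iff)
        have "\<bar>x $ i\<bar> < 2" using x by (simp add: W0_def)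
        then have "1 \<le> \<bar>(x - y) $ i\<bar>" using i by simp
        also have "\<dots> \<le> norm (x - y)" by (rule component_le_norm_cart)
        also have "\<dots> \<le> norm ((1/\<eta>) *\<^sub>R (x - y))"
        proof -
          have "1 * norm (x - y) \<le> (1/\<eta>) * norm (x - y)" using \<eta> \<eta>0 by (intro mult_right_mono) auto
          then show ?thesis using \<eta>(1) by simp
        qed
        finally show ?thesis using \<phi>(3) by (simp add: \<psi>_def)
      qed
      have "integrable lborel (\<lambda>y. indicator (cbox a b) y *\<^sub>R ?h y)"
        by (rule borel_integrable_compact) (auto intro: continuous_on_subset[OF conth])
      moreover have "(\<lambda>y. indicator (cbox a b) y *\<^sub>R ?h y) = ?h"
        using zero by (auto simp: indicator_def fun_eq_iff)
      ultimately have inth: "integrable lborel ?h" by simp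
      have "(?h has_integral (\<integral>y. ?h y \<partial>lborel)) UNIV"
        by (rule has_integral_integral_lborel[OF inth])
      then have "((\<lambda>y. if y \<in> cbox a b then ?h y else 0) has_integral (\<integral>y. ?h y \<partial>lborel)) UNIV"
        by (rule has_integral_eq[rotated]) (simp add: zero)
      then have "(?h has_integral (\<integral>y. ?h y \<partial>lborel)) (cbox a b)"
        unfolding has_integral_restrict_UNIV .
      then have "g x = (\<integral>y. ?h y \<partial>lborel)" by (simp add: g_def integral_unique)
      also have "\<dots> = \<bar>-\<eta>\<bar> ^ DIM(real^'m) *\<^sub>R (\<integral>z. ?h (x + (-\<eta>) *\<^sub>R z) \<partial>lborel)"
        using \<eta>(1) by (intro integral_lborel_affine) (auto intro: borel_measurable_continuous_onI conth)
      also have "\<dots> = (\<integral>z. \<phi> z *\<^sub>R f (x - \<eta> *\<^sub>R z) \<partial>lborel)"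
      proof -
        have hh: "?h (x + (-\<eta>) *\<^sub>R z) = (1/\<eta>) ^ ?m *\<^sub>R (\<phi> z *\<^sub>R f (x - \<eta> *\<^sub>R z))" for z
          using \<eta>(1) by (simp add: \<psi>_def)
        have "(\<integral>z. ?h (x + (-\<eta>) *\<^sub>R z) \<partial>lborel) = (1/\<eta>) ^ ?m *\<^sub>R (\<integral>z. \<phi> z *\<^sub>R f (x - \<eta> *\<^sub>R z) \<partial>lborel)"
          unfolding hh by (rule Bochner_Integration.integral_scaleR_right)
        then show ?thesis using \<eta>(1) by (simp add: power_one_over)
      qed
      finally show ?thesis .
    qed
    have gf: "norm (g x - f x) \<le> K * \<eta>" if x: "x \<in> W0" for x
    proof -
      note i1 = nn_integral_1_imp_integral[of \<phi>, OF _ \<phi>(2,4)]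
      have "g x - f x = (\<integral>z. \<phi> z *\<^sub>R f (x - \<eta> *\<^sub>R z) \<partial>lborel) - (\<integral>z. \<phi> z *\<^sub>R f x \<partial>lborel)"
        using geq[OF x] i1 by simp
      also have "\<dots> = (\<integral>z. \<phi> z *\<^sub>R f (x - \<eta> *\<^sub>R z) - \<phi> z *\<^sub>R f x \<partial>lborel)"
        using int i1 by (intro Bochner_Integration.integral_diff[symmetric]) auto
      also have "\<dots> = (\<integral>z. \<phi> z *\<^sub>R (f (x - \<eta> *\<^sub>R z) - f x) \<partial>lborel)"
        by (simp add: scaleR_diff_right)
      also have "norm \<dots> \<le> K * \<eta>"
      proof (rule integral_average_bound(2))
        fix z assume "\<phi> z \<noteq> 0"
        then have "norm z \<le> 1" using \<phi>(3)[of z] by linarith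
        have "norm (f (x - \<eta> *\<^sub>R z) - f x) \<le> K * norm ((x - \<eta> *\<^sub>R z) - x)" by (rule f)
        also have "\<dots> \<le> K * \<eta>" using \<open>norm z \<le> 1\<close> K0 \<eta>(1) by (intro mult_left_mono) (auto simp: mult_left_le)
        finally show "norm (f (x - \<eta> *\<^sub>R z) - f x) \<le> K * \<eta>" .
      qed (use \<phi> in auto)
      finally show ?thesis .
    qed
    have gg: "norm (g x - g y) \<le> K * norm (x - y)" if xy: "x \<in> W0" "y \<in> W0" for x y
    proof -
      have "g x - g y = (\<integral>z. \<phi> z *\<^sub>R f (x - \<eta> *\<^sub>R z) - \<phi> z *\<^sub>R f (y - \<eta> *\<^sub>R z) \<partial>lborel)"
        unfolding geq[OF xy(1)] geq[OF xy(2)] by (rule Bochner_Integration.integral_diff[symmetric]) (rule int)+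
      also have "\<dots> = (\<integral>z. \<phi> z *\<^sub>R (f (x - \<eta> *\<^sub>R z) - f (y - \<eta> *\<^sub>R z)) \<partial>lborel)"
        by (simp add: scaleR_diff_right)
      also have "norm \<dots> \<le> K * norm (x - y)"
      proof (rule integral_average_bound(2))
        fix z
        show "norm (f (x - \<eta> *\<^sub>R z) - f (y - \<eta> *\<^sub>R z)) \<le> K * norm (x - y)"
          using f(2)[of "x - \<eta> *\<^sub>R z" "y - \<eta> *\<^sub>R z"] by simp
      qed (use \<phi> in auto)
      finally show ?thesis .
    qed
    have K\<eta>: "K * \<eta> \<le> \<iota>0"
    proof -
      have "K * \<eta> \<le> (K + 1) * (\<iota>0 / (K + 1))" using K0 \<eta> \<eta>0 \<iota>0(1) by (intro mult_mono) auto
      then show ?thesis using K0 by simp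
    qed
    have gnear: "infdist (g x) N \<le> \<iota>0" if "x \<in> W0" for x
      using infdist_le2[OF f(1)[of x], of "g x" \<iota>0] gf[OF that] K\<eta> by (simp add: dist_norm)
    have fnear: "infdist (f x) N \<le> \<iota>0" for x using f(1)[of x] \<iota>0(1) by simp
    define w where "w x = r (g x)" for x
    have clQ: "closure open_cube \<subseteq> W0"
    proof
      fix x :: "real^'m" assume "x \<in> closure open_cube"
      then have "\<bar>x $ i\<bar> < 2" for i using closure_open_cube_le[of x i] by linarith
      then show "x \<in> W0" by (simp add: W0_def)
    qed
    then have Q: "open_cube \<subseteq> W0" using closure_subset by blast
    have gU: "g x \<in> U" if "x \<in> W0" for x using gnear[OF that] \<iota>0(2) by blast
    have smw: "smooth_on_open W0 w"
      unfolding w_def by (rule smooth_on_open_compose[OF smooth_on_open_subset[OF smg oW0] sr]) (use gU in auto)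
    have "w \<in> smooth_maps N"
      unfolding smooth_maps_def
    proof (rule CollectI, rule conjI)
      show "\<forall>x\<in>closure open_cube. w x \<in> N" using clQ gU rN by (auto simp: w_def)
      show "\<exists>W g. closure open_cube \<subseteq> W \<and> smooth_on_open W g \<and> (\<forall>x\<in>closure open_cube. g x = w x)"
        by (rule exI[of _ W0], rule exI[of _ w]) (use clQ smw in auto)
    qed
    moreover have "continuous_on open_cube w"
      using smooth_on_open_continuous[OF smw] Q by (rule continuous_on_subset)
    moreover have "norm (w x - f x) \<le> C * \<eta>" if "x \<in> open_cube" for x
    proof -
      have x: "x \<in> W0" using that Q by blast
      have "norm (w x - f x) = norm (r (g x) - r (f x))" using rid[OF f(1)] by (simp add: w_def)
      also have "\<dots> \<le> L * norm (g x - f x)" using gnear[OF x] fnear by (rule L(2))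
      also have "\<dots> \<le> L * (K * \<eta>)" using gf[OF x] L(1) by (intro mult_left_mono) auto
      also have "\<dots> = (L * K) * \<eta>" by simp
      also have "\<dots> \<le> C * \<eta>" using C \<eta>(1) by (intro mult_right_mono) auto
      finally show ?thesis .
    qed
    moreover have "norm (w x - w y) \<le> C * norm (x - y)" if "x \<in> open_cube" "y \<in> open_cube" for x y
    proof -
      have xy: "x \<in> W0" "y \<in> W0" using that Q by auto
      have "norm (w x - w y) \<le> L * norm (g x - g y)" unfolding w_def using gnear xy by (intro L(2)) auto
      also have "\<dots> \<le> L * (K * norm (x - y))" using gg[OF xy] L(1) by (intro mult_left_mono) auto
      also have "\<dots> = (L * K) * norm (x - y)" by simp
      also have "\<dots> \<le> C * norm (x - y)" using C by (intro mult_right_mono) auto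
      finally show ?thesis .
    qed
    ultimately show ?thesis by blast
  qed
  show ?thesis
    by (rule exI[of _ C], rule conjI[OF C(1)], rule exI[of _ \<eta>0], rule conjI[OF \<eta>0(1)]) (intro allI impI main)
qed

section \<open>Integrability of the weights\<close>

lemma nn_integral_inverse_powr_finite:
  assumes "0 < r" "r < (1::real)" "0 \<le> A"
  shows "(\<integral>\<^sup>+t. inverse (ennreal (\<bar>t\<bar> powr r)) * indicator {-A..A} t \<partial>lborel) < \<infinity>"
proof -
  have I: "((\<lambda>t. t powr (-r)) has_integral (A powr (-r + 1) / (-r + 1))) {0..A}"
    using assms by (intro has_integral_powr_from_0) auto
  have "(\<integral>\<^sup>+t. indicator {0..A} t * t powr (-r) \<partial>lborel) = ennreal (A powr (-r + 1) / (-r + 1))"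
    by (rule nn_integral_has_integral_lebesgue[OF _ I]) simp
  then have fin: "(\<integral>\<^sup>+t. indicator {0..A} t * t powr (-r) \<partial>lborel) < \<infinity>" by simp
  let ?f = "\<lambda>t::real. inverse (ennreal (\<bar>t\<bar> powr r)) * indicator {0..A} t"
  have "(\<integral>\<^sup>+t. ?f t \<partial>lborel) = (\<integral>\<^sup>+t. indicator {0..A} t * t powr (-r) \<partial>lborel)"
  proof (rule nn_integral_cong_AE)
    have "AE t in lborel. t \<noteq> (0::real)" by (rule AE_lborel_singleton)
    then show "AE t in lborel. ?f t = ennreal (indicator {0..A} t * t powr (-r))"
    proof eventually_elim
      case (elim t)
      then show ?case by (auto simp: indicator_def inverse_ennreal powr_minus)
    qed
  qed
  then have f: "(\<integral>\<^sup>+t. ?f t \<partial>lborel) < \<infinity>" using fin by simp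
  have refl: "(\<integral>\<^sup>+t. ?f t \<partial>lborel) = (\<integral>\<^sup>+t. ?f (0 + (-1) * t) \<partial>lborel)"
    using nn_integral_real_affine[of ?f "-1" 0] by simp
  have "(\<integral>\<^sup>+t. inverse (ennreal (\<bar>t\<bar> powr r)) * indicator {-A..A} t \<partial>lborel)
      \<le> (\<integral>\<^sup>+t. ?f t + ?f (0 + (-1) * t) \<partial>lborel)"
    by (intro nn_integral_mono) (auto simp: indicator_def)
  also have "\<dots> = (\<integral>\<^sup>+t. ?f t \<partial>lborel) + (\<integral>\<^sup>+t. ?f (0 + (-1) * t) \<partial>lborel)"
    by (rule nn_integral_add) auto
  also have "\<dots> < \<infinity>" unfolding refl[symmetric] using f by simp
  finally show ?thesis .
qed

text \<open>On each unit interval the weight is a translate of the power |t|^(-r) to the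
  half-integer inside, and only finitely many intervals meet the range.\<close>

lemma nn_integral_inverse_cdist_finite:
  assumes "0 < r" "r < (1::real)" "0 \<le> A"
  shows "(\<integral>\<^sup>+t. inverse (ennreal (cdist t powr r)) * indicator {-A..A} t \<partial>lborel) < \<infinity>"
proof -
  define K where "K = \<lceil>A\<rceil> + 1"
  define B where "B = A + of_int K + 1"
  have K: "A < of_int K" "K > 0" using assms(3) by (auto simp: K_def) linarith+
  then have B: "B \<ge> 0" using assms(3) by (simp add: B_def)
  let ?g = "\<lambda>t::real. inverse (ennreal (\<bar>t\<bar> powr r)) * indicator {-B..B} t"
  have g: "(\<integral>\<^sup>+t. ?g t \<partial>lborel) < \<infinity>" using nn_integral_inverse_powr_finite[OF assms(1,2) B] .
  have shift: "(\<integral>\<^sup>+t. ?g (- (of_int n + 1/2) + 1 * t) \<partial>lborel) = (\<integral>\<^sup>+t. ?g t \<partial>lborel)" for n :: int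
    using nn_integral_real_affine[of ?g 1 "- (of_int n + 1/2)"] by simp
  have "(\<integral>\<^sup>+t. inverse (ennreal (cdist t powr r)) * indicator {-A..A} t \<partial>lborel)
      \<le> (\<integral>\<^sup>+t. (\<Sum>n\<in>{-K..K}. ?g (- (of_int n + 1/2) + 1 * t)) \<partial>lborel)"
  proof (rule nn_integral_mono)
    fix t :: real
    show "inverse (ennreal (cdist t powr r)) * indicator {-A..A} t \<le> (\<Sum>n\<in>{-K..K}. ?g (- (of_int n + 1/2) + 1 * t))"
    proof (cases "t \<in> {-A..A}")
      case True
      let ?n = "\<lfloor>t\<rfloor>"
      have n: "?n \<in> {-K..K}" using True K by (auto simp: floor_le_iff le_floor_iff)
      have "\<bar>- (of_int ?n + 1/2) + 1 * t\<bar> = cdist t" by (simp add: cdist_def frac_def)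
      moreover have "- (of_int ?n + 1/2) + 1 * t \<in> {-B..B}"
        using True n K by (auto simp: B_def)
      ultimately have "inverse (ennreal (cdist t powr r)) * indicator {-A..A} t = ?g (- (of_int ?n + 1/2) + 1 * t)"
        using True by simp
      also have "\<dots> \<le> (\<Sum>n\<in>{-K..K}. ?g (- (of_int n + 1/2) + 1 * t))"
        using n by (intro member_le_sum) auto
      finally show ?thesis .
    qed simp
  qed
  also have "\<dots> = (\<Sum>n\<in>{-K..K}. \<integral>\<^sup>+t. ?g (- (of_int n + 1/2) + 1 * t) \<partial>lborel)"
    by (rule nn_integral_sum) auto
  also have "\<dots> = (\<Sum>n\<in>{-K..K}. \<integral>\<^sup>+t. ?g t \<partial>lborel)" unfolding shift ..
  also have "\<dots> < \<infinity>" using g by (simp add: ennreal_mult_less_top of_nat_less_top)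
  finally show ?thesis .
qed

lemma prod_ennreal_less_top:
  fixes f :: "'i \<Rightarrow> ennreal"
  shows "finite I \<Longrightarrow> (\<And>i. i \<in> I \<Longrightarrow> f i < \<infinity>) \<Longrightarrow> prod f I < \<infinity>"
  by (induction I rule: finite_induct) (auto simp: ennreal_mult_less_top)

lemma prod_mono_ennreal:
  fixes f g :: "'i \<Rightarrow> ennreal"
  shows "finite I \<Longrightarrow> (\<And>i. i \<in> I \<Longrightarrow> f i \<le> g i) \<Longrightarrow> prod f I \<le> prod g I"
  by (induction I rule: finite_induct) (auto intro: mult_mono)

lemma powr_times_nat: "0 < (x::real) \<Longrightarrow> x powr (a * real n) = (x powr a) ^ n"
  by (simp add: powr_powr[symmetric] powr_realpow)

text \<open>Splits a singularity of codimension \<open>card I\<close> into one-dimensional ones,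
  each carrying an equal share r of the exponent.\<close>

lemma prod_inverse_powr_ge:
  fixes c :: "'i \<Rightarrow> real" and r M :: real
  assumes "finite I" "I \<noteq> {}" "\<And>i. i \<in> I \<Longrightarrow> 0 \<le> c i" "\<And>i. i \<in> I \<Longrightarrow> c i \<le> M" "0 < r"
  shows "inverse (ennreal (M powr (r * card I))) \<le> (\<Prod>i\<in>I. inverse (ennreal (c i powr r)))"
proof (cases "\<exists>i\<in>I. c i = 0")
  case True
  \<comment> \<open>One factor is infinite and no other is 0, being the inverse of a finite number,
    so the product is infinite.\<close>
  then obtain i where i: "i \<in> I" "c i = 0" by blast
  have "(\<Prod>i\<in>I. inverse (ennreal (c i powr r))) = inverse (ennreal (c i powr r)) * (\<Prod>i\<in>I - {i}. inverse (ennreal (c i powr r)))"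
    using assms(1) i by (intro prod.remove) auto
  also have "inverse (ennreal (c i powr r)) = top" using i by simp
  also have "top * (\<Prod>i\<in>I - {i}. inverse (ennreal (c i powr r))) = top"
    using assms(1) by (simp add: ennreal_top_mult prod_zero_iff)
  finally show ?thesis by simp
next
  case False
  then have pos: "c i > 0" if "i \<in> I" for i using assms(3)[OF that] that by force
  have Mpos: "M > 0" using pos assms(2,4) by (metis all_not_in_conv less_le_trans)
  have "(\<Prod>i\<in>I. inverse (ennreal (c i powr r))) = (\<Prod>i\<in>I. ennreal (inverse (c i powr r)))"
  proof (rule prod.cong)
    show "inverse (ennreal (c i powr r)) = ennreal (inverse (c i powr r))" if "i \<in> I" for i
      using pos[OF that] by (intro inverse_ennreal) simp
  qed simp
  also have "\<dots> = ennreal (\<Prod>i\<in>I. inverse (c i powr r))"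
    by (rule prod_ennreal) auto
  finally have eq: "(\<Prod>i\<in>I. inverse (ennreal (c i powr r))) = ennreal (\<Prod>i\<in>I. inverse (c i powr r))" .
  have "inverse (M powr (r * card I)) = (\<Prod>i\<in>I. inverse (M powr r))"
    using Mpos by (simp add: powr_powr[symmetric] powr_realpow power_inverse)
  also have "\<dots> \<le> (\<Prod>i\<in>I. inverse (c i powr r))"
  proof (rule prod_mono, rule conjI)
    fix i assume i: "i \<in> I"
    have "c i powr r \<le> M powr r" using pos[OF i] assms(4)[OF i] assms(5) by (intro powr_mono2) auto
    then show "inverse (M powr r) \<le> inverse (c i powr r)" using pos[OF i] by (intro le_imp_inverse_le) auto
  qed simp
  finally show ?thesis
    unfolding eq using Mpos by (simp add: inverse_ennreal ennreal_leI)
qed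

lemma nn_integral_prod_coordinates:
  fixes g :: "'v::finite \<Rightarrow> real \<Rightarrow> ennreal"
  assumes [measurable]: "\<And>i. g i \<in> borel_measurable borel"
  shows "(\<integral>\<^sup>+x. (\<Prod>i\<in>UNIV. g i (x $ i)) \<partial>(lborel :: (real^'v) measure)) = (\<Prod>i\<in>UNIV. \<integral>\<^sup>+t. g i t \<partial>lborel)"
proof -
  have inj: "inj (\<lambda>i. axis i (1::real) :: real^'v)" by (auto simp: inj_on_def axis_eq_axis)
  have B: "(Basis :: (real^'v) set) = range (\<lambda>i. axis i 1)" by (auto simp: Basis_vec_def)
  define f where "f b = g (inv (\<lambda>i. axis i (1::real) :: real^'v) b)" for b :: "real^'v"
  have f: "f (axis i 1) = g i" for i using inv_f_f[OF inj] by (simp add: f_def)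
  have "(\<integral>\<^sup>+x. (\<Prod>b\<in>Basis. f b (x \<bullet> b)) \<partial>(lborel :: (real^'v) measure)) = (\<Prod>b\<in>Basis. \<integral>\<^sup>+t. f b t \<partial>lborel)"
    by (rule nn_integral_lborel_prod) (auto simp: f_def)
  then show ?thesis
    unfolding B prod.reindex[OF inj] by (simp add: f inner_axis)
qed

text \<open>The value on the dual skeleton is \<open>inverse 0 = \<infinity>\<close>, as it should be.\<close>

definition gapw :: "nat \<Rightarrow> real \<Rightarrow> real \<Rightarrow> real^'v \<Rightarrow> ennreal" where
  "gapw k h q x = inverse (ennreal (gap k ((1/h) *\<^sub>R x) powr q))"

lemma continuous_gap: "continuous_on UNIV (gap k :: real^'v \<Rightarrow> real)"
proof (rule lipschitz_on_continuous_on)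
  show "1-lipschitz_on UNIV (gap k :: real^'v \<Rightarrow> real)"
    using gap_lipschitz[of k] by (intro lipschitz_onI) (auto simp: dist_norm)
qed

lemma measurable_gap [measurable]: "(gap k :: real^'v \<Rightarrow> real) \<in> borel_measurable borel"
  by (rule borel_measurable_continuous_onI[OF continuous_gap])

lemma measurable_gapw [measurable]: "(gapw k h q :: real^'v \<Rightarrow> ennreal) \<in> borel_measurable borel"
  unfolding gapw_def by measurable

lemma measurable_cdist [measurable]: "cdist \<in> borel_measurable borel"
  unfolding cdist_def frac_def by measurable

text \<open>The weight of a minimum is at most the sum of the weights of its candidates. For one
  index set, the maximum of k + 1 distances to the power -q is at most the product of the distances
  to the power -r, where r = q / (k + 1) < 1, and each factor is integrable in its own
  variable.\<close>

theorem nn_integral_gapw_finite: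
  assumes q: "0 < q" "q < real (Suc k)" and h: "0 < h"
  shows "(\<integral>\<^sup>+x. gapw k h q x * indicator (cball 0 R) x \<partial>(lborel :: (real^'v) measure)) < \<infinity>"
proof -
  define r where "r = q / real (Suc k)"
  have r: "0 < r" "r < 1" "r * real (Suc k) = q" using q by (auto simp: r_def)
  define A where "A = \<bar>R\<bar> / h"
  have A: "A \<ge> 0" using h by (simp add: A_def)
  let ?w = "\<lambda>t. inverse (ennreal (cdist t powr r)) * indicator {-A..A} t"
  have w: "(\<integral>\<^sup>+t. ?w t \<partial>lborel) < \<infinity>" by (rule nn_integral_inverse_cdist_finite[OF r(1,2) A])
  let ?C = "(indicator {-A..A} :: real \<Rightarrow> ennreal)"
  define g where "g I i = (if i \<in> I then ?w else ?C)" for I :: "'v::finite set" and i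
  have [measurable]: "g I i \<in> borel_measurable borel" for I i by (simp add: g_def)
  have gfin: "(\<integral>\<^sup>+t. g I i t \<partial>lborel) < \<infinity>" for I i
    using w A by (auto simp: g_def ennreal_mult_less_top less_top[symmetric])
  let ?cube = "\<lambda>x :: real^'v. \<Prod>i\<in>UNIV. ?C (x $ i)"
  let ?\<I> = "{I :: 'v set. card I = Suc k}"
  have pointwise: "inverse (ennreal (gap k x powr q)) * ?cube x
      \<le> ennreal (2 powr q) * ?cube x + (\<Sum>I\<in>?\<I>. \<Prod>i\<in>UNIV. g I i (x $ i))" for x :: "real^'v"
  proof (cases rule: gap_cases[of k x])
    case 1
    have "inverse (ennreal (gap k x powr q)) = ennreal (2 powr q)"
      unfolding 1 by (simp add: inverse_ennreal powr_divide)
    then show ?thesis by (simp add: add_increasing2)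
  next
    case (2 I)
    then have I: "finite I" "I \<noteq> {}" by auto
    have "inverse (ennreal (gap k x powr (r * card I))) \<le> (\<Prod>i\<in>I. inverse (ennreal (cdist (x $ i) powr r)))"
      using I 2 r(1) by (intro prod_inverse_powr_ge) (auto simp: cdist_bounds)
    then have "inverse (ennreal (gap k x powr q)) * ?cube x \<le> (\<Prod>i\<in>I. inverse (ennreal (cdist (x $ i) powr r))) * ?cube x"
      using 2(1) r(3) by (intro mult_right_mono) auto
    also have "(\<Prod>i\<in>I. inverse (ennreal (cdist (x $ i) powr r))) = (\<Prod>i\<in>UNIV. if i \<in> I then inverse (ennreal (cdist (x $ i) powr r)) else 1)"
      by (simp add: prod.If_cases)
    also have "\<dots> * ?cube x = (\<Prod>i\<in>UNIV. g I i (x $ i))"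
      unfolding prod.distrib[symmetric] by (intro prod.cong) (auto simp: g_def)
    also have "\<dots> \<le> (\<Sum>I\<in>?\<I>. \<Prod>i\<in>UNIV. g I i (x $ i))"
      using 2(1) by (intro member_le_sum) auto
    finally show ?thesis by (simp add: add_increasing)
  qed
  have cube: "(\<integral>\<^sup>+x. ?cube x \<partial>lborel) < \<infinity>"
    using A by (subst nn_integral_prod_coordinates) (auto simp: ennreal_power)
  have prods: "(\<integral>\<^sup>+x. (\<Prod>i\<in>UNIV. g I i (x $ i)) \<partial>lborel) < \<infinity>" for I
    using gfin by (subst nn_integral_prod_coordinates) (auto intro!: prod_ennreal_less_top[unfolded infinity_ennreal_def])
  have "(\<integral>\<^sup>+x. inverse (ennreal (gap k x powr q)) * ?cube x \<partial>lborel)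
      \<le> (\<integral>\<^sup>+x. ennreal (2 powr q) * ?cube x + (\<Sum>I\<in>?\<I>. \<Prod>i\<in>UNIV. g I i (x $ i)) \<partial>lborel)"
    by (intro nn_integral_mono pointwise)
  also have "\<dots> = ennreal (2 powr q) * (\<integral>\<^sup>+x. ?cube x \<partial>lborel) + (\<Sum>I\<in>?\<I>. \<integral>\<^sup>+x. (\<Prod>i\<in>UNIV. g I i (x $ i)) \<partial>lborel)"
    by (subst nn_integral_add) (auto simp: nn_integral_cmult nn_integral_sum)
  also have "\<dots> < \<infinity>"
    using cube prods by (auto simp: ennreal_mult_less_top)
  finally have fin: "(\<integral>\<^sup>+x. inverse (ennreal (gap k x powr q)) * ?cube x \<partial>lborel) < \<infinity>" .
  have cube1: "?cube x = 1" if "h *\<^sub>R x \<in> cball 0 R" for x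
  proof -
    have "x $ i \<in> {-A..A}" for i
    proof -
      have "\<bar>x $ i\<bar> \<le> norm x" by (rule component_le_norm_cart)
      also have "\<dots> \<le> A" using that h by (simp add: A_def field_simps)
      finally show ?thesis by auto
    qed
    then show ?thesis by simp
  qed
  have "(\<integral>\<^sup>+x. gapw k h q x * indicator (cball 0 R) x \<partial>(lborel :: (real^'v) measure))
      = ennreal (\<bar>h\<bar> ^ DIM(real^'v)) * (\<integral>\<^sup>+x. gapw k h q (0 + h *\<^sub>R x) * indicator (cball 0 R) (0 + h *\<^sub>R x) \<partial>(lborel :: (real^'v) measure))"
  proof (rule nn_integral_lborel_affine[where f="\<lambda>x::real^'v. gapw k h q x * indicator (cball 0 R) x" and t=0 and c=h])
    show "(\<lambda>x::real^'v. gapw k h q x * indicator (cball 0 R) x) \<in> borel_measurable borel"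
      by (intro borel_measurable_times_ennreal measurable_gapw borel_measurable_indicator) simp
  qed (use h in simp)
  also have "\<dots> \<le> ennreal (\<bar>h\<bar> ^ DIM(real^'v)) * (\<integral>\<^sup>+x. inverse (ennreal (gap k x powr q)) * ?cube x \<partial>lborel)"
    using h cube1 by (intro mult_left_mono nn_integral_mono) (auto simp: gapw_def indicator_def simp del: mem_cball)
  also have "\<dots> < \<infinity>" using fin by (simp add: ennreal_mult_less_top)
  finally show ?thesis .
qed

text \<open>The integrand behaves like |z|^(q - m - \<sigma>) near 0 and like |z|^(-m - \<sigma>) at
  infinity. Instead of polar coordinates, each coordinate receives one m-th of the exponent: -r > -1
  near 0 and e < -1 at infinity.\<close>

theorem nn_integral_kernel_finite:
  assumes \<sigma>: "0 < \<sigma>" and q: "\<sigma> < q"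
  shows "(\<integral>\<^sup>+z. ennreal (min 1 (norm z) powr q / norm z powr (real CARD('m) + \<sigma>)) \<partial>(lborel :: (real^'m) measure)) < \<infinity>"
proof -
  define m where "m = real CARD('m)"
  have m: "m \<ge> 1" by (simp add: m_def Suc_leI)
  \<comment> \<open>Lowering the exponent only increases the kernel for |z| < 1, and it ensures a <
    m, so that the share -r is negative and monotone in the coordinate.\<close>
  define q' where "q' = min q (\<sigma> + m/2)"
  define a where "a = q' - \<sigma>"
  have a: "0 < a" "a < m" using q m by (auto simp: a_def q'_def)
  define r where "r = 1 - a / m"
  have r: "0 < r" "r < 1" using a m by (auto simp: r_def)
  define e where "e = -1 - \<sigma>/m"
  have e: "e < -1" using \<sigma> m by (simp add: e_def)
  \<comment> \<open>Small coordinates of a large z are covered by the first term too, since there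
    |z|^e \<le> 1 \<le> |t|^(-r).\<close>
  define g where "g t = inverse (ennreal (\<bar>t\<bar> powr r)) * indicator {-1..1} t + ennreal (\<bar>t\<bar> powr e) * (indicator {1..} t + indicator {1..} (-t))" for t :: real
  have [measurable]: "g \<in> borel_measurable borel" unfolding g_def by measurable
  have gfin: "(\<integral>\<^sup>+t. g t \<partial>lborel) < \<infinity>"
  proof -
    have I: "((\<lambda>t. t powr e) has_integral -(1 powr (e + 1)) / (e + 1)) {1..}"
      using e by (intro has_integral_powr_to_inf) auto
    have "(\<integral>\<^sup>+t. indicator {1..} t * t powr e \<partial>lborel) = ennreal (-(1 powr (e + 1)) / (e + 1))"
      by (rule nn_integral_has_integral_lebesgue[OF _ I]) simp
    moreover have "(\<integral>\<^sup>+t. ennreal (\<bar>t\<bar> powr e) * indicator {1..} t \<partial>lborel) = (\<integral>\<^sup>+t. indicator {1..} t * t powr e \<partial>lborel)"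
      by (intro nn_integral_cong) (auto simp: indicator_def)
    ultimately have f1: "(\<integral>\<^sup>+t. ennreal (\<bar>t\<bar> powr e) * indicator {1..} t \<partial>lborel) < \<infinity>" by simp
    have f2: "(\<integral>\<^sup>+t. ennreal (\<bar>t\<bar> powr e) * indicator {1..} (-t) \<partial>lborel) < \<infinity>"
      using f1 nn_integral_real_affine[of "\<lambda>t. ennreal (\<bar>t\<bar> powr e) * indicator {1..} t" "-1" 0] by simp
    have f0: "(\<integral>\<^sup>+t. inverse (ennreal (\<bar>t\<bar> powr r)) * indicator {-1..1} t \<partial>lborel) < \<infinity>"
      by (rule nn_integral_inverse_powr_finite[OF r]) simp
    have "(\<integral>\<^sup>+t. g t \<partial>lborel) = (\<integral>\<^sup>+t. inverse (ennreal (\<bar>t\<bar> powr r)) * indicator {-1..1} t \<partial>lborel) +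
        ((\<integral>\<^sup>+t. ennreal (\<bar>t\<bar> powr e) * indicator {1..} t \<partial>lborel) + (\<integral>\<^sup>+t. ennreal (\<bar>t\<bar> powr e) * indicator {1..} (-t) \<partial>lborel))"
      unfolding g_def distrib_left
      by (subst nn_integral_add, simp, simp, subst nn_integral_add) auto
    then show ?thesis using f0 f1 f2 by simp
  qed
  have pt: "ennreal (min 1 (norm z) powr q / norm z powr (m + \<sigma>)) \<le> (\<Prod>i\<in>UNIV. g (z $ i))" for z :: "real^'m"
  proof (cases "z = 0")
    case True
    then show ?thesis using \<sigma> m by simp
  next
    case False
    define R where "R = norm z"
    have R: "R > 0" using False by (simp add: R_def)
    have comp: "\<bar>z $ i\<bar> \<le> R" for i by (simp add: R_def component_le_norm_cart)
    have inv_ge: "ennreal (R' powr (-r)) \<le> inverse (ennreal (\<bar>t\<bar> powr r))" if "\<bar>t\<bar> \<le> R'" "R' > 0" for t R'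
    proof (cases "t = 0")
      case False
      then have "inverse (ennreal (\<bar>t\<bar> powr r)) = ennreal (\<bar>t\<bar> powr (-r))" by (simp add: inverse_ennreal powr_minus)
      moreover have "R' powr (-r) \<le> \<bar>t\<bar> powr (-r)" using that False r by (intro powr_mono2') auto
      ultimately show ?thesis by (simp add: ennreal_leI)
    qed simp
    show ?thesis
    proof (cases "R \<ge> 1")
      case True
      have "min 1 R powr q / R powr (m + \<sigma>) = R powr (- (m + \<sigma>))" using True by (simp only: powr_minus_divide) simp
      also have "- (m + \<sigma>) = e * real CARD('m)" using m by (simp add: e_def m_def[symmetric] field_simps)
      also have "R powr \<dots> = (\<Prod>i\<in>(UNIV :: 'm set). R powr e)" using powr_times_nat[OF R] by simp
      finally have "ennreal (min 1 R powr q / R powr (m + \<sigma>)) = ennreal (\<Prod>i\<in>(UNIV :: 'm set). R powr e)" by simp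
      also have "\<dots> = (\<Prod>i\<in>(UNIV :: 'm set). ennreal (R powr e))" by (rule prod_ennreal[symmetric]) simp
      also have "\<dots> \<le> (\<Prod>i\<in>UNIV. g (z $ i))"
      proof (rule prod_mono_ennreal)
        fix i
        have R1: "R powr e \<le> 1" using True e powr_mono[of e 0 R] by simp
        show "ennreal (R powr e) \<le> g (z $ i)"
        proof (cases "\<bar>z $ i\<bar> \<le> 1")
          case True
          have "ennreal (R powr e) \<le> ennreal (1 powr (-r))" using R1 by (simp add: ennreal_leI)
          also have "\<dots> \<le> inverse (ennreal (\<bar>z $ i\<bar> powr r))" using True by (intro inv_ge) auto
          also have "\<dots> \<le> g (z $ i)" using True by (simp add: g_def abs_le_iff minus_le_iff indicator_def)
          finally show ?thesis .
        next
          case False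
          have "R powr e \<le> \<bar>z $ i\<bar> powr e" using False comp[of i] e by (intro powr_mono2') auto
          then have "ennreal (R powr e) \<le> ennreal (\<bar>z $ i\<bar> powr e)" by (rule ennreal_leI)
          also have "\<dots> \<le> g (z $ i)" using False by (auto simp: g_def indicator_def abs_if split: if_splits)
          finally show ?thesis .
        qed
      qed simp_all
      finally show ?thesis by (simp add: R_def)
    next
      case False
      have "min 1 R powr q / R powr (m + \<sigma>) = R powr (q - (m + \<sigma>))"
        using False R by (simp add: powr_diff)
      also have "\<dots> \<le> R powr (q' - (m + \<sigma>))"
        using False R by (intro powr_mono') (auto simp: q'_def)
      also have "\<dots> = R powr ((-r) * m)"
      proof -
        have "q' - (m + \<sigma>) = (-r) * m" using m by (simp add: r_def a_def field_simps)
        then show ?thesis by simp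
      qed
      also have "\<dots> = (\<Prod>i\<in>(UNIV :: 'm set). R powr (-r))"
        using powr_times_nat[OF R, of "-r" "CARD('m)"] by (simp add: m_def)
      finally have "ennreal (min 1 R powr q / R powr (m + \<sigma>)) \<le> ennreal (\<Prod>i\<in>(UNIV :: 'm set). R powr (-r))" by (rule ennreal_leI)
      also have "\<dots> = (\<Prod>i\<in>(UNIV :: 'm set). ennreal (R powr (-r)))" by (rule prod_ennreal[symmetric]) simp
      also have "\<dots> \<le> (\<Prod>i\<in>UNIV. g (z $ i))"
      proof (rule prod_mono_ennreal)
        fix i
        have "ennreal (R powr (-r)) \<le> inverse (ennreal (\<bar>z $ i\<bar> powr r))" using comp R by (intro inv_ge) auto
        also have "\<dots> \<le> g (z $ i)" using comp[of i] False by (simp add: g_def abs_le_iff indicator_def)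
        finally show "ennreal (R powr (-r)) \<le> g (z $ i)" .
      qed simp_all
      finally show ?thesis by (simp add: R_def)
    qed
  qed
  have "(\<integral>\<^sup>+z. ennreal (min 1 (norm z) powr q / norm z powr (m + \<sigma>)) \<partial>(lborel :: (real^'m) measure))
      \<le> (\<integral>\<^sup>+z. (\<Prod>i\<in>UNIV. g (z $ i)) \<partial>(lborel :: (real^'m) measure))"
    by (intro nn_integral_mono pt)
  also have "\<dots> = (\<Prod>i\<in>(UNIV :: 'm set). \<integral>\<^sup>+t. g t \<partial>lborel)" by (rule nn_integral_prod_coordinates) simp
  also have "\<dots> < \<infinity>" using gfin by (intro prod_ennreal_less_top) auto
  finally show ?thesis by (simp add: m_def)
qed

section \<open>Averages and fractional energies\<close>

text \<open>Convexity of t^p as a tangent line inequality at A, obtained from Young's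
  inequality.\<close>

lemma powr_tangent:
  fixes p t A :: real
  assumes "p \<ge> 1" "t \<ge> 0" "A \<ge> 0"
  shows "p * t * A powr (p - 1) - (p - 1) * A powr p \<le> t powr p"
proof (cases "A = 0 \<or> t = 0")
  case True
  then show ?thesis using assms by (auto intro!: mult_nonneg_nonneg)
next
  case False
  then have A: "A > 0" "t > 0" using assms by simp_all
  have "(t powr p) powr (1/p) * (A powr p) powr (1 - 1/p) \<le> (1/p) * (t powr p) + (1 - 1/p) * (A powr p)"
    using assms A by (intro Youngs_inequality_0) auto
  also have "(t powr p) powr (1/p) = t" using assms by (simp add: powr_powr)
  also have "(A powr p) powr (1 - 1/p) = A powr (p - 1)"
    using assms by (simp add: powr_powr right_diff_distrib)
  finally have "p * (t * A powr (p - 1)) \<le> p * ((1/p) * (t powr p) + (1 - 1/p) * (A powr p))"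
    using assms by (intro mult_left_mono) auto
  also have "\<dots> = t powr p + (p - 1) * A powr p" using assms by (simp add: field_simps)
  finally show ?thesis by (simp add: algebra_simps)
qed

lemma add_powr_le:
  fixes a b p :: real
  assumes "a \<ge> 0" "b \<ge> 0" "p > 0"
  shows "(a + b) powr p \<le> 2 powr p * (a powr p + b powr p)"
proof -
  have "(a + b) powr p \<le> (2 * max a b) powr p" using assms by (intro powr_mono2) auto
  also have "\<dots> = 2 powr p * (max a b) powr p" by (rule powr_mult)
  also have "\<dots> \<le> 2 powr p * (a powr p + b powr p)" by (intro mult_left_mono) (auto simp: max_def)
  finally show ?thesis .
qed

text \<open>Jensen's inequality for the probability density \<phi>: the tangent inequality at the
  mean A of the norms is integrated.\<close>

lemma average_powr_le:
  fixes \<phi> :: "'a::euclidean_space \<Rightarrow> real" and g :: "'a \<Rightarrow> 'b::euclidean_space"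
  assumes [measurable]: "\<phi> \<in> borel_measurable borel" "g \<in> borel_measurable borel"
    and \<phi>: "\<And>x. 0 \<le> \<phi> x" "(\<integral>\<^sup>+x. ennreal (\<phi> x) \<partial>lborel) = 1"
    and B: "\<And>x. norm (g x) \<le> B" and p: "p \<ge> 1"
  shows "ennreal (norm (\<integral>z. \<phi> z *\<^sub>R g z \<partial>lborel) powr p) \<le> (\<integral>\<^sup>+z. ennreal (\<phi> z * norm (g z) powr p) \<partial>lborel)"
proof -
  note int\<phi> = nn_integral_1_imp_integral[OF assms(1) \<phi>]
  have i1: "integrable lborel (\<lambda>z. \<phi> z * norm (g z))"
    using integral_average_bound(1)[OF assms(1) _ \<phi>, of "\<lambda>z. norm (g z)" B] B by simp
  have Bp: "norm (norm (g z) powr p) \<le> B powr p" for z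
    using B[of z] p by (auto intro: powr_mono2)
  have i2: "integrable lborel (\<lambda>z. \<phi> z * norm (g z) powr p)"
    using integral_average_bound(1)[OF assms(1) _ \<phi>, of "\<lambda>z. norm (g z) powr p" "B powr p"] Bp by simp
  define A where "A = (\<integral>z. \<phi> z * norm (g z) \<partial>lborel)"
  have A0: "A \<ge> 0" unfolding A_def using \<phi>(1) by (intro Bochner_Integration.integral_nonneg) auto
  have "norm (\<integral>z. \<phi> z *\<^sub>R g z \<partial>lborel) \<le> (\<integral>z. norm (\<phi> z *\<^sub>R g z) \<partial>lborel)" by (rule integral_norm_bound)
  also have "\<dots> = A" unfolding A_def using \<phi>(1) by simp
  finally have "norm (\<integral>z. \<phi> z *\<^sub>R g z \<partial>lborel) powr p \<le> A powr p" using p by (intro powr_mono2) auto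
  also have "A powr p = p * A * A powr (p - 1) - (p - 1) * A powr p"
  proof (cases "A = 0")
    case False
    then have "A * A powr (p - 1) = A powr p" using A0 by (simp add: powr_mult_base)
    then show ?thesis by (simp add: algebra_simps)
  qed (use p in simp)
  also have "\<dots> = (\<integral>z. p * A powr (p - 1) * (\<phi> z * norm (g z)) - (p - 1) * A powr p * \<phi> z \<partial>lborel)"
    using i1 int\<phi> by (subst Bochner_Integration.integral_diff) (auto simp: A_def[symmetric])
  also have "\<dots> \<le> (\<integral>z. \<phi> z * norm (g z) powr p \<partial>lborel)"
  proof (rule integral_mono)
    fix z
    have "\<phi> z * (p * norm (g z) * A powr (p - 1) - (p - 1) * A powr p) \<le> \<phi> z * norm (g z) powr p"
      using powr_tangent[OF p _ A0, of "norm (g z)"] \<phi>(1) by (intro mult_left_mono) auto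
    then show "p * A powr (p - 1) * (\<phi> z * norm (g z)) - (p - 1) * A powr p * \<phi> z \<le> \<phi> z * norm (g z) powr p"
      by (simp add: algebra_simps)
  qed (use i1 i2 int\<phi> in auto)
  finally have "ennreal (norm (\<integral>z. \<phi> z *\<^sub>R g z \<partial>lborel) powr p) \<le> ennreal (\<integral>z. \<phi> z * norm (g z) powr p \<partial>lborel)"
    by (rule ennreal_leI)
  also have "\<dots> = (\<integral>\<^sup>+z. ennreal (\<phi> z * norm (g z) powr p) \<partial>lborel)"
    using i2 \<phi>(1) by (intro nn_integral_eq_integral[symmetric]) auto
  finally show ?thesis .
qed

text \<open>The contraction by \<open>1 - \<epsilon>\<close> keeps the argument in the cube, so no extension of \<open>u\<close> across the
  boundary is needed.\<close>

definition avg :: "(real^'m \<Rightarrow> real) \<Rightarrow> real \<Rightarrow> (real^'m \<Rightarrow> real^'v) \<Rightarrow> real^'m \<Rightarrow> real^'v" where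
  "avg \<phi> \<epsilon> u x = (\<integral>z. \<phi> z *\<^sub>R u ((1 - \<epsilon>) *\<^sub>R x + \<epsilon> *\<^sub>R z) \<partial>lborel)"

lemma mollifierD:
  assumes "mollifier \<phi> A"
  shows "\<phi> \<in> borel_measurable borel" "0 \<le> \<phi> x" "norm x \<ge> 1 \<Longrightarrow> \<phi> x = 0" "(\<integral>\<^sup>+x. ennreal (\<phi> x) \<partial>lborel) = 1"
    "A > 0" "\<bar>\<phi> x - \<phi> y\<bar> \<le> A * norm (x - y)" "\<phi> x \<le> A"
  using assms unfolding mollifier_def
  by (auto intro: borel_measurable_continuous_onI smooth_on_open_continuous)

lemma avg_diff_const:
  assumes \<phi>: "mollifier \<phi> A" and [measurable]: "u \<in> borel_measurable borel" and b: "\<And>x. norm (u x) \<le> b"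
  shows "avg \<phi> \<epsilon> u x - c = (\<integral>z. \<phi> z *\<^sub>R (u ((1 - \<epsilon>) *\<^sub>R x + \<epsilon> *\<^sub>R z) - c) \<partial>lborel)"
proof -
  note m = mollifierD[OF \<phi>]
  note [measurable] = m(1)
  note i1 = nn_integral_1_imp_integral[OF m(1,2,4)]
  have int: "integrable lborel (\<lambda>z. \<phi> z *\<^sub>R u ((1 - \<epsilon>) *\<^sub>R x + \<epsilon> *\<^sub>R z))"
    by (rule integral_average_bound(1)[where B=b]) (use m b in auto)
  have "avg \<phi> \<epsilon> u x - c = avg \<phi> \<epsilon> u x - (\<integral>z. \<phi> z *\<^sub>R c \<partial>lborel)" using i1 by simp
  also have "\<dots> = (\<integral>z. \<phi> z *\<^sub>R u ((1 - \<epsilon>) *\<^sub>R x + \<epsilon> *\<^sub>R z) - \<phi> z *\<^sub>R c \<partial>lborel)"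
    unfolding avg_def using int i1 by (intro Bochner_Integration.integral_diff[symmetric]) auto
  finally show ?thesis by (simp add: scaleR_diff_right)
qed

lemma avg_diff:
  assumes \<phi>: "mollifier \<phi> A" and [measurable]: "u \<in> borel_measurable borel" and b: "\<And>x. norm (u x) \<le> b"
  shows "avg \<phi> \<epsilon> u x - avg \<phi> \<epsilon> u y =
    (\<integral>z. \<phi> z *\<^sub>R (u ((1 - \<epsilon>) *\<^sub>R x + \<epsilon> *\<^sub>R z) - u ((1 - \<epsilon>) *\<^sub>R y + \<epsilon> *\<^sub>R z)) \<partial>lborel)"
proof -
  note m = mollifierD[OF \<phi>]
  note [measurable] = m(1)
  have int: "integrable lborel (\<lambda>z. \<phi> z *\<^sub>R u ((1 - \<epsilon>) *\<^sub>R x + \<epsilon> *\<^sub>R z))" for x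
    by (rule integral_average_bound(1)[where B=b]) (use m b in auto)
  have "avg \<phi> \<epsilon> u x - avg \<phi> \<epsilon> u y = (\<integral>z. \<phi> z *\<^sub>R u ((1 - \<epsilon>) *\<^sub>R x + \<epsilon> *\<^sub>R z) - \<phi> z *\<^sub>R u ((1 - \<epsilon>) *\<^sub>R y + \<epsilon> *\<^sub>R z) \<partial>lborel)"
    unfolding avg_def by (rule Bochner_Integration.integral_diff[symmetric]) (rule int)+
  then show ?thesis by (simp add: scaleR_diff_right)
qed

lemma avg_bound:
  assumes \<phi>: "mollifier \<phi> A" and [measurable]: "u \<in> borel_measurable borel" and b: "\<And>x. norm (u x) \<le> b"
  shows "norm (avg \<phi> \<epsilon> u x) \<le> b"
  unfolding avg_def
  by (rule integral_average_bound(2)) (use mollifierD[OF \<phi>] b in auto)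

text \<open>A change of variable moves the increment from u, which is only measurable, to the
  Lipschitz kernel. The difference of the kernels is supported in two unit balls, whence the volume
  V and the factor 2.\<close>

lemma avg_lipschitz:
  fixes u :: "real^'m \<Rightarrow> real^'v"
  assumes \<phi>: "mollifier \<phi> A" and [measurable]: "u \<in> borel_measurable borel" and b: "\<And>x. norm (u x) \<le> b"
  shows "\<exists>C>0. \<forall>\<epsilon> x y. 0 < \<epsilon> \<longrightarrow> \<epsilon> \<le> 1 \<longrightarrow> norm (avg \<phi> \<epsilon> u x - avg \<phi> \<epsilon> u y) \<le> C / \<epsilon> * norm (x - y)"
proof -
  note m = mollifierD[OF \<phi>]
  note [measurable] = m(1)
  have b0: "b \<ge> 0" using b[of 0] norm_ge_zero order_trans by blast
  define V where "V = measure lborel (ball (0 :: real^'m) 1)"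
  define C where "C = 2 * A * b * V + 1"
  have V: "V \<ge> 0" by (simp add: V_def)
  have C: "C > 0" "C \<ge> 2 * A * b * V" using m(5) b0 V by (auto simp: C_def intro!: add_nonneg_pos)
  have main: "norm (avg \<phi> \<epsilon> u x - avg \<phi> \<epsilon> u y) \<le> C / \<epsilon> * norm (x - y)" if \<epsilon>: "0 < \<epsilon>" "\<epsilon> \<le> 1" for \<epsilon> x y
  proof -
    \<comment> \<open>Chosen so that \<epsilon> a = (1 - \<epsilon>) (x - y): shifting z by a turns
      the argument belonging to y into the one belonging to x.\<close>
    define a where "a = ((1 - \<epsilon>) / \<epsilon>) *\<^sub>R (x - y)"
    let ?u = "\<lambda>z. u ((1 - \<epsilon>) *\<^sub>R x + \<epsilon> *\<^sub>R z)"
    have arg: "(1 - \<epsilon>) *\<^sub>R y + \<epsilon> *\<^sub>R (a + 1 *\<^sub>R z) = (1 - \<epsilon>) *\<^sub>R x + \<epsilon> *\<^sub>R z" for z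
    proof -
      have "\<epsilon> *\<^sub>R a = (1 - \<epsilon>) *\<^sub>R (x - y)" using \<epsilon>(1) by (simp add: a_def)
      then show ?thesis by (simp add: scaleR_add_right) (simp add: algebra_simps)
    qed
    have "avg \<phi> \<epsilon> u y = (\<bar>1\<bar> ^ DIM(real^'m)) *\<^sub>R (\<integral>z. \<phi> (a + 1 *\<^sub>R z) *\<^sub>R u ((1 - \<epsilon>) *\<^sub>R y + \<epsilon> *\<^sub>R (a + 1 *\<^sub>R z)) \<partial>lborel)"
      unfolding avg_def by (rule integral_lborel_affine[where t=a and c=1]) auto
    then have y: "avg \<phi> \<epsilon> u y = (\<integral>z. \<phi> (a + z) *\<^sub>R ?u z \<partial>lborel)" unfolding arg by simp
    have ix: "integrable lborel (\<lambda>z. \<phi> z *\<^sub>R ?u z)"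
      by (rule integral_average_bound(1)[where B=b]) (use m b in auto)
    have iy: "integrable lborel (\<lambda>z. \<phi> (a + z) *\<^sub>R ?u z)"
    proof (rule integral_average_bound(1)[where B=b])
      show "(\<integral>\<^sup>+z. ennreal (\<phi> (a + z)) \<partial>lborel) = 1"
        using nn_integral_lborel_affine[of "\<lambda>z. ennreal (\<phi> z)" 1 a] m by simp
    qed (use m b in auto)
    define g where "g z = A * norm a * b * (indicator (ball 0 1) z + indicator (ball (-a) 1) z)" for z :: "real^'m"
    have Vc: "measure lborel (ball c 1) = V" for c :: "real^'m"
      by (simp add: V_def content_ball)
    have iball: "integrable lborel (indicator (ball c 1) :: real^'m \<Rightarrow> real)" for c
      using emeasure_lborel_ball_finite[of c 1] by (intro integrable_real_indicator) auto
    have ig: "integrable lborel g"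
      unfolding g_def by (intro integrable_mult_right Bochner_Integration.integrable_add iball)
    have "avg \<phi> \<epsilon> u x - avg \<phi> \<epsilon> u y = (\<integral>z. \<phi> z *\<^sub>R ?u z - \<phi> (a + z) *\<^sub>R ?u z \<partial>lborel)"
      unfolding y unfolding avg_def by (rule Bochner_Integration.integral_diff[symmetric, OF ix iy])
    also have "norm \<dots> \<le> (\<integral>z. g z \<partial>lborel)"
    proof (rule order_trans[OF integral_norm_bound integral_mono])
      show "integrable lborel (\<lambda>z. norm (\<phi> z *\<^sub>R ?u z - \<phi> (a + z) *\<^sub>R ?u z))" using ix iy by simp
      fix z
      have "norm (\<phi> z *\<^sub>R ?u z - \<phi> (a + z) *\<^sub>R ?u z) = \<bar>\<phi> z - \<phi> (a + z)\<bar> * norm (?u z)"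
        by (simp add: scaleR_diff_left[symmetric])
      also have "\<dots> \<le> g z"
      proof (cases "z \<in> ball 0 1 \<or> z \<in> ball (-a) 1")
        case True
        have "\<bar>\<phi> z - \<phi> (a + z)\<bar> * norm (?u z) \<le> (A * norm a) * b"
          using m(6)[of z "a + z"] b m(5) by (intro mult_mono) auto
        also have "\<dots> = A * norm a * b * 1" by simp
        also have "\<dots> \<le> g z"
          unfolding g_def using True m(5) b0 by (intro mult_left_mono) (auto simp: indicator_def)
        finally show ?thesis .
      next
        case False
        then have "\<phi> z = 0" "\<phi> (a + z) = 0"
          using m(3)[of z] m(3)[of "a + z"] by (auto simp: dist_norm norm_minus_commute add.commute)
        then show ?thesis using m(5) b0 by (simp add: g_def)
      qed
      finally show "norm (\<phi> z *\<^sub>R ?u z - \<phi> (a + z) *\<^sub>R ?u z) \<le> g z" .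
    qed (rule ig)
    also have "(\<integral>z. g z \<partial>lborel) = A * norm a * b * (V + V)"
    proof -
      have "(\<integral>z. indicator (ball 0 1) z + indicator (ball (-a) 1) z \<partial>(lborel :: (real^'m) measure)) = V + V"
        using Bochner_Integration.integral_add[OF iball[of 0] iball[of "-a"]] by (simp add: Vc)
      then show ?thesis unfolding g_def by simp
    qed
    also have "\<dots> = (2 * A * b * V) * norm a" by (simp add: algebra_simps)
    also have "\<dots> \<le> C * (norm (x - y) / \<epsilon>)"
    proof (rule mult_mono)
      have "norm a = (1 - \<epsilon>) * (norm (x - y) / \<epsilon>)" using \<epsilon> by (simp add: a_def)
      also have "\<dots> \<le> 1 * (norm (x - y) / \<epsilon>)" using \<epsilon> by (intro mult_right_mono) auto
      finally show "norm a \<le> norm (x - y) / \<epsilon>" by simp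
    qed (use C in auto)
    finally show ?thesis by (simp add: mult.commute)
  qed
  then show ?thesis using C(1) by blast
qed

lemma continuous_avg:
  fixes u :: "real^'m \<Rightarrow> real^'v"
  assumes "mollifier \<phi> A" "u \<in> borel_measurable borel" "\<And>x. norm (u x) \<le> b" "0 < \<epsilon>" "\<epsilon> \<le> 1"
  shows "continuous_on UNIV (avg \<phi> \<epsilon> u)"
proof -
  obtain C where C: "C > 0" "\<And>\<epsilon> x y. 0 < \<epsilon> \<Longrightarrow> \<epsilon> \<le> 1 \<Longrightarrow> norm (avg \<phi> \<epsilon> u x - avg \<phi> \<epsilon> u y) \<le> C / \<epsilon> * norm (x - y)"
    using avg_lipschitz[OF assms(1-3)] by blast
  have "(C/\<epsilon>)-lipschitz_on UNIV (avg \<phi> \<epsilon> u)"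
    using C assms by (intro lipschitz_onI) (auto simp: dist_norm)
  then show ?thesis by (rule lipschitz_on_continuous_on)
qed

definition ed :: "real \<Rightarrow> real \<Rightarrow> (real^'m \<Rightarrow> real^'v) \<Rightarrow> real^'m \<Rightarrow> real^'m \<Rightarrow> ennreal" where
  "ed p \<alpha> u x y = ennreal (norm (u x - u y) powr p / norm (x - y) powr \<alpha>) * indicator open_cube x * indicator open_cube y"

text \<open>For \<alpha> = m + s p this is the p-th power of the Gagliardo seminorm. The cube enters
  through indicators in \<open>ed\<close>, so that Tonelli's theorem and affine changes of variable
  on \<open>lborel\<close> apply directly.\<close>

definition energy :: "real \<Rightarrow> real \<Rightarrow> (real^'m \<Rightarrow> real^'v) \<Rightarrow> ennreal" where
  "energy p \<alpha> u = (\<integral>\<^sup>+x. \<integral>\<^sup>+y. ed p \<alpha> u x y \<partial>lborel \<partial>lborel)"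

definition near_energy :: "real \<Rightarrow> real \<Rightarrow> (real^'m \<Rightarrow> real^'v) \<Rightarrow> real \<Rightarrow> ennreal" where
  "near_energy p \<alpha> u c = (\<integral>\<^sup>+x. \<integral>\<^sup>+y. ed p \<alpha> u x y * indicator {..c} (norm (x - y)) \<partial>lborel \<partial>lborel)"

definition lpint :: "real \<Rightarrow> (real^'m \<Rightarrow> real^'v) \<Rightarrow> ennreal" where
  "lpint p u = (\<integral>\<^sup>+x. ennreal (norm (u x) powr p) * indicator open_cube x \<partial>lborel)"

lemma open_cube_eq_box: "(open_cube :: (real^'m) set) = box (- 1) 1"
  by (auto simp: open_cube_def mem_box_cart)

lemma sets_open_cube [measurable]: "open_cube \<in> sets borel"
  by (simp add: open_cube_eq_box)

lemma open_cube_convex_comb: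
  "x \<in> open_cube \<Longrightarrow> z \<in> open_cube \<Longrightarrow> 0 \<le> \<epsilon> \<Longrightarrow> \<epsilon> \<le> 1 \<Longrightarrow> (1 - \<epsilon>) *\<^sub>R x + \<epsilon> *\<^sub>R z \<in> open_cube"
  unfolding open_cube_eq_box by (intro convexD[OF convex_box(2)]) auto

lemma norm_open_cube_le:
  fixes x :: "real^'m"
  assumes "x \<in> open_cube"
  shows "norm x \<le> real CARD('m)"
proof -
  have "norm x \<le> (\<Sum>i\<in>UNIV. \<bar>x $ i\<bar>)" by (rule norm_le_l1_cart)
  also have "\<dots> \<le> (\<Sum>i\<in>(UNIV :: 'm set). 1)"
    using assms by (intro sum_mono) (auto simp: mem_open_cube_iff less_imp_le)
  finally show ?thesis by simp
qed

lemma ball_subset_open_cube: "norm (z :: real^'m) < 1 \<Longrightarrow> z \<in> open_cube"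
  using component_le_norm_cart[of z] by (auto simp: mem_open_cube_iff intro: le_less_trans)

lemma measurable_ed [measurable]:
  assumes [measurable]: "u \<in> borel_measurable borel"
  shows "(\<lambda>(x, y). ed p \<alpha> u x y) \<in> borel_measurable (borel \<Otimes>\<^sub>M borel)"
  unfolding ed_def case_prod_beta by measurable

lemma measurable_ed2:
  assumes [measurable]: "u \<in> borel_measurable borel" "f \<in> borel_measurable M" "g \<in> borel_measurable M"
  shows "(\<lambda>x. ed p \<alpha> u (f x) (g x)) \<in> borel_measurable M"
  unfolding ed_def by measurable

lemma nn_integral_lborel_affine':
  fixes f :: "'a::euclidean_space \<Rightarrow> ennreal"
  assumes [measurable]: "f \<in> borel_measurable borel" and c: "c > 0"
  shows "(\<integral>\<^sup>+x. f (t + c *\<^sub>R x) \<partial>lborel) = ennreal ((1/c) ^ DIM('a)) * (\<integral>\<^sup>+x. f x \<partial>lborel)"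
proof -
  have "ennreal ((1/c) ^ DIM('a)) * (\<integral>\<^sup>+x. f x \<partial>lborel)
      = ennreal ((1/c) ^ DIM('a)) * (ennreal (\<bar>c\<bar> ^ DIM('a)) * (\<integral>\<^sup>+x. f (t + c *\<^sub>R x) \<partial>lborel))"
    using nn_integral_lborel_affine[OF assms(1), of c t] c by simp
  also have "\<dots> = ennreal ((1/c) ^ DIM('a) * \<bar>c\<bar> ^ DIM('a)) * (\<integral>\<^sup>+x. f (t + c *\<^sub>R x) \<partial>lborel)"
    using c by (simp add: ennreal_mult mult.assoc)
  also have "(1/c) ^ DIM('a) * \<bar>c\<bar> ^ DIM('a) = 1"
    using c by (simp add: power_mult_distrib[symmetric])
  finally show ?thesis by simp
qed

text \<open>The average at x only sees points y of the cube with |x - y| \<le> c0 \<epsilon>, so |x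
  - y|^\<alpha> can be inserted at the price of (c0 \<epsilon>)^\<alpha>. The change of variable
  costs \<epsilon>^(-m), leaving \<epsilon>^\<sigma> when \<alpha> = m + \<sigma>. The constant c0 =
  2 m covers |x| \<le> m plus |z| < 1.\<close>

lemma lpint_avg_diff_le:
  fixes u :: "real^'m \<Rightarrow> real^'v"
  assumes \<phi>: "mollifier \<phi> A" and [measurable]: "u \<in> borel_measurable borel" and b: "\<And>x. norm (u x) \<le> b"
    and p: "p \<ge> 1" and \<epsilon>: "0 < \<epsilon>" "\<epsilon> \<le> 1" and \<alpha>: "\<alpha> \<ge> 0"
  defines "c0 \<equiv> 2 * real CARD('m)"
  shows "lpint p (\<lambda>x. avg \<phi> \<epsilon> u x - u x) \<le> ennreal (A * c0 powr \<alpha> * \<epsilon> powr (\<alpha> - real CARD('m))) * near_energy p \<alpha> u (c0 * \<epsilon>)"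
proof -
  note m = mollifierD[OF \<phi>]
  note [measurable] = m(1)
  let ?m = "CARD('m)"
  have c0: "c0 > 0" by (simp add: c0_def)
  have pw: "ennreal (norm (avg \<phi> \<epsilon> u x - u x) powr p) \<le>
      ennreal ((1/\<epsilon>) ^ ?m * (A * (c0 * \<epsilon>) powr \<alpha>)) * (\<integral>\<^sup>+y. ed p \<alpha> u x y * indicator {..c0 * \<epsilon>} (norm (x - y)) \<partial>lborel)"
    if x: "x \<in> open_cube" for x
  proof -
    define F where "F y = ennreal (A * norm (u y - u x) powr p) * indicator open_cube y * indicator {..c0 * \<epsilon>} (norm (x - y))" for y
    have [measurable]: "F \<in> borel_measurable borel" unfolding F_def by measurable
    let ?t = "(1 - \<epsilon>) *\<^sub>R x"
    have "ennreal (norm (avg \<phi> \<epsilon> u x - u x) powr p) \<le> (\<integral>\<^sup>+z. ennreal (\<phi> z * norm (u (?t + \<epsilon> *\<^sub>R z) - u x) powr p) \<partial>lborel)"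
      unfolding avg_diff_const[OF \<phi> assms(2) b]
    proof (rule average_powr_le[where B="b + b"])
      show "norm (u (?t + \<epsilon> *\<^sub>R z) - u x) \<le> b + b" for z
        using norm_triangle_ineq4[of "u (?t + \<epsilon> *\<^sub>R z)" "u x"] b[of "?t + \<epsilon> *\<^sub>R z"] b[of x] by linarith
    qed (use m p in auto)
    also have "\<dots> \<le> (\<integral>\<^sup>+z. F (?t + \<epsilon> *\<^sub>R z) \<partial>lborel)"
    proof (rule nn_integral_mono)
      fix z
      show "ennreal (\<phi> z * norm (u (?t + \<epsilon> *\<^sub>R z) - u x) powr p) \<le> F (?t + \<epsilon> *\<^sub>R z)"
      proof (cases "\<phi> z = 0")
        case False
        then have z: "norm z < 1" using m(3)[of z] by linarith
        have Q: "?t + \<epsilon> *\<^sub>R z \<in> open_cube"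
          using open_cube_convex_comb[OF x ball_subset_open_cube[OF z]] \<epsilon> by simp
        have "x - (?t + \<epsilon> *\<^sub>R z) = \<epsilon> *\<^sub>R (x - z)" by (simp add: algebra_simps)
        then have "norm (x - (?t + \<epsilon> *\<^sub>R z)) = \<epsilon> * norm (x - z)" using \<epsilon> by simp
        also have "norm (x - z) \<le> c0"
        proof -
          have "norm (x - z) \<le> norm x + norm z" by (rule norm_triangle_ineq4)
          also have "\<dots> \<le> real ?m + 1" using norm_open_cube_le[OF x] z by simp
          also have "\<dots> \<le> c0" by (simp add: c0_def Suc_leI)
          finally show ?thesis .
        qed
        finally have "norm (x - (?t + \<epsilon> *\<^sub>R z)) \<le> c0 * \<epsilon>" using \<epsilon> by (simp add: mult.commute)
        moreover have "\<phi> z * norm (u (?t + \<epsilon> *\<^sub>R z) - u x) powr p \<le> A * norm (u (?t + \<epsilon> *\<^sub>R z) - u x) powr p"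
          using m(7) by (intro mult_right_mono) auto
        ultimately show ?thesis using Q by (simp add: F_def ennreal_leI)
      qed simp
    qed
    also have "\<dots> = ennreal ((1/\<epsilon>) ^ DIM(real^'m)) * (\<integral>\<^sup>+y. F y \<partial>lborel)"
      using \<epsilon> by (intro nn_integral_lborel_affine') auto
    also have "(\<integral>\<^sup>+y. F y \<partial>lborel) \<le> (\<integral>\<^sup>+y. ennreal (A * (c0 * \<epsilon>) powr \<alpha>) * (ed p \<alpha> u x y * indicator {..c0 * \<epsilon>} (norm (x - y))) \<partial>lborel)"
    proof (rule nn_integral_mono)
      fix y
      show "F y \<le> ennreal (A * (c0 * \<epsilon>) powr \<alpha>) * (ed p \<alpha> u x y * indicator {..c0 * \<epsilon>} (norm (x - y)))"
      proof (cases "y \<in> open_cube \<and> norm (x - y) \<le> c0 * \<epsilon> \<and> y \<noteq> x")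
        case True
        let ?N = "norm (u x - u y) powr p" and ?d = "norm (x - y) powr \<alpha>"
        have d: "?d > 0" using True by auto
        have "A * ?N = A * ?d * (?N / ?d)" using d by simp
        also have "\<dots> \<le> A * (c0 * \<epsilon>) powr \<alpha> * (?N / ?d)"
          using True m(5) \<alpha> by (intro mult_right_mono mult_left_mono powr_mono2) auto
        finally have "ennreal (A * ?N) \<le> ennreal (A * (c0 * \<epsilon>) powr \<alpha>) * ennreal (?N / ?d)"
          using m(5) by (subst ennreal_mult[symmetric]) (auto intro: ennreal_leI)
        then show ?thesis using True x by (simp add: F_def ed_def norm_minus_commute)
      next
        case False
        then have "F y = 0" using p by (auto simp: F_def indicator_def)
        then show ?thesis by simp
      qed
    qed
    also have "\<dots> = ennreal (A * (c0 * \<epsilon>) powr \<alpha>) * (\<integral>\<^sup>+y. ed p \<alpha> u x y * indicator {..c0 * \<epsilon>} (norm (x - y)) \<partial>lborel)"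
      by (intro nn_integral_cmult borel_measurable_times_ennreal measurable_ed2) auto
    finally show ?thesis
      using m(5) \<epsilon> by (simp add: ennreal_mult mult_left_mono mult.assoc)
  qed
  have "lpint p (\<lambda>x. avg \<phi> \<epsilon> u x - u x) \<le> (\<integral>\<^sup>+x. ennreal ((1/\<epsilon>) ^ ?m * (A * (c0 * \<epsilon>) powr \<alpha>)) *
      (\<integral>\<^sup>+y. ed p \<alpha> u x y * indicator {..c0 * \<epsilon>} (norm (x - y)) \<partial>lborel) \<partial>lborel)"
    unfolding lpint_def using pw by (intro nn_integral_mono) (auto simp: indicator_def)
  also have "\<dots> = ennreal ((1/\<epsilon>) ^ ?m * (A * (c0 * \<epsilon>) powr \<alpha>)) * near_energy p \<alpha> u (c0 * \<epsilon>)"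
    unfolding near_energy_def
    by (intro nn_integral_cmult lborel.borel_measurable_nn_integral) (auto simp: case_prod_beta intro!: borel_measurable_times_ennreal measurable_ed2)
  also have "(1/\<epsilon>) ^ ?m * (A * (c0 * \<epsilon>) powr \<alpha>) = A * c0 powr \<alpha> * \<epsilon> powr (\<alpha> - real ?m)"
    using \<epsilon> c0 by (simp add: powr_mult powr_diff powr_realpow power_one_over field_simps)
  finally show ?thesis .
qed

text \<open>The energy does not charge the diagonal. This makes the rate of the averages a small o
  of \<epsilon>^\<sigma> and not merely a large O.\<close>

lemma near_energy_tendsto_0:
  fixes u :: "real^'m \<Rightarrow> real^'v"
  assumes [measurable]: "u \<in> borel_measurable borel" and fin: "energy p \<alpha> u < \<infinity>" and p: "p > 0"
    and c: "c \<longlonglongrightarrow> 0"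
  shows "(\<lambda>j. near_energy p \<alpha> u (c j)) \<longlonglongrightarrow> 0"
proof -
  let ?M = "lborel \<Otimes>\<^sub>M lborel :: ((real^'m) \<times> (real^'m)) measure"
  let ?f = "\<lambda>j z. ed p \<alpha> u (fst z) (snd z) * indicator {..c j} (norm (fst z - snd z))"
  have meas: "(\<lambda>z. ed p \<alpha> u (fst z) (snd z)) \<in> borel_measurable ?M"
    by (intro measurable_ed2) auto
  have measf: "?f j \<in> borel_measurable ?M" for j
    by (intro borel_measurable_times_ennreal meas) measurable
  have "(\<lambda>j. \<integral>\<^sup>+z. ?f j z \<partial>?M) \<longlonglongrightarrow> (\<integral>\<^sup>+z. 0 \<partial>?M)"
  proof (rule nn_integral_dominated_convergence[where w="\<lambda>z. ed p \<alpha> u (fst z) (snd z)"])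
    show "AE z in ?M. ?f j z \<le> ed p \<alpha> u (fst z) (snd z)" for j
      by (intro AE_I2) (auto simp: indicator_def)
    show "(\<integral>\<^sup>+z. ed p \<alpha> u (fst z) (snd z) \<partial>?M) < \<infinity>"
      using fin lborel.nn_integral_fst[OF meas] by (simp add: energy_def)
    show "AE z in ?M. (\<lambda>j. ?f j z) \<longlonglongrightarrow> 0"
    proof (rule AE_I2)
      fix z :: "(real^'m) \<times> (real^'m)"
      show "(\<lambda>j. ?f j z) \<longlonglongrightarrow> 0"
      proof (cases "fst z = snd z")
        case True
        then show ?thesis using p by (simp add: ed_def)
      next
        case False
        then have "norm (fst z - snd z) > 0" by simp
        then have "\<forall>\<^sub>F j in sequentially. c j < norm (fst z - snd z)"
          using c by (simp add: order_tendstoD)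
        then have "\<forall>\<^sub>F j in sequentially. ?f j z = 0"
          by eventually_elim auto
        then show ?thesis by (rule tendsto_eventually)
      qed
    qed
  qed (use meas measf in auto)
  moreover have "(\<integral>\<^sup>+z. ?f j z \<partial>?M) = near_energy p \<alpha> u (c j)" for j
    using lborel.nn_integral_fst[OF measf[of j]] by (simp add: near_energy_def)
  ultimately show ?thesis by simp
qed

text \<open>Jensen's inequality under the double integral, then the same contraction in both
  variables: the kernel contributes (1 - \<epsilon>)^\<alpha> and the two Jacobians (1 -
  \<epsilon>)^(-2 m). What matters is that the factor tends to 1, so no energy is gained in the
  limit.\<close>

lemma energy_avg_le:
  fixes u :: "real^'m \<Rightarrow> real^'v"
  assumes \<phi>: "mollifier \<phi> A" and [measurable]: "u \<in> borel_measurable borel" and b: "\<And>x. norm (u x) \<le> b"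
    and p: "p \<ge> 1" and \<epsilon>: "0 < \<epsilon>" "\<epsilon> < 1"
  shows "energy p \<alpha> (avg \<phi> \<epsilon> u) \<le> ennreal ((1 - \<epsilon>) powr (\<alpha> - 2 * real CARD('m))) * energy p \<alpha> u"
proof -
  note m = mollifierD[OF \<phi>]
  note [measurable] = m(1)
  let ?m = "CARD('m)"
  define c where "c = 1 - \<epsilon>"
  have c: "c > 0" using \<epsilon> by (simp add: c_def)
  define h where "h x y z = ennreal (\<phi> z) * (ennreal (c powr \<alpha>) * ed p \<alpha> u (\<epsilon> *\<^sub>R z + c *\<^sub>R x) (\<epsilon> *\<^sub>R z + c *\<^sub>R y))" for x y z
  have pw: "ed p \<alpha> (avg \<phi> \<epsilon> u) x y \<le> (\<integral>\<^sup>+z. h x y z \<partial>lborel)" for x y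
  proof (cases "x \<in> open_cube \<and> y \<in> open_cube")
    case True
    let ?\<Delta> = "\<lambda>z. u ((1 - \<epsilon>) *\<^sub>R x + \<epsilon> *\<^sub>R z) - u ((1 - \<epsilon>) *\<^sub>R y + \<epsilon> *\<^sub>R z)"
    let ?d = "norm (x - y) powr \<alpha>"
    have "ed p \<alpha> (avg \<phi> \<epsilon> u) x y = ennreal (1 / ?d) * ennreal (norm (avg \<phi> \<epsilon> u x - avg \<phi> \<epsilon> u y) powr p)"
      using True by (simp add: ed_def ennreal_mult[symmetric])
    also have "\<dots> \<le> ennreal (1 / ?d) * (\<integral>\<^sup>+z. ennreal (\<phi> z * norm (?\<Delta> z) powr p) \<partial>lborel)"
    proof (rule mult_left_mono)
      show "ennreal (norm (avg \<phi> \<epsilon> u x - avg \<phi> \<epsilon> u y) powr p) \<le> (\<integral>\<^sup>+z. ennreal (\<phi> z * norm (?\<Delta> z) powr p) \<partial>lborel)"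
        unfolding avg_diff[OF \<phi> assms(2) b]
      proof (rule average_powr_le[where B="b + b"])
        show "norm (?\<Delta> z) \<le> b + b" for z
          by (rule order_trans[OF norm_triangle_ineq4 add_mono[OF b b]])
      qed (use m p in auto)
    qed simp
    also have "\<dots> = (\<integral>\<^sup>+z. ennreal (1 / ?d) * ennreal (\<phi> z * norm (?\<Delta> z) powr p) \<partial>lborel)"
      by (rule nn_integral_cmult[symmetric]) measurable
    also have "\<dots> \<le> (\<integral>\<^sup>+z. h x y z \<partial>lborel)"
    proof (rule nn_integral_mono)
      fix z
      show "ennreal (1 / ?d) * ennreal (\<phi> z * norm (?\<Delta> z) powr p) \<le> h x y z"
      proof (cases "\<phi> z = 0")
        case False
        then have z: "z \<in> open_cube" using m(3)[of z] by (intro ball_subset_open_cube) linarith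
        have Q: "\<epsilon> *\<^sub>R z + c *\<^sub>R x \<in> open_cube" "\<epsilon> *\<^sub>R z + c *\<^sub>R y \<in> open_cube"
          using open_cube_convex_comb[OF _ z, of _ \<epsilon>] True \<epsilon> by (auto simp: c_def add.commute)
        have "(\<epsilon> *\<^sub>R z + c *\<^sub>R x) - (\<epsilon> *\<^sub>R z + c *\<^sub>R y) = c *\<^sub>R (x - y)" by (simp add: algebra_simps)
        then have dd: "norm ((\<epsilon> *\<^sub>R z + c *\<^sub>R x) - (\<epsilon> *\<^sub>R z + c *\<^sub>R y)) powr \<alpha> = c powr \<alpha> * ?d"
          using c by (simp add: powr_mult)
        have \<Delta>: "norm (u (\<epsilon> *\<^sub>R z + c *\<^sub>R x) - u (\<epsilon> *\<^sub>R z + c *\<^sub>R y)) = norm (?\<Delta> z)"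
          by (simp add: c_def add.commute)
        let ?X = "norm (?\<Delta> z) powr p / (c powr \<alpha> * ?d)"
        have e1: "ennreal (c powr \<alpha> * ?X) = ennreal (c powr \<alpha>) * ennreal ?X" by (rule ennreal_mult) auto
        have e2: "ennreal (\<phi> z * (c powr \<alpha> * ?X)) = ennreal (\<phi> z) * ennreal (c powr \<alpha> * ?X)"
          using m(2) by (intro ennreal_mult) auto
        have "h x y z = ennreal (\<phi> z) * (ennreal (c powr \<alpha>) * ennreal ?X)"
          unfolding h_def ed_def dd \<Delta> using Q by (simp only: indicator_simps mult_1_right)
        also have "\<dots> = ennreal (\<phi> z * (c powr \<alpha> * ?X))" by (simp only: e1 e2)
        also have "\<phi> z * (c powr \<alpha> * (norm (?\<Delta> z) powr p / (c powr \<alpha> * ?d))) = 1 / ?d * (\<phi> z * norm (?\<Delta> z) powr p)"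
          using c by simp
        finally have "h x y z = ennreal (1 / ?d * (\<phi> z * norm (?\<Delta> z) powr p))" .
        moreover have "ennreal (1 / ?d) * ennreal (\<phi> z * norm (?\<Delta> z) powr p) = ennreal (1 / ?d * (\<phi> z * norm (?\<Delta> z) powr p))"
          using m(2) by (intro ennreal_mult[symmetric]) auto
        ultimately show ?thesis by (simp only: order_refl)
      qed simp
    qed
    finally show ?thesis .
  next
    case False
    then show ?thesis by (auto simp: ed_def)
  qed
  have hm: "(\<lambda>w. h (f w) (g w) (k w)) \<in> borel_measurable M"
    if [measurable]: "f \<in> borel_measurable M" "g \<in> borel_measurable M" "k \<in> borel_measurable M" for f g k and M :: "'z measure"
    unfolding h_def by (intro borel_measurable_times_ennreal measurable_ed2) measurable
  have "energy p \<alpha> (avg \<phi> \<epsilon> u) \<le> (\<integral>\<^sup>+x. \<integral>\<^sup>+y. \<integral>\<^sup>+z. h x y z \<partial>lborel \<partial>lborel \<partial>lborel)"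
    unfolding energy_def by (intro nn_integral_mono pw)
  also have "\<dots> = (\<integral>\<^sup>+x. \<integral>\<^sup>+z. \<integral>\<^sup>+y. h x y z \<partial>lborel \<partial>lborel \<partial>lborel)"
  proof (rule nn_integral_cong)
    fix x
    show "(\<integral>\<^sup>+y. \<integral>\<^sup>+z. h x y z \<partial>lborel \<partial>lborel) = (\<integral>\<^sup>+z. \<integral>\<^sup>+y. h x y z \<partial>lborel \<partial>lborel)"
      by (rule lborel_pair.Fubini'[of "\<lambda>z y. h x y z"]) (unfold case_prod_beta, intro hm, measurable)
  qed
  also have "\<dots> = (\<integral>\<^sup>+z. \<integral>\<^sup>+x. \<integral>\<^sup>+y. h x y z \<partial>lborel \<partial>lborel \<partial>lborel)"
    by (rule lborel_pair.Fubini'[of "\<lambda>z x. \<integral>\<^sup>+y. h x y z \<partial>lborel"])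
      (unfold case_prod_beta, rule lborel.borel_measurable_nn_integral, unfold case_prod_beta, intro hm, measurable)
  also have "\<dots> = (\<integral>\<^sup>+z. ennreal (\<phi> z) * (ennreal (c powr \<alpha>) * (ennreal ((1/c) ^ ?m) * (ennreal ((1/c) ^ ?m) * energy p \<alpha> u))) \<partial>lborel)"
  proof (rule nn_integral_cong)
    fix z
    have "(\<integral>\<^sup>+x. \<integral>\<^sup>+y. h x y z \<partial>lborel \<partial>lborel)
        = ennreal (\<phi> z) * (ennreal (c powr \<alpha>) * (\<integral>\<^sup>+x. \<integral>\<^sup>+y. ed p \<alpha> u (\<epsilon> *\<^sub>R z + c *\<^sub>R x) (\<epsilon> *\<^sub>R z + c *\<^sub>R y) \<partial>lborel \<partial>lborel))"
    proof -
      have m1: "(\<lambda>y. ed p \<alpha> u X (\<epsilon> *\<^sub>R z + c *\<^sub>R y)) \<in> borel_measurable lborel" for X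
        by (intro measurable_ed2) auto
      have "(\<lambda>x. \<integral>\<^sup>+y. ed p \<alpha> u (\<epsilon> *\<^sub>R z + c *\<^sub>R x) (\<epsilon> *\<^sub>R z + c *\<^sub>R y) \<partial>lborel) \<in> borel_measurable lborel"
        by (rule lborel.borel_measurable_nn_integral, unfold case_prod_beta, intro measurable_ed2) measurable
      then show ?thesis
        unfolding h_def using m1 by (simp add: nn_integral_cmult)
    qed
    also have "(\<integral>\<^sup>+x. \<integral>\<^sup>+y. ed p \<alpha> u (\<epsilon> *\<^sub>R z + c *\<^sub>R x) (\<epsilon> *\<^sub>R z + c *\<^sub>R y) \<partial>lborel \<partial>lborel)
        = (\<integral>\<^sup>+x. ennreal ((1/c) ^ ?m) * (\<integral>\<^sup>+y. ed p \<alpha> u (\<epsilon> *\<^sub>R z + c *\<^sub>R x) y \<partial>lborel) \<partial>lborel)"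
    proof (rule nn_integral_cong)
      fix x
      show "(\<integral>\<^sup>+y. ed p \<alpha> u (\<epsilon> *\<^sub>R z + c *\<^sub>R x) (\<epsilon> *\<^sub>R z + c *\<^sub>R y) \<partial>lborel)
          = ennreal ((1/c) ^ ?m) * (\<integral>\<^sup>+y. ed p \<alpha> u (\<epsilon> *\<^sub>R z + c *\<^sub>R x) y \<partial>lborel)"
        using nn_integral_lborel_affine'[of "\<lambda>y. ed p \<alpha> u (\<epsilon> *\<^sub>R z + c *\<^sub>R x) y" c "\<epsilon> *\<^sub>R z"] c
        by (simp add: measurable_ed2)
    qed
    also have "\<dots> = ennreal ((1/c) ^ ?m) * (\<integral>\<^sup>+x. (\<integral>\<^sup>+y. ed p \<alpha> u (\<epsilon> *\<^sub>R z + c *\<^sub>R x) y \<partial>lborel) \<partial>lborel)"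
      by (intro nn_integral_cmult lborel.borel_measurable_nn_integral) (auto simp: case_prod_beta intro!: measurable_ed2)
    also have "(\<integral>\<^sup>+x. (\<integral>\<^sup>+y. ed p \<alpha> u (\<epsilon> *\<^sub>R z + c *\<^sub>R x) y \<partial>lborel) \<partial>lborel) = ennreal ((1/c) ^ ?m) * energy p \<alpha> u"
    proof -
      have "(\<lambda>x. \<integral>\<^sup>+y. ed p \<alpha> u x y \<partial>lborel) \<in> borel_measurable borel"
        by (intro lborel.borel_measurable_nn_integral) (auto simp: case_prod_beta intro!: measurable_ed2)
      from nn_integral_lborel_affine'[OF this c, of "\<epsilon> *\<^sub>R z"] show ?thesis
        by (simp add: energy_def)
    qed
    finally show "(\<integral>\<^sup>+x. \<integral>\<^sup>+y. h x y z \<partial>lborel \<partial>lborel)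
        = ennreal (\<phi> z) * (ennreal (c powr \<alpha>) * (ennreal ((1/c) ^ ?m) * (ennreal ((1/c) ^ ?m) * energy p \<alpha> u)))" .
  qed
  also have "\<dots> = ennreal (c powr \<alpha>) * (ennreal ((1/c) ^ ?m) * (ennreal ((1/c) ^ ?m) * energy p \<alpha> u))"
    using m(4) by (simp add: nn_integral_multc)
  also have "\<dots> = ennreal (c powr \<alpha> * ((1/c) ^ ?m * (1/c) ^ ?m)) * energy p \<alpha> u"
    using c by (simp add: ennreal_mult mult.assoc)
  also have "c powr \<alpha> * ((1/c) ^ ?m * (1/c) ^ ?m) = c powr (\<alpha> - 2 * real ?m)"
  proof -
    have "c powr (\<alpha> - 2 * real ?m) = c powr \<alpha> / (c powr real ?m * c powr real ?m)"
      using c by (simp add: powr_diff powr_add[symmetric])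
    then show ?thesis using c by (simp add: powr_realpow power_one_over)
  qed
  finally show ?thesis by (simp add: c_def)
qed

lemma avg_rate:
  fixes u :: "real^'m \<Rightarrow> real^'v"
  assumes \<phi>: "mollifier \<phi> A" and u[measurable]: "u \<in> borel_measurable borel" and b: "\<And>x. norm (u x) \<le> b"
    and p: "p \<ge> 1" and \<alpha>: "\<alpha> = real CARD('m) + \<sigma>" "\<sigma> \<ge> 0" and fin: "energy p \<alpha> u < \<infinity>"
    and \<epsilon>: "\<And>j. 0 < \<epsilon> j" "\<And>j. \<epsilon> j \<le> 1" "\<epsilon> \<longlonglongrightarrow> 0"
  shows "(\<lambda>j. ennreal (\<epsilon> j powr (-\<sigma>)) * lpint p (\<lambda>x. avg \<phi> (\<epsilon> j) u x - u x)) \<longlonglongrightarrow> 0"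
proof -
  define c0 where "c0 = 2 * real CARD('m)"
  have A: "A > 0" using mollifierD[OF \<phi>] by simp
  have \<alpha>0: "\<alpha> \<ge> 0" using \<alpha> by simp
  have le: "ennreal (\<epsilon> j powr (-\<sigma>)) * lpint p (\<lambda>x. avg \<phi> (\<epsilon> j) u x - u x) \<le> ennreal (A * c0 powr \<alpha>) * near_energy p \<alpha> u (c0 * \<epsilon> j)" for j
  proof -
    have "ennreal (\<epsilon> j powr (-\<sigma>)) * lpint p (\<lambda>x. avg \<phi> (\<epsilon> j) u x - u x)
        \<le> ennreal (\<epsilon> j powr (-\<sigma>)) * (ennreal (A * c0 powr \<alpha> * \<epsilon> j powr (\<alpha> - real CARD('m))) * near_energy p \<alpha> u (c0 * \<epsilon> j))"
      using lpint_avg_diff_le[OF \<phi> u b p \<epsilon>(1,2) \<alpha>0] by (intro mult_left_mono) (auto simp: c0_def)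
    also have "\<dots> = ennreal (\<epsilon> j powr (-\<sigma>) * (A * c0 powr \<alpha> * \<epsilon> j powr (\<alpha> - real CARD('m)))) * near_energy p \<alpha> u (c0 * \<epsilon> j)"
      using A by (subst ennreal_mult) (auto simp: mult.assoc)
    also have "\<epsilon> j powr (-\<sigma>) * (A * c0 powr \<alpha> * \<epsilon> j powr (\<alpha> - real CARD('m))) = A * c0 powr \<alpha>"
      using \<epsilon>(1)[of j] \<alpha> by (simp add: powr_minus field_simps)
    finally show ?thesis .
  qed
  have "(\<lambda>j. near_energy p \<alpha> u (c0 * \<epsilon> j)) \<longlonglongrightarrow> 0"
    using p tendsto_mult[OF tendsto_const[of c0] \<epsilon>(3)] by (intro near_energy_tendsto_0 u fin) auto
  then have "(\<lambda>j. ennreal (A * c0 powr \<alpha>) * near_energy p \<alpha> u (c0 * \<epsilon> j)) \<longlonglongrightarrow> ennreal (A * c0 powr \<alpha>) * 0"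
    by (intro ennreal_tendsto_cmult) auto
  then have lim: "(\<lambda>j. ennreal (A * c0 powr \<alpha>) * near_energy p \<alpha> u (c0 * \<epsilon> j)) \<longlonglongrightarrow> 0" by simp
  show ?thesis
  proof (rule tendsto_sandwich[OF _ _ tendsto_const lim])
    show "\<forall>\<^sub>F j in sequentially. 0 \<le> ennreal (\<epsilon> j powr (-\<sigma>)) * lpint p (\<lambda>x. avg \<phi> (\<epsilon> j) u x - u x)"
      by simp
    show "\<forall>\<^sub>F j in sequentially. ennreal (\<epsilon> j powr (-\<sigma>)) * lpint p (\<lambda>x. avg \<phi> (\<epsilon> j) u x - u x)
        \<le> ennreal (A * c0 powr \<alpha>) * near_energy p \<alpha> u (c0 * \<epsilon> j)"
      using le by (intro always_eventually allI)
  qed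
qed

text \<open>The rate is made summable, so that the averages converge almost everywhere along the
  whole sequence without passing to a subsequence.\<close>

lemma avg_good_sequence:
  fixes u :: "real^'m \<Rightarrow> real^'v"
  assumes \<phi>: "mollifier \<phi> A" and u[measurable]: "u \<in> borel_measurable borel" and b: "\<And>x. norm (u x) \<le> b"
    and p: "p \<ge> 1" and \<alpha>: "\<alpha> = real CARD('m) + \<sigma>" "\<sigma> \<ge> 0" and fin: "energy p \<alpha> u < \<infinity>"
  shows "\<exists>e :: nat \<Rightarrow> real. (\<forall>j. 0 < e j \<and> e j \<le> 1 / real (j + 2) \<and>
    ennreal (e j powr (-\<sigma>)) * lpint p (\<lambda>x. avg \<phi> (e j) u x - u x) \<le> ennreal ((1/2) ^ j))"
proof (rule choice, rule allI)
  fix j :: nat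
  define \<epsilon> where "\<epsilon> i = 1 / real (i + j + 2)" for i
  have "(\<lambda>i. 1 / real (i + (j + 2))) \<longlonglongrightarrow> 0"
    by (rule LIMSEQ_ignore_initial_segment[OF lim_1_over_n])
  then have lim: "\<epsilon> \<longlonglongrightarrow> 0" by (simp add: \<epsilon>_def[abs_def] add.assoc)
  have \<epsilon>: "0 < \<epsilon> i" "\<epsilon> i \<le> 1" "\<epsilon> i \<le> 1 / real (j + 2)" for i
    by (auto simp: \<epsilon>_def intro!: divide_left_mono)
  have "(\<lambda>i. ennreal (\<epsilon> i powr (-\<sigma>)) * lpint p (\<lambda>x. avg \<phi> (\<epsilon> i) u x - u x)) \<longlonglongrightarrow> 0"
    by (rule avg_rate[OF \<phi> u b p \<alpha> fin \<epsilon>(1,2) lim])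
  then have "\<forall>\<^sub>F i in sequentially. ennreal (\<epsilon> i powr (-\<sigma>)) * lpint p (\<lambda>x. avg \<phi> (\<epsilon> i) u x - u x) < ennreal ((1/2) ^ j)"
    by (rule order_tendstoD) simp
  then obtain i where "ennreal (\<epsilon> i powr (-\<sigma>)) * lpint p (\<lambda>x. avg \<phi> (\<epsilon> i) u x - u x) < ennreal ((1/2) ^ j)"
    by (auto simp: eventually_sequentially)
  then show "\<exists>e. 0 < e \<and> e \<le> 1 / real (j + 2) \<and>
    ennreal (e powr (-\<sigma>)) * lpint p (\<lambda>x. avg \<phi> e u x - u x) \<le> ennreal ((1/2) ^ j)"
    using \<epsilon>[of i] by (intro exI[of _ "\<epsilon> i"]) auto
qed

text \<open>The sum of the p-th powers has finite integral, hence is finite almost everywhere, and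
  the terms of a convergent series tend to 0.\<close>

lemma AE_tendsto_if_lpint_summable:
  fixes u :: "real^'m \<Rightarrow> real^'v"
  assumes [measurable]: "\<And>j. v j \<in> borel_measurable borel" "u \<in> borel_measurable borel" and p: "p \<ge> 1"
    and le: "\<And>j. lpint p (\<lambda>x. v j x - u x) \<le> ennreal ((1/2) ^ j)"
  shows "AE x in lborel. x \<in> open_cube \<longrightarrow> (\<lambda>j. v j x) \<longlonglongrightarrow> u x"
proof -
  let ?f = "\<lambda>j x. ennreal (norm (v j x - u x) powr p) * indicator open_cube x"
  have "(\<integral>\<^sup>+x. (\<Sum>j. ?f j x) \<partial>lborel) = (\<Sum>j. \<integral>\<^sup>+x. ?f j x \<partial>lborel)"
    by (rule nn_integral_suminf) measurable
  also have "\<dots> \<le> (\<Sum>j. ennreal ((1/2) ^ j))"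
    using le by (intro suminf_le) (auto simp: lpint_def)
  also have "\<dots> = ennreal (\<Sum>j. (1/2) ^ j)"
    by (intro suminf_ennreal2) (auto intro: summable_geometric)
  finally have "(\<integral>\<^sup>+x. (\<Sum>j. ?f j x) \<partial>lborel) \<noteq> \<infinity>" by (auto simp: top_unique)
  then have "AE x in lborel. (\<Sum>j. ?f j x) \<noteq> \<infinity>"
    by (intro nn_integral_noteq_infinite) auto
  then show ?thesis
  proof eventually_elim
    case (elim x)
    show ?case
    proof
      assume x: "x \<in> open_cube"
      then have "(\<Sum>j. ennreal (norm (v j x - u x) powr p)) \<noteq> \<infinity>" using elim by simp
      then have "summable (\<lambda>j. norm (v j x - u x) powr p)"
        by (intro summable_suminf_not_top) auto
      then have "(\<lambda>j. norm (v j x - u x) powr p) \<longlonglongrightarrow> 0" by (rule summable_LIMSEQ_zero)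
      then have "(\<lambda>j. (norm (v j x - u x) powr p) powr (1/p)) \<longlonglongrightarrow> 0"
        by (rule tendsto_zero_powrI[where g="\<lambda>j. 1/p" and b="1/p"]) (use p in auto)
      then have "(\<lambda>j. norm (v j x - u x)) \<longlonglongrightarrow> 0" using p by (simp add: powr_powr)
      then show "(\<lambda>j. v j x) \<longlonglongrightarrow> u x" by (simp add: tendsto_norm_zero_iff LIM_zero_iff)
    qed
  qed
qed

section \<open>Convergence of energies under composition with a Lipschitz map\<close>

lemma AE_lborel_pairI:
  fixes Q :: "'a::euclidean_space \<Rightarrow> bool"
  assumes "AE x in lborel. Q x"
  shows "AE z in lborel \<Otimes>\<^sub>M lborel. Q (fst z) \<and> Q (snd z)"
proof -
  obtain N where N: "{x. \<not> Q x} \<subseteq> N" "N \<in> sets borel" "emeasure lborel N = 0"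
    using AE_E[OF assms] by auto
  have "N \<times> UNIV \<in> null_sets (lborel \<Otimes>\<^sub>M (lborel :: 'a measure))" "UNIV \<times> N \<in> null_sets ((lborel :: 'a measure) \<Otimes>\<^sub>M lborel)"
    using N by (auto simp: null_sets_def lborel.emeasure_pair_measure_Times)
  then have "N \<times> UNIV \<union> UNIV \<times> N \<in> null_sets (lborel \<Otimes>\<^sub>M (lborel :: 'a measure))" by (rule null_sets.Un)
  moreover have "{z \<in> space (lborel \<Otimes>\<^sub>M (lborel :: 'a measure)). \<not> (Q (fst z) \<and> Q (snd z))} \<subseteq> N \<times> UNIV \<union> UNIV \<times> N"
    using N(1) by force
  ultimately show ?thesis by (rule AE_I')
qed

text \<open>The real-valued form of \<open>ed\<close>, on pairs; Fatou's lemma will be applied to a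
  difference of densities, which needs genuine subtraction.\<close>

definition edr :: "real \<Rightarrow> real \<Rightarrow> (real^'m \<Rightarrow> real^'v) \<Rightarrow> (real^'m) \<times> (real^'m) \<Rightarrow> real" where
  "edr p \<alpha> u z = norm (u (fst z) - u (snd z)) powr p / norm (fst z - snd z) powr \<alpha> * indicator open_cube (fst z) * indicator open_cube (snd z)"

lemma ed_eq_edr: "ed p \<alpha> u (fst z) (snd z) = ennreal (edr p \<alpha> u z)"
  by (simp add: ed_def edr_def indicator_def)

lemma edr_nonneg: "0 \<le> edr p \<alpha> u z"
  by (simp add: edr_def)

lemma measurable_edr [measurable]:
  assumes [measurable]: "u \<in> borel_measurable borel"
  shows "edr p \<alpha> u \<in> borel_measurable (lborel \<Otimes>\<^sub>M lborel)"
  unfolding edr_def by measurable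

lemma energy_eq_edr:
  assumes [measurable]: "u \<in> borel_measurable borel"
  shows "energy p \<alpha> u = (\<integral>\<^sup>+z. ennreal (edr p \<alpha> u z) \<partial>(lborel \<Otimes>\<^sub>M lborel))"
proof -
  have "(\<lambda>z. ed p \<alpha> u (fst z) (snd z)) \<in> borel_measurable (lborel \<Otimes>\<^sub>M lborel)"
    by (intro measurable_ed2) auto
  from lborel.nn_integral_fst[OF this] show ?thesis
    by (simp add: energy_def ed_eq_edr)
qed

lemma edr_tendsto:
  assumes "(\<lambda>i. v i (fst z)) \<longlonglongrightarrow> a" "(\<lambda>i. v i (snd z)) \<longlonglongrightarrow> c" "p > 0"
  shows "(\<lambda>i. edr p \<alpha> (v i) z) \<longlonglongrightarrow> norm (a - c) powr p / norm (fst z - snd z) powr \<alpha> * indicator open_cube (fst z) * indicator open_cube (snd z)"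
proof -
  have "(\<lambda>i. norm (v i (fst z) - v i (snd z)) powr p) \<longlonglongrightarrow> norm (a - c) powr p"
    using assms by (intro tendsto_powr' tendsto_intros) auto
  then show ?thesis
    unfolding edr_def divide_inverse by (intro tendsto_mult tendsto_const)
qed

text \<open>Generalised dominated convergence: apply Fatou's lemma to the difference between the
  dominating functions and the energy densities.\<close>

lemma energy_compose_small:
  fixes u :: "real^'m \<Rightarrow> real^'v" and P :: "real^'v \<Rightarrow> real^'v"
  assumes [measurable]: "u \<in> borel_measurable borel" "\<And>i. v i \<in> borel_measurable borel" "P \<in> borel_measurable borel"
    and P: "\<And>x y. norm (P x - P y) \<le> C * norm (x - y)" "\<And>x. P (u x) = u x" and C: "C > 0" and p: "p \<ge> 1"
    and ae: "AE x in lborel. x \<in> open_cube \<longrightarrow> (\<lambda>i. v i x) \<longlonglongrightarrow> u x"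
    and e0: "energy p \<alpha> u = ennreal e0" "e0 \<ge> 0"
    and le: "\<And>i. energy p \<alpha> (v i) \<le> ennreal (c i) * energy p \<alpha> u" "\<And>i. c i \<ge> 0" "c \<longlonglongrightarrow> 1"
    and \<xi>: "\<xi> \<longlonglongrightarrow> 0" and \<eta>: "\<eta> > 0"
  shows "\<exists>i. energy p \<alpha> (\<lambda>x. P (v i x - \<xi> i) - u x) < ennreal \<eta>"
proof (rule ccontr)
  assume "\<not> ?thesis"
  then have big: "ennreal \<eta> \<le> energy p \<alpha> (\<lambda>x. P (v i x - \<xi> i) - u x)" for i by (auto simp: not_less)
  let ?M = "lborel \<Otimes>\<^sub>M lborel :: ((real^'m) \<times> (real^'m)) measure"
  define w where "w i x = P (v i x - \<xi> i) - u x" for i x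
  have [measurable]: "w i \<in> borel_measurable borel" for i unfolding w_def by measurable
  \<comment> \<open>Dominates the density of w by those of v and u: C^p comes from P, the 1 from u,
    and 2^p from splitting the p-th power of a sum.\<close>
  define K where "K = 2 powr p * (C powr p + 1)"
  have K: "K > 0" by (simp add: K_def add_nonneg_pos)
  define rh where "rh i z = K * (edr p \<alpha> (v i) z + edr p \<alpha> u z)" for i z
  have fh: "edr p \<alpha> (w i) z \<le> rh i z" for i z
  proof -
    let ?x = "fst z" and ?y = "snd z"
    have "norm (w i ?x - w i ?y) \<le> norm (P (v i ?x - \<xi> i) - P (v i ?y - \<xi> i)) + norm (u ?x - u ?y)"
      using norm_triangle_ineq4[of "P (v i ?x - \<xi> i) - P (v i ?y - \<xi> i)" "u ?x - u ?y"]
      by (simp add: w_def algebra_simps)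
    also have "\<dots> \<le> C * norm (v i ?x - v i ?y) + norm (u ?x - u ?y)"
      using P(1)[of "v i ?x - \<xi> i" "v i ?y - \<xi> i"] by simp
    finally have "norm (w i ?x - w i ?y) powr p \<le> (C * norm (v i ?x - v i ?y) + norm (u ?x - u ?y)) powr p"
      using p by (intro powr_mono2) auto
    also have "\<dots> \<le> 2 powr p * ((C * norm (v i ?x - v i ?y)) powr p + norm (u ?x - u ?y) powr p)"
      using C p by (intro add_powr_le) auto
    also have "\<dots> = 2 powr p * (C powr p * norm (v i ?x - v i ?y) powr p + norm (u ?x - u ?y) powr p)"
      using C by (simp add: powr_mult)
    also have "\<dots> \<le> 2 powr p * ((C powr p + 1) * norm (v i ?x - v i ?y) powr p + (C powr p + 1) * norm (u ?x - u ?y) powr p)"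
      by (intro mult_left_mono add_mono) (auto simp: distrib_right)
    also have "\<dots> = K * (norm (v i ?x - v i ?y) powr p + norm (u ?x - u ?y) powr p)" by (simp add: K_def algebra_simps)
    finally have "norm (w i ?x - w i ?y) powr p / norm (?x - ?y) powr \<alpha> \<le>
        K * (norm (v i ?x - v i ?y) powr p + norm (u ?x - u ?y) powr p) / norm (?x - ?y) powr \<alpha>"
      by (rule divide_right_mono) simp
    also have "\<dots> = K * (norm (v i ?x - v i ?y) powr p / norm (?x - ?y) powr \<alpha> + norm (u ?x - u ?y) powr p / norm (?x - ?y) powr \<alpha>)"
      by (simp only: times_divide_eq_right[symmetric] add_divide_distrib)
    finally show ?thesis
      by (auto simp: rh_def edr_def indicator_def)
  qed
  define G where "G i = (\<integral>\<^sup>+z. ennreal (rh i z - edr p \<alpha> (w i) z) \<partial>?M)" for i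
  have rhm[measurable]: "rh i \<in> borel_measurable ?M" for i
    unfolding rh_def by (intro borel_measurable_times borel_measurable_add borel_measurable_const measurable_edr) auto
  have wm[measurable]: "edr p \<alpha> (w i) \<in> borel_measurable ?M" for i by (rule measurable_edr) measurable
  have um[measurable]: "edr p \<alpha> u \<in> borel_measurable ?M" by (rule measurable_edr) measurable
  have vm[measurable]: "edr p \<alpha> (v i) \<in> borel_measurable ?M" for i by (rule measurable_edr) measurable
  \<comment> \<open>If every energy of w were at least \<eta>, the integrals G would stay \<eta>
    below K (c i + 1) e0, whose limit is 2 K e0; Fatou's lemma below gives 2 K e0 as a lower bound
    for their liminf.\<close>
  have Geq: "G i + ennreal \<eta> \<le> ennreal (K * (c i * e0 + e0))" for i
  proof -
    have "G i + ennreal \<eta> \<le> G i + energy p \<alpha> (w i)" using big[of i] by (intro add_left_mono) (simp add: w_def[abs_def])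
    also have "\<dots> = (\<integral>\<^sup>+z. ennreal (rh i z - edr p \<alpha> (w i) z) + ennreal (edr p \<alpha> (w i) z) \<partial>?M)"
      unfolding G_def by (subst energy_eq_edr, measurable, subst nn_integral_add, measurable)
    also have "\<dots> = (\<integral>\<^sup>+z. ennreal (rh i z) \<partial>?M)"
    proof (rule nn_integral_cong)
      fix z
      show "ennreal (rh i z - edr p \<alpha> (w i) z) + ennreal (edr p \<alpha> (w i) z) = ennreal (rh i z)"
        using fh[of i z] edr_nonneg[of p \<alpha> "w i" z] by (subst ennreal_plus[symmetric]) auto
    qed
    also have "\<dots> = (\<integral>\<^sup>+z. ennreal K * (ennreal (edr p \<alpha> (v i) z) + ennreal (edr p \<alpha> u z)) \<partial>?M)"
    proof (rule nn_integral_cong)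
      fix z
      have "ennreal (rh i z) = ennreal K * ennreal (edr p \<alpha> (v i) z + edr p \<alpha> u z)"
        unfolding rh_def using K edr_nonneg[of p \<alpha> "v i" z] edr_nonneg[of p \<alpha> u z] by (intro ennreal_mult) auto
      then show "ennreal (rh i z) = ennreal K * (ennreal (edr p \<alpha> (v i) z) + ennreal (edr p \<alpha> u z))"
        by (simp add: edr_nonneg)
    qed
    also have "\<dots> = ennreal K * (energy p \<alpha> (v i) + energy p \<alpha> u)"
      by (subst nn_integral_cmult, measurable, subst nn_integral_add, measurable, simp add: energy_eq_edr)
    also have "\<dots> \<le> ennreal K * (ennreal (c i) * energy p \<alpha> u + energy p \<alpha> u)"
      by (intro mult_left_mono add_right_mono le) simp
    also have "\<dots> = ennreal (K * (c i * e0 + e0))"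
      using K e0(2) le(2)[of i] unfolding e0(1) by (simp add: ennreal_mult ennreal_plus)
    finally show ?thesis .
  qed
  have "ennreal (2 * K * e0) = (\<integral>\<^sup>+z. ennreal (2 * K) * ennreal (edr p \<alpha> u z) \<partial>?M)"
    using K e0 by (subst nn_integral_cmult, measurable, simp add: energy_eq_edr[symmetric] ennreal_mult)
  also have "\<dots> = (\<integral>\<^sup>+z. liminf (\<lambda>i. ennreal (rh i z - edr p \<alpha> (w i) z)) \<partial>?M)"
  proof (rule nn_integral_cong_AE)
    show "AE z in ?M. ennreal (2 * K) * ennreal (edr p \<alpha> u z) = liminf (\<lambda>i. ennreal (rh i z - edr p \<alpha> (w i) z))"
      using AE_lborel_pairI[OF ae]
    proof eventually_elim
      case (elim z)
      have "(\<lambda>i. rh i z - edr p \<alpha> (w i) z) \<longlonglongrightarrow> 2 * K * edr p \<alpha> u z"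
      proof (cases "fst z \<in> open_cube \<and> snd z \<in> open_cube")
        case True
        then have lim: "(\<lambda>i. v i (fst z)) \<longlonglongrightarrow> u (fst z)" "(\<lambda>i. v i (snd z)) \<longlonglongrightarrow> u (snd z)" using elim by auto
        have Pcont: "isCont P a" for a
        proof -
          have "C-lipschitz_on UNIV P" using P(1) C by (intro lipschitz_onI) (auto simp: dist_norm)
          then have "continuous_on UNIV P" by (rule lipschitz_on_continuous_on)
          then show ?thesis by (simp add: continuous_on_eq_continuous_at)
        qed
        have wlim: "(\<lambda>i. w i x) \<longlonglongrightarrow> 0" if "(\<lambda>i. v i x) \<longlonglongrightarrow> u x" for x
        proof -
          have "(\<lambda>i. v i x - \<xi> i) \<longlonglongrightarrow> u x - 0" using that \<xi> by (intro tendsto_diff)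
          then have "(\<lambda>i. P (v i x - \<xi> i)) \<longlonglongrightarrow> P (u x)"
            using isCont_tendsto_compose[OF Pcont] by simp
          from tendsto_diff[OF this tendsto_const[of "u x"]] show ?thesis by (simp add: P(2) w_def)
        qed
        have "(\<lambda>i. edr p \<alpha> (v i) z) \<longlonglongrightarrow> edr p \<alpha> u z"
          using edr_tendsto[OF lim, of p \<alpha>] p by (simp add: edr_def)
        moreover have "(\<lambda>i. edr p \<alpha> (w i) z) \<longlonglongrightarrow> 0"
          using edr_tendsto[of w z 0 0 p \<alpha>] wlim lim p by simp
        ultimately have "(\<lambda>i. K * (edr p \<alpha> (v i) z + edr p \<alpha> u z) - edr p \<alpha> (w i) z) \<longlonglongrightarrow> K * (edr p \<alpha> u z + edr p \<alpha> u z) - 0"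
          by (intro tendsto_intros)
        then show ?thesis by (simp add: rh_def algebra_simps)
      next
        case False
        then have "edr p \<alpha> f z = 0" for f :: "real^'m \<Rightarrow> real^'v" by (auto simp: edr_def)
        then show ?thesis by (simp add: rh_def)
      qed
      then have "(\<lambda>i. ennreal (rh i z - edr p \<alpha> (w i) z)) \<longlonglongrightarrow> ennreal (2 * K * edr p \<alpha> u z)"
        by (rule tendsto_ennrealI)
      then have "liminf (\<lambda>i. ennreal (rh i z - edr p \<alpha> (w i) z)) = ennreal (2 * K * edr p \<alpha> u z)"
        by (rule lim_imp_Liminf[OF sequentially_bot])
      then show ?case using K edr_nonneg[of p \<alpha> u z] by (simp add: ennreal_mult)
    qed
  qed
  also have "\<dots> \<le> liminf G"
    unfolding G_def[abs_def] by (rule nn_integral_liminf) measurable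
  finally have fatou: "ennreal (2 * K * e0) \<le> liminf G" .
  have "(\<lambda>i. K * (c i * e0 + e0)) \<longlonglongrightarrow> K * (1 * e0 + e0)" by (intro tendsto_intros le)
  then have lim: "(\<lambda>i. K * (c i * e0 + e0)) \<longlonglongrightarrow> 2 * K * e0" by (simp add: algebra_simps)
  have ev1: "\<forall>\<^sub>F i in sequentially. K * (c i * e0 + e0) < 2 * K * e0 + \<eta>/2"
    by (rule order_tendstoD(2)[OF lim]) (use \<eta> in simp)
  have Ke: "2 * K * e0 \<ge> 0" using K e0(2) by simp
  show False
  \<comment> \<open>\<open>ennreal\<close> sends negative numbers to 0, so 2 K e0 - \<eta>/2 is
    usable as a lower bound for G only if it is nonnegative; in the other case \<open>Geq\<close>
    alone is contradictory.\<close>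
  proof (cases "2 * K * e0 < \<eta>/2")
    case True
    obtain i where "K * (c i * e0 + e0) < 2 * K * e0 + \<eta>/2" using ev1 by (auto simp: eventually_sequentially)
    then have "K * (c i * e0 + e0) < \<eta>" using True by simp
    then have "ennreal (K * (c i * e0 + e0)) < ennreal \<eta>" using \<eta> by (simp add: ennreal_lessI)
    moreover have "ennreal \<eta> \<le> ennreal (K * (c i * e0 + e0))" by (rule order_trans[OF _ Geq[of i]]) simp
    ultimately show False by simp
  next
    case False
    then have "ennreal (2 * K * e0 - \<eta>/2) < ennreal (2 * K * e0)" using \<eta> by (intro ennreal_lessI) auto
    then have "ennreal (2 * K * e0 - \<eta>/2) < liminf G" using fatou by (rule less_le_trans)
    then have "\<forall>\<^sub>F i in sequentially. ennreal (2 * K * e0 - \<eta>/2) < G i" by (rule less_LiminfD)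
    with ev1 have "\<forall>\<^sub>F i in sequentially. K * (c i * e0 + e0) < 2 * K * e0 + \<eta>/2 \<and> ennreal (2 * K * e0 - \<eta>/2) < G i"
      by (rule eventually_conj)
    then obtain i where i: "K * (c i * e0 + e0) < 2 * K * e0 + \<eta>/2" "ennreal (2 * K * e0 - \<eta>/2) < G i"
      by (auto simp: eventually_sequentially)
    have "ennreal (2 * K * e0 + \<eta>/2) = ennreal (2 * K * e0 - \<eta>/2) + ennreal \<eta>"
      using False \<eta> by (subst ennreal_plus[symmetric]) auto
    also have "\<dots> \<le> G i + ennreal \<eta>" using i(2) by (intro add_right_mono) simp
    also have "\<dots> \<le> ennreal (K * (c i * e0 + e0))" by (rule Geq)
    finally have "2 * K * e0 + \<eta>/2 \<le> K * (c i * e0 + e0)"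
      using Ke \<eta> by (subst (asm) ennreal_le_iff2) auto
    then show False using i(1) by simp
  qed
qed

lemma lpint_compose_tendsto:
  fixes u :: "real^'m \<Rightarrow> real^'v" and P :: "real^'v \<Rightarrow> real^'v"
  assumes [measurable]: "u \<in> borel_measurable borel" "\<And>i. v i \<in> borel_measurable borel" "P \<in> borel_measurable borel"
    and P: "\<And>x y. norm (P x - P y) \<le> C * norm (x - y)" "\<And>x. P (u x) = u x" and C: "C > 0" and p: "p \<ge> 1"
    and b: "\<And>x. norm (u x) \<le> b" "\<And>i x. norm (v i x) \<le> b" and \<xi>1: "\<And>i. norm (\<xi> i) \<le> 1"
    and ae: "AE x in lborel. x \<in> open_cube \<longrightarrow> (\<lambda>i. v i x) \<longlonglongrightarrow> u x"
    and \<xi>: "\<xi> \<longlonglongrightarrow> 0"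
  shows "(\<lambda>i. lpint p (\<lambda>x. P (v i x - \<xi> i) - u x)) \<longlonglongrightarrow> 0"
proof -
  have le: "norm (P (v i x - \<xi> i) - u x) \<le> C * (norm (v i x - u x) + norm (\<xi> i))" for i x
  proof -
    have "norm (P (v i x - \<xi> i) - P (u x)) \<le> C * norm ((v i x - \<xi> i) - u x)" by (rule P)
    also have "\<dots> \<le> C * (norm (v i x - u x) + norm (\<xi> i))"
      using C norm_triangle_ineq4[of "v i x - u x" "\<xi> i"] by (intro mult_left_mono) (auto simp: algebra_simps)
    finally show ?thesis by (simp add: P(2))
  qed
  define B where "B = C * (2 * b + 1)"
  have bd: "norm (P (v i x - \<xi> i) - u x) \<le> B" for i x
  proof -
    have "norm (v i x - u x) + norm (\<xi> i) \<le> 2 * b + 1"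
      using norm_triangle_ineq4[of "v i x" "u x"] b(1)[of x] b(2)[of i x] \<xi>1[of i] by linarith
    then have "C * (norm (v i x - u x) + norm (\<xi> i)) \<le> B" unfolding B_def using C by (intro mult_left_mono) auto
    then show ?thesis using le[of i x] by linarith
  qed
  have "(\<lambda>i. \<integral>\<^sup>+x. ennreal (norm (P (v i x - \<xi> i) - u x) powr p) * indicator open_cube x \<partial>lborel) \<longlonglongrightarrow> (\<integral>\<^sup>+x. 0 \<partial>(lborel :: (real^'m) measure))"
  proof (rule nn_integral_dominated_convergence[where w="\<lambda>x. ennreal (B powr p) * indicator open_cube x"])
    show "AE x in lborel. ennreal (norm (P (v i x - \<xi> i) - u x) powr p) * indicator open_cube x \<le> ennreal (B powr p) * indicator open_cube x" for i
      using bd[of i] p by (intro AE_I2 mult_right_mono ennreal_leI powr_mono2) auto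
    have "emeasure lborel (open_cube :: (real^'m) set) < \<infinity>"
      unfolding open_cube_eq_box using emeasure_lborel_box_finite[of "-1" "1 :: real^'m"] by simp
    then show "(\<integral>\<^sup>+x. ennreal (B powr p) * indicator open_cube x \<partial>(lborel :: (real^'m) measure)) < \<infinity>"
      by (simp add: nn_integral_cmult ennreal_mult_less_top)
    show "AE x in lborel. (\<lambda>i. ennreal (norm (P (v i x - \<xi> i) - u x) powr p) * indicator open_cube x) \<longlonglongrightarrow> 0"
      using ae
    proof eventually_elim
      case (elim x)
      show ?case
      proof (cases "x \<in> open_cube")
        case True
        then have "(\<lambda>i. v i x) \<longlonglongrightarrow> u x" using elim by simp
        then have "(\<lambda>i. C * (norm (v i x - u x) + norm (\<xi> i))) \<longlonglongrightarrow> C * (norm (u x - u x) + norm (0 :: real^'v))"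
          using \<xi> by (intro tendsto_intros)
        then have lim: "(\<lambda>i. C * (norm (v i x - u x) + norm (\<xi> i))) \<longlonglongrightarrow> 0" by simp
        have "(\<lambda>i. norm (P (v i x - \<xi> i) - u x)) \<longlonglongrightarrow> 0"
        proof (rule tendsto_sandwich[OF _ _ tendsto_const lim])
          show "\<forall>\<^sub>F i in sequentially. norm (P (v i x - \<xi> i) - u x) \<le> C * (norm (v i x - u x) + norm (\<xi> i))"
            using le by (intro always_eventually allI)
        qed simp
        then have "(\<lambda>i. norm (P (v i x - \<xi> i) - u x) powr p) \<longlonglongrightarrow> 0"
          by (rule tendsto_zero_powrI[where g="\<lambda>i. p" and b=p]) (use p in auto)
        then have "(\<lambda>i. ennreal (norm (P (v i x - \<xi> i) - u x) powr p)) \<longlonglongrightarrow> ennreal 0" by (rule tendsto_ennrealI)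
        then show ?thesis using True by simp
      qed simp
    qed
  qed measurable
  then show ?thesis by (simp add: lpint_def)
qed

text \<open>Uniformity in the scale and the translation, by contradiction: violations along j
  tending to infinity and \<xi> tending to 0 form sequences to which the convergence lemmas apply.
  The radius has to be uniform because \<xi> is selected only after the scale.\<close>

lemma avg_compose_small:
  fixes u :: "real^'m \<Rightarrow> real^'v" and P :: "real^'v \<Rightarrow> real^'v"
  assumes \<phi>: "mollifier \<phi> A" and u[measurable]: "u \<in> borel_measurable borel" and b: "\<And>x. norm (u x) \<le> b"
    and p: "p \<ge> 1" and \<sigma>: "\<sigma> \<ge> 0" and fin: "energy p \<alpha> u < \<infinity>"
    and P: "\<And>x y. norm (P x - P y) \<le> C * norm (x - y)" "\<And>x. P (u x) = u x" and C: "C > 0"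
    and e: "\<And>j. 0 < e j" "\<And>j. e j \<le> 1 / real (j + 2)"
      "\<And>j. ennreal (e j powr (-\<sigma>)) * lpint p (\<lambda>x. avg \<phi> (e j) u x - u x) \<le> ennreal ((1/2) ^ j)"
    and \<eta>: "\<eta> > 0"
  shows "\<exists>r>0. \<exists>J. \<forall>j\<ge>J. \<forall>\<xi>. norm \<xi> \<le> r \<longrightarrow>
    energy p \<alpha> (\<lambda>x. P (avg \<phi> (e j) u x - \<xi>) - u x) < ennreal \<eta> \<and>
    lpint p (\<lambda>x. P (avg \<phi> (e j) u x - \<xi>) - u x) < ennreal \<eta>"
proof (rule ccontr)
  define ok where "ok j \<xi> \<longleftrightarrow> energy p \<alpha> (\<lambda>x. P (avg \<phi> (e j) u x - \<xi>) - u x) < ennreal \<eta> \<and>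
    lpint p (\<lambda>x. P (avg \<phi> (e j) u x - \<xi>) - u x) < ennreal \<eta>" for j \<xi>
  assume "\<not> ?thesis"
  then have neg: "\<not> (\<exists>r>0. \<exists>J. \<forall>j\<ge>J. \<forall>\<xi>. norm \<xi> \<le> r \<longrightarrow> ok j \<xi>)" unfolding ok_def .
  have ex: "\<exists>j \<xi>. j \<ge> i \<and> norm \<xi> \<le> 1 / real (i + 1) \<and> \<not> ok j \<xi>" for i :: nat
  proof (rule ccontr)
    assume a: "\<not> ?thesis"
    have "\<forall>j\<ge>i. \<forall>\<xi>. norm \<xi> \<le> 1 / real (i + 1) \<longrightarrow> ok j \<xi>"
    proof (intro allI impI)
      fix j :: nat and \<xi> :: "real^'v" assume "j \<ge> i" "norm \<xi> \<le> 1 / real (i + 1)"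
      then show "ok j \<xi>" using a by blast
    qed
    then have "\<exists>J. \<forall>j\<ge>J. \<forall>\<xi>. norm \<xi> \<le> 1 / real (i + 1) \<longrightarrow> ok j \<xi>" by (rule exI)
    moreover have "1 / real (i + 1) > 0" by simp
    ultimately show False using neg by blast
  qed
  have "\<exists>z. \<forall>i. fst (z i) \<ge> i \<and> norm (snd (z i)) \<le> 1 / real (i + 1) \<and> \<not> ok (fst (z i)) (snd (z i))"
  proof (rule choice, rule allI)
    fix i
    show "\<exists>z. fst z \<ge> i \<and> norm (snd z) \<le> 1 / real (i + 1) \<and> \<not> ok (fst z) (snd z)"
      using ex[of i] by auto
  qed
  then obtain z where z: "\<forall>i. fst (z i) \<ge> i \<and> norm (snd (z i)) \<le> 1 / real (i + 1) \<and> \<not> ok (fst (z i)) (snd (z i))" ..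
  define jj where "jj i = fst (z i)" for i
  define \<xi> where "\<xi> i = snd (z i)" for i
  have j: "jj i \<ge> i" "norm (\<xi> i) \<le> 1 / real (i + 1)" "\<not> ok (jj i) (\<xi> i)" for i
    using z[rule_format, of i] by (simp_all add: jj_def \<xi>_def)
  have e1: "e j \<le> 1/2" for j
  proof -
    have "1 / real (j + 2) \<le> 1 / 2" by (intro divide_left_mono) auto
    then show ?thesis using e(2)[of j] by linarith
  qed
  have Pm[measurable]: "P \<in> borel_measurable borel"
  proof -
    have "C-lipschitz_on UNIV P" using P(1) C by (intro lipschitz_onI) (auto simp: dist_norm)
    then show ?thesis by (intro borel_measurable_continuous_onI lipschitz_on_continuous_on)
  qed
  have avgm[measurable]: "avg \<phi> (e j) u \<in> borel_measurable borel" for j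
    using e(1)[of j] e1[of j] by (intro borel_measurable_continuous_onI continuous_avg[OF \<phi> u b]) auto
  have lp: "lpint p (\<lambda>x. avg \<phi> (e j) u x - u x) \<le> ennreal ((1/2) ^ j)" for j
  proof -
    have "1 \<le> e j powr (-\<sigma>)"
    proof -
      have "1 = 1 powr (-\<sigma>)" by simp
      also have "\<dots> \<le> e j powr (-\<sigma>)" using e(1)[of j] e1[of j] \<sigma> by (intro powr_mono2') auto
      finally show ?thesis .
    qed
    then have "1 \<le> ennreal (e j powr (-\<sigma>))" using ennreal_leI[of 1] by simp
    then have "1 * lpint p (\<lambda>x. avg \<phi> (e j) u x - u x) \<le> ennreal (e j powr (-\<sigma>)) * lpint p (\<lambda>x. avg \<phi> (e j) u x - u x)"
      by (rule mult_right_mono) simp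
    then show ?thesis using e(3)[of j] by simp
  qed
  have ae: "AE x in lborel. x \<in> open_cube \<longrightarrow> (\<lambda>j. avg \<phi> (e j) u x) \<longlonglongrightarrow> u x"
    by (rule AE_tendsto_if_lpint_summable[OF avgm u p lp])
  have jj: "filterlim jj at_top sequentially"
    using j(1) by (intro filterlim_at_top_mono[OF filterlim_ident]) auto
  have ae': "AE x in lborel. x \<in> open_cube \<longrightarrow> (\<lambda>i. avg \<phi> (e (jj i)) u x) \<longlonglongrightarrow> u x"
    using ae
  proof eventually_elim
    case (elim x)
    show ?case
    proof
      assume "x \<in> open_cube"
      then have "(\<lambda>j. avg \<phi> (e j) u x) \<longlonglongrightarrow> u x" using elim by simp
      then show "(\<lambda>i. avg \<phi> (e (jj i)) u x) \<longlonglongrightarrow> u x" by (rule filterlim_compose) (rule jj)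
    qed
  qed
  have lim1: "(\<lambda>i. 1 / real (i + 1)) \<longlonglongrightarrow> 0" by (rule LIMSEQ_ignore_initial_segment[OF lim_1_over_n])
  have \<xi>0: "\<xi> \<longlonglongrightarrow> 0"
    by (rule Lim_null_comparison[OF _ lim1]) (use j(2) in \<open>auto intro: always_eventually\<close>)
  have \<xi>1: "norm (\<xi> i) \<le> 1" for i
  proof -
    have "1 / real (i + 1) \<le> 1 / 1" by (intro divide_left_mono) auto
    then show ?thesis using j(2)[of i] by linarith
  qed
  have vb: "norm (avg \<phi> (e (jj i)) u x) \<le> b" for i x by (rule avg_bound[OF \<phi> u b])
  have "(\<lambda>i. lpint p (\<lambda>x. P (avg \<phi> (e (jj i)) u x - \<xi> i) - u x)) \<longlonglongrightarrow> 0"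
    by (rule lpint_compose_tendsto[OF u avgm Pm P C p b vb \<xi>1 ae' \<xi>0])
  then have "\<forall>\<^sub>F i in sequentially. lpint p (\<lambda>x. P (avg \<phi> (e (jj i)) u x - \<xi> i) - u x) < ennreal \<eta>"
    by (rule order_tendstoD) (use \<eta> in simp)
  then obtain I where I: "\<And>i. i \<ge> I \<Longrightarrow> lpint p (\<lambda>x. P (avg \<phi> (e (jj i)) u x - \<xi> i) - u x) < ennreal \<eta>"
    by (auto simp: eventually_sequentially)
  \<comment> \<open>From index I on the integral of the p-th power is already small, so a violation
    can only come from the energy; all sequences are therefore shifted by I.\<close>
  define c where "c i = (1 - e (jj (i + I))) powr (\<alpha> - 2 * real CARD('m))" for i
  have ejj: "(\<lambda>i. e (jj (i + I))) \<longlonglongrightarrow> 0"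
  proof -
    have "e \<longlonglongrightarrow> 0"
    proof (rule tendsto_sandwich[OF _ _ tendsto_const])
      show "(\<lambda>j. 1 / real (j + 2)) \<longlonglongrightarrow> 0" by (rule LIMSEQ_ignore_initial_segment[OF lim_1_over_n])
      show "\<forall>\<^sub>F j in sequentially. 0 \<le> e j" using e(1) by (auto intro: always_eventually less_imp_le)
      show "\<forall>\<^sub>F j in sequentially. e j \<le> 1 / real (j + 2)" using e(2) by (intro always_eventually allI)
    qed
    then have "(\<lambda>i. e (jj i)) \<longlonglongrightarrow> 0" by (rule filterlim_compose) (rule jj)
    then show ?thesis by (rule LIMSEQ_ignore_initial_segment)
  qed
  have "(\<lambda>i. (1 - e (jj (i + I))) powr (\<alpha> - 2 * real CARD('m))) \<longlonglongrightarrow> (1 - 0) powr (\<alpha> - 2 * real CARD('m))"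
    by (intro tendsto_powr tendsto_diff tendsto_const ejj) simp
  then have c1: "c \<longlonglongrightarrow> 1" by (simp add: c_def[abs_def])
  obtain e0 where e0: "energy p \<alpha> u = ennreal e0" "e0 \<ge> 0"
    using fin by (cases "energy p \<alpha> u") auto
  have "\<exists>i. energy p \<alpha> (\<lambda>x. P (avg \<phi> (e (jj (i + I))) u x - \<xi> (i + I)) - u x) < ennreal \<eta>"
  proof (rule energy_compose_small[where v="\<lambda>i. avg \<phi> (e (jj (i + I))) u" and \<xi>="\<lambda>i. \<xi> (i + I)" and c=c and P=P and C=C and u=u])
    show "AE x in lborel. x \<in> open_cube \<longrightarrow> (\<lambda>i. avg \<phi> (e (jj (i + I))) u x) \<longlonglongrightarrow> u x"
      using ae'
    proof eventually_elim
      case (elim x)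
      then show ?case using LIMSEQ_ignore_initial_segment by blast
    qed
    show "energy p \<alpha> (avg \<phi> (e (jj (i + I))) u) \<le> ennreal (c i) * energy p \<alpha> u" for i
      unfolding c_def using e(1)[of "jj (i + I)"] e1[of "jj (i + I)"] by (intro energy_avg_le[OF \<phi> u b p]) auto
    show "(\<lambda>i. \<xi> (i + I)) \<longlonglongrightarrow> 0" using \<xi>0 by (rule LIMSEQ_ignore_initial_segment)
  qed (use P C p e0 c1 \<eta> in \<open>auto simp: c_def\<close>)
  then obtain i where "energy p \<alpha> (\<lambda>x. P (avg \<phi> (e (jj (i + I))) u x - \<xi> (i + I)) - u x) < ennreal \<eta>" by blast
  then show False using I[of "i + I"] j(3)[of "i + I"] by (simp add: ok_def)
qed

text \<open>The substitution y = x + \<epsilon> z yields \<epsilon>^m \<epsilon>^(-\<alpha>) =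
  \<epsilon>^(-\<sigma>), the factor that all later smallness has to beat.\<close>

lemma nn_integral_kernel_scaled:
  fixes x :: "real^'m"
  assumes \<epsilon>: "\<epsilon> > 0" and \<alpha>: "\<alpha> = real CARD('m) + \<sigma>"
  shows "(\<integral>\<^sup>+y. ennreal (min 1 (norm (x - y) / \<epsilon>) powr q / norm (x - y) powr \<alpha>) \<partial>lborel)
    = ennreal (\<epsilon> powr (-\<sigma>)) * (\<integral>\<^sup>+z. ennreal (min 1 (norm z) powr q / norm z powr \<alpha>) \<partial>(lborel :: (real^'m) measure))"
proof -
  let ?m = "CARD('m)"
  have "(\<integral>\<^sup>+y. ennreal (min 1 (norm (x - y) / \<epsilon>) powr q / norm (x - y) powr \<alpha>) \<partial>lborel)
    = ennreal (\<bar>\<epsilon>\<bar> ^ DIM(real^'m)) * (\<integral>\<^sup>+z. ennreal (min 1 (norm (x - (x + \<epsilon> *\<^sub>R z)) / \<epsilon>) powr q / norm (x - (x + \<epsilon> *\<^sub>R z)) powr \<alpha>) \<partial>lborel)"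
    by (rule nn_integral_lborel_affine) (use \<epsilon> in auto)
  also have "(\<integral>\<^sup>+z. ennreal (min 1 (norm (x - (x + \<epsilon> *\<^sub>R z)) / \<epsilon>) powr q / norm (x - (x + \<epsilon> *\<^sub>R z)) powr \<alpha>) \<partial>lborel)
    = (\<integral>\<^sup>+z. ennreal (\<epsilon> powr (-\<alpha>)) * ennreal (min 1 (norm z) powr q / norm z powr \<alpha>) \<partial>(lborel :: (real^'m) measure))"
  proof (rule nn_integral_cong)
    fix z :: "real^'m"
    have n: "norm (x - (x + \<epsilon> *\<^sub>R z)) = \<epsilon> * norm z" using \<epsilon> by simp
    have nd: "\<epsilon> * norm z / \<epsilon> = norm z" using \<epsilon> by simp
    have "min 1 (norm (x - (x + \<epsilon> *\<^sub>R z)) / \<epsilon>) powr q / norm (x - (x + \<epsilon> *\<^sub>R z)) powr \<alpha> = \<epsilon> powr (-\<alpha>) * (min 1 (norm z) powr q / norm z powr \<alpha>)"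
      unfolding n nd using \<epsilon> by (simp add: powr_mult powr_minus field_simps)
    then show "ennreal (min 1 (norm (x - (x + \<epsilon> *\<^sub>R z)) / \<epsilon>) powr q / norm (x - (x + \<epsilon> *\<^sub>R z)) powr \<alpha>)
        = ennreal (\<epsilon> powr (-\<alpha>)) * ennreal (min 1 (norm z) powr q / norm z powr \<alpha>)"
      by (simp only: ennreal_mult powr_ge_zero divide_nonneg_nonneg)
  qed
  also have "\<dots> = ennreal (\<epsilon> powr (-\<alpha>)) * (\<integral>\<^sup>+z. ennreal (min 1 (norm z) powr q / norm z powr \<alpha>) \<partial>(lborel :: (real^'m) measure))"
    by (rule nn_integral_cmult) measurable
  also have "ennreal (\<bar>\<epsilon>\<bar> ^ DIM(real^'m)) * (ennreal (\<epsilon> powr (-\<alpha>)) * (\<integral>\<^sup>+z. ennreal (min 1 (norm z) powr q / norm z powr \<alpha>) \<partial>(lborel :: (real^'m) measure)))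
    = ennreal (\<bar>\<epsilon>\<bar> ^ DIM(real^'m) * \<epsilon> powr (-\<alpha>)) * (\<integral>\<^sup>+z. ennreal (min 1 (norm z) powr q / norm z powr \<alpha>) \<partial>(lborel :: (real^'m) measure))"
    by (simp add: ennreal_mult mult.assoc)
  also have "\<bar>\<epsilon>\<bar> ^ DIM(real^'m) * \<epsilon> powr (-\<alpha>) = \<epsilon> powr (-\<sigma>)"
  proof -
    have "\<bar>\<epsilon>\<bar> ^ DIM(real^'m) = \<epsilon> powr real ?m" using \<epsilon> by (simp add: powr_realpow)
    then have "\<bar>\<epsilon>\<bar> ^ DIM(real^'m) * \<epsilon> powr (-\<alpha>) = \<epsilon> powr (real ?m + (-\<alpha>))" by (simp only: powr_add)
    then show ?thesis by (simp add: \<alpha>)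
  qed
  finally show ?thesis .
qed

lemma energy_add_le:
  fixes f g :: "real^'m \<Rightarrow> real^'v"
  assumes [measurable]: "f \<in> borel_measurable borel" "g \<in> borel_measurable borel" and p: "p \<ge> 1"
  shows "energy p \<alpha> (\<lambda>x. f x + g x) \<le> ennreal (2 powr p) * (energy p \<alpha> f + energy p \<alpha> g)"
proof -
  have le: "edr p \<alpha> (\<lambda>x. f x + g x) z \<le> 2 powr p * (edr p \<alpha> f z + edr p \<alpha> g z)" for z
  proof -
    let ?x = "fst z" and ?y = "snd z"
    have "norm ((f ?x + g ?x) - (f ?y + g ?y)) \<le> norm (f ?x - f ?y) + norm (g ?x - g ?y)"
      using norm_triangle_ineq[of "f ?x - f ?y" "g ?x - g ?y"] by (simp add: algebra_simps)
    then have "norm ((f ?x + g ?x) - (f ?y + g ?y)) powr p \<le> (norm (f ?x - f ?y) + norm (g ?x - g ?y)) powr p"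
      using p by (intro powr_mono2) auto
    also have "\<dots> \<le> 2 powr p * (norm (f ?x - f ?y) powr p + norm (g ?x - g ?y) powr p)"
      using p by (intro add_powr_le) auto
    finally have "norm ((f ?x + g ?x) - (f ?y + g ?y)) powr p / norm (?x - ?y) powr \<alpha>
        \<le> 2 powr p * (norm (f ?x - f ?y) powr p + norm (g ?x - g ?y) powr p) / norm (?x - ?y) powr \<alpha>"
      by (rule divide_right_mono) simp
    also have "\<dots> = 2 powr p * (norm (f ?x - f ?y) powr p / norm (?x - ?y) powr \<alpha> + norm (g ?x - g ?y) powr p / norm (?x - ?y) powr \<alpha>)"
      by (simp only: times_divide_eq_right[symmetric] add_divide_distrib)
    finally show ?thesis by (auto simp: edr_def indicator_def)
  qed
  have [measurable]: "edr p \<alpha> f \<in> borel_measurable (lborel \<Otimes>\<^sub>M lborel)" "edr p \<alpha> g \<in> borel_measurable (lborel \<Otimes>\<^sub>M lborel)"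
    by (rule measurable_edr, measurable)+
  have "energy p \<alpha> (\<lambda>x. f x + g x) = (\<integral>\<^sup>+z. ennreal (edr p \<alpha> (\<lambda>x. f x + g x) z) \<partial>(lborel \<Otimes>\<^sub>M lborel))"
    by (rule energy_eq_edr) measurable
  also have "\<dots> \<le> (\<integral>\<^sup>+z. ennreal (2 powr p) * (ennreal (edr p \<alpha> f z) + ennreal (edr p \<alpha> g z)) \<partial>(lborel \<Otimes>\<^sub>M lborel))"
  proof (rule nn_integral_mono)
    fix z
    have "ennreal (edr p \<alpha> (\<lambda>x. f x + g x) z) \<le> ennreal (2 powr p * (edr p \<alpha> f z + edr p \<alpha> g z))"
      using le by (rule ennreal_leI)
    also have "\<dots> = ennreal (2 powr p) * ennreal (edr p \<alpha> f z + edr p \<alpha> g z)"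
      using edr_nonneg[of p \<alpha> f z] edr_nonneg[of p \<alpha> g z] by (intro ennreal_mult) auto
    finally show "ennreal (edr p \<alpha> (\<lambda>x. f x + g x) z) \<le> ennreal (2 powr p) * (ennreal (edr p \<alpha> f z) + ennreal (edr p \<alpha> g z))"
      by (simp add: edr_nonneg)
  qed
  also have "\<dots> = ennreal (2 powr p) * (energy p \<alpha> f + energy p \<alpha> g)"
    by (subst nn_integral_cmult, measurable, subst nn_integral_add, measurable, simp add: energy_eq_edr)
  finally show ?thesis .
qed

lemma lpint_add_le:
  fixes f g :: "real^'m \<Rightarrow> real^'v"
  assumes [measurable]: "f \<in> borel_measurable borel" "g \<in> borel_measurable borel" and p: "p \<ge> 1"
  shows "lpint p (\<lambda>x. f x + g x) \<le> ennreal (2 powr p) * (lpint p f + lpint p g)"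
proof -
  have "lpint p (\<lambda>x. f x + g x) \<le> (\<integral>\<^sup>+x. ennreal (2 powr p) * (ennreal (norm (f x) powr p) * indicator open_cube x + ennreal (norm (g x) powr p) * indicator open_cube x) \<partial>lborel)"
    unfolding lpint_def
  proof (rule nn_integral_mono)
    fix x
    have "norm (f x + g x) powr p \<le> (norm (f x) + norm (g x)) powr p"
      using p norm_triangle_ineq by (intro powr_mono2) auto
    also have "\<dots> \<le> 2 powr p * (norm (f x) powr p + norm (g x) powr p)" using p by (intro add_powr_le) auto
    finally have "ennreal (norm (f x + g x) powr p) \<le> ennreal (2 powr p * (norm (f x) powr p + norm (g x) powr p))" by (rule ennreal_leI)
    also have "\<dots> = ennreal (2 powr p) * ennreal (norm (f x) powr p + norm (g x) powr p)" by (rule ennreal_mult) auto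
    finally show "ennreal (norm (f x + g x) powr p) * indicator open_cube x
      \<le> ennreal (2 powr p) * (ennreal (norm (f x) powr p) * indicator open_cube x + ennreal (norm (g x) powr p) * indicator open_cube x)"
      by (auto simp: indicator_def)
  qed
  also have "\<dots> = ennreal (2 powr p) * (lpint p f + lpint p g)"
    unfolding lpint_def by (subst nn_integral_cmult, measurable, subst nn_integral_add, measurable)
  finally show ?thesis .
qed

section \<open>Composition with a singular retraction\<close>

text \<open>The bound b of N is inherited by averages of maps into N, and translates by vectors of
  norm at most 1 stay in the ball of radius b + 1, where all estimates below take place.\<close>

locale bounded_singular_retraction =
  fixes N :: "(real^'v) set" and k :: nat and \<kappa> :: "real \<Rightarrow> real^'v \<Rightarrow> real^'v" and P :: "real^'v \<Rightarrow> real^'v"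
    and C \<iota> h q b :: real
  assumes sr: "singular_retraction N k \<kappa> P C \<iota> h"
    and b: "\<And>x. x \<in> N \<Longrightarrow> norm x \<le> b" "0 \<le> b" and q: "0 < q" "q < real (Suc k)"
begin

definition bad :: "real \<Rightarrow> (real^'v) set" where
  "bad \<delta> = {a. \<iota> < infdist a N \<or> gap k ((1/h) *\<^sub>R a) < 2 * \<delta>}"

definition err :: "real \<Rightarrow> real^'v \<Rightarrow> real^'v" where
  "err \<delta> a = \<kappa> \<delta> a - P a"

text \<open>A sup bound for \<open>err\<close> on the ball of radius b + 1: b for \<kappa>, the rest
  for the Lipschitz map P.\<close>

definition err_max :: real where
  "err_max = b + norm (P 0) + C * (b + 1)"

definition bad_weight :: "real \<Rightarrow> real^'v \<Rightarrow> ennreal" where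
  "bad_weight \<delta> a = gapw k h q a * indicator (bad \<delta>) a"

definition bad_lpint :: "real \<Rightarrow> (real^'m \<Rightarrow> real^'v) \<Rightarrow> real^'v \<Rightarrow> ennreal" where
  "bad_lpint \<delta> v \<xi> = (\<integral>\<^sup>+x. bad_weight \<delta> (v x - \<xi>) * indicator open_cube x \<partial>lborel)"

definition gap_tail :: "real \<Rightarrow> ennreal" where
  "gap_tail \<delta> = (\<integral>\<^sup>+a. gapw k h q a * indicator {a. gap k ((1/h) *\<^sub>R a) < 2 * \<delta>} a * indicator (cball 0 (b + 1)) a \<partial>(lborel :: (real^'v) measure))"

lemma pos: "C > 0" "\<iota> > 0" "h > 0"
  and P_id: "x \<in> N \<Longrightarrow> P x = x"
  and P_lip: "norm (P x - P y) \<le> C * norm (x - y)"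
  using sr by (auto simp: singular_retraction_def)

lemma
  assumes "\<delta> > 0"
  shows \<kappa>_in: "\<kappa> \<delta> x \<in> N"
    and \<kappa>_lip: "\<exists>L. \<forall>x y. norm (\<kappa> \<delta> x - \<kappa> \<delta> y) \<le> L * norm (x - y)"
    and \<kappa>_gap: "gap k ((1/h) *\<^sub>R x) * norm (\<kappa> \<delta> x - \<kappa> \<delta> y) \<le> C * norm (x - y)"
    and \<kappa>_eq: "infdist x N \<le> \<iota> \<Longrightarrow> gap k ((1/h) *\<^sub>R x) \<ge> 2 * \<delta> \<Longrightarrow> \<kappa> \<delta> x = P x"
  using sr assms by (auto simp: singular_retraction_def)

lemma measurable_cball [measurable]: "cball x r \<in> sets (borel :: (real^'v) measure)"
  by (rule borel_closed) simp

lemma measurable_bad [measurable]: "bad \<delta> \<in> sets borel"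
proof -
  have "bad \<delta> = {a \<in> space borel. \<iota> < infdist a N} \<union> {a \<in> space borel. gap k ((1/h) *\<^sub>R a) < 2 * \<delta>}"
    by (auto simp: bad_def)
  also have "\<dots> \<in> sets borel"
  proof (intro sets.Un)
    have [measurable]: "(\<lambda>a::real^'v. infdist a N) \<in> borel_measurable borel"
      by (intro borel_measurable_continuous_onI continuous_on_infdist continuous_on_id)
    show "{a \<in> space borel. \<iota> < infdist a N} \<in> sets borel" by measurable
    show "{a \<in> space borel. gap k ((1/h) *\<^sub>R a) < 2 * \<delta>} \<in> sets borel" by measurable
  qed
  finally show ?thesis .
qed

lemma measurable_bad_weight [measurable]: "bad_weight \<delta> \<in> borel_measurable borel"
  unfolding bad_weight_def[abs_def] by measurable

lemma P_measurable [measurable]: "P \<in> borel_measurable borel"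
proof -
  have "C-lipschitz_on UNIV P" using P_lip pos by (intro lipschitz_onI) (auto simp: dist_norm)
  then show ?thesis by (intro borel_measurable_continuous_onI lipschitz_on_continuous_on)
qed

lemma \<kappa>_measurable: assumes "\<delta> > 0" shows "\<kappa> \<delta> \<in> borel_measurable borel"
proof -
  obtain L where L: "\<forall>x y. norm (\<kappa> \<delta> x - \<kappa> \<delta> y) \<le> L * norm (x - y)" using \<kappa>_lip[OF assms] ..
  have "\<bar>L\<bar>-lipschitz_on UNIV (\<kappa> \<delta>)"
  proof (rule lipschitz_onI)
    fix x y :: "real^'v"
    have "L * norm (x - y) \<le> \<bar>L\<bar> * norm (x - y)" by (intro mult_right_mono) auto
    then show "dist (\<kappa> \<delta> x) (\<kappa> \<delta> y) \<le> \<bar>L\<bar> * dist x y" using L[rule_format, of x y] by (simp add: dist_norm)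
  qed simp
  then show ?thesis by (intro borel_measurable_continuous_onI lipschitz_on_continuous_on)
qed

lemma err_measurable: assumes "\<delta> > 0" shows "err \<delta> \<in> borel_measurable borel"
  unfolding err_def[abs_def] using \<kappa>_measurable[OF assms] by simp

lemma err_eq_0: "\<delta> > 0 \<Longrightarrow> a \<notin> bad \<delta> \<Longrightarrow> err \<delta> a = 0"
  using \<kappa>_eq[of \<delta> a] by (auto simp: bad_def err_def not_less)

lemma err_max_pos: "err_max > 0"
  unfolding err_max_def using pos b(2) by (intro add_nonneg_pos mult_pos_pos) auto

lemma norm_err_le: assumes "\<delta> > 0" "norm a \<le> b + 1" shows "norm (err \<delta> a) \<le> err_max"
proof -
  have "norm (err \<delta> a) \<le> norm (\<kappa> \<delta> a) + norm (P a)" unfolding err_def by (rule norm_triangle_ineq4)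
  moreover have "norm (\<kappa> \<delta> a) \<le> b" by (intro b \<kappa>_in assms)
  moreover have "norm (P a) \<le> norm (P 0) + norm (P a - P 0)" using norm_triangle_ineq[of "P 0" "P a - P 0"] by simp
  moreover have "norm (P a - P 0) \<le> C * norm (a - 0)" by (rule P_lip)
  moreover have "C * norm (a - 0) \<le> C * (b + 1)" using assms pos by (intro mult_left_mono) auto
  ultimately show ?thesis unfolding err_max_def by linarith
qed

text \<open>Gaps are at most 1/2. Thanks to this bound the L^p error can be charged to the same
  weight as the energy error.\<close>

lemma gapw_ge_1: "1 \<le> gapw k h q a"
proof -
  have "gap k ((1/h) *\<^sub>R a) powr q \<le> 1"
    using gap_nonneg[of k "(1/h) *\<^sub>R a"] gap_le_half[of k "(1/h) *\<^sub>R a"] q by (intro powr_le1) auto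
  then have le: "1 \<le> inverse (gap k ((1/h) *\<^sub>R a) powr q)" if "gap k ((1/h) *\<^sub>R a) powr q > 0"
    using that by (simp add: one_le_inverse_iff)
  show ?thesis
  proof (cases "gap k ((1/h) *\<^sub>R a) powr q > 0")
    case True
    then show ?thesis using ennreal_leI[OF le[OF True]] by (simp add: gapw_def inverse_ennreal)
  next
    case False
    then have "gap k ((1/h) *\<^sub>R a) powr q = 0" using powr_ge_zero[of "gap k ((1/h) *\<^sub>R a)" q] by linarith
    then show ?thesis by (simp del: powr_eq_0_iff add: gapw_def)
  qed
qed

text \<open>Interpolation: p - q powers of the increment are bounded by the sup of the error, and q
  powers by the weighted Lipschitz bound, which produces the gap to the power -q. Only the gap of a
  appears; a' is arbitrary.\<close>

lemma err_diff_le_bad: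
  assumes \<delta>: "\<delta> > 0" and a: "norm a \<le> b + 1" "norm a' \<le> b + 1" and p: "q \<le> p"
  shows "ennreal (norm (err \<delta> a - err \<delta> a') powr p)
    \<le> ennreal ((2 * err_max) powr (p - q) * (2 * C) powr q * norm (a - a') powr q) * gapw k h q a"
proof -
  let ?d = "gap k ((1/h) *\<^sub>R a)" and ?e = "norm (err \<delta> a - err \<delta> a')"
  let ?K = "(2 * err_max) powr (p - q) * (2 * C) powr q"
  have K: "?K > 0" using err_max_pos pos by simp
  have d: "0 \<le> ?d" "?d \<le> 1/2" using gap_nonneg gap_le_half by auto
  consider "a = a'" | "a \<noteq> a'" "?d = 0" | "?d > 0" using d by linarith
  then show ?thesis
  proof cases
    case 1
    then show ?thesis by simp
  next
    case 2
    \<comment> \<open>On the dual skeleton the weight is infinite, and since a \<noteq> a' its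
      prefactor is positive, so the right-hand side is infinite.\<close>
    then have kp: "?K * norm (a - a') powr q > 0" using K by simp
    have "gapw k h q a = \<infinity>" using 2 by (simp add: gapw_def)
    moreover from kp have "ennreal (?K * norm (a - a') powr q) \<noteq> 0" by (metis ennreal_eq_0_iff not_le)
    ultimately have "ennreal (?K * norm (a - a') powr q) * gapw k h q a = top"
      by (simp only: infinity_ennreal_def ennreal_mult_top if_False)
    then show ?thesis by simp
  next
    case 3
    have e1: "?e \<le> 2 * err_max"
      using norm_triangle_ineq4[of "err \<delta> a" "err \<delta> a'"] norm_err_le[OF \<delta> a(1)] norm_err_le[OF \<delta> a(2)] by linarith
    have "?e \<le> norm (\<kappa> \<delta> a - \<kappa> \<delta> a') + norm (P a - P a')"
      unfolding err_def using norm_triangle_ineq4[of "\<kappa> \<delta> a - \<kappa> \<delta> a'" "P a - P a'"] by (simp add: algebra_simps)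
    then have "?d * ?e \<le> ?d * (norm (\<kappa> \<delta> a - \<kappa> \<delta> a') + norm (P a - P a'))" using d by (intro mult_left_mono)
    also have "\<dots> = ?d * norm (\<kappa> \<delta> a - \<kappa> \<delta> a') + ?d * norm (P a - P a')" by (rule distrib_left)
    also have "\<dots> \<le> C * norm (a - a') + 1 * (C * norm (a - a'))"
      using d by (intro add_mono mult_mono \<kappa>_gap[OF \<delta>] P_lip) auto
    finally have e2: "?e \<le> 2 * C * norm (a - a') / ?d" using 3 by (simp add: field_simps)
    have "?e powr p = ?e powr (p - q) * ?e powr q" using powr_add[of ?e "p - q" q] by simp
    also have "\<dots> \<le> (2 * err_max) powr (p - q) * (2 * C * norm (a - a') / ?d) powr q"
      using e1 e2 p q by (intro mult_mono powr_mono2) auto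
    also have "(2 * C * norm (a - a') / ?d) powr q = (2 * C) powr q * norm (a - a') powr q / ?d powr q"
      using pos 3 by (simp add: powr_divide powr_mult)
    finally have "ennreal (?e powr p) \<le> ennreal (?K * norm (a - a') powr q * inverse (?d powr q))"
      by (intro ennreal_leI) (simp add: field_simps)
    also have "\<dots> = ennreal (?K * norm (a - a') powr q) * ennreal (inverse (?d powr q))"
      using K by (intro ennreal_mult) auto
    also have "ennreal (inverse (?d powr q)) = gapw k h q a"
      using 3 by (simp add: gapw_def inverse_ennreal)
    finally show ?thesis .
  qed
qed

text \<open>If one of the points is bad, its own gap is used; if neither is, both errors vanish.
  This is where the asymmetry of \<open>err_diff_le_bad\<close> pays off.\<close>

lemma err_diff_le:
  assumes \<delta>: "\<delta> > 0" and a: "norm a \<le> b + 1" "norm a' \<le> b + 1" and p: "q \<le> p"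
  shows "ennreal (norm (err \<delta> a - err \<delta> a') powr p)
    \<le> ennreal ((2 * err_max) powr (p - q) * (2 * C) powr q * norm (a - a') powr q) * (bad_weight \<delta> a + bad_weight \<delta> a')"
proof -
  let ?K = "ennreal ((2 * err_max) powr (p - q) * (2 * C) powr q * norm (a - a') powr q)"
  consider "a \<in> bad \<delta>" | "a' \<in> bad \<delta>" | "a \<notin> bad \<delta>" "a' \<notin> bad \<delta>" by blast
  then show ?thesis
  proof cases
    case 1
    have "ennreal (norm (err \<delta> a - err \<delta> a') powr p) \<le> ?K * gapw k h q a" by (rule err_diff_le_bad[OF \<delta> a p])
    also have "\<dots> \<le> ?K * (bad_weight \<delta> a + bad_weight \<delta> a')" using 1 by (intro mult_left_mono) (auto simp: bad_weight_def)
    finally show ?thesis .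
  next
    case 2
    have "ennreal (norm (err \<delta> a - err \<delta> a') powr p) \<le> ?K * gapw k h q a'"
      using err_diff_le_bad[OF \<delta> a(2,1) p] by (simp add: norm_minus_commute)
    also have "\<dots> \<le> ?K * (bad_weight \<delta> a + bad_weight \<delta> a')" using 2 by (intro mult_left_mono) (auto simp: bad_weight_def)
    finally show ?thesis .
  next
    case 3
    then show ?thesis using err_eq_0[OF \<delta>] by simp
  qed
qed

lemma lpint_err_le:
  fixes v :: "real^'m \<Rightarrow> real^'v"
  assumes \<delta>: "\<delta> > 0" and [measurable]: "v \<in> borel_measurable borel" and v: "\<And>x. norm (v x) \<le> b" and \<xi>: "norm \<xi> \<le> 1" and p: "0 \<le> p"
  shows "lpint p (\<lambda>x. err \<delta> (v x - \<xi>)) \<le> ennreal (err_max powr p) * bad_lpint \<delta> v \<xi>"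
proof -
  have "lpint p (\<lambda>x. err \<delta> (v x - \<xi>)) \<le> (\<integral>\<^sup>+x. ennreal (err_max powr p) * (bad_weight \<delta> (v x - \<xi>) * indicator open_cube x) \<partial>lborel)"
    unfolding lpint_def
  proof (rule nn_integral_mono)
    fix x
    have n: "norm (v x - \<xi>) \<le> b + 1" using norm_triangle_ineq4[of "v x" \<xi>] v[of x] \<xi> by linarith
    have "ennreal (norm (err \<delta> (v x - \<xi>)) powr p) \<le> ennreal (err_max powr p) * bad_weight \<delta> (v x - \<xi>)"
    proof (cases "v x - \<xi> \<in> bad \<delta>")
      case True
      have "ennreal (norm (err \<delta> (v x - \<xi>)) powr p) \<le> ennreal (err_max powr p)"
        using norm_err_le[OF \<delta> n] p by (intro ennreal_leI powr_mono2) auto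
      also have "\<dots> = ennreal (err_max powr p) * 1" by simp
      also have "\<dots> \<le> ennreal (err_max powr p) * bad_weight \<delta> (v x - \<xi>)"
        using True gapw_ge_1 by (intro mult_left_mono) (auto simp: bad_weight_def)
      finally show ?thesis .
    next
      case False
      then show ?thesis using err_eq_0[OF \<delta>] by simp
    qed
    then show "ennreal (norm (err \<delta> (v x - \<xi>)) powr p) * indicator open_cube x
        \<le> ennreal (err_max powr p) * (bad_weight \<delta> (v x - \<xi>) * indicator open_cube x)"
      by (auto simp: indicator_def)
  qed
  also have "\<dots> = ennreal (err_max powr p) * bad_lpint \<delta> v \<xi>"
    unfolding bad_lpint_def by (rule nn_integral_cmult) measurable
  finally show ?thesis .
qed

text \<open>The sup bound and the Lipschitz bound of v combine to a multiple of min 1 (|x - y| /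
  \<epsilon>). Its q-th power against the kernel has integral of order \<epsilon>^(-\<sigma>) in one
  variable, leaving the weight in the other; the 2 comes from the symmetry of x and y.\<close>

lemma energy_err_le:
  fixes v :: "real^'m \<Rightarrow> real^'v"
  assumes \<delta>: "\<delta> > 0" and [measurable]: "v \<in> borel_measurable borel" and v: "\<And>x. norm (v x) \<le> b"
    and lip: "\<And>x y. norm (v x - v y) \<le> L / \<epsilon> * norm (x - y)" and L: "L > 0" and \<epsilon>: "\<epsilon> > 0"
    and \<xi>: "norm \<xi> \<le> 1" and p: "q \<le> p" and \<alpha>: "\<alpha> = real CARD('m) + \<sigma>"
  shows "energy p \<alpha> (\<lambda>x. err \<delta> (v x - \<xi>)) \<le>
    ennreal ((2 * err_max) powr (p - q) * (2 * C) powr q * max (2 * b) L powr q) *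
    (2 * ((ennreal (\<epsilon> powr (-\<sigma>)) * (\<integral>\<^sup>+z. ennreal (min 1 (norm z) powr q / norm z powr \<alpha>) \<partial>(lborel :: (real^'m) measure))) * bad_lpint \<delta> v \<xi>))"
    (is "_ \<le> ennreal (?K * ?M powr q) * (2 * (?c * _))")
proof -
  define F where "F x = bad_weight \<delta> (v x - \<xi>) * indicator open_cube x" for x
  define ker where "ker x y = ennreal (min 1 (norm (x - y) / \<epsilon>) powr q / norm (x - y) powr \<alpha>)" for x y :: "real^'m"
  have M: "?M \<ge> 0" using b(2) by simp
  have K: "?K \<ge> 0" by simp
  have [measurable]: "F \<in> borel_measurable borel" unfolding F_def[abs_def] by measurable
  have kerm [measurable]: "(\<lambda>z. ker (fst z) (snd z)) \<in> borel_measurable (lborel \<Otimes>\<^sub>M lborel)" "\<And>x. ker x \<in> borel_measurable borel"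
    unfolding ker_def[abs_def] by measurable
  have Fin: "(\<integral>\<^sup>+x. F x \<partial>lborel) = bad_lpint \<delta> v \<xi>" by (simp add: F_def bad_lpint_def)
  have pt: "ed p \<alpha> (\<lambda>x. err \<delta> (v x - \<xi>)) x y \<le> ennreal (?K * ?M powr q) * (ker x y * F x + ker x y * F y)" for x y
  proof (cases "x \<in> open_cube \<and> y \<in> open_cube")
    case True
    let ?m = "min 1 (norm (x - y) / \<epsilon>)" and ?D = "norm (x - y) powr \<alpha>"
    have n: "norm (v x - \<xi>) \<le> b + 1" for x using norm_triangle_ineq4[of "v x" \<xi>] v[of x] \<xi> by linarith
    have m0: "?m \<ge> 0" using \<epsilon> by simp
    have T: "norm (v x - v y) \<le> ?M * ?m"
    proof (cases "norm (x - y) / \<epsilon> \<le> 1")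
      case True
      have "norm (v x - v y) \<le> L * (norm (x - y) / \<epsilon>)" using lip[of x y] by simp
      also have "\<dots> \<le> ?M * (norm (x - y) / \<epsilon>)" using \<epsilon> by (intro mult_right_mono) auto
      finally show ?thesis using True by (simp only: min_absorb2)
    next
      case False
      have "norm (v x - v y) \<le> 2 * b" using norm_triangle_ineq4[of "v x" "v y"] v[of x] v[of y] by linarith
      then show ?thesis using False by (simp add: min_def max_def)
    qed
    have "ennreal (norm (err \<delta> (v x - \<xi>) - err \<delta> (v y - \<xi>)) powr p)
        \<le> ennreal (?K * norm ((v x - \<xi>) - (v y - \<xi>)) powr q) * (bad_weight \<delta> (v x - \<xi>) + bad_weight \<delta> (v y - \<xi>))"
      by (rule err_diff_le[OF \<delta> n n p])
    also have "\<dots> \<le> ennreal (?K * (?M * ?m) powr q) * (bad_weight \<delta> (v x - \<xi>) + bad_weight \<delta> (v y - \<xi>))"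
      using T q by (intro mult_right_mono ennreal_leI mult_left_mono powr_mono2) auto
    finally have 1: "ennreal (norm (err \<delta> (v x - \<xi>) - err \<delta> (v y - \<xi>)) powr p)
        \<le> ennreal (?K * (?M * ?m) powr q) * (F x + F y)" using True by (simp add: F_def)
    have "ed p \<alpha> (\<lambda>x. err \<delta> (v x - \<xi>)) x y = ennreal (norm (err \<delta> (v x - \<xi>) - err \<delta> (v y - \<xi>)) powr p * (1 / ?D))"
      using True by (simp add: ed_def)
    also have "\<dots> = ennreal (norm (err \<delta> (v x - \<xi>) - err \<delta> (v y - \<xi>)) powr p) * ennreal (1 / ?D)"
      by (rule ennreal_mult) auto
    also have "\<dots> \<le> (ennreal (?K * (?M * ?m) powr q) * (F x + F y)) * ennreal (1 / ?D)"
      using 1 by (rule mult_right_mono) simp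
    also have "\<dots> = (ennreal (?K * (?M * ?m) powr q) * ennreal (1 / ?D)) * (F x + F y)" by (simp add: ac_simps)
    also have "ennreal (?K * (?M * ?m) powr q) * ennreal (1 / ?D) = ennreal (?K * (?M * ?m) powr q * (1 / ?D))"
      by (rule ennreal_mult[symmetric]) auto
    also have "?K * (?M * ?m) powr q * (1 / ?D) = (?K * ?M powr q) * (?m powr q / ?D)"
      using M m0 by (simp add: powr_mult)
    also have "ennreal \<dots> = ennreal (?K * ?M powr q) * ker x y"
      unfolding ker_def by (rule ennreal_mult) auto
    finally show ?thesis by (simp add: distrib_left mult.assoc)
  next
    case False
    then show ?thesis by (auto simp: ed_def)
  qed
  have kin: "(\<integral>\<^sup>+y. ker x y \<partial>lborel) = ?c" for x
    unfolding ker_def by (rule nn_integral_kernel_scaled[OF \<epsilon> \<alpha>])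
  have A: "(\<integral>\<^sup>+x. \<integral>\<^sup>+y. ker x y * F x \<partial>lborel \<partial>lborel) = ?c * bad_lpint \<delta> v \<xi>"
  proof -
    have "(\<integral>\<^sup>+y. ker x y * F x \<partial>lborel) = ?c * F x" for x
      by (subst nn_integral_multc) (auto simp: kin)
    then show ?thesis by (simp add: nn_integral_cmult Fin)
  qed
  have B: "(\<integral>\<^sup>+x. \<integral>\<^sup>+y. ker x y * F y \<partial>lborel \<partial>lborel) = ?c * bad_lpint \<delta> v \<xi>"
  proof -
    have "(\<integral>\<^sup>+x. \<integral>\<^sup>+y. ker x y * F y \<partial>lborel \<partial>lborel) = (\<integral>\<^sup>+y. \<integral>\<^sup>+x. ker x y * F y \<partial>lborel \<partial>lborel)"
      by (rule lborel_pair.Fubini'[symmetric]) (simp add: case_prod_beta)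
    also have "\<dots> = (\<integral>\<^sup>+y. \<integral>\<^sup>+x. ker y x * F y \<partial>lborel \<partial>lborel)" by (simp add: ker_def norm_minus_commute)
    finally show ?thesis using A by simp
  qed
  have "energy p \<alpha> (\<lambda>x. err \<delta> (v x - \<xi>))
      \<le> (\<integral>\<^sup>+x. \<integral>\<^sup>+y. ennreal (?K * ?M powr q) * (ker x y * F x + ker x y * F y) \<partial>lborel \<partial>lborel)"
    unfolding energy_def by (intro nn_integral_mono pt)
  also have "\<dots> = (\<integral>\<^sup>+x. ennreal (?K * ?M powr q) * ((\<integral>\<^sup>+y. ker x y * F x \<partial>lborel) + (\<integral>\<^sup>+y. ker x y * F y \<partial>lborel)) \<partial>lborel)"
    by (intro nn_integral_cong) (simp add: nn_integral_cmult nn_integral_add)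
  also have "\<dots> = ennreal (?K * ?M powr q) * ((\<integral>\<^sup>+x. \<integral>\<^sup>+y. ker x y * F x \<partial>lborel \<partial>lborel) + (\<integral>\<^sup>+x. \<integral>\<^sup>+y. ker x y * F y \<partial>lborel \<partial>lborel))"
  proof -
    have [measurable]: "(\<lambda>x. \<integral>\<^sup>+y. ker x y * F x \<partial>lborel) \<in> borel_measurable lborel" "(\<lambda>x. \<integral>\<^sup>+y. ker x y * F y \<partial>lborel) \<in> borel_measurable lborel"
      by (rule lborel.borel_measurable_nn_integral, simp add: case_prod_beta)+
    show ?thesis by (subst nn_integral_cmult, measurable, subst nn_integral_add, measurable)
  qed
  also have "\<dots> = ennreal (?K * ?M powr q) * (2 * (?c * bad_lpint \<delta> v \<xi>))" by (simp only: A B mult_2)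
  finally show ?thesis .
qed

lemma gap_tail_small:
  assumes \<eta>: "\<eta> > 0"
  shows "\<exists>\<delta>>0. gap_tail \<delta> < ennreal \<eta>"
proof -
  let ?W = "\<lambda>a. gapw k h q a * indicator (cball 0 (b + 1)) (a :: real^'v) :: ennreal"
  have W: "(\<integral>\<^sup>+a. ?W a \<partial>(lborel :: (real^'v) measure)) < \<infinity>" by (rule nn_integral_gapw_finite[OF q pos(3)])
  have "(\<lambda>i. \<integral>\<^sup>+a. gapw k h q a * indicator {a. gap k ((1/h) *\<^sub>R a) < 2 * (1 / real (Suc i))} a * indicator (cball 0 (b + 1)) a \<partial>(lborel :: (real^'v) measure))
      \<longlonglongrightarrow> (\<integral>\<^sup>+a. 0 \<partial>(lborel :: (real^'v) measure))"
  proof (rule nn_integral_dominated_convergence[where w="?W"])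
    show "AE a in (lborel :: (real^'v) measure). gapw k h q a * indicator {a. gap k ((1/h) *\<^sub>R a) < 2 * (1 / real (Suc i))} a * indicator (cball 0 (b + 1)) a \<le> ?W a" for i
      by (intro AE_I2) (auto simp: indicator_def)
    \<comment> \<open>An integrable weight is finite almost everywhere, so the gap is positive there
      and the shrinking neighbourhoods of the dual skeleton eventually miss the point.\<close>
    have "AE a in (lborel :: (real^'v) measure). ?W a \<noteq> \<infinity>"
      proof (rule nn_integral_PInf_AE)
      show "?W \<in> borel_measurable lborel" by measurable
    qed (use W in auto)
    then show "AE a in (lborel :: (real^'v) measure). (\<lambda>i. gapw k h q a * indicator {a. gap k ((1/h) *\<^sub>R a) < 2 * (1 / real (Suc i))} a * indicator (cball 0 (b + 1)) a) \<longlonglongrightarrow> 0"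
    proof eventually_elim
      case (elim a)
      show ?case
      proof (cases "a \<in> cball 0 (b + 1)")
        case True
        then have "gapw k h q a \<noteq> \<infinity>" using elim by simp
        then have "gap k ((1/h) *\<^sub>R a) \<noteq> 0" by (auto simp: gapw_def)
        then have g: "0 < gap k ((1/h) *\<^sub>R a)" using gap_nonneg[of k "(1/h) *\<^sub>R a"] by linarith
        have "(\<lambda>i. 2 * (1 / real (Suc i))) \<longlonglongrightarrow> 2 * 0"
          using LIMSEQ_inverse_real_of_nat by (intro tendsto_mult tendsto_const) (simp add: inverse_eq_divide)
        then have "\<forall>\<^sub>F i in sequentially. 2 * (1 / real (Suc i)) < gap k ((1/h) *\<^sub>R a)"
          using g by (intro order_tendstoD(2)) auto
        then have "\<forall>\<^sub>F i in sequentially. gapw k h q a * indicator {a. gap k ((1/h) *\<^sub>R a) < 2 * (1 / real (Suc i))} a * indicator (cball 0 (b + 1)) a = 0"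
        proof eventually_elim
          case (elim i)
          then show ?case by (simp add: indicator_def del: of_nat_Suc)
        qed
        then show ?thesis by (rule tendsto_eventually)
      qed simp
    qed
    show "(\<integral>\<^sup>+a. ?W a \<partial>lborel) < \<infinity>" by (rule W)
  qed measurable
  then have "(\<lambda>i. gap_tail (1 / real (Suc i))) \<longlonglongrightarrow> 0" by (simp add: gap_tail_def)
  then have "\<forall>\<^sub>F i in sequentially. gap_tail (1 / real (Suc i)) < ennreal \<eta>"
    by (rule order_tendstoD) (use \<eta> in simp)
  then obtain i where "gap_tail (1 / real (Suc i)) < ennreal \<eta>" by (auto simp: eventually_sequentially)
  then show ?thesis by (intro exI[of _ "1 / real (Suc i)"]) simp
qed

text \<open>After Tonelli's theorem, v x - \<xi> sweeps a ball of the target for fixed x. If |v x -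
  u x| > \<iota>/2 the whole weight is paid, and Chebyshev's inequality supplies the factor (2 |v x
  - u x| / \<iota>)^p \<ge> 1. Otherwise |\<xi>| \<le> \<iota>/2 keeps every translate within
  \<iota> of N, and it can be bad only through its gap.\<close>

lemma nn_integral_bad_lpint_le:
  fixes v u :: "real^'m \<Rightarrow> real^'v"
  assumes \<delta>: "\<delta> > 0" and [measurable]: "v \<in> borel_measurable borel" "u \<in> borel_measurable borel" and v: "\<And>x. norm (v x) \<le> b" and u: "\<And>x. u x \<in> N"
    and r: "0 < r" "r \<le> 1" "r \<le> \<iota> / 2" and p: "p \<ge> 1"
  shows "(\<integral>\<^sup>+\<xi>. bad_lpint \<delta> v \<xi> * indicator (cball 0 r) \<xi> \<partial>lborel)
    \<le> (\<integral>\<^sup>+a. gapw k h q a * indicator (cball 0 (b + 1)) a \<partial>(lborel :: (real^'v) measure)) * ennreal ((2 / \<iota>) powr p) * lpint p (\<lambda>x. v x - u x)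
      + gap_tail \<delta> * emeasure lborel (open_cube :: (real^'m) set)"
proof -
  define W0 where "W0 = (\<integral>\<^sup>+a. gapw k h q a * indicator (cball 0 (b + 1)) a \<partial>(lborel :: (real^'v) measure))"
  let ?B = "cball 0 r :: (real^'v) set"
  have reflect: "(\<integral>\<^sup>+\<xi>. f (t - \<xi>) \<partial>lborel) = (\<integral>\<^sup>+a. f a \<partial>lborel)" if "f \<in> borel_measurable borel" for f :: "real^'v \<Rightarrow> ennreal" and t
    using nn_integral_lborel_affine[OF that, of "-1" t] by simp
  have n: "norm (v x - \<xi>) \<le> b + 1" if "\<xi> \<in> ?B" for x \<xi>
    using norm_triangle_ineq4[of "v x" \<xi>] v[of x] that r by simp
  have pt: "(\<integral>\<^sup>+\<xi>. bad_weight \<delta> (v x - \<xi>) * indicator ?B \<xi> \<partial>lborel) \<le> W0 * (ennreal ((2 / \<iota>) powr p) * ennreal (norm (v x - u x) powr p)) + gap_tail \<delta>" for x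
  proof (cases "\<iota> / 2 < norm (v x - u x)")
    case True
    have "(\<integral>\<^sup>+\<xi>. bad_weight \<delta> (v x - \<xi>) * indicator ?B \<xi> \<partial>lborel)
        \<le> (\<integral>\<^sup>+\<xi>. gapw k h q (v x - \<xi>) * indicator (cball 0 (b + 1)) (v x - \<xi>) \<partial>lborel)"
      using n[of _ x] by (intro nn_integral_mono) (auto simp: bad_weight_def indicator_def)
    also have "\<dots> = W0" unfolding W0_def
      by (rule reflect[of "\<lambda>a. gapw k h q a * indicator (cball 0 (b + 1)) a"]) measurable
    also have "\<dots> \<le> W0 * (ennreal ((2 / \<iota>) powr p) * ennreal (norm (v x - u x) powr p))"
    proof -
      have "1 \<le> (2 / \<iota> * norm (v x - u x)) powr p" using True pos p by (intro ge_one_powr_ge_zero) (auto simp: field_simps)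
      also have "\<dots> = (2 / \<iota>) powr p * norm (v x - u x) powr p" by (rule powr_mult)
      finally have "ennreal 1 \<le> ennreal ((2 / \<iota>) powr p * norm (v x - u x) powr p)" by (rule ennreal_leI)
      then have "1 \<le> ennreal ((2 / \<iota>) powr p) * ennreal (norm (v x - u x) powr p)" by (simp add: ennreal_mult)
      then have "W0 * 1 \<le> W0 * (ennreal ((2 / \<iota>) powr p) * ennreal (norm (v x - u x) powr p))" by (intro mult_left_mono) auto
      then show ?thesis by simp
    qed
    finally show ?thesis by (rule order_trans) simp
  next
    case False
    let ?G = "{a::real^'v. gap k ((1/h) *\<^sub>R a) < 2 * \<delta>}"
    have [measurable]: "?G \<in> sets borel" by measurable
    have "(\<integral>\<^sup>+\<xi>. bad_weight \<delta> (v x - \<xi>) * indicator ?B \<xi> \<partial>lborel)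
        \<le> (\<integral>\<^sup>+\<xi>. gapw k h q (v x - \<xi>) * indicator ?G (v x - \<xi>) * indicator (cball 0 (b + 1)) (v x - \<xi>) \<partial>lborel)"
    proof (rule nn_integral_mono)
      fix \<xi>
      show "bad_weight \<delta> (v x - \<xi>) * indicator ?B \<xi> \<le> gapw k h q (v x - \<xi>) * indicator ?G (v x - \<xi>) * indicator (cball 0 (b + 1)) (v x - \<xi>)"
      proof (cases "\<xi> \<in> ?B")
        case True
        have "infdist (v x - \<xi>) N \<le> dist (v x - \<xi>) (u x)" by (rule infdist_le[OF u])
        also have "\<dots> \<le> norm (v x - u x) + norm \<xi>"
          using norm_triangle_ineq4[of "v x - u x" \<xi>] by (simp add: dist_norm algebra_simps)
        also have "\<dots> \<le> \<iota>" using False True r by simp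
        finally have "infdist (v x - \<xi>) N \<le> \<iota>" .
        then have "indicator (bad \<delta>) (v x - \<xi>) \<le> (indicator ?G (v x - \<xi>) :: ennreal)" by (auto simp: bad_def indicator_def)
        then have "bad_weight \<delta> (v x - \<xi>) \<le> gapw k h q (v x - \<xi>) * indicator ?G (v x - \<xi>)"
          unfolding bad_weight_def by (rule mult_left_mono) simp
        moreover have "v x - \<xi> \<in> cball 0 (b + 1)" using n[OF True, of x] by simp
        ultimately show ?thesis using True by (simp only: indicator_simps) simp
      qed simp
    qed
    also have "\<dots> = gap_tail \<delta>" unfolding gap_tail_def
      by (rule reflect[of "\<lambda>a. gapw k h q a * indicator ?G a * indicator (cball 0 (b + 1)) a"]) measurable
    finally show ?thesis by (rule order_trans) simp
  qed
  have "(\<integral>\<^sup>+\<xi>. bad_lpint \<delta> v \<xi> * indicator ?B \<xi> \<partial>lborel)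
      = (\<integral>\<^sup>+\<xi>. \<integral>\<^sup>+x. (bad_weight \<delta> (v x - \<xi>) * indicator open_cube x) * indicator ?B \<xi> \<partial>lborel \<partial>lborel)"
    unfolding bad_lpint_def by (intro nn_integral_cong nn_integral_multc[symmetric]) measurable
  also have "\<dots> = (\<integral>\<^sup>+x. \<integral>\<^sup>+\<xi>. (bad_weight \<delta> (v x - \<xi>) * indicator open_cube x) * indicator ?B \<xi> \<partial>lborel \<partial>lborel)"
    by (rule lborel_pair.Fubini') (unfold case_prod_beta, measurable)
  also have "\<dots> = (\<integral>\<^sup>+x. (\<integral>\<^sup>+\<xi>. bad_weight \<delta> (v x - \<xi>) * indicator ?B \<xi> \<partial>lborel) * indicator open_cube x \<partial>lborel)"
  proof (rule nn_integral_cong)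
    fix x :: "real^'m"
    show "(\<integral>\<^sup>+\<xi>. (bad_weight \<delta> (v x - \<xi>) * indicator open_cube x) * indicator ?B \<xi> \<partial>lborel)
        = (\<integral>\<^sup>+\<xi>. bad_weight \<delta> (v x - \<xi>) * indicator ?B \<xi> \<partial>lborel) * indicator open_cube x"
      by (cases "x \<in> open_cube") simp_all
  qed
  also have "\<dots> \<le> (\<integral>\<^sup>+x. W0 * ennreal ((2 / \<iota>) powr p) * (ennreal (norm (v x - u x) powr p) * indicator open_cube x) + gap_tail \<delta> * indicator open_cube x \<partial>lborel)"
  proof (rule nn_integral_mono)
    fix x :: "real^'m"
    show "(\<integral>\<^sup>+\<xi>. bad_weight \<delta> (v x - \<xi>) * indicator ?B \<xi> \<partial>lborel) * indicator open_cube x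
        \<le> W0 * ennreal ((2 / \<iota>) powr p) * (ennreal (norm (v x - u x) powr p) * indicator open_cube x) + gap_tail \<delta> * indicator open_cube x"
      using pt[of x] by (cases "x \<in> open_cube") (simp_all add: mult.assoc)
  qed
  also have "\<dots> = W0 * ennreal ((2 / \<iota>) powr p) * lpint p (\<lambda>x. v x - u x) + gap_tail \<delta> * emeasure lborel (open_cube :: (real^'m) set)"
  proof -
    define A where "A = W0 * ennreal ((2 / \<iota>) powr p)"
    have "(\<integral>\<^sup>+x. A * (ennreal (norm (v x - u x) powr p) * indicator open_cube x) + gap_tail \<delta> * indicator open_cube x \<partial>(lborel :: (real^'m) measure))
      = (\<integral>\<^sup>+x. A * (ennreal (norm (v x - u x) powr p) * indicator open_cube x) \<partial>(lborel :: (real^'m) measure)) + (\<integral>\<^sup>+x. gap_tail \<delta> * indicator open_cube x \<partial>(lborel :: (real^'m) measure))"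
      by (rule nn_integral_add) measurable
    also have "(\<integral>\<^sup>+x. A * (ennreal (norm (v x - u x) powr p) * indicator open_cube x) \<partial>(lborel :: (real^'m) measure)) = A * lpint p (\<lambda>x. v x - u x)"
      unfolding lpint_def by (rule nn_integral_cmult) measurable
    also have "(\<integral>\<^sup>+x. gap_tail \<delta> * indicator open_cube x \<partial>(lborel :: (real^'m) measure)) = gap_tail \<delta> * emeasure lborel (open_cube :: (real^'m) set)"
      by (rule nn_integral_cmult_indicator) simp
    finally show ?thesis unfolding A_def .
  qed
  finally show ?thesis unfolding W0_def .
qed

end

lemma two_powr_add_less:
  assumes \<eta>: "\<eta> > 0" and X: "X \<le> ennreal (\<eta> / (4 * 2 powr p))" and Y: "Y \<le> ennreal (\<eta> / (4 * 2 powr p))"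
  shows "ennreal (2 powr p) * (X + Y) < ennreal \<eta>"
proof -
  let ?e = "\<eta> / (4 * 2 powr p)"
  have e: "0 \<le> ?e" using \<eta> by simp
  have "ennreal (2 powr p) * (X + Y) \<le> ennreal (2 powr p) * (ennreal ?e + ennreal ?e)"
    by (intro mult_left_mono add_mono X Y) auto
  also have "\<dots> = ennreal (2 powr p * (?e + ?e))"
    by (simp only: ennreal_plus[OF e e, symmetric] ennreal_mult[OF powr_ge_zero add_nonneg_nonneg[OF e e]])
  also have "2 powr p * (?e + ?e) = \<eta> / 2" by simp
  also have "ennreal (\<eta> / 2) < ennreal \<eta>" using \<eta> by (intro ennreal_lessI) auto
  finally show ?thesis .
qed

context bounded_singular_retraction
begin

text \<open>A mean value argument: if every \<xi> of the ball failed, the integral over the ball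
  would be at least \<tau> times its volume. The factor E stands for \<epsilon>^(-\<sigma>) and is
  kept with the L^p distance, where the rate of the averages compensates it.\<close>

lemma small_bad_translate:
  fixes v u :: "real^'m \<Rightarrow> real^'v"
  assumes \<delta>: "\<delta> > 0" and vm[measurable]: "v \<in> borel_measurable borel" and um: "u \<in> borel_measurable borel" and v: "\<And>x. norm (v x) \<le> b" and u: "\<And>x. u x \<in> N"
    and r: "0 < r" "r \<le> 1" "r \<le> \<iota> / 2" and p: "p \<ge> 1" and E: "E \<ge> 0" and \<tau>: "\<tau> > 0"
    and w0: "(\<integral>\<^sup>+a. gapw k h q a * indicator (cball 0 (b + 1)) a \<partial>(lborel :: (real^'v) measure)) = ennreal w0" "w0 \<ge> 0"
    and lp: "ennreal E * lpint p (\<lambda>x. v x - u x) \<le> ennreal l" "l \<ge> 0" and tail: "gap_tail \<delta> \<le> ennreal t" "t \<ge> 0"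
    and small: "w0 * (2 / \<iota>) powr p * l + E * t * measure lborel (open_cube :: (real^'m) set) < \<tau> * measure lborel (cball 0 r :: (real^'v) set)"
  shows "\<exists>\<xi>. norm \<xi> \<le> r \<and> ennreal E * bad_lpint \<delta> v \<xi> \<le> ennreal \<tau>"
proof (rule ccontr)
  let ?B = "cball 0 r :: (real^'v) set" and ?Q = "open_cube :: (real^'m) set"
  assume neg: "\<not> ?thesis"
  have ge: "ennreal \<tau> \<le> ennreal E * bad_lpint \<delta> v \<xi>" if "\<xi> \<in> ?B" for \<xi>
  proof -
    have "norm \<xi> \<le> r" using that by simp
    then show ?thesis using neg by (meson linear)
  qed
  have [measurable]: "bad_lpint \<delta> v \<in> borel_measurable borel"
  proof -
    have "(\<lambda>\<xi>. \<integral>\<^sup>+x. bad_weight \<delta> (v x - \<xi>) * indicator open_cube x \<partial>lborel) \<in> borel_measurable lborel"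
      by (rule lborel.borel_measurable_nn_integral) (unfold case_prod_beta, measurable)
    then show ?thesis by (simp add: bad_lpint_def[abs_def])
  qed
  have Q: "emeasure lborel ?Q = ennreal (measure lborel ?Q)"
    unfolding open_cube_eq_box using emeasure_lborel_box_finite[of "-1" "1 :: real^'m"] by (intro emeasure_eq_ennreal_measure) auto
  have B: "emeasure lborel ?B = ennreal (measure lborel ?B)"
    using emeasure_lborel_cball_finite[of "0::real^'v" r] by (intro emeasure_eq_ennreal_measure) auto
  have "ennreal (\<tau> * measure lborel ?B) = ennreal \<tau> * emeasure lborel ?B"
    using \<tau> by (simp add: B ennreal_mult)
  also have "\<dots> = (\<integral>\<^sup>+\<xi>. ennreal \<tau> * indicator ?B \<xi> \<partial>lborel)"
    by (rule nn_integral_cmult_indicator[symmetric]) simp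
  also have "\<dots> \<le> (\<integral>\<^sup>+\<xi>. ennreal E * (bad_lpint \<delta> v \<xi> * indicator ?B \<xi>) \<partial>lborel)"
  proof (rule nn_integral_mono)
    fix \<xi>
    show "ennreal \<tau> * indicator ?B \<xi> \<le> ennreal E * (bad_lpint \<delta> v \<xi> * indicator ?B \<xi>)"
      using ge[of \<xi>] by (cases "\<xi> \<in> ?B") simp_all
  qed
  also have "\<dots> = ennreal E * (\<integral>\<^sup>+\<xi>. bad_lpint \<delta> v \<xi> * indicator ?B \<xi> \<partial>lborel)"
    by (rule nn_integral_cmult) measurable
  also have "\<dots> \<le> ennreal E * (ennreal w0 * ennreal ((2 / \<iota>) powr p) * lpint p (\<lambda>x. v x - u x) + gap_tail \<delta> * emeasure lborel ?Q)"
    by (rule mult_left_mono[OF nn_integral_bad_lpint_le[OF \<delta> vm um v u r p, unfolded w0(1)]]) simp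
  also have "\<dots> = (ennreal w0 * ennreal ((2 / \<iota>) powr p)) * (ennreal E * lpint p (\<lambda>x. v x - u x)) + ennreal E * (gap_tail \<delta> * emeasure lborel ?Q)"
    by (simp add: distrib_left ac_simps)
  also have "\<dots> \<le> (ennreal w0 * ennreal ((2 / \<iota>) powr p)) * ennreal l + ennreal E * (ennreal t * ennreal (measure lborel ?Q))"
    unfolding Q by (intro add_mono mult_left_mono mult_right_mono lp tail) auto
  also have "\<dots> = ennreal (w0 * (2 / \<iota>) powr p * l + E * t * measure lborel ?Q)"
    using w0(2) lp(2) tail(2) E by (simp add: ennreal_mult[symmetric] ennreal_plus[symmetric] mult.assoc del: ennreal_plus)
  also have "\<dots> < ennreal (\<tau> * measure lborel ?B)"
    using small w0(2) lp(2) tail(2) E by (intro ennreal_lessI) (auto intro!: add_nonneg_nonneg mult_nonneg_nonneg elim: le_less_trans[rotated])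
  finally show False by simp
qed

theorem lipschitz_approximation:
  fixes u :: "real^'m \<Rightarrow> real^'v"
  assumes u[measurable]: "u \<in> borel_measurable borel" and uN: "\<And>x. u x \<in> N"
    and \<alpha>: "\<alpha> = real CARD('m) + \<sigma>" and \<sigma>: "0 < \<sigma>" "\<sigma> < q" and p: "q \<le> p" "1 \<le> p"
    and fin: "energy p \<alpha> u < \<infinity>" and \<eta>: "\<eta> > 0"
  shows "\<exists>f K. (\<forall>x. f x \<in> N) \<and> (\<forall>x y. norm (f x - f y) \<le> K * norm (x - y)) \<and>
    energy p \<alpha> (\<lambda>x. f x - u x) < ennreal \<eta> \<and> lpint p (\<lambda>x. f x - u x) < ennreal \<eta>"
proof -
  have ub: "norm (u x) \<le> b" for x by (rule b(1)[OF uN])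
  have \<sigma>0: "\<sigma> \<ge> 0" using \<sigma> by simp
  have Pu: "P (u x) = u x" for x by (rule P_id[OF uN])
  obtain \<phi> :: "real^'m \<Rightarrow> real" and A where \<phi>: "mollifier \<phi> A" using mollifier_exists by blast
  obtain e :: "nat \<Rightarrow> real" where e: "\<forall>j. 0 < e j \<and> e j \<le> 1 / real (j + 2) \<and>
      ennreal (e j powr (-\<sigma>)) * lpint p (\<lambda>x. avg \<phi> (e j) u x - u x) \<le> ennreal ((1/2) ^ j)"
    using avg_good_sequence[OF \<phi> u ub p(2) \<alpha> \<sigma>0 fin] ..
  have e': "0 < e j" "e j \<le> 1 / real (j + 2)"
      "ennreal (e j powr (-\<sigma>)) * lpint p (\<lambda>x. avg \<phi> (e j) u x - u x) \<le> ennreal ((1/2) ^ j)" for j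
    using e by auto
  obtain L where L: "L > 0" "\<forall>\<epsilon> x y. 0 < \<epsilon> \<longrightarrow> \<epsilon> \<le> 1 \<longrightarrow> norm (avg \<phi> \<epsilon> u x - avg \<phi> \<epsilon> u y) \<le> L / \<epsilon> * norm (x - y)"
    using avg_lipschitz[OF \<phi> u ub] by blast
  define \<eta>' where "\<eta>' = \<eta> / (4 * 2 powr p)"
  have \<eta>': "\<eta>' > 0" using \<eta> by (simp add: \<eta>'_def)
  have two: "ennreal (2 powr p) * (X + Y) < ennreal \<eta>" if "X \<le> ennreal \<eta>'" "Y \<le> ennreal \<eta>'" for X Y
    using two_powr_add_less[OF \<eta>] that by (simp add: \<eta>'_def)
  define J where "J = (\<integral>\<^sup>+z. ennreal (min 1 (norm z) powr q / norm z powr \<alpha>) \<partial>(lborel :: (real^'m) measure))"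
  have "J < \<infinity>" unfolding J_def \<alpha> by (rule nn_integral_kernel_finite[OF \<sigma>])
  then obtain j0 where j0: "J = ennreal j0" "j0 \<ge> 0" by (cases J) auto
  have "(\<integral>\<^sup>+a. gapw k h q a * indicator (cball 0 (b + 1)) a \<partial>(lborel :: (real^'v) measure)) < \<infinity>"
    by (rule nn_integral_gapw_finite[OF q pos(3)])
  then obtain w0 where w0: "(\<integral>\<^sup>+a. gapw k h q a * indicator (cball 0 (b + 1)) a \<partial>(lborel :: (real^'v) measure)) = ennreal w0" "w0 \<ge> 0"
    by (cases "(\<integral>\<^sup>+a. gapw k h q a * indicator (cball 0 (b + 1)) a \<partial>(lborel :: (real^'v) measure))") auto
  define Kc where "Kc = (2 * err_max) powr (p - q) * (2 * C) powr q * max (2 * b) L powr q"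
  have Kc: "Kc \<ge> 0" by (simp add: Kc_def)
  \<comment> \<open>The admissible size of the weighted bad integral: both the energy constant 2 Kc
    j0 and the L^p constant err_max^p times \<tau> must stay below \<eta>'.\<close>
  define \<tau> where "\<tau> = \<eta>' / (1 + 2 * Kc * j0 + err_max powr p)"
  have den: "1 + 2 * Kc * j0 + err_max powr p > 0" using Kc j0 by (intro add_pos_nonneg) auto
  have \<tau>: "\<tau> > 0" unfolding \<tau>_def using \<eta>' den by simp
  have \<tau>\<eta>: "(1 + 2 * Kc * j0 + err_max powr p) * \<tau> = \<eta>'" unfolding \<tau>_def using den by simp
  have \<tau>1: "2 * Kc * j0 * \<tau> \<le> \<eta>'" "err_max powr p * \<tau> \<le> \<eta>'"
  proof -
    have "2 * Kc * j0 * \<tau> \<le> (1 + 2 * Kc * j0 + err_max powr p) * \<tau>" using \<tau> by (intro mult_right_mono) auto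
    then show "2 * Kc * j0 * \<tau> \<le> \<eta>'" by (simp only: \<tau>\<eta>)
    have "err_max powr p * \<tau> \<le> (1 + 2 * Kc * j0 + err_max powr p) * \<tau>" using \<tau> Kc j0 by (intro mult_right_mono) auto
    then show "err_max powr p * \<tau> \<le> \<eta>'" by (simp only: \<tau>\<eta>)
  qed
  obtain r0 J0 where r0: "r0 > 0" and J0: "\<forall>j\<ge>J0. \<forall>\<xi>. norm \<xi> \<le> r0 \<longrightarrow>
    energy p \<alpha> (\<lambda>x. P (avg \<phi> (e j) u x - \<xi>) - u x) < ennreal \<eta>' \<and>
    lpint p (\<lambda>x. P (avg \<phi> (e j) u x - \<xi>) - u x) < ennreal \<eta>'"
    using avg_compose_small[OF \<phi> u ub p(2) \<sigma>0 fin P_lip Pu pos(1) e' \<eta>'] by blast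
  \<comment> \<open>Fixed before the scale, because the volume of the ball of translations enters
    the smallness demanded of the scale.\<close>
  define r where "r = min r0 (min 1 (\<iota> / 2))"
  have r: "0 < r" "r \<le> 1" "r \<le> \<iota> / 2" "r \<le> r0" using r0 pos by (auto simp: r_def)
  define V where "V = measure lborel (cball 0 r :: (real^'v) set)"
  have V: "V > 0" unfolding V_def using r by (intro content_cball_pos) auto
  define Q where "Q = measure lborel (open_cube :: (real^'m) set)"
  have Q: "Q \<ge> 0" by (simp add: Q_def)
  define c1 where "c1 = w0 * (2 / \<iota>) powr p"
  have c1: "c1 \<ge> 0" using w0 by (simp add: c1_def)
  have "(\<lambda>j. c1 * (1/2) ^ j) \<longlonglongrightarrow> c1 * 0" by (intro tendsto_mult tendsto_const LIMSEQ_realpow_zero) auto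
  then have "\<forall>\<^sub>F j in sequentially. c1 * (1/2) ^ j < \<tau> * V / 2"
    using \<tau> V by (intro order_tendstoD(2)) auto
  then have "\<forall>\<^sub>F j in sequentially. c1 * (1/2) ^ j < \<tau> * V / 2 \<and> J0 \<le> j" by (rule eventually_conj) (rule eventually_ge_at_top)
  then obtain j where j: "c1 * (1/2) ^ j < \<tau> * V / 2" "J0 \<le> j" by (auto simp: eventually_sequentially)
  define \<epsilon> where "\<epsilon> = e j"
  have "1 / real (j + 2) \<le> 1 / 1" by (intro divide_left_mono) auto
  then have \<epsilon>: "0 < \<epsilon>" "\<epsilon> \<le> 1" using e'(1)[of j] e'(2)[of j] unfolding \<epsilon>_def by linarith+
  define v where "v = avg \<phi> \<epsilon> u"
  have vm[measurable]: "v \<in> borel_measurable borel"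
    unfolding v_def by (intro borel_measurable_continuous_onI continuous_avg[OF \<phi> u ub \<epsilon>])
  have vb: "norm (v x) \<le> b" for x unfolding v_def by (rule avg_bound[OF \<phi> u ub])
  have vlip: "norm (v x - v y) \<le> L / \<epsilon> * norm (x - y)" for x y using L(2) \<epsilon> by (simp add: v_def)
  define E where "E = \<epsilon> powr (-\<sigma>)"
  have E1: "E \<ge> 1"
  proof -
    have "1 = 1 powr (-\<sigma>)" by simp
    also have "\<dots> \<le> \<epsilon> powr (-\<sigma>)" using \<epsilon> \<sigma> by (intro powr_mono2') auto
    finally show ?thesis by (simp add: E_def)
  qed
  \<comment> \<open>The scale is now fixed, so E is a mere number and the tail can be made small
    relative to it; the cut-off \<delta> is chosen to that end. Q + 1 keeps the denominator
    positive.\<close>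
  define t where "t = \<tau> * V / (2 * (E * (Q + 1)))"
  have EQ: "E * (Q + 1) > 0" using E1 Q by simp
  have t: "t > 0" unfolding t_def using \<tau> V EQ by simp
  obtain \<delta> where \<delta>: "\<delta> > 0" "gap_tail \<delta> < ennreal t" using gap_tail_small[OF t] by blast
  have EtQ: "E * t * Q \<le> \<tau> * V / 2"
  proof -
    have "E * t * Q \<le> E * t * (Q + 1)" using E1 t by (intro mult_left_mono) auto
    also have "\<dots> = (E * (Q + 1)) * t" by simp
    also have "\<dots> = \<tau> * V / 2" unfolding t_def using EQ by (simp del: mult_eq_0_iff add: field_simps)
    finally show ?thesis .
  qed
  have "\<exists>\<xi>. norm \<xi> \<le> r \<and> ennreal E * bad_lpint \<delta> v \<xi> \<le> ennreal \<tau>"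
  proof (rule small_bad_translate[OF \<delta>(1) vm u vb uN r(1-3) p(2) _ \<tau> w0])
    show "ennreal E * lpint p (\<lambda>x. v x - u x) \<le> ennreal ((1/2) ^ j)" using e'(3)[of j] by (simp add: E_def v_def \<epsilon>_def)
    show "gap_tail \<delta> \<le> ennreal t" using \<delta> by simp
    show "w0 * (2 / \<iota>) powr p * (1/2) ^ j + E * t * measure lborel (open_cube :: (real^'m) set) < \<tau> * measure lborel (cball 0 r :: (real^'v) set)"
      using j(1) EtQ unfolding c1_def V_def Q_def by linarith
  qed (use E1 t in auto)
  then obtain \<xi> where \<xi>: "norm \<xi> \<le> r" "ennreal E * bad_lpint \<delta> v \<xi> \<le> ennreal \<tau>" by blast
  have \<xi>1: "norm \<xi> \<le> 1" using \<xi> r by simp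
  have bl: "bad_lpint \<delta> v \<xi> \<le> ennreal \<tau>"
  proof -
    have "1 \<le> ennreal E" using ennreal_leI[OF E1] by simp
    then have "1 * bad_lpint \<delta> v \<xi> \<le> ennreal E * bad_lpint \<delta> v \<xi>" by (rule mult_right_mono) simp
    then show ?thesis using \<xi>(2) by simp
  qed
  have en: "energy p \<alpha> (\<lambda>x. err \<delta> (v x - \<xi>)) \<le> ennreal \<eta>'"
  proof -
    have "energy p \<alpha> (\<lambda>x. err \<delta> (v x - \<xi>)) \<le> ennreal Kc * (2 * ((ennreal E * J) * bad_lpint \<delta> v \<xi>))"
      unfolding Kc_def E_def J_def by (rule energy_err_le[OF \<delta>(1) vm vb vlip L(1) \<epsilon>(1) \<xi>1 p(1) \<alpha>])
    also have "\<dots> = ennreal Kc * 2 * J * (ennreal E * bad_lpint \<delta> v \<xi>)" by (simp only: ac_simps)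
    also have "\<dots> \<le> ennreal Kc * 2 * J * ennreal \<tau>" by (rule mult_left_mono[OF \<xi>(2)]) simp
    also have "\<dots> = ennreal (2 * Kc * j0 * \<tau>)" using Kc j0 \<tau> by (simp add: ennreal_mult ac_simps)
    also have "\<dots> \<le> ennreal \<eta>'" by (rule ennreal_leI[OF \<tau>1(1)])
    finally show ?thesis .
  qed
  have lp: "lpint p (\<lambda>x. err \<delta> (v x - \<xi>)) \<le> ennreal \<eta>'"
  proof -
    have "lpint p (\<lambda>x. err \<delta> (v x - \<xi>)) \<le> ennreal (err_max powr p) * bad_lpint \<delta> v \<xi>"
      by (rule lpint_err_le[OF \<delta>(1) vm vb \<xi>1]) (use p in simp)
    also have "\<dots> \<le> ennreal (err_max powr p) * ennreal \<tau>" by (rule mult_left_mono[OF bl]) simp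
    also have "\<dots> = ennreal (err_max powr p * \<tau>)" using \<tau> by (simp add: ennreal_mult)
    also have "\<dots> \<le> ennreal \<eta>'" by (rule ennreal_leI[OF \<tau>1(2)])
    finally show ?thesis .
  qed
  have "norm \<xi> \<le> r0" using \<xi> r by simp
  then have en2: "energy p \<alpha> (\<lambda>x. P (v x - \<xi>) - u x) \<le> ennreal \<eta>'" and lp2: "lpint p (\<lambda>x. P (v x - \<xi>) - u x) \<le> ennreal \<eta>'"
    using J0 j(2) by (simp_all add: v_def \<epsilon>_def less_imp_le)
  have split: "(\<lambda>x. \<kappa> \<delta> (v x - \<xi>) - u x) = (\<lambda>x. err \<delta> (v x - \<xi>) + (P (v x - \<xi>) - u x))"
    by (simp add: err_def)
  note [measurable] = err_measurable[OF \<delta>(1)]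
  have m1: "(\<lambda>x. err \<delta> (v x - \<xi>)) \<in> borel_measurable borel" by measurable
  have m2: "(\<lambda>x. P (v x - \<xi>) - u x) \<in> borel_measurable borel" by measurable
  have f1: "energy p \<alpha> (\<lambda>x. \<kappa> \<delta> (v x - \<xi>) - u x) < ennreal \<eta>"
    unfolding split by (rule le_less_trans[OF energy_add_le[OF m1 m2 p(2)] two[OF en en2]])
  have f2: "lpint p (\<lambda>x. \<kappa> \<delta> (v x - \<xi>) - u x) < ennreal \<eta>"
    unfolding split by (rule le_less_trans[OF lpint_add_le[OF m1 m2 p(2)] two[OF lp lp2]])
  obtain L' where L': "\<forall>x y. norm (\<kappa> \<delta> x - \<kappa> \<delta> y) \<le> L' * norm (x - y)" using \<kappa>_lip[OF \<delta>(1)] ..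
  have f3: "norm (\<kappa> \<delta> (v x - \<xi>) - \<kappa> \<delta> (v y - \<xi>)) \<le> (\<bar>L'\<bar> * (L / \<epsilon>)) * norm (x - y)" for x y
  proof -
    have "norm (\<kappa> \<delta> (v x - \<xi>) - \<kappa> \<delta> (v y - \<xi>)) \<le> L' * norm (v x - v y)"
      using L'[rule_format, of "v x - \<xi>" "v y - \<xi>"] by simp
    also have "\<dots> \<le> \<bar>L'\<bar> * (L / \<epsilon> * norm (x - y))" by (intro mult_mono vlip) auto
    finally show ?thesis by simp
  qed
  show ?thesis
    by (rule exI[of _ "\<lambda>x. \<kappa> \<delta> (v x - \<xi>)"], rule exI[of _ "\<bar>L'\<bar> * (L / \<epsilon>)"])
      (intro conjI allI \<kappa>_in[OF \<delta>(1)] f1 f2 f3)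
qed

end

section \<open>Density of smooth maps\<close>

text \<open>A map with both oscillation c and Lipschitz constant c / \<epsilon> has energy of order
  c^p \<epsilon>^(-\<sigma>), by the scaling of the truncated kernel.\<close>

lemma energy_concentrated_le:
  fixes D :: "real^'m \<Rightarrow> real^'v"
  assumes D: "\<And>x y. x \<in> open_cube \<Longrightarrow> y \<in> open_cube \<Longrightarrow> norm (D x - D y) \<le> c * min 1 (norm (x - y) / \<epsilon>)"
    and c: "c \<ge> 0" and \<epsilon>: "\<epsilon> > 0" and p: "p \<ge> 0" and \<alpha>: "\<alpha> = real CARD('m) + \<sigma>"
  shows "energy p \<alpha> D \<le> ennreal (c powr p) * (ennreal (\<epsilon> powr (-\<sigma>)) *
    (\<integral>\<^sup>+z. ennreal (min 1 (norm z) powr p / norm z powr \<alpha>) \<partial>(lborel :: (real^'m) measure))) * emeasure lborel (open_cube :: (real^'m) set)"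
proof -
  let ?c = "ennreal (\<epsilon> powr (-\<sigma>)) * (\<integral>\<^sup>+z. ennreal (min 1 (norm z) powr p / norm z powr \<alpha>) \<partial>(lborel :: (real^'m) measure))"
  have pt: "ed p \<alpha> D x y \<le> ennreal (c powr p) * ennreal (min 1 (norm (x - y) / \<epsilon>) powr p / norm (x - y) powr \<alpha>) * indicator open_cube x" for x y
  proof (cases "x \<in> open_cube \<and> y \<in> open_cube")
    case True
    have m: "0 \<le> min 1 (norm (x - y) / \<epsilon>)" using \<epsilon> by simp
    have "norm (D x - D y) powr p \<le> (c * min 1 (norm (x - y) / \<epsilon>)) powr p"
      using D True p by (intro powr_mono2) auto
    also have "\<dots> = c powr p * min 1 (norm (x - y) / \<epsilon>) powr p" by (rule powr_mult)
    finally have "norm (D x - D y) powr p / norm (x - y) powr \<alpha> \<le> c powr p * min 1 (norm (x - y) / \<epsilon>) powr p / norm (x - y) powr \<alpha>"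
      by (rule divide_right_mono) simp
    then have "ennreal (norm (D x - D y) powr p / norm (x - y) powr \<alpha>) \<le> ennreal (c powr p * (min 1 (norm (x - y) / \<epsilon>) powr p / norm (x - y) powr \<alpha>))"
      by (intro ennreal_leI) simp
    also have "\<dots> = ennreal (c powr p) * ennreal (min 1 (norm (x - y) / \<epsilon>) powr p / norm (x - y) powr \<alpha>)"
      by (rule ennreal_mult) auto
    finally show ?thesis using True by (simp add: ed_def)
  next
    case False
    then show ?thesis by (auto simp: ed_def)
  qed
  have "energy p \<alpha> D \<le> (\<integral>\<^sup>+x. \<integral>\<^sup>+y. ennreal (c powr p) * ennreal (min 1 (norm (x - y) / \<epsilon>) powr p / norm (x - y) powr \<alpha>) * indicator open_cube x \<partial>lborel \<partial>(lborel :: (real^'m) measure))"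
    unfolding energy_def by (intro nn_integral_mono pt)
  also have "\<dots> = (\<integral>\<^sup>+x. (ennreal (c powr p) * ?c) * indicator open_cube x \<partial>(lborel :: (real^'m) measure))"
  proof (rule nn_integral_cong)
    fix x :: "real^'m"
    have "(\<integral>\<^sup>+y. ennreal (c powr p) * ennreal (min 1 (norm (x - y) / \<epsilon>) powr p / norm (x - y) powr \<alpha>) * indicator open_cube x \<partial>lborel)
        = (\<integral>\<^sup>+y. ennreal (c powr p) * ennreal (min 1 (norm (x - y) / \<epsilon>) powr p / norm (x - y) powr \<alpha>) \<partial>lborel) * indicator open_cube x"
      by (rule nn_integral_multc) measurable
    also have "(\<integral>\<^sup>+y. ennreal (c powr p) * ennreal (min 1 (norm (x - y) / \<epsilon>) powr p / norm (x - y) powr \<alpha>) \<partial>lborel)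
        = ennreal (c powr p) * (\<integral>\<^sup>+y. ennreal (min 1 (norm (x - y) / \<epsilon>) powr p / norm (x - y) powr \<alpha>) \<partial>lborel)"
      by (rule nn_integral_cmult) measurable
    also have "(\<integral>\<^sup>+y. ennreal (min 1 (norm (x - y) / \<epsilon>) powr p / norm (x - y) powr \<alpha>) \<partial>lborel) = ?c"
      by (rule nn_integral_kernel_scaled[OF \<epsilon> \<alpha>])
    finally show "(\<integral>\<^sup>+y. ennreal (c powr p) * ennreal (min 1 (norm (x - y) / \<epsilon>) powr p / norm (x - y) powr \<alpha>) * indicator open_cube x \<partial>lborel)
      = ennreal (c powr p) * ?c * indicator open_cube x" .
  qed
  also have "\<dots> = (ennreal (c powr p) * ?c) * emeasure lborel (open_cube :: (real^'m) set)"
    by (rule nn_integral_cmult_indicator) simp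
  finally show ?thesis .
qed

lemma smooth_approximation:
  fixes f :: "real^'m \<Rightarrow> real^'v"
  assumes N: "compact N" "N \<noteq> {}" "embedded_submanifold n N"
    and f: "\<And>x. f x \<in> N" "\<And>x y. norm (f x - f y) \<le> K * norm (x - y)"
    and \<sigma>: "0 < \<sigma>" "\<sigma> < p" and \<alpha>: "\<alpha> = real CARD('m) + \<sigma>" and \<tau>: "\<tau> > 0"
  shows "\<exists>w \<in> smooth_maps N. \<exists>w'\<in>borel_measurable borel. (\<forall>x\<in>open_cube. w' x = w x) \<and>
    energy p \<alpha> (\<lambda>x. w' x - f x) < ennreal \<tau> \<and> lpint p (\<lambda>x. w' x - f x) < ennreal \<tau>"
proof -
  let ?Q = "open_cube :: (real^'m) set"
  obtain C \<eta>0 where C: "C > 0" and \<eta>0: "\<eta>0 > 0" and W: "\<forall>\<eta>. 0 < \<eta> \<longrightarrow> \<eta> < \<eta>0 \<longrightarrow>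
    (\<exists>w. w \<in> smooth_maps N \<and> continuous_on open_cube w \<and> (\<forall>x\<in>open_cube. norm (w x - f x) \<le> C * \<eta>) \<and>
       (\<forall>x\<in>open_cube. \<forall>y\<in>open_cube. norm (w x - w y) \<le> C * norm (x - y)))"
    using lipschitz_smooth_approximation[OF N f] by blast
  have Q: "emeasure lborel ?Q = ennreal (measure lborel ?Q)"
    unfolding open_cube_eq_box using emeasure_lborel_box_finite[of "-1" "1 :: real^'m"] by (intro emeasure_eq_ennreal_measure) auto
  define J where "J = (\<integral>\<^sup>+z. ennreal (min 1 (norm z) powr p / norm z powr \<alpha>) \<partial>(lborel :: (real^'m) measure))"
  have "J < \<infinity>" unfolding J_def \<alpha> by (rule nn_integral_kernel_finite[OF \<sigma>])
  then obtain j0 where j0: "J = ennreal j0" "j0 \<ge> 0" by (cases J) auto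
  \<comment> \<open>The first entry bounds the oscillation of the difference by c \<eta>, the second
    its Lipschitz constant by c. The energy is then of order \<eta>^(p - \<sigma>), which tends to 0
    because \<sigma> < p.\<close>
  define c where "c = max (2 * C) (C + \<bar>K\<bar>)"
  have c: "c \<ge> 0" "2 * C \<le> c" "C + \<bar>K\<bar> \<le> c" using C by (auto simp: c_def)
  define a1 where "a1 = c powr p * j0 * measure lborel ?Q"
  define a2 where "a2 = C powr p * measure lborel ?Q"
  have p: "p > 0" using \<sigma> by simp
  have lim: "((\<lambda>\<eta>. a * \<eta> powr d) \<longlongrightarrow> a * 0) (at_right 0)" if "d > 0" for a d :: real
    by (intro tendsto_mult tendsto_const tendsto_zero_powrI[where g="\<lambda>_. d" and b=d] tendsto_ident_at)
      (use that in \<open>auto simp: eventually_at_filter\<close>)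
  have "\<forall>\<^sub>F \<eta> in at_right 0. a1 * \<eta> powr (p - \<sigma>) < \<tau>"
    using lim[of "p - \<sigma>" a1] \<sigma> \<tau> by (intro order_tendstoD(2)) auto
  moreover have "\<forall>\<^sub>F \<eta> in at_right 0. a2 * \<eta> powr p < \<tau>"
    using lim[of p a2] p \<tau> by (intro order_tendstoD(2)) auto
  moreover have "\<forall>\<^sub>F \<eta> in at_right 0. \<eta> \<in> {0<..<\<eta>0}" by (rule eventually_at_right_real[OF \<eta>0])
  ultimately have "\<forall>\<^sub>F \<eta> in at_right 0. a1 * \<eta> powr (p - \<sigma>) < \<tau> \<and> a2 * \<eta> powr p < \<tau> \<and> \<eta> \<in> {0<..<\<eta>0}"
    by (intro eventually_conj)
  then obtain \<eta> where \<eta>: "a1 * \<eta> powr (p - \<sigma>) < \<tau>" "a2 * \<eta> powr p < \<tau>" "0 < \<eta>" "\<eta> < \<eta>0"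
    using eventually_happens'[OF trivial_limit_at_right_real] by auto
  obtain w where w: "w \<in> smooth_maps N" "continuous_on open_cube w" "\<forall>x\<in>open_cube. norm (w x - f x) \<le> C * \<eta>"
      "\<forall>x\<in>open_cube. \<forall>y\<in>open_cube. norm (w x - w y) \<le> C * norm (x - y)"
    using W[rule_format, OF \<eta>(3,4)] by blast
  \<comment> \<open>Continuity of w is known on the cube only; cutting it off to 0 elsewhere gives a
    Borel map on the whole space.\<close>
  define w' where "w' x = indicator ?Q x *\<^sub>R w x" for x
  have w'm: "w' \<in> borel_measurable borel" unfolding w'_def[abs_def]
    by (intro borel_measurable_continuous_on_indicator w) simp
  have w': "w' x = w x" if "x \<in> ?Q" for x using that by (simp add: w'_def)
  let ?D = "\<lambda>x. w' x - f x"
  have D: "norm (?D x - ?D y) \<le> (c * \<eta>) * min 1 (norm (x - y) / \<eta>)" if xy: "x \<in> ?Q" "y \<in> ?Q" for x y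
  proof -
    have "norm (?D x - ?D y) \<le> norm (w x - f x) + norm (w y - f y)" using w' xy norm_triangle_ineq4[of "w x - f x" "w y - f y"] by simp
    also have "\<dots> \<le> 2 * C * \<eta>" using w(3)[rule_format, OF xy(1)] w(3)[rule_format, OF xy(2)] by linarith
    also have "\<dots> \<le> c * \<eta>" using c \<eta> by (intro mult_right_mono) auto
    finally have 1: "norm (?D x - ?D y) \<le> c * \<eta>" .
    have "norm (?D x - ?D y) \<le> norm (w x - w y) + norm (f x - f y)"
      using w' xy norm_triangle_ineq4[of "w x - w y" "f x - f y"] by (simp add: algebra_simps)
    also have "norm (w x - w y) \<le> C * norm (x - y)" using w(4) xy by blast
    also have "norm (f x - f y) \<le> K * norm (x - y)" by (rule f)
    also have "K * norm (x - y) \<le> \<bar>K\<bar> * norm (x - y)" by (intro mult_right_mono) auto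
    finally have "norm (?D x - ?D y) \<le> (C + \<bar>K\<bar>) * norm (x - y)" by (simp add: distrib_right)
    also have "\<dots> \<le> c * norm (x - y)" using c by (intro mult_right_mono) auto
    finally have 2: "norm (?D x - ?D y) \<le> c * norm (x - y)" .
    show ?thesis
    proof (cases "norm (x - y) / \<eta> \<le> 1")
      case True
      then have "(c * \<eta>) * min 1 (norm (x - y) / \<eta>) = (c * \<eta>) * (norm (x - y) / \<eta>)" by (simp only: min_absorb2)
      also have "\<dots> = c * norm (x - y)" using \<eta> by simp
      finally show ?thesis using 2 by (simp only:)
    next
      case False
      then show ?thesis using 1 by (simp add: min_absorb1)
    qed
  qed
  have "energy p \<alpha> ?D \<le> ennreal ((c * \<eta>) powr p) * (ennreal (\<eta> powr (-\<sigma>)) * J) * ennreal (measure lborel ?Q)"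
    unfolding J_def Q[symmetric] by (rule energy_concentrated_le[OF D _ \<eta>(3) _ \<alpha>]) (use c \<eta> p in auto)
  also have "\<dots> = ennreal ((c * \<eta>) powr p * (\<eta> powr (-\<sigma>) * j0) * measure lborel ?Q)"
    using j0 by (simp add: ennreal_mult)
  also have "(c * \<eta>) powr p * (\<eta> powr (-\<sigma>) * j0) * measure lborel ?Q = a1 * (\<eta> powr p * \<eta> powr (-\<sigma>))"
    unfolding a1_def powr_mult by (simp only: ac_simps)
  also have "\<eta> powr p * \<eta> powr (-\<sigma>) = \<eta> powr (p - \<sigma>)" by (simp add: powr_add[symmetric])
  also have "ennreal (a1 * \<eta> powr (p - \<sigma>)) < ennreal \<tau>" using \<eta>(1) \<tau> by (rule ennreal_lessI[rotated])
  finally have en: "energy p \<alpha> ?D < ennreal \<tau>" .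
  have "lpint p ?D \<le> (\<integral>\<^sup>+x. ennreal ((C * \<eta>) powr p) * indicator ?Q x \<partial>lborel)"
    unfolding lpint_def
  proof (rule nn_integral_mono)
    fix x
    show "ennreal (norm (?D x) powr p) * indicator ?Q x \<le> ennreal ((C * \<eta>) powr p) * indicator ?Q x"
      using w(3) p w' by (cases "x \<in> ?Q") (auto intro!: ennreal_leI powr_mono2)
  qed
  also have "\<dots> = ennreal ((C * \<eta>) powr p) * ennreal (measure lborel ?Q)"
    unfolding Q[symmetric] by (rule nn_integral_cmult_indicator) simp
  also have "\<dots> = ennreal (a2 * \<eta> powr p)"
    by (simp add: a2_def powr_mult ennreal_mult[symmetric] mult.assoc mult.commute mult.left_commute)
  also have "\<dots> < ennreal \<tau>" using \<eta>(2) \<tau> by (rule ennreal_lessI[rotated])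
  finally have lp: "lpint p ?D < ennreal \<tau>" .
  show ?thesis using w(1) w'm w' en lp by blast
qed

section \<open>From Lebesgue measure on the cube to Borel representatives, and the density
  theorem\<close>

lemma lebesgue_on_cube_AE: "(AE x in lebesgue_on (open_cube :: (real^'m) set). R x) \<longleftrightarrow> (AE x in lborel. x \<in> open_cube \<longrightarrow> R x)"
proof -
  have "(open_cube :: (real^'m) set) \<inter> space lebesgue \<in> sets lebesgue" by simp
  then show ?thesis by (simp add: AE_restrict_space_iff AE_completion_iff)
qed

lemma nn_integral_lebesgue_on_cube:
  "(\<integral>\<^sup>+x. F x \<partial>lebesgue_on (open_cube :: (real^'m) set)) = (\<integral>\<^sup>+x. F x * indicator open_cube x \<partial>lborel)"
proof -
  have "(open_cube :: (real^'m) set) \<inter> space lebesgue \<in> sets lebesgue" by simp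
  then show ?thesis by (simp add: nn_integral_restrict_space nn_integral_completion)
qed

lemma cube_Lp_norm_eq:
  fixes d d' :: "real^'m \<Rightarrow> real^'v"
  assumes ae: "AE x in lborel. x \<in> open_cube \<longrightarrow> d x = d' x"
  shows "cube_Lp_norm p d = ennreal_pow (lpint p d') (1 / p)"
proof -
  have "(\<integral>\<^sup>+x. ennreal (norm (d x) powr p) \<partial>lebesgue_on open_cube) = lpint p d'"
    unfolding nn_integral_lebesgue_on_cube lpint_def
  proof (rule nn_integral_cong_AE)
    show "AE x in lborel. ennreal (norm (d x) powr p) * indicator open_cube x = ennreal (norm (d' x) powr p) * indicator open_cube x"
      using ae by eventually_elim (auto simp: indicator_def)
  qed
  then show ?thesis by (simp add: cube_Lp_norm_def)
qed

lemma gagliardo_seminorm_eq: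
  fixes d d' :: "real^'m \<Rightarrow> real^'v"
  assumes ae: "AE x in lborel. x \<in> open_cube \<longrightarrow> d x = d' x"
  shows "gagliardo_seminorm s p d = ennreal_pow (energy p (real CARD('m) + s * p) d') (1 / p)"
proof -
  let ?\<alpha> = "real CARD('m) + s * p"
  let ?k = "\<lambda>d x y. ennreal (norm (d x - d y :: real^'v) powr p / norm (x - y :: real^'m) powr ?\<alpha>)"
  have "(\<integral>\<^sup>+x. (\<integral>\<^sup>+y. ?k d x y \<partial>lebesgue_on open_cube) \<partial>lebesgue_on open_cube)
    = (\<integral>\<^sup>+x. (\<integral>\<^sup>+y. ?k d x y * indicator open_cube y \<partial>lborel) * indicator open_cube x \<partial>lborel)"
    by (simp only: nn_integral_lebesgue_on_cube)
  also have "\<dots> = energy p ?\<alpha> d'"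
    unfolding energy_def
  proof (rule nn_integral_cong_AE)
    show "AE x in lborel. (\<integral>\<^sup>+y. ?k d x y * indicator open_cube y \<partial>lborel) * indicator open_cube x = (\<integral>\<^sup>+y. ed p ?\<alpha> d' x y \<partial>lborel)"
      using ae
    proof eventually_elim
      case (elim x)
      show ?case
      proof (cases "x \<in> open_cube")
        case True
        have "(\<integral>\<^sup>+y. ?k d x y * indicator open_cube y \<partial>lborel) = (\<integral>\<^sup>+y. ed p ?\<alpha> d' x y \<partial>lborel)"
        proof (rule nn_integral_cong_AE)
          show "AE y in lborel. ?k d x y * indicator open_cube y = ed p ?\<alpha> d' x y"
            using ae by eventually_elim (use True elim in \<open>auto simp: ed_def indicator_def\<close>)
        qed
        then show ?thesis using True by simp
      next
        case False
        then show ?thesis by (simp add: ed_def)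
      qed
    qed
  qed
  finally show ?thesis by (simp add: gagliardo_seminorm_def)
qed

lemma ennreal_pow_le:
  assumes "a \<le> ennreal (t powr p)" "t \<ge> 0" "p > 0"
  shows "ennreal_pow a (1 / p) \<le> ennreal t"
proof -
  obtain r where r: "a = ennreal r" "r \<ge> 0" using assms(1) by (cases a) (auto simp: top_unique)
  then have "r \<le> t powr p" using assms(1) by (simp add: ennreal_le_iff)
  then have "r powr (1/p) \<le> (t powr p) powr (1/p)" using r assms by (intro powr_mono2) auto
  also have "\<dots> = t" using assms by (simp add: powr_powr)
  finally show ?thesis using r by (simp add: ennreal_pow_def ennreal_leI)
qed

text \<open>The completion yields Borel representatives one real coordinate at a time. Wherever the
  result leaves N it is reset to c, which inside the cube changes it only on a null set; values in
  N, and hence bounds, then hold at every point.\<close>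

lemma borel_representative:
  fixes u :: "real^'m \<Rightarrow> real^'v"
  assumes u: "u \<in> borel_measurable (lebesgue_on open_cube)" and N: "AE x in lebesgue_on open_cube. u x \<in> N" "closed N" "N \<noteq> {}"
  shows "\<exists>u'\<in>borel_measurable borel. (\<forall>x. u' x \<in> N) \<and> (AE x in lborel. x \<in> open_cube \<longrightarrow> u x = u' x)"
proof -
  obtain c where c: "c \<in> N" using N(3) by blast
  define u1 where "u1 x = indicator open_cube x *\<^sub>R u x" for x
  have u1[measurable]: "u1 \<in> borel_measurable lebesgue"
    using u borel_measurable_restrict_space_iff[of open_cube lebesgue u] by (simp add: u1_def[abs_def])
  have "\<exists>g'\<in>borel_measurable lborel. AE x in lborel. u1 x $ i = g' x" for i
  proof (rule completion_ex_borel_measurable_real)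
    have "(\<lambda>y::real^'v. y $ i) \<in> borel_measurable borel" by (intro borel_measurable_continuous_onI continuous_intros)
    from measurable_compose[OF u1 this] show "(\<lambda>x. u1 x $ i) \<in> borel_measurable lebesgue" .
  qed
  then obtain g where g: "\<And>i. g i \<in> borel_measurable lborel" "\<And>i. AE x in lborel. u1 x $ i = g i x" by metis
  define u2 where "u2 x = (\<Sum>i\<in>UNIV. g i x *\<^sub>R axis i (1::real))" for x
  have [measurable]: "u2 \<in> borel_measurable borel" using g(1) by (simp add: u2_def[abs_def])
  have u2: "AE x in lborel. u1 x = u2 x"
  proof -
    have "AE x in lborel. \<forall>i. u1 x $ i = g i x" using g(2) by (simp add: AE_all_countable)
    then show ?thesis
    proof eventually_elim
      case (elim x)
      have "u2 x $ j = g j x" for j by (simp add: u2_def sum_component axis_def if_distrib cong: if_cong)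
      then show ?case using elim by (simp add: vec_eq_iff)
    qed
  qed
  define u' where "u' x = (if u2 x \<in> N then u2 x else c)" for x
  have [measurable]: "N \<in> sets borel" using N(2) by simp
  have m: "u' \<in> borel_measurable borel" unfolding u'_def[abs_def] by measurable
  have uN: "u' x \<in> N" for x using c by (simp add: u'_def)
  have "AE x in lborel. x \<in> open_cube \<longrightarrow> u x \<in> N" using N(1) by (simp add: lebesgue_on_cube_AE)
  then have ae: "AE x in lborel. x \<in> open_cube \<longrightarrow> u x = u' x"
    using u2 by eventually_elim (auto simp: u'_def u1_def)
  show ?thesis using m uN ae by blast
qed

text \<open>The cube is open and nonempty, hence not null, so a property holding almost everywhere
  on it holds somewhere.\<close>

lemma sobolev_maps_nonempty_target:
  assumes "AE x in lebesgue_on (open_cube :: (real^'m) set). u x \<in> N"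
  shows "N \<noteq> {}"
proof
  assume "N = {}"
  then have "AE x in lborel. x \<notin> (open_cube :: (real^'m) set)" using assms by (simp add: lebesgue_on_cube_AE)
  then have "(open_cube :: (real^'m) set) \<in> null_sets lborel" by (subst AE_iff_null_sets) auto
  then have "negligible (open_cube :: (real^'m) set)" by (simp add: negligible_iff_null_sets null_sets_completionI)
  moreover have "(0 :: real^'m) \<in> open_cube" by (simp add: open_cube_def)
  moreover have "open (open_cube :: (real^'m) set)" by (simp add: open_cube_eq_box open_box)
  ultimately show False using open_not_negligible by blast
qed

theorem theorem2:
  fixes n :: nat and s p :: real and N :: "(real^'v) set" and u :: "real^'m \<Rightarrow> real^'v"
  assumes "0 < s" and "s < 1" and "1 \<le> p"
    and "compact N" and "embedded_submanifold n N"
    and "s * p < real CARD('m)"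
    and "\<And>l::nat. int l \<le> \<lfloor>s * p\<rfloor> \<Longrightarrow> trivial_homotopy_group l N"
    and "u \<in> sobolev_maps s p N"
  shows "\<exists>w :: nat \<Rightarrow> real^'m \<Rightarrow> real^'v.
           (\<forall>k. w k \<in> smooth_maps N) \<and> (\<lambda>k. sobolev_dist s p (w k) u) \<longlonglongrightarrow> 0"
proof -
  define \<sigma> where "\<sigma> = s * p"
  define k where "k = nat \<lfloor>\<sigma>\<rfloor>"
  \<comment> \<open>The midpoint between \<sigma> and min p (k + 1), so that q is strictly above
    \<sigma>, strictly below k + 1 and at most p.\<close>
  define q where "q = (\<sigma> + min p (real (Suc k))) / 2"
  define \<alpha> where "\<alpha> = real CARD('m) + \<sigma>"
  have p: "0 < p" using assms(3) by simp
  have \<sigma>0: "0 < \<sigma>" using assms(1,3) by (simp add: \<sigma>_def)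
  have \<sigma>p: "\<sigma> < p" using assms(2) p by (simp add: \<sigma>_def)
  have "\<sigma> < real (Suc k)" using \<sigma>0 by (simp add: k_def) linarith
  then have qq: "0 < q" "q < real (Suc k)" "\<sigma> < q" "q \<le> p"
    using \<sigma>0 \<sigma>p unfolding q_def min_def by (auto split: if_splits)
  have u: "u \<in> borel_measurable (lebesgue_on open_cube)" "AE x in lebesgue_on open_cube. u x \<in> N" "gagliardo_seminorm s p u < \<infinity>"
    using assms(8) by (auto simp: sobolev_maps_def)
  have N0: "N \<noteq> {}" by (rule sobolev_maps_nonempty_target[OF u(2)])
  obtain u' where u'm[measurable]: "u' \<in> borel_measurable borel" and u'N: "\<And>x. u' x \<in> N"
      and u'u: "AE x in lborel. x \<in> open_cube \<longrightarrow> u x = u' x"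
    using borel_representative[OF u(1,2) compact_imp_closed[OF assms(4)] N0] by blast
  have fin: "energy p \<alpha> u' < \<infinity>"
    using u(3) unfolding gagliardo_seminorm_eq[OF u'u] \<alpha>_def \<sigma>_def by (auto simp: ennreal_pow_def top.not_eq_extremum split: if_splits)
  have triv: "trivial_homotopy_group j N" if "j \<le> k" for j
    using that \<sigma>0 by (intro assms(7)) (simp add: k_def \<sigma>_def le_nat_iff)
  obtain \<kappa> P C \<iota> h where sr: "singular_retraction N k \<kappa> P C \<iota> h"
    using singular_retraction_exists[OF assms(4) N0 assms(5) triv] by blast
  obtain b where b: "b > 0" "\<And>x. x \<in> N \<Longrightarrow> norm x \<le> b"
    using compact_imp_bounded[OF assms(4)] by (auto simp: bounded_pos)
  interpret bounded_singular_retraction N k \<kappa> P C \<iota> h q b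
    by unfold_locales (use sr b qq in auto)
  have approx: "\<exists>w\<in>smooth_maps N. sobolev_dist s p w u \<le> ennreal (2 * t)" if t: "t > 0" for t
  proof -
    \<comment> \<open>The seminorm is a p-th root, hence t^p. The factor 2^p pays for splitting w' -
      u' at f, and the remaining 4 leaves room for two pieces.\<close>
    define \<eta> where "\<eta> = t powr p / (4 * 2 powr p)"
    have tp: "t powr p > 0" using t by simp
    then have \<eta>: "\<eta> > 0" by (simp add: \<eta>_def)
    obtain f K where f: "\<forall>x. f x \<in> N" "\<forall>x y. norm (f x - f y) \<le> K * norm (x - y)"
        "energy p \<alpha> (\<lambda>x. f x - u' x) < ennreal \<eta>" "lpint p (\<lambda>x. f x - u' x) < ennreal \<eta>"
      using lipschitz_approximation[OF u'm u'N \<alpha>_def \<sigma>0 qq(3,4) assms(3) fin \<eta>] by blast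
    obtain w w' where w: "w \<in> smooth_maps N" "w' \<in> borel_measurable borel" "\<forall>x\<in>open_cube. w' x = w x"
        "energy p \<alpha> (\<lambda>x. w' x - f x) < ennreal \<eta>" "lpint p (\<lambda>x. w' x - f x) < ennreal \<eta>"
      using smooth_approximation[OF assms(4) N0 assms(5) f(1)[rule_format] f(2)[rule_format] \<sigma>0 \<sigma>p \<alpha>_def \<eta>] by blast
    have fm: "f \<in> borel_measurable borel"
    proof -
      have "\<bar>K\<bar>-lipschitz_on UNIV f"
      proof (rule lipschitz_onI)
        fix x y :: "real^'m"
        have "K * norm (x - y) \<le> \<bar>K\<bar> * norm (x - y)" by (intro mult_right_mono) auto
        then show "dist (f x) (f y) \<le> \<bar>K\<bar> * dist x y" using f(2)[rule_format, of x y] by (simp add: dist_norm)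
      qed simp
      then show ?thesis by (intro borel_measurable_continuous_onI lipschitz_on_continuous_on)
    qed
    have m1: "(\<lambda>x. w' x - f x) \<in> borel_measurable borel" using w(2) fm by simp
    have m2: "(\<lambda>x. f x - u' x) \<in> borel_measurable borel" using u'm fm by simp
    have split: "(\<lambda>x. w' x - u' x) = (\<lambda>x. (w' x - f x) + (f x - u' x))" by simp
    have en: "energy p \<alpha> (\<lambda>x. w' x - u' x) \<le> ennreal (t powr p)" unfolding split
      by (rule order_trans[OF energy_add_le[OF m1 m2 assms(3)] less_imp_le[OF two_powr_add_less[OF tp]]])
        (use w(4) f(3) in \<open>simp_all add: \<eta>_def less_imp_le\<close>)
    have lp: "lpint p (\<lambda>x. w' x - u' x) \<le> ennreal (t powr p)" unfolding split
      by (rule order_trans[OF lpint_add_le[OF m1 m2 assms(3)] less_imp_le[OF two_powr_add_less[OF tp]]])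
        (use w(5) f(4) in \<open>simp_all add: \<eta>_def less_imp_le\<close>)
    have ae: "AE x in lborel. x \<in> open_cube \<longrightarrow> w x - u x = w' x - u' x"
      using u'u by eventually_elim (use w(3) in auto)
    have t0: "t \<ge> 0" using t by simp
    have "sobolev_dist s p w u \<le> ennreal t + ennreal t"
      unfolding sobolev_dist_def cube_Lp_norm_eq[OF ae] gagliardo_seminorm_eq[OF ae]
      using ennreal_pow_le[OF en t0 p] ennreal_pow_le[OF lp t0 p] unfolding \<alpha>_def \<sigma>_def by (rule add_mono[rotated])
    also have "\<dots> = ennreal (2 * t)" using t by (simp add: ennreal_plus[symmetric] del: ennreal_plus)
    finally show ?thesis using w(1) by blast
  qed
  have "\<forall>j. \<exists>w. w \<in> smooth_maps N \<and> sobolev_dist s p w u \<le> ennreal (2 * (1 / real (Suc j)))"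
  proof
    fix j
    have "1 / real (Suc j) > 0" by simp
    from approx[OF this] show "\<exists>w. w \<in> smooth_maps N \<and> sobolev_dist s p w u \<le> ennreal (2 * (1 / real (Suc j)))" by blast
  qed
  then obtain w where w: "\<forall>j. w j \<in> smooth_maps N \<and> sobolev_dist s p (w j) u \<le> ennreal (2 * (1 / real (Suc j)))"
    by (rule choice[THEN exE])
  have "(\<lambda>j. 2 * (1 / real (Suc j))) \<longlonglongrightarrow> 2 * 0"
    using LIMSEQ_inverse_real_of_nat by (intro tendsto_mult tendsto_const) (simp add: inverse_eq_divide)
  then have lim: "(\<lambda>j. ennreal (2 * (1 / real (Suc j)))) \<longlonglongrightarrow> 0" using tendsto_ennrealI by fastforce
  have "(\<lambda>j. sobolev_dist s p (w j) u) \<longlonglongrightarrow> 0"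
  proof (rule tendsto_sandwich[OF _ _ tendsto_const lim])
    show "\<forall>\<^sub>F j in sequentially. sobolev_dist s p (w j) u \<le> ennreal (2 * (1 / real (Suc j)))"
      using w by (intro always_eventually allI) blast
  qed simp
  then show ?thesis using w by blast
qed

end
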